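(* Let $N\ge 3$ and $p>p_{\rm S}=\frac{N+2}{N-2}$. For $\Gamma>0$ let $U(\cdot,\Gamma)$ be the solution of the initial value problem $$U''+(N-1)\frac{\cos\theta}{\sin\theta}U'+|U|^{p-1}U=0\ (0<\theta<\pi),\qquad U(0)=\Gamma,\ U'(0)=0,$$ and let $\Theta(\Gamma)$ be its first positive zero. Then: (i) for every $\Gamma>0$, $\Theta(\Gamma)$ is defined and $0<\Theta(\Gamma)<\pi$, and $\Gamma\mapsto\Theta(\Gamma)$ is of class $C^1$ on $(0,\infty)$; (ii) $\Theta(\Gamma)\to\pi$ as $\Gamma\downarrow 0$, and $\Theta'(\Gamma)<0$ for all sufficiently small $\Gamma>0$; (iii) $\Theta(\Gamma)\to\Theta^*$ as $\Gamma\to\infty$, where $\Theta^*\in(0,\pi)$ is the first positive zero of the singular solution $U^*$ described in the context; (iv) if moreover $p<p_{\rm JL}$, then $\Theta(\Gamma)$ oscillates infinitely many times around $\Theta^*$ as $\Gamma\to\infty$: there is a sequence $\hat\Gamma_1<\hat\Gamma_2<\cdots\to\infty$ such that $\Theta(\hat\Gamma_n)-\Theta^*\neq 0$ changes sign between consecutive indices, and there is a sequence $\Gamma_n\to\infty$ with $\Theta(\Gamma_n)=\Theta^*$.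
   Context: $p_{\rm JL}:=1+\frac{4}{N-4-2\sqrt{N-1}}$ if $N\ge 11$ and $p_{\rm JL}:=\infty$ if $3\le N\le 10$. Let $\mu:=\frac{2}{p-1}$ and $a:=\{\mu(N-2-\mu)\}^{\mu/2}$. The singular solution: there is a unique function $U^*$, defined for small $\theta>0$ and extended as a solution of $U''+(N-1)\frac{\cos\theta}{\sin\theta}U'+|U|^{p-1}U=0$, satisfying $U^*(\theta)=a(\cos\frac{\theta}{2})^{-(N-2)}(2\tan\frac{\theta}{2})^{-\mu}(1+o(1))$ as $\theta\downarrow0$; it has a first positive zero $\Theta^*\in(0,\pi)$, and $U^*>0$ on $(0,\Theta^* )$. *)

theory Defs
  imports "HOL-Analysis.Analysis"
begin

definition nl :: "real \<Rightarrow> real \<Rightarrow> real" where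
  "nl p u = \<bar>u\<bar> powr (p - 1) * u"

definition rhs :: "nat \<Rightarrow> real \<Rightarrow> real \<Rightarrow> real \<Rightarrow> real \<Rightarrow> real" where
  "rhs N p t u v = - (real N - 1) * (cos t / sin t) * v - nl p u"

definition ivp_sol :: "nat \<Rightarrow> real \<Rightarrow> real \<Rightarrow> real \<Rightarrow> (real \<Rightarrow> real) \<Rightarrow> (real \<Rightarrow> real) \<Rightarrow> bool" where
  "ivp_sol N p \<Gamma> b U V \<longleftrightarrow>
     0 < b \<and> b \<le> pi \<and>
     U 0 = \<Gamma> \<and> V 0 = 0 \<and>
     continuous_on {0..<b} V \<and>
     (\<forall>t\<in>{0..<b}. (U has_real_derivative V t) (at t within {0..<b})) \<and>
     (\<forall>t\<in>{0<..<b}. (V has_real_derivative rhs N p t (U t) (V t)) (at t))"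

definition first_zero :: "nat \<Rightarrow> real \<Rightarrow> real \<Rightarrow> real \<Rightarrow> bool" where
  "first_zero N p \<Gamma> \<theta> \<longleftrightarrow> 0 < \<theta> \<and>
     (\<exists>U V b. \<theta> < b \<and> ivp_sol N p \<Gamma> b U V \<and> U \<theta> = 0 \<and> (\<forall>t\<in>{0..<\<theta>}. U t > 0))"

definition Theta :: "nat \<Rightarrow> real \<Rightarrow> real \<Rightarrow> real" where
  "Theta N p \<Gamma> = (THE \<theta>. first_zero N p \<Gamma> \<theta>)"

definition mu :: "real \<Rightarrow> real" where
  "mu p = 2 / (p - 1)"

definition acoef :: "nat \<Rightarrow> real \<Rightarrow> real" where
  "acoef N p = (mu p * (real N - 2 - mu p)) powr (mu p / 2)"

definition sing_profile :: "nat \<Rightarrow> real \<Rightarrow> real \<Rightarrow> real" where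
  "sing_profile N p t = acoef N p * cos (t/2) powr (- (real N - 2)) * (2 * tan (t/2)) powr (- mu p)"

definition sing_sol :: "nat \<Rightarrow> real \<Rightarrow> real \<Rightarrow> (real \<Rightarrow> real) \<Rightarrow> (real \<Rightarrow> real) \<Rightarrow> bool" where
  "sing_sol N p b U V \<longleftrightarrow>
     0 < b \<and> b \<le> pi \<and>
     (\<forall>t\<in>{0<..<b}. (U has_real_derivative V t) (at t)) \<and>
     (\<forall>t\<in>{0<..<b}. (V has_real_derivative rhs N p t (U t) (V t)) (at t)) \<and>
     ((\<lambda>t. U t / sing_profile N p t) \<longlongrightarrow> 1) (at_right 0)"

definition sing_first_zero :: "nat \<Rightarrow> real \<Rightarrow> real \<Rightarrow> bool" where
  "sing_first_zero N p \<theta> \<longleftrightarrow> 0 < \<theta> \<and>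
     (\<exists>U V b. \<theta> < b \<and> sing_sol N p b U V \<and> U \<theta> = 0 \<and> (\<forall>t\<in>{0<..<\<theta>}. U t > 0))"

definition Theta_star :: "nat \<Rightarrow> real \<Rightarrow> real" where
  "Theta_star N p = (THE \<theta>. sing_first_zero N p \<theta>)"

text \<open>p < p_JL, with p_JL = infinity for N <= 10.\<close>
definition below_JL :: "nat \<Rightarrow> real \<Rightarrow> bool" where
  "below_JL N p \<longleftrightarrow> N \<le> 10 \<or> p < 1 + 4 / (real N - 4 - 2 * sqrt (real N - 1))"

end

(* Regular solutions solve a Volterra equation for the averaging operator (sin^n)^-1 int sin^n, n = N - 1, so they
   exist on [0, pi) and depend smoothly on \<Gamma>; the first zero exists because sin^n U' becomes and stays negative.
   The implicit function theorem gives \<Theta>' = - w(\<Theta>) / U'(\<Theta>), where w solves the linearized equation; for small \<Gamma>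
   Sturm comparison shows w(\<Theta>) < 0.

   For large \<Gamma> put \<Gamma> = \<epsilon>^-\<mu> and t = ln (tan (\<theta>/2)). Then W = (sin \<theta>)^\<mu> U satisfies an
   autonomous damped equation up to terms O(e^(2t)), with the stable equilibrium W = A corresponding to the singular
   profile. On the scale \<theta> = \<epsilon> r the solution U follows the Lane-Emden solution, whose orbit tends to this equilibrium;
   the equilibrium then keeps W close to A up to a time that does not depend on \<epsilon>. Differences of such solutions decay,
   so the family U is Cauchy away from \<theta> = 0, and its limit as \<epsilon> goes to 0 is the singular solution.

   If p < p_JL the linearization at the equilibrium has complex eigenvalues. The difference between the regular and the
   singular solution therefore leaves the inner region with a phase proportional to - ln \<epsilon>, which is transported to
   the zero of the singular solution by a nonzero linear functional, so that the value of U there changes sign infinitely often. *)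
theory Submission
  imports Defs
begin

section \<open>Gronwall inequalities and Volterra equations\<close>

text \<open>The condition p > p_S means \<alpha> = N - 2 - 2\<mu> > 0, and \<alpha> is the friction
  of the Emden-Fowler equation. The time t = ln (tan (\<theta>/2)) satisfies d\<theta>/dt = sin
  \<theta>, so (sin \<theta>)^\<mu> reproduces itself under differentiation, and \<mu>(p - 1) = 2
  removes it from the nonlinear term. The nonlinearity need not be twice differentiable at zeros of
  U, so derivatives in \<Gamma> come from the mean value theorem and uniform continuity; a quadratic
  remainder is used only near A > 0. In the last part the difference of two solutions is damped over
  a time that grows like - ln \<epsilon>, so its sign can only be read off from an estimate relative
  to its own amplitude. This needs perturbations whose integral is small uniformly in \<epsilon>,
  and an initial amplitude that does not vanish: the Lane-Emden orbit never meets the equilibrium.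
  The exponent p_JL comes from the discriminant: p < p_JL gives \<alpha>^2 < 4m, with m the linear
  restoring force at A.\<close>

lemma deriv_nonpos_imp_le:
  fixes f f' :: "real \<Rightarrow> real"
  assumes "a \<le> b" "continuous_on {a..b} f"
    and "\<And>x. a < x \<Longrightarrow> x < b \<Longrightarrow> (f has_real_derivative f' x) (at x)"
    and "\<And>x. a < x \<Longrightarrow> x < b \<Longrightarrow> f' x \<le> 0"
  shows "f b \<le> f a"
  using DERIV_nonpos_imp_decreasing_open[of a b f] assms by blast

text \<open>The sign of \<open>K\<close> is free: a negative \<open>K\<close> turns the estimate
  into exponential decay, which is how the Lyapunov functions are used.\<close>

lemma gronwall_deriv:
  fixes y y' :: "real \<Rightarrow> real"
  assumes "a \<le> b" "continuous_on {a..b} y"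
    and der: "\<And>x. a < x \<Longrightarrow> x < b \<Longrightarrow> (y has_real_derivative y' x) (at x)"
    and le: "\<And>x. a < x \<Longrightarrow> x < b \<Longrightarrow> y' x \<le> K * y x"
  shows "y b \<le> y a * exp (K * (b - a))"
proof -
  let ?f = "\<lambda>x. y x * exp (- K * (x - a))"
  have "?f b \<le> ?f a"
  proof (rule deriv_nonpos_imp_le[OF \<open>a \<le> b\<close>, where f' = "\<lambda>x. (y' x - K * y x) * exp (- K * (x - a))"])
    show "continuous_on {a..b} ?f" by (intro continuous_intros assms)
    fix x assume x: "a < x" "x < b"
    show "(?f has_real_derivative (y' x - K * y x) * exp (- K * (x - a))) (at x)"
      by (rule derivative_eq_intros der[OF x] refl)+ (simp add: algebra_simps)
    show "(y' x - K * y x) * exp (- K * (x - a)) \<le> 0"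
      using le[OF x] by (intro mult_nonpos_nonneg) auto
  qed
  then have "y b * exp (- K * (b - a)) * exp (K * (b - a)) \<le> y a * exp (K * (b - a))"
    by (intro mult_right_mono) auto
  then show ?thesis by (simp add: mult.assoc flip: exp_add)
qed

text \<open>Applied to - y, the forward estimate with - K bounds the left end by the right end; this
  serves the weights and the backward uniqueness of the Lane-Emden orbit.\<close>

lemma gronwall_deriv_backward:
  fixes y y' :: "real \<Rightarrow> real"
  assumes "a \<le> b" "continuous_on {a..b} y"
    and der: "\<And>x. a < x \<Longrightarrow> x < b \<Longrightarrow> (y has_real_derivative y' x) (at x)"
    and le: "\<And>x. a < x \<Longrightarrow> x < b \<Longrightarrow> - K * y x \<le> y' x"
  shows "y a \<le> y b * exp (K * (b - a))"
proof -
  have "- y b \<le> - y a * exp (- K * (b - a))"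
  proof (rule gronwall_deriv[where y' = "\<lambda>x. - y' x"])
    show "continuous_on {a..b} (\<lambda>x. - y x)" by (intro continuous_intros assms)
    fix x assume x: "a < x" "x < b"
    show "((\<lambda>x. - y x) has_real_derivative - y' x) (at x)"
      by (rule derivative_eq_intros der[OF x] refl)+
    show "- y' x \<le> - K * - y x" using le[OF x] by simp
  qed fact
  then have "y a * exp (- K * (b - a)) * exp (K * (b - a)) \<le> y b * exp (K * (b - a))"
    by (intro mult_right_mono) auto
  then show ?thesis by (simp add: mult.assoc flip: exp_add)
qed

text \<open>The right-hand side of the integral inequality, unlike \<phi>, is differentiable, so the
  differential inequality is run for it.\<close>

lemma gronwall_integral:
  fixes \<phi> :: "real \<Rightarrow> real"
  assumes cont: "continuous_on {a..b} \<phi>" and L: "0 \<le> L"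
    and le: "\<And>x. x \<in> {a..b} \<Longrightarrow> \<phi> x \<le> A + L * integral {a..x} \<phi>"
    and x: "x \<in> {a..b}"
  shows "\<phi> x \<le> A * exp (L * (x - a))"
proof -
  let ?y = "\<lambda>x. A + L * integral {a..x} \<phi>"
  have der: "((\<lambda>x. integral {a..x} \<phi>) has_real_derivative \<phi> y) (at y within {a..b})"
    if "y \<in> {a..b}" for y
    using integral_has_real_derivative[OF cont that] .
  have "?y x \<le> ?y a * exp (L * (x - a))"
  proof (rule gronwall_deriv[where y' = "\<lambda>x. L * \<phi> x"])
    show "a \<le> x" using x by simp
    have "continuous_on {a..b} (\<lambda>x. integral {a..x} \<phi>)"
      by (rule DERIV_continuous_on[OF der])
    then show "continuous_on {a..x} ?y"
      using x by (intro continuous_intros) (auto elim: continuous_on_subset)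
    fix y assume y: "a < y" "y < x"
    have "((\<lambda>x. integral {a..x} \<phi>) has_real_derivative \<phi> y) (at y)"
      using der[of y] y x by (simp add: at_within_Icc_at)
    then show "(?y has_real_derivative L * \<phi> y) (at y)"
      by (auto intro!: derivative_eq_intros)
    show "L * \<phi> y \<le> L * ?y y"
      using le[of y] y x L by (intro mult_left_mono) auto
  qed
  with order_trans[OF le[OF x]] show ?thesis by simp
qed

text \<open>Continuity argument: at the first point where \<phi> reaches \<rho>, all earlier values
  are at most \<rho>, so \<open>step\<close> gives a strict inequality there. It serves for
  estimates that are valid only while the solution stays in a given region.\<close>

lemma bootstrap_bound:
  fixes \<phi> :: "real \<Rightarrow> real"
  assumes cont: "continuous_on {a..b} \<phi>"
    and step: "\<And>x. x \<in> {a..b} \<Longrightarrow> (\<And>s. s \<in> {a..x} \<Longrightarrow> \<phi> s \<le> \<rho>) \<Longrightarrow> \<phi> x < \<rho>"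
    and a: "\<phi> a \<le> \<rho>"
    and x: "x \<in> {a..b}"
  shows "\<phi> x < \<rho>"
proof (rule ccontr)
  assume "\<not> \<phi> x < \<rho>"
  define S where "S = {a..b} \<inter> \<phi> -` {\<rho>..}"
  have "closed S" unfolding S_def
    by (intro continuous_closed_preimage cont) auto
  moreover have "bounded S" unfolding S_def by (rule bounded_subset[of "{a..b}"]) auto
  moreover have "S \<noteq> {}" using x \<open>\<not> \<phi> x < \<rho>\<close> by (auto simp: S_def)
  ultimately obtain c where c: "c \<in> S" "\<And>s. s \<in> S \<Longrightarrow> c \<le> s"
    using compact_attains_inf[of S] by (auto simp: compact_eq_bounded_closed)
  then have cab: "c \<in> {a..b}" "\<phi> c \<ge> \<rho>" by (auto simp: S_def)
  have below: "\<phi> s \<le> \<rho>" if "s \<in> {a..<c}" for s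
  proof (rule ccontr)
    assume "\<not> \<phi> s \<le> \<rho>"
    then have "s \<in> S" using that cab by (auto simp: S_def)
    then show False using c(2)[of s] that by auto
  qed
  have "\<phi> c \<le> \<rho>"
  proof (cases "c = a")
    case False
    then have "a < c" using cab by auto
    have "(\<phi> \<longlongrightarrow> \<phi> c) (at c within {a..b})"
      using cont cab(1) unfolding continuous_on_def by blast
    then have "(\<phi> \<longlongrightarrow> \<phi> c) (at c within {a..c})"
      by (rule tendsto_within_subset) (use cab in auto)
    then have "(\<phi> \<longlongrightarrow> \<phi> c) (at_left c)"
      using \<open>a < c\<close> by (simp add: at_within_Icc_at_left)
    moreover have "\<forall>\<^sub>F s in at_left c. \<phi> s \<le> \<rho>"
      unfolding eventually_at_left[OF \<open>a < c\<close>] using \<open>a < c\<close> below by (intro exI[of _ a]) auto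
    ultimately show ?thesis
      by (rule tendsto_upperbound) simp
  qed (use a in auto)
  then have "\<phi> s \<le> \<rho>" if "s \<in> {a..c}" for s
    using that below by (cases "s = c") auto
  then show False using step[OF cab(1)] cab(2) by auto
qed

text \<open>Contraction in the norm sup exp (- \<kappa> (x - a)) |u x|: integrating an exponential
  of rate \<kappa> gains a factor 1/\<kappa>, so one contraction covers the whole interval.\<close>

lemma volterra_fixpoint:
  fixes T :: "(real \<Rightarrow> real) \<Rightarrow> real \<Rightarrow> real"
  assumes "a \<le> b" and L: "0 \<le> L"
    and cont: "\<And>u. continuous_on {a..b} u \<Longrightarrow> continuous_on {a..b} (T u)"
    and lip: "\<And>u v x. continuous_on {a..b} u \<Longrightarrow> continuous_on {a..b} v \<Longrightarrow> x \<in> {a..b} \<Longrightarrow>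
        \<bar>T u x - T v x\<bar> \<le> L * integral {a..x} (\<lambda>s. \<bar>u s - v s\<bar>)"
  obtains u where "continuous_on {a..b} u" "\<And>x. x \<in> {a..b} \<Longrightarrow> u x = T u x"
proof -
  define \<kappa> where "\<kappa> = 2 * L + 1"
  have \<kappa>: "\<kappa> > 0" "L / \<kappa> < 1" "0 \<le> L / \<kappa>" using L by (auto simp: \<kappa>_def field_simps)
  \<comment> \<open>The Banach space consists of bounded continuous functions on the whole line;
    freezing the argument at the ends of the interval makes the image of the operator such a
    function.\<close>
  define cl where "cl x = max a (min x b)" for x
  have cl: "cl x \<in> {a..b}" for x using \<open>a \<le> b\<close> by (auto simp: cl_def)
  have cl_id: "cl x = x" if "x \<in> {a..b}" for x using that by (auto simp: cl_def)
  \<comment> \<open>\<open>up\<close> removes the exponential weight: the fixed point h is the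
    weighted version of the solution.\<close>
  define up where "up h = (\<lambda>y. exp (\<kappa> * (y - a)) * h y)" for h :: "real \<Rightarrow> real"
  define \<Phi>0 where "\<Phi>0 h = (\<lambda>x. exp (- \<kappa> * (cl x - a)) * T (up h) (cl x))" for h
  have up_cont: "continuous_on S (up (apply_bcontfun h))" for h :: "real \<Rightarrow>\<^sub>C real" and S
    unfolding up_def by (intro continuous_intros) auto
  have \<Phi>0: "\<Phi>0 (apply_bcontfun h) \<in> bcontfun" for h :: "real \<Rightarrow>\<^sub>C real"
  proof -
    have c: "continuous_on {a..b} (\<lambda>x. exp (- \<kappa> * (x - a)) * T (up h) x)" (is "continuous_on _ ?k")
      by (intro continuous_intros cont up_cont)
    have "continuous_on UNIV cl" unfolding cl_def by (intro continuous_intros)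
    then have "continuous_on UNIV (?k \<circ> cl)"
      by (rule continuous_on_compose) (use c cl in \<open>auto elim!: continuous_on_subset\<close>)
    moreover have "bounded (?k ` {a..b})"
      by (intro compact_imp_bounded compact_continuous_image c) auto
    then have "bounded (range (?k \<circ> cl))"
      by (rule bounded_subset) (use cl in auto)
    ultimately show ?thesis by (auto simp: bcontfun_def \<Phi>0_def o_def)
  qed
  define \<Phi> where "\<Phi> h = Bcontfun (\<Phi>0 (apply_bcontfun h))" for h :: "real \<Rightarrow>\<^sub>C real"
  have \<Phi>: "apply_bcontfun (\<Phi> h) = \<Phi>0 (apply_bcontfun h)" for h
    unfolding \<Phi>_def by (rule Bcontfun_inverse[OF \<Phi>0])
  have "dist (\<Phi> h) (\<Phi> k) \<le> L / \<kappa> * dist h k" for h k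
  proof (rule dist_bound)
    fix x
    define z where "z = cl x"
    have z: "z \<in> {a..b}" using cl z_def by auto
    have "\<bar>T (up h) z - T (up k) z\<bar> \<le> L * integral {a..z} (\<lambda>s. \<bar>up h s - up k s\<bar>)"
      by (intro lip up_cont z)
    also have "\<dots> \<le> L * integral {a..z} (\<lambda>s. exp (\<kappa> * (s - a)) * dist h k)"
    proof (intro mult_left_mono integral_le L)
      show "(\<lambda>s. \<bar>up h s - up k s\<bar>) integrable_on {a..z}"
        by (intro integrable_continuous_interval continuous_intros up_cont)
      show "(\<lambda>s. exp (\<kappa> * (s - a)) * dist h k) integrable_on {a..z}"
        by (intro integrable_continuous_interval continuous_intros)
      fix s
      have "\<bar>up h s - up k s\<bar> = exp (\<kappa> * (s - a)) * dist (h s) (k s)"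
        by (simp add: up_def dist_real_def abs_mult flip: right_diff_distrib)
      also have "\<dots> \<le> exp (\<kappa> * (s - a)) * dist h k"
        by (intro mult_left_mono dist_bounded) auto
      finally show "\<bar>up h s - up k s\<bar> \<le> exp (\<kappa> * (s - a)) * dist h k" .
    qed
    also have "integral {a..z} (\<lambda>s. exp (\<kappa> * (s - a)) * dist h k)
        = (exp (\<kappa> * (z - a)) / \<kappa> * dist h k) - (exp (\<kappa> * (a - a)) / \<kappa> * dist h k)"
    proof (intro integral_unique fundamental_theorem_of_calculus)
      show "a \<le> z" using z by auto
      fix s
      show "((\<lambda>s. exp (\<kappa> * (s - a)) / \<kappa> * dist h k) has_vector_derivative
          exp (\<kappa> * (s - a)) * dist h k) (at s within {a..z})"
        unfolding has_real_derivative_iff_has_vector_derivative[symmetric]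
        using \<kappa> by (auto intro!: derivative_eq_intros)
    qed
    also have "L * \<dots> \<le> L * (exp (\<kappa> * (z - a)) / \<kappa> * dist h k)"
      using \<kappa> by (intro mult_left_mono L) auto
    finally have "exp (- \<kappa> * (z - a)) * \<bar>T (up h) z - T (up k) z\<bar>
        \<le> exp (- \<kappa> * (z - a)) * (L * (exp (\<kappa> * (z - a)) / \<kappa> * dist h k))"
      by (intro mult_left_mono) auto
    also have "\<dots> = (exp (- \<kappa> * (z - a)) * exp (\<kappa> * (z - a))) * (L / \<kappa> * dist h k)"
      by (simp add: field_simps)
    also have "\<dots> = L / \<kappa> * dist h k" by (simp flip: exp_add)
    finally show "dist ((\<Phi> h) x) ((\<Phi> k) x) \<le> L / \<kappa> * dist h k"
      by (simp add: \<Phi> \<Phi>0_def dist_real_def z_def[symmetric] abs_mult flip: right_diff_distrib)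
  qed
  then obtain h where h: "\<Phi> h = h" using banach_fix_type[of "L / \<kappa>" \<Phi>] \<kappa> by auto
  show ?thesis
  proof (rule that[of "up h"])
    show "continuous_on {a..b} (up h)" by (rule up_cont)
    fix x assume x: "x \<in> {a..b}"
    have "h x = exp (- \<kappa> * (x - a)) * T (up h) x"
      using fun_cong[OF \<Phi>[of h], of x] x by (simp add: h \<Phi>0_def cl_id)
    then have "up h x = (exp (\<kappa> * (x - a)) * exp (- \<kappa> * (x - a))) * T (up h) x"
      by (simp add: up_def)
    then show "up h x = T (up h) x" by (simp flip: exp_add)
  qed
qed

section \<open>The weighted Volterra operator\<close>

text \<open>With weight \<open>q\<close>, the equation \<open>(q u')' = - q h\<close> with \<open>u' a = 0\<close> reads \<open>u' = - wavg q a h\<close>.\<close>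
definition wavg :: "(real \<Rightarrow> real) \<Rightarrow> real \<Rightarrow> (real \<Rightarrow> real) \<Rightarrow> real \<Rightarrow> real" where
  "wavg q a h x = integral {a..x} (\<lambda>r. q r * h r) / q x"

text \<open>\<open>q_growth\<close> replaces monotonicity: sin^n decreases beyond pi/2, but on an
  interval ending before pi at most at an exponential rate. Both q a = 0, the pole, and q a > 0, an
  interior starting point, are covered.\<close>

locale weight =
  fixes q q' :: "real \<Rightarrow> real" and a b K :: real
  assumes ab: "a < b" and K: "0 \<le> K"
    and q_cont: "continuous_on {a..b} q"
    and q_nonneg: "0 \<le> q a"
    and q_pos: "\<And>x. a < x \<Longrightarrow> x \<le> b \<Longrightarrow> 0 < q x"
    and q_deriv: "\<And>x. a < x \<Longrightarrow> x < b \<Longrightarrow> (q has_real_derivative q' x) (at x)"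
    and q_growth: "\<And>x. a < x \<Longrightarrow> x < b \<Longrightarrow> - K * q x \<le> q' x"
begin

text \<open>Bound for the kernel q r / q x of the averaging operator over r \<le> x; it equals 1 for
  an increasing weight, where \<open>K\<close> = 0.\<close>

definition CM :: real where "CM = exp (K * (b - a))"

lemma CM_ge_1: "1 \<le> CM" using ab K by (simp add: CM_def)

lemma CM_pos: "0 < CM" using CM_ge_1 by linarith

lemma q_ge_0: "x \<in> {a..b} \<Longrightarrow> 0 \<le> q x"
  using q_nonneg q_pos[of x] by (cases "x = a") auto

lemma q_le:
  assumes "a \<le> r" "r \<le> s" "s \<le> b"
  shows "q r \<le> CM * q s"
proof -
  have "q r \<le> q s * exp (K * (s - r))"
    by (rule gronwall_deriv_backward[where y' = q'])
      (use assms q_growth in \<open>auto intro: continuous_on_subset[OF q_cont] q_deriv\<close>)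
  also have "\<dots> \<le> q s * CM"
    unfolding CM_def using assms K q_ge_0[of s] by (intro mult_left_mono) (auto intro!: mult_mono)
  finally show ?thesis by (simp add: mult.commute)
qed

lemma int_qh:
  assumes "continuous_on {a..b} h" "x \<in> {a..b}"
  shows "(\<lambda>r. q r * h r) integrable_on {a..x}"
  using assms
  by (intro integrable_continuous_interval continuous_intros)
    (auto intro: continuous_on_subset[OF q_cont] continuous_on_subset)

lemma int_h:
  fixes h :: "real \<Rightarrow> real"
  assumes "continuous_on {a..b} h" "x \<in> {a..b}"
  shows "h integrable_on {a..x}"
  using assms by (intro integrable_continuous_interval) (auto intro: continuous_on_subset)

text \<open>Only quotients q r / q x with r \<le> x enter, so a zero of q at the left end does no
  harm.\<close>

lemma wavg_bound:
  assumes h: "continuous_on {a..b} h" and x: "x \<in> {a..b}"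
  shows "\<bar>wavg q a h x\<bar> \<le> CM * integral {a..x} (\<lambda>r. \<bar>h r\<bar>)"
proof (cases "x = a")
  case True
  then show ?thesis by (simp add: wavg_def)
next
  case False
  then have qx: "0 < q x" using x q_pos by auto
  have "\<bar>integral {a..x} (\<lambda>r. q r * h r)\<bar> \<le> integral {a..x} (\<lambda>r. CM * q x * \<bar>h r\<bar>)"
  proof (rule integral_norm_bound_integral[where 'a = real, unfolded real_norm_def])
    show "(\<lambda>r. q r * h r) integrable_on {a..x}" by (rule int_qh[OF h x])
    show "(\<lambda>r. CM * q x * \<bar>h r\<bar>) integrable_on {a..x}"
      by (intro int_h[OF _ x] continuous_intros h)
    fix r assume r: "r \<in> {a..x}"
    show "\<bar>q r * h r\<bar> \<le> CM * q x * \<bar>h r\<bar>"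
      using q_le[of r x] r x q_ge_0[of r] by (auto simp: abs_mult intro!: mult_right_mono)
  qed
  then show ?thesis using qx
    by (simp add: wavg_def abs_divide pos_divide_le_eq algebra_simps)
qed

lemma integral_has_deriv:
  assumes h: "continuous_on {a..b} h" and x: "a < x" "x < b"
  shows "((\<lambda>x. integral {a..x} h) has_real_derivative h x) (at x)"
  using integral_has_real_derivative[OF h, of x] x by (simp add: at_within_Icc_at)

lemma integral_cont:
  assumes h: "continuous_on {a..b} (h :: real \<Rightarrow> real)"
  shows "continuous_on {a..b} (\<lambda>x. integral {a..x} h)"
  by (rule DERIV_continuous_on[OF integral_has_real_derivative[OF h]])

lemma wavg_cont:
  assumes h: "continuous_on {a..b} h"
  shows "continuous_on {a..b} (wavg q a h)"
  unfolding continuous_on_eq_continuous_within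
proof
  fix x assume x: "x \<in> {a..b}"
  have qh: "continuous_on {a..b} (\<lambda>r. q r * h r)" by (intro continuous_intros q_cont h)
  show "continuous (at x within {a..b}) (wavg q a h)"
  proof (cases "x = a")
    case False
    then have "q x \<noteq> 0" using x q_pos[of x] by auto
    then show ?thesis
      using integral_cont[OF qh] q_cont x unfolding wavg_def continuous_on_eq_continuous_within
      by (auto simp: continuous_within intro!: tendsto_divide)
  next
    case True
    \<comment> \<open>At the left end q may vanish; the bound by the integral of |h| forces the
      limit 0, and the empty integral gives the value 0.\<close>
    have ah: "continuous_on {a..b} (\<lambda>r. \<bar>h r\<bar>)" by (intro continuous_intros h)
    have "((\<lambda>x. CM * integral {a..x} (\<lambda>r. \<bar>h r\<bar>)) \<longlongrightarrow> CM * integral {a..a} (\<lambda>r. \<bar>h r\<bar>))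
        (at a within {a..b})"
      using integral_cont[OF ah] ab unfolding continuous_on_def by (intro tendsto_intros) force
    then have "((\<lambda>x. CM * integral {a..x} (\<lambda>r. \<bar>h r\<bar>)) \<longlongrightarrow> 0) (at a within {a..b})" by simp
    moreover have "\<forall>\<^sub>F x in at a within {a..b}.
        norm (wavg q a h x) \<le> CM * integral {a..x} (\<lambda>r. \<bar>h r\<bar>)"
      using wavg_bound[OF h] by (auto simp: eventually_at intro!: exI[of _ 1])
    ultimately have "((\<lambda>x. wavg q a h x) \<longlongrightarrow> 0) (at a within {a..b})"
      by (rule Lim_null_comparison[rotated])
    moreover have "wavg q a h a = 0" by (simp add: wavg_def)
    ultimately show ?thesis using True by (simp add: continuous_within)
  qed
qed

lemma wavg_deriv:
  assumes h: "continuous_on {a..b} h" and x: "a < x" "x < b"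
  shows "(wavg q a h has_real_derivative h x - q' x / q x * wavg q a h x) (at x)"
proof -
  have qh: "continuous_on {a..b} (\<lambda>r. q r * h r)" by (intro continuous_intros q_cont h)
  have "q x > 0" using q_pos x by auto
  then show ?thesis unfolding wavg_def
    by (intro DERIV_cong[OF DERIV_divide[OF integral_has_deriv[OF qh x] q_deriv[OF x]]])
      (auto simp: field_simps)
qed

lemma wavg_diff:
  assumes "continuous_on {a..b} h" "continuous_on {a..b} k" "x \<in> {a..b}"
  shows "wavg q a (\<lambda>r. h r - k r) x = wavg q a h x - wavg q a k x"
proof -
  have "(\<lambda>r. q r * (h r - k r)) = (\<lambda>r. q r * h r - q r * k r)" by (simp add: algebra_simps)
  then show ?thesis using assms
    by (simp add: wavg_def integral_diff[OF int_qh int_qh] diff_divide_distrib)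
qed

lemma wavg_cmult: "wavg q a (\<lambda>r. c * h r) x = c * wavg q a h x"
proof -
  have "(\<lambda>r. q r * (c * h r)) = (\<lambda>r. c * (q r * h r))" by (simp add: algebra_simps)
  then show ?thesis by (simp add: wavg_def)
qed

lemma integral_wavg_diff:
  assumes "continuous_on {a..b} h" "continuous_on {a..b} k" "x \<in> {a..b}"
  shows "integral {a..x} (wavg q a (\<lambda>r. h r - k r)) =
    integral {a..x} (wavg q a h) - integral {a..x} (wavg q a k)"
proof -
  have "integral {a..x} (wavg q a (\<lambda>r. h r - k r)) =
      integral {a..x} (\<lambda>r. wavg q a h r - wavg q a k r)"
    by (rule integral_cong) (use assms in \<open>auto intro!: wavg_diff\<close>)
  also have "\<dots> = integral {a..x} (wavg q a h) - integral {a..x} (wavg q a k)"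
    by (intro integral_diff int_h wavg_cont assms)
  finally show ?thesis .
qed

lemma integral_mono_upper:
  assumes "continuous_on {a..b} h" "\<And>x. 0 \<le> h x" "a \<le> x" "x \<le> y" "y \<le> b"
  shows "integral {a..x} h \<le> integral {a..y} (h :: real \<Rightarrow> real)"
  using assms by (intro integral_subset_le int_h) auto

text \<open>The outer integration costs only the length of the interval; what remains is the
  integral of |h| up to x, the form of Lipschitz bound that the fixed point theorem asks
  for.\<close>

lemma integral_wavg_bound:
  assumes h: "continuous_on {a..b} h" and x: "x \<in> {a..b}"
  shows "\<bar>integral {a..x} (wavg q a h)\<bar> \<le> CM * (b - a) * integral {a..x} (\<lambda>r. \<bar>h r\<bar>)"
proof -
  let ?I = "integral {a..x} (\<lambda>r. \<bar>h r\<bar>)"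
  have ah: "continuous_on {a..b} (\<lambda>r. \<bar>h r\<bar>)" by (intro continuous_intros h)
  have I: "0 \<le> ?I" by (intro integral_nonneg int_h[OF ah x]) auto
  have "\<bar>integral {a..x} (wavg q a h)\<bar> \<le> integral {a..x} (\<lambda>_. CM * ?I)"
  proof (rule integral_norm_bound_integral[where 'a = real, unfolded real_norm_def])
    show "wavg q a h integrable_on {a..x}" by (rule int_h[OF wavg_cont[OF h] x])
    fix r assume r: "r \<in> {a..x}"
    have "\<bar>wavg q a h r\<bar> \<le> CM * integral {a..r} (\<lambda>r. \<bar>h r\<bar>)"
      using r x by (intro wavg_bound h) auto
    also have "\<dots> \<le> CM * ?I"
      using r x CM_pos by (intro mult_left_mono integral_mono_upper ah) auto
    finally show "\<bar>wavg q a h r\<bar> \<le> CM * ?I" .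
  qed auto
  also have "\<dots> = (x - a) * (CM * ?I)" using x by simp
  also have "\<dots> \<le> (b - a) * (CM * ?I)"
    using x CM_pos I by (intro mult_right_mono) auto
  finally show ?thesis by (simp add: algebra_simps)
qed

text \<open>The common source of boundedness, uniqueness, continuous dependence and
  differentiability in \<Gamma>: u is a solution or a difference of solutions, and \<open>e\<close>
  is the part of its source term that is not controlled by u itself.\<close>

lemma wavg_gronwall:
  assumes u: "continuous_on {a..b} u" and H: "continuous_on {a..b} H"
    and eq: "\<And>x. x \<in> {a..b} \<Longrightarrow> u x = g x - integral {a..x} (wavg q a H)"
    and g: "\<And>x. x \<in> {a..b} \<Longrightarrow> \<bar>g x\<bar> \<le> A"
    and le: "\<And>r. r \<in> {a..b} \<Longrightarrow> \<bar>H r\<bar> \<le> L * \<bar>u r\<bar> + e"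
    and L: "0 \<le> L" and e: "0 \<le> e" and x: "x \<in> {a..b}"
  shows "\<bar>u x\<bar> \<le> (A + CM * (b - a) ^ 2 * e) * exp (CM * (b - a) * L * (b - a))"
proof -
  have abH: "continuous_on {a..b} (\<lambda>r. \<bar>H r\<bar>)" and abu: "continuous_on {a..b} (\<lambda>r. \<bar>u r\<bar>)"
    by (intro continuous_intros H u)+
  define C where "C = CM * (b - a)"
  have C: "0 \<le> C" using CM_pos ab by (simp add: C_def)
  have "\<bar>u x\<bar> \<le> (A + C * (b - a) * e) * exp (C * L * (x - a))"
  proof (rule gronwall_integral[OF abu _ _ x])
    fix y assume y: "y \<in> {a..b}"
    have "\<bar>u y\<bar> \<le> A + \<bar>integral {a..y} (wavg q a H)\<bar>"
      using eq[OF y] g[OF y] by linarith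
    also have "\<bar>integral {a..y} (wavg q a H)\<bar> \<le> C * integral {a..y} (\<lambda>r. \<bar>H r\<bar>)"
      using integral_wavg_bound[OF H y] by (simp add: C_def)
    also have "\<dots> \<le> C * integral {a..y} (\<lambda>r. L * \<bar>u r\<bar> + e)"
      using y by (intro mult_left_mono integral_le int_h[OF abH y] C int_h[OF _ y] continuous_intros u le) auto
    also have "integral {a..y} (\<lambda>r. L * \<bar>u r\<bar> + e) = L * integral {a..y} (\<lambda>r. \<bar>u r\<bar>) + e * (y - a)"
      using y by (subst integral_add) (auto intro!: int_h[OF _ y] continuous_intros u)
    also have "C * \<dots> \<le> C * (L * integral {a..y} (\<lambda>r. \<bar>u r\<bar>) + e * (b - a))"
      using y C e by (intro mult_left_mono add_left_mono) auto
    finally show "\<bar>u y\<bar> \<le> A + C * (b - a) * e + C * L * integral {a..y} (\<lambda>r. \<bar>u r\<bar>)"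
      by (simp add: algebra_simps)
  qed (use C L in auto)
  also have "\<dots> \<le> (A + C * (b - a) * e) * exp (C * L * (b - a))"
  proof (intro mult_left_mono)
    show "exp (C * L * (x - a)) \<le> exp (C * L * (b - a))"
      using x C L by (auto intro!: mult_left_mono)
    show "0 \<le> A + C * (b - a) * e"
      using g[OF x] C e ab by (intro add_nonneg_nonneg mult_nonneg_nonneg) auto
  qed
  finally show ?thesis by (simp add: C_def power2_eq_square mult.assoc)
qed

lemma wavg_volterra_exists:
  assumes g: "continuous_on {a..b} g"
    and cont: "\<And>u. continuous_on {a..b} u \<Longrightarrow> continuous_on {a..b} (\<lambda>r. F r (u r))"
    and lip: "\<And>r x y. r \<in> {a..b} \<Longrightarrow> \<bar>F r x - F r y\<bar> \<le> L * \<bar>x - y\<bar>"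
    and L: "0 \<le> L"
  obtains u where "continuous_on {a..b} u"
    "\<And>x. x \<in> {a..b} \<Longrightarrow> u x = g x - integral {a..x} (wavg q a (\<lambda>r. F r (u r)))"
proof -
  define T where "T u x = g x - integral {a..x} (wavg q a (\<lambda>r. F r (u r)))" for u x
  have "0 \<le> CM * (b - a) * L" using CM_pos ab L by auto
  moreover have "continuous_on {a..b} (T u)" if u: "continuous_on {a..b} u" for u
    unfolding T_def by (intro continuous_intros g integral_cont wavg_cont cont u)
  moreover have "\<bar>T u x - T v x\<bar> \<le> CM * (b - a) * L * integral {a..x} (\<lambda>s. \<bar>u s - v s\<bar>)"
    if u: "continuous_on {a..b} u" and v: "continuous_on {a..b} v" and x: "x \<in> {a..b}" for u v x
  proof -
    let ?d = "\<lambda>r. F r (u r) - F r (v r)"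
    have d: "continuous_on {a..b} ?d" by (intro continuous_intros cont u v)
    have ad: "continuous_on {a..b} (\<lambda>r. \<bar>?d r\<bar>)" by (intro continuous_intros d)
    have "\<bar>T u x - T v x\<bar> = \<bar>integral {a..x} (wavg q a ?d)\<bar>"
      using integral_wavg_diff[OF cont[OF u] cont[OF v] x] by (simp add: T_def)
    also have "\<dots> \<le> CM * (b - a) * integral {a..x} (\<lambda>r. \<bar>?d r\<bar>)"
      by (rule integral_wavg_bound[OF d x])
    also have "\<dots> \<le> CM * (b - a) * integral {a..x} (\<lambda>r. L * \<bar>u r - v r\<bar>)"
      using CM_pos ab x
      by (intro mult_left_mono integral_le int_h[OF ad x] int_h[OF _ x] lip continuous_intros u v) auto
    finally show ?thesis by (simp add: algebra_simps)
  qed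
  ultimately obtain u where "continuous_on {a..b} u" "\<And>x. x \<in> {a..b} \<Longrightarrow> u x = T u x"
    using volterra_fixpoint[OF less_imp_le[OF ab], of "CM * (b - a) * L" T] by blast
  then show ?thesis using that by (auto simp: T_def)
qed

text \<open>In divergence form (q v)' = - q h the singular coefficient q'/q has disappeared, and v a
  = 0 removes the boundary term, so integrating twice is legitimate even from the pole.\<close>

lemma ode_imp_volterra:
  assumes u: "continuous_on {a..b} u" and v: "continuous_on {a..b} v" and h: "continuous_on {a..b} h"
    and u': "\<And>x. a < x \<Longrightarrow> x < b \<Longrightarrow> (u has_real_derivative v x) (at x)"
    and v': "\<And>x. a < x \<Longrightarrow> x < b \<Longrightarrow> (v has_real_derivative - q' x / q x * v x - h x) (at x)"
    and 0: "q a * v a = 0" "v a = 0"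
    and x: "x \<in> {a..b}"
  shows "v x = - wavg q a h x" "u x = u a - integral {a..x} (wavg q a h)"
proof -
  have qv: "v y = - wavg q a h y" if y: "y \<in> {a..b}" for y
  proof (cases "y = a")
    case False
    have "((\<lambda>r. - q r * h r) has_integral q y * v y - q a * v a) {a..y}"
    proof (rule fundamental_theorem_of_calculus_interior)
      show "a \<le> y" using y by auto
      show "continuous_on {a..y} (\<lambda>r. q r * v r)"
        using y by (intro continuous_intros) (auto intro: continuous_on_subset[OF q_cont] continuous_on_subset[OF v])
      fix r assume r: "r \<in> {a<..<y}"
      then have "q r > 0" using q_pos[of r] y by auto
      then show "((\<lambda>r. q r * v r) has_vector_derivative - q r * h r) (at r)"
        unfolding has_real_derivative_iff_has_vector_derivative[symmetric]
        using r y by (auto intro!: derivative_eq_intros q_deriv[of r] v'[of r] simp: field_simps)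
    qed
    then have "q y * v y = - integral {a..y} (\<lambda>r. q r * h r)"
      using 0 by (simp add: integral_unique[symmetric] has_integral_iff)
    moreover have "q y > 0" using False y q_pos by auto
    ultimately show ?thesis by (simp add: wavg_def field_simps)
  qed (use 0 in \<open>simp add: wavg_def\<close>)
  then show "v x = - wavg q a h x" using x by blast
  have "(v has_integral u x - u a) {a..x}"
  proof (rule fundamental_theorem_of_calculus_interior)
    show "a \<le> x" using x by auto
    show "continuous_on {a..x} u" using x by (auto intro: continuous_on_subset[OF u])
    fix r assume r: "r \<in> {a<..<x}"
    then show "(u has_vector_derivative v r) (at r)"
      unfolding has_real_derivative_iff_has_vector_derivative[symmetric] using x by (auto intro!: u')
  qed
  then have "u x - u a = integral {a..x} v" by (simp add: integral_unique)
  also have "\<dots> = integral {a..x} (\<lambda>y. - wavg q a h y)"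
    using x by (intro integral_cong) (auto intro!: qv)
  finally show "u x = u a - integral {a..x} (wavg q a h)" by simp
qed

end

section \<open>The power nonlinearity\<close>

lemma nl_pos: "0 < u \<Longrightarrow> nl p u = u powr p"
  by (simp add: nl_def powr_mult_base mult.commute)

lemma nl_0 [simp]: "nl p 0 = 0" by (simp add: nl_def)

lemma nl_minus [simp]: "nl p (- u) = - nl p u" by (simp add: nl_def)

lemma nl_scale: "0 < c \<Longrightarrow> nl p (c * u) = c powr p * nl p u"
  by (simp add: nl_def abs_mult powr_mult powr_diff)

text \<open>At 0 the difference quotient is |h|^(p - 1) itself, which tends to 0 as p > 1; a second
  derivative does not exist there when p < 2.\<close>

lemma nl_deriv:
  assumes p: "1 < p"
  shows "(nl p has_real_derivative p * \<bar>u\<bar> powr (p - 1)) (at u)"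
proof -
  consider "u > 0" | "u < 0" | "u = 0" by linarith
  then show ?thesis
  proof cases
    case 1
    have "((\<lambda>x. x powr p) has_real_derivative p * \<bar>u\<bar> powr (p - 1)) (at u)"
      using 1 by (auto intro!: derivative_eq_intros)
    then show ?thesis
      by (rule has_field_derivative_transform_within_open[of _ _ _ "{0<..}"]) (use 1 in \<open>auto simp: nl_pos\<close>)
  next
    case 2
    have "((\<lambda>x. - ((- x) powr p)) has_real_derivative p * \<bar>u\<bar> powr (p - 1)) (at u)"
      using 2 by (auto intro!: derivative_eq_intros)
    moreover have "- ((- x) powr p) = nl p x" if "x < 0" for x
      using nl_pos[of "- x" p] that by simp
    ultimately show ?thesis
      by (elim has_field_derivative_transform_within_open[of _ _ _ "{..<0}"]) (use 2 in auto)
  next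
    case 3
    have "((\<lambda>h. \<bar>h\<bar> powr (p - 1)) \<longlongrightarrow> 0) (at (0::real))"
      by (rule tendsto_eq_intros refl | use p in force)+
    moreover have "\<forall>\<^sub>F h in at (0::real). \<bar>h\<bar> powr (p - 1) = (nl p (0 + h) - nl p 0) / h"
      by (auto simp: nl_def eventually_at intro!: exI[of _ 1])
    ultimately have "((\<lambda>h. (nl p (0 + h) - nl p 0) / h) \<longlongrightarrow> 0) (at 0)"
      by (rule Lim_transform_eventually)
    then show ?thesis using 3 p by (simp add: DERIV_def)
  qed
qed

lemma nl_cont: "1 < p \<Longrightarrow> continuous_on S (nl p)"
  using nl_deriv by (meson DERIV_isCont continuous_at_imp_continuous_on)

lemma nl_comp_cont:
  fixes u :: "real \<Rightarrow> real"
  shows "1 < p \<Longrightarrow> continuous_on S u \<Longrightarrow> continuous_on S (\<lambda>r. nl p (u r))"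
  by (rule continuous_on_compose2[OF nl_cont[of p UNIV]]) auto

lemma nl_deriv_cont:
  fixes u :: "real \<Rightarrow> real"
  shows "1 < p \<Longrightarrow> continuous_on S u \<Longrightarrow> continuous_on S (\<lambda>r. p * \<bar>u r\<bar> powr (p - 1))"
  by (intro continuous_on_mult continuous_on_const continuous_on_powr' continuous_on_rabs) auto

text \<open>The position of \<open>z\<close> is recorded twice: the distance to x suits the uniform
  continuity of the derivative, the order bounds keep z in intervals that contain x and y.\<close>

lemma nl_mvt:
  assumes p: "1 < p"
  obtains z where "\<bar>z - x\<bar> \<le> \<bar>y - x\<bar>" "min x y \<le> z" "z \<le> max x y"
    "nl p y - nl p x = p * \<bar>z\<bar> powr (p - 1) * (y - x)"
proof -
  consider "x < y" | "y < x" | "x = y" by linarith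
  then show ?thesis
  proof cases
    case 1
    then obtain z where "x < z" "z < y" "nl p y - nl p x = (y - x) * (p * \<bar>z\<bar> powr (p - 1))"
      using MVT2[OF 1, of "nl p" "\<lambda>z. p * \<bar>z\<bar> powr (p - 1)"] nl_deriv[OF p] by blast
    then show ?thesis by (intro that[of z]) (auto simp: algebra_simps)
  next
    case 2
    then obtain z where "y < z" "z < x" "nl p x - nl p y = (x - y) * (p * \<bar>z\<bar> powr (p - 1))"
      using MVT2[OF 2, of "nl p" "\<lambda>z. p * \<bar>z\<bar> powr (p - 1)"] nl_deriv[OF p] by blast
    then show ?thesis by (intro that[of z]) (auto simp: algebra_simps)
  qed (use that[of x] in auto)
qed

lemma nl_lip:
  assumes p: "1 < p" and "\<bar>x\<bar> \<le> M" "\<bar>y\<bar> \<le> M"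
  shows "\<bar>nl p x - nl p y\<bar> \<le> p * M powr (p - 1) * \<bar>x - y\<bar>"
proof -
  obtain z where z: "min y x \<le> z" "z \<le> max y x" "nl p x - nl p y = p * \<bar>z\<bar> powr (p - 1) * (x - y)"
    using nl_mvt[OF p] by metis
  then have "\<bar>z\<bar> \<le> M" using assms by linarith
  then have "p * \<bar>z\<bar> powr (p - 1) \<le> p * M powr (p - 1)"
    using p by (intro mult_left_mono powr_mono2) auto
  then show ?thesis unfolding z(3) using p by (simp add: abs_mult mult_right_mono)
qed

definition nlpot :: "real \<Rightarrow> real \<Rightarrow> real" where
  "nlpot p u = \<bar>u\<bar> powr (p + 1) / (p + 1)"

lemma nlpot_deriv:
  assumes p: "1 < p"
  shows "(nlpot p has_real_derivative nl p u) (at u)"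
proof -
  \<comment> \<open>As a product of nl p u and u the potential can be differentiated at 0 without a
    case distinction.\<close>
  have eq: "nlpot p = (\<lambda>u. nl p u * u / (p + 1))"
  proof
    fix u :: real
    have "\<bar>u\<bar> powr (p + 1) = \<bar>u\<bar> powr (p - 1) * (u * u)"
    proof (cases "u = 0")
      case False
      have "\<bar>u\<bar> powr ((p - 1) + 2) = \<bar>u\<bar> powr (p - 1) * \<bar>u\<bar> powr 2"
        by (rule powr_add)
      then show ?thesis using False by (simp add: power2_eq_square[symmetric] algebra_simps)
    qed simp
    then show "nlpot p u = nl p u * u / (p + 1)" by (simp add: nlpot_def nl_def mult.assoc)
  qed
  show ?thesis unfolding eq using p
    by (intro DERIV_cong[OF DERIV_cdivide[OF DERIV_mult[OF nl_deriv[OF p] DERIV_ident]]])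
      (simp add: nl_def field_simps)
qed

lemma nlpot_nonneg: "1 < p \<Longrightarrow> 0 \<le> nlpot p u" by (simp add: nlpot_def)

lemma nlpot_0 [simp]: "nlpot p 0 = 0" by (simp add: nlpot_def)

lemma nlpot_cont:
  fixes u :: "real \<Rightarrow> real"
  shows "1 < p \<Longrightarrow> continuous_on S u \<Longrightarrow> continuous_on S (\<lambda>r. nlpot p (u r))"
  unfolding nlpot_def
  by (intro continuous_on_divide continuous_on_const continuous_on_powr' continuous_on_rabs) auto

section \<open>Regular solutions\<close>

text \<open>\<open>g\<close> is a function, not a constant, so that a nonzero initial slope at an
  interior point can be moved into it.\<close>

definition volt_sol ::
  "(real \<Rightarrow> real) \<Rightarrow> real \<Rightarrow> real \<Rightarrow> (real \<Rightarrow> real \<Rightarrow> real) \<Rightarrow> (real \<Rightarrow> real) \<Rightarrow> (real \<Rightarrow> real) \<Rightarrow> bool" where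
  "volt_sol q a b F g u \<longleftrightarrow> continuous_on {a..b} u \<and>
     (\<forall>x\<in>{a..b}. u x = g x - integral {a..x} (wavg q a (\<lambda>r. F r (u r))))"

lemma wavg_cong:
  assumes "\<And>r. r \<in> {a..x} \<Longrightarrow> h r = k r"
  shows "wavg q a h x = wavg q a k x"
  unfolding wavg_def using assms by (auto intro!: arg_cong2[of _ _ _ _ "(/)"] integral_cong)

lemma integral_wavg_cong:
  assumes "\<And>r. r \<in> {a..x} \<Longrightarrow> h r = k r"
  shows "integral {a..x} (wavg q a h) = integral {a..x} (wavg q a k)"
  using assms by (intro integral_cong wavg_cong) auto

lemma volt_sol_subset: "volt_sol q a b F g u \<Longrightarrow> c \<le> b \<Longrightarrow> volt_sol q a c F g u"
  unfolding volt_sol_def by (auto elim: continuous_on_subset)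

lemma volt_sol_cong:
  assumes "volt_sol q a b F g u" "\<And>x. x \<in> {a..b} \<Longrightarrow> u x = w x"
  shows "volt_sol q a b F g w"
  unfolding volt_sol_def
proof (intro conjI ballI)
  have "continuous_on {a..b} u" using assms(1) by (simp add: volt_sol_def)
  then show "continuous_on {a..b} w" by (rule continuous_on_eq) (rule assms(2))
  fix x assume x: "x \<in> {a..b}"
  have "integral {a..x} (wavg q a (\<lambda>r. F r (u r))) = integral {a..x} (wavg q a (\<lambda>r. F r (w r)))"
    using x assms(2) by (intro integral_wavg_cong) auto
  then show "w x = g x - integral {a..x} (wavg q a (\<lambda>r. F r (w r)))"
    using assms x by (auto simp: volt_sol_def)
qed

lemma volt_sol_glue:
  assumes ex: "\<And>b. a < b \<Longrightarrow> b < B \<Longrightarrow> \<exists>u. volt_sol q a b F g u"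
    and un: "\<And>b u w x. a < b \<Longrightarrow> b < B \<Longrightarrow> volt_sol q a b F g u \<Longrightarrow> volt_sol q a b F g w \<Longrightarrow>
      x \<in> {a..b} \<Longrightarrow> u x = w x"
  shows "\<exists>u. \<forall>b. a < b \<and> b < B \<longrightarrow> volt_sol q a b F g u"
proof -
  obtain U where U: "\<And>b. a < b \<Longrightarrow> b < B \<Longrightarrow> volt_sol q a b F g (U b)" using ex by metis
  \<comment> \<open>The midpoint (x + B) / 2 is an endpoint strictly between x and B, so the
    solution chosen for it is available at x.\<close>
  define u where "u x = U ((x + B) / 2) x" for x
  have "volt_sol q a b F g u" if b: "a < b" "b < B" for b
  proof (rule volt_sol_cong[OF U[OF b]])
    fix x assume x: "x \<in> {a..b}"
    let ?c = "(x + B) / 2"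
    have c: "a < ?c" "?c < B" "x \<le> ?c" using x b by auto
    have m: "a < min b ?c" "min b ?c < B" using b c by auto
    show "U b x = u x" unfolding u_def
      by (rule un[OF m volt_sol_subset[OF U[OF b] min.cobounded1] volt_sol_subset[OF U[OF c(1,2)] min.cobounded2]]) (use x c in auto)
  qed
  then show ?thesis by blast
qed

context weight
begin

lemma volt_sol_deriv:
  assumes u: "volt_sol q a b F (\<lambda>_. \<Gamma>) u"
    and cont: "continuous_on {a..b} (\<lambda>r. F r (u r))"
  defines "v \<equiv> \<lambda>x. - wavg q a (\<lambda>r. F r (u r)) x"
  shows "continuous_on {a..b} v"
    "\<And>x. x \<in> {a..b} \<Longrightarrow> (u has_real_derivative v x) (at x within {a..b})"
    "\<And>x. a < x \<Longrightarrow> x < b \<Longrightarrow> (v has_real_derivative - q' x / q x * v x - F x (u x)) (at x)"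
    "u a = \<Gamma>" "v a = 0"
proof -
  show "continuous_on {a..b} v" unfolding v_def by (intro continuous_intros wavg_cont cont)
  have ux: "\<Gamma> - integral {a..x} (wavg q a (\<lambda>r. F r (u r))) = u x" if "x \<in> {a..b}" for x
    using u that by (simp add: volt_sol_def)
  show "(u has_real_derivative v x) (at x within {a..b})" if x: "x \<in> {a..b}" for x
  proof -
    have "((\<lambda>x. \<Gamma> - integral {a..x} (wavg q a (\<lambda>r. F r (u r)))) has_real_derivative v x) (at x within {a..b})"
      unfolding v_def
      by (auto intro!: derivative_eq_intros integral_has_real_derivative[OF wavg_cont[OF cont] x])
    then show ?thesis
      by (rule has_field_derivative_transform_within[OF _ zero_less_one x]) (rule ux)
  qed
  show "(v has_real_derivative - q' x / q x * v x - F x (u x)) (at x)" if "a < x" "x < b" for x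
    unfolding v_def using DERIV_minus[OF wavg_deriv[OF cont that]] by simp
  show "u a = \<Gamma>" using ux[of a] ab by simp
  show "v a = 0" by (simp add: v_def wavg_def)
qed

lemma volt_sol_deriv_at:
  assumes "volt_sol q a b F (\<lambda>_. \<Gamma>) u" "continuous_on {a..b} (\<lambda>r. F r (u r))" "a < x" "x < b"
  shows "(u has_real_derivative - wavg q a (\<lambda>r. F r (u r)) x) (at x)"
  using volt_sol_deriv(2)[OF assms(1,2), of x] assms(3,4) by (simp add: at_within_Icc_at)

text \<open>The energy v^2/2 + nlpot u changes only through the damping term - q'/q v^2, which is at
  most K v^2. At the left end it consists of the potential alone because v a = 0.\<close>

lemma nl_energy_bound:
  assumes p: "1 < p" and x: "x \<in> {a..b}"
    and u: "continuous_on {a..x} u" and v: "continuous_on {a..x} v" and va: "v a = 0"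
    and u': "\<And>y. a < y \<Longrightarrow> y < x \<Longrightarrow> (u has_real_derivative v y) (at y)"
    and v': "\<And>y. a < y \<Longrightarrow> y < x \<Longrightarrow> (v has_real_derivative - q' y / q y * v y - nl p (u y)) (at y)"
  shows "\<bar>u x\<bar> \<le> \<bar>u a\<bar> * CM ^ 2"
proof -
  let ?E = "\<lambda>y. v y ^ 2 / 2 + nlpot p (u y)"
  have "?E x \<le> ?E a * exp (2 * K * (x - a))"
  proof (rule gronwall_deriv[where y' = "\<lambda>y. - q' y / q y * v y ^ 2"])
    show "a \<le> x" using x by simp
    show "continuous_on {a..x} ?E" by (intro continuous_intros nlpot_cont p u v) auto
    fix y assume y: "a < y" "y < x"
    have "((\<lambda>y. nlpot p (u y)) has_real_derivative nl p (u y) * v y) (at y)"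
      by (rule DERIV_chain2[OF nlpot_deriv[OF p] u'[OF y]])
    then show "(?E has_real_derivative - q' y / q y * v y ^ 2) (at y)"
      by (auto intro!: derivative_eq_intros v'[OF y] simp: power2_eq_square algebra_simps add_divide_distrib diff_divide_distrib)
    have "q y > 0" "- K * q y \<le> q' y" using q_pos[of y] q_growth[of y] y x by auto
    then have "- q' y / q y \<le> K" by (simp add: field_simps)
    then have "- q' y / q y * v y ^ 2 \<le> K * v y ^ 2" by (intro mult_right_mono) auto
    also have "\<dots> \<le> 2 * K * ?E y" using K nlpot_nonneg[OF p] by (simp add: field_simps)
    finally show "- q' y / q y * v y ^ 2 \<le> 2 * K * ?E y" .
  qed
  also have "\<dots> \<le> nlpot p (u a) * CM ^ 2"
    unfolding CM_def power2_eq_square exp_add[symmetric] using x K va nlpot_nonneg[OF p, of "u a"]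
    by (auto intro!: mult_left_mono simp: algebra_simps intro: mult_left_mono)
  finally have "nlpot p (u x) \<le> nlpot p (u a) * CM ^ 2" using zero_le_power2[of "v x"] by linarith
  then have le: "\<bar>u x\<bar> powr (p + 1) \<le> \<bar>u a\<bar> powr (p + 1) * CM ^ 2"
    using p by (simp add: nlpot_def divide_le_cancel)
  \<comment> \<open>Since CM \<ge> 1, the factor CM^2 may be enlarged to its power p + 1; taking
    roots then leaves a bound that is linear in |u a|.\<close>
  have "(CM ^ 2) powr 1 \<le> (CM ^ 2) powr (p + 1)"
    using p CM_ge_1 by (intro powr_mono) auto
  then have "CM ^ 2 \<le> (CM ^ 2) powr (p + 1)" using CM_pos by simp
  then have "\<bar>u x\<bar> powr (p + 1) \<le> \<bar>u a\<bar> powr (p + 1) * (CM ^ 2) powr (p + 1)"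
    using le by (meson mult_left_mono order_trans powr_ge_zero)
  also have "\<dots> = (\<bar>u a\<bar> * CM ^ 2) powr (p + 1)" using CM_pos by (simp add: powr_mult)
  finally have "\<bar>u x\<bar> powr (p + 1) \<le> (\<bar>u a\<bar> * CM ^ 2) powr (p + 1)" .
  moreover have "0 \<le> \<bar>u a\<bar> * CM ^ 2" by simp
  ultimately show ?thesis
    using powr_less_mono2[of "p + 1" "\<bar>u a\<bar> * CM ^ 2" "\<bar>u x\<bar>"] p by linarith
qed

lemma nl_volt_bound:
  assumes p: "1 < p" and u: "volt_sol q a b (\<lambda>_. nl p) (\<lambda>_. \<Gamma>) u" and x: "x \<in> {a..b}"
  shows "\<bar>u x\<bar> \<le> \<bar>\<Gamma>\<bar> * CM ^ 2"
proof -
  have uc: "continuous_on {a..b} u" using u by (simp add: volt_sol_def)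
  note c = nl_comp_cont[OF p uc]
  note d = volt_sol_deriv[OF u c]
  have "\<bar>u x\<bar> \<le> \<bar>u a\<bar> * CM ^ 2"
    by (rule nl_energy_bound[where u = u and v = "\<lambda>x. - wavg q a (\<lambda>r. nl p (u r)) x", OF p x _ _ d(5)])
      (use x volt_sol_deriv_at[OF u c] d(3) in \<open>auto intro: continuous_on_subset[OF uc] continuous_on_subset[OF d(1)]\<close>)
  then show ?thesis using d(4) by simp
qed

text \<open>The nonlinearity is cut off at a height M above the energy bound: the cut-off problem is
  globally Lipschitz, and the bootstrap shows that its solution never meets the cut-off.\<close>

lemma nl_volt_exists:
  assumes p: "1 < p"
  shows "\<exists>u. volt_sol q a b (\<lambda>_. nl p) (\<lambda>_. \<Gamma>) u"
proof -
  define M where "M = \<bar>\<Gamma>\<bar> * CM ^ 2 + 1"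
  have M: "M > 0" unfolding M_def by (intro add_nonneg_pos mult_nonneg_nonneg) auto
  define cl where "cl x = max (- M) (min x M)" for x
  have cl: "\<bar>cl x\<bar> \<le> M" "\<bar>cl x - cl y\<bar> \<le> \<bar>x - y\<bar>" for x y using M by (auto simp: cl_def)
  have cl_id: "cl x = x" if "\<bar>x\<bar> \<le> M" for x using that by (auto simp: cl_def)
  define F where "F x = nl p (cl x)" for x
  have Fc: "continuous_on {a..b} (\<lambda>r. F (u r))" if "continuous_on {a..b} u" for u
    unfolding F_def cl_def by (intro nl_comp_cont p continuous_intros that)
  have FL: "\<bar>F x - F y\<bar> \<le> p * M powr (p - 1) * \<bar>x - y\<bar>" for x y
    unfolding F_def using p
    by (intro order_trans[OF nl_lip[OF p cl(1) cl(1)]] mult_left_mono cl(2)) auto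
  obtain u where u: "continuous_on {a..b} u"
    "\<And>x. x \<in> {a..b} \<Longrightarrow> u x = \<Gamma> - integral {a..x} (wavg q a (\<lambda>r. F (u r)))"
    using wavg_volterra_exists[of "\<lambda>_. \<Gamma>" "\<lambda>_. F" "p * M powr (p - 1)"] Fc FL p by auto
  then have vs: "volt_sol q a b (\<lambda>_. F) (\<lambda>_. \<Gamma>) u" by (simp add: volt_sol_def)
  note d = volt_sol_deriv[OF vs Fc[OF u(1)]]
  have bd: "\<bar>u x\<bar> < M" if x: "x \<in> {a..b}" for x
  proof (rule bootstrap_bound[of a b "\<lambda>x. \<bar>u x\<bar>", OF _ _ _ x])
    show "continuous_on {a..b} (\<lambda>x. \<bar>u x\<bar>)" by (intro continuous_intros u)
    have "1 \<le> CM ^ 2" using CM_ge_1 by (simp add: one_le_power)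
    then have "\<bar>\<Gamma>\<bar> * 1 \<le> \<bar>\<Gamma>\<bar> * CM ^ 2" by (intro mult_left_mono) auto
    then show "\<bar>u a\<bar> \<le> M" using d(4) by (simp add: M_def)
    fix y assume y: "y \<in> {a..b}" and le: "\<And>s. s \<in> {a..y} \<Longrightarrow> \<bar>u s\<bar> \<le> M"
    have "\<bar>u y\<bar> \<le> \<bar>u a\<bar> * CM ^ 2"
    proof (rule nl_energy_bound[where u = u and v = "\<lambda>x. - wavg q a (\<lambda>r. F (u r)) x", OF p y _ _ d(5)])
      show "continuous_on {a..y} u" "continuous_on {a..y} (\<lambda>x. - wavg q a (\<lambda>r. F (u r)) x)"
        using y by (auto intro: continuous_on_subset[OF u(1)] continuous_on_subset[OF d(1)])
      fix s assume s: "a < s" "s < y"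
      show "(u has_real_derivative - wavg q a (\<lambda>r. F (u r)) s) (at s)"
        using volt_sol_deriv_at[OF vs Fc[OF u(1)]] s y by auto
      have "F (u s) = nl p (u s)" using le[of s] s by (simp add: F_def cl_id)
      then show "((\<lambda>x. - wavg q a (\<lambda>r. F (u r)) x) has_real_derivative
          - q' s / q s * - wavg q a (\<lambda>r. F (u r)) s - nl p (u s)) (at s)"
        using d(3)[of s] s y by auto
    qed
    then show "\<bar>u y\<bar> < M" using d(4) by (simp add: M_def)
  qed
  have "volt_sol q a b (\<lambda>_. nl p) (\<lambda>_. \<Gamma>) u"
    unfolding volt_sol_def
  proof (intro conjI ballI u(1))
    fix x assume x: "x \<in> {a..b}"
    have "integral {a..x} (wavg q a (\<lambda>r. F (u r))) = integral {a..x} (wavg q a (\<lambda>r. nl p (u r)))"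
    proof (rule integral_wavg_cong)
      fix r assume "r \<in> {a..x}"
      then show "F (u r) = nl p (u r)" using bd[of r] x by (simp add: F_def cl_id)
    qed
    then show "u x = \<Gamma> - integral {a..x} (wavg q a (\<lambda>r. nl p (u r)))" using u(2)[OF x] by simp
  qed
  then show ?thesis by blast
qed

lemma nl_volt_dep:
  assumes p: "1 < p" and u: "volt_sol q a b (\<lambda>_. nl p) (\<lambda>_. \<Gamma>) u"
    and w: "volt_sol q a b (\<lambda>_. nl p) (\<lambda>_. \<Delta>) w"
    and M: "\<bar>\<Gamma>\<bar> \<le> M" "\<bar>\<Delta>\<bar> \<le> M" and x: "x \<in> {a..b}"
  shows "\<bar>u x - w x\<bar> \<le> \<bar>\<Gamma> - \<Delta>\<bar> * exp (CM * (b - a) * (p * (M * CM ^ 2) powr (p - 1)) * (b - a))"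
proof -
  have c: "continuous_on {a..b} u" "continuous_on {a..b} w" using u w by (auto simp: volt_sol_def)
  note nc = nl_comp_cont[OF p c(1)] nl_comp_cont[OF p c(2)]
  have le: "\<bar>u r\<bar> \<le> M * CM ^ 2" "\<bar>w r\<bar> \<le> M * CM ^ 2" if "r \<in> {a..b}" for r
    using nl_volt_bound[OF p u that] nl_volt_bound[OF p w that] M
    by (meson mult_right_mono order_trans zero_le_power2)+
  have "\<bar>u x - w x\<bar> \<le> (\<bar>\<Gamma> - \<Delta>\<bar> + CM * (b - a) ^ 2 * 0) *
      exp (CM * (b - a) * (p * (M * CM ^ 2) powr (p - 1)) * (b - a))"
  proof (rule wavg_gronwall[where g = "\<lambda>_. \<Gamma> - \<Delta>" and H = "\<lambda>r. nl p (u r) - nl p (w r)", OF _ _ _ _ _ _ _ x])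
    fix y assume y: "y \<in> {a..b}"
    show "u y - w y = \<Gamma> - \<Delta> - integral {a..y} (wavg q a (\<lambda>r. nl p (u r) - nl p (w r)))"
      using u w y unfolding integral_wavg_diff[OF nc y] by (simp add: volt_sol_def)
    show "\<bar>nl p (u y) - nl p (w y)\<bar> \<le> p * (M * CM\<^sup>2) powr (p - 1) * \<bar>u y - w y\<bar> + 0"
      using nl_lip[OF p le[OF y]] by simp
  qed (use p in \<open>auto intro!: continuous_intros c nc\<close>)
  then show ?thesis by simp
qed

lemma nl_volt_unique:
  assumes p: "1 < p" and u: "volt_sol q a b (\<lambda>_. nl p) (\<lambda>_. \<Gamma>) u"
    and w: "volt_sol q a b (\<lambda>_. nl p) (\<lambda>_. \<Gamma>) w" and x: "x \<in> {a..b}"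
  shows "u x = w x"
  using nl_volt_dep[OF p u w order_refl order_refl x] by simp

end

section \<open>Regular solutions on the sphere and their first zero\<close>

text \<open>The growth condition is a lower bound for cot on (0, b): up to pi/2 it is nonnegative,
  and beyond pi/2 one has sin x \<ge> sin b and cos x \<ge> -1.\<close>

lemma sphere_weight:
  assumes n: "0 < n" and a: "0 \<le> a" "a < b" and b: "b < pi"
  shows "weight (\<lambda>x. sin x ^ n) (\<lambda>x. real n * sin x ^ (n - 1) * cos x) a b (real n / sin b)"
proof
  have sb: "sin b > 0" using a b by (intro sin_gt_zero) auto
  show "a < b" "0 \<le> real n / sin b" using a sb by auto
  show "continuous_on {a..b} (\<lambda>x. sin x ^ n)" by (intro continuous_intros)
  show "0 \<le> sin a ^ n" using a b by (intro zero_le_power sin_ge_zero) auto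
  fix x assume x: "a < x"
  show "0 < sin x ^ n" if "x \<le> b" using x a b that by (intro zero_less_power sin_gt_zero) auto
  assume xb: "x < b"
  then have sx: "sin x > 0" using x a b by (intro sin_gt_zero) auto
  show "((\<lambda>x. sin x ^ n) has_real_derivative real n * sin x ^ (n - 1) * cos x) (at x)"
    by (auto intro!: derivative_eq_intros)
  have "- (sin x / sin b) \<le> cos x"
  proof (cases "x \<le> pi / 2")
    case True
    then have "cos x \<ge> 0" using x a by (intro cos_ge_zero) auto
    moreover have "sin x / sin b \<ge> 0" using sx sb by auto
    ultimately show ?thesis by linarith
  next
    case False
    then have "sin (pi - b) \<le> sin (pi - x)" using xb b by (intro sin_monotone_2pi_le) auto
    then have "sin x / sin b \<ge> 1" using sb by (simp add: field_simps)
    then show ?thesis using cos_ge_minus_one[of x] by linarith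
  qed
  then have le: "real n * sin x ^ (n - 1) * (- (sin x / sin b)) \<le> real n * sin x ^ (n - 1) * cos x"
    using sx by (intro mult_left_mono) auto
  have "sin x ^ n = sin x ^ (n - 1) * sin x" using n by (cases n) auto
  then have "- (real n / sin b) * sin x ^ n = real n * sin x ^ (n - 1) * (- (sin x / sin b))" by simp
  also note le
  finally show "- (real n / sin b) * sin x ^ n \<le> real n * sin x ^ (n - 1) * cos x" .
qed

lemma first_root_exists:
  fixes U :: "real \<Rightarrow> real"
  assumes "continuous_on {a..b} U" "a \<le> b" "0 < U a" "U b \<le> 0"
  obtains \<theta> where "a < \<theta>" "\<theta> \<le> b" "U \<theta> = 0" "\<And>t. a \<le> t \<Longrightarrow> t < \<theta> \<Longrightarrow> 0 < U t"
proof -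
  define S where "S = {a..b} \<inter> U -` {..0}"
  have "closed S" unfolding S_def
    by (intro continuous_closed_preimage assms) auto
  moreover have "bounded S" unfolding S_def by (rule bounded_subset[of "{a..b}"]) auto
  moreover have "b \<in> S" using assms by (auto simp: S_def)
  ultimately obtain c where c: "c \<in> S" "\<And>s. s \<in> S \<Longrightarrow> c \<le> s"
    using compact_attains_inf[of S] by (auto simp: compact_eq_bounded_closed)
  then have cab: "c \<in> {a..b}" "U c \<le> 0" by (auto simp: S_def)
  have pos: "0 < U t" if "a \<le> t" "t < c" for t
  proof (rule ccontr)
    assume "\<not> 0 < U t"
    then have "t \<in> S" using that cab by (auto simp: S_def)
    then show False using c(2)[of t] that by auto
  qed
  obtain z where z: "a \<le> z" "z \<le> c" "U z = 0"
    using IVT2'[of U c 0 a] assms cab continuous_on_subset[OF assms(1), of "{a..c}"] by auto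
  then have "z \<in> S" using cab by (auto simp: S_def)
  then have "z = c" using c(2)[of z] z by auto
  moreover have "a < c" using cab assms(3) by (cases "a = c") auto
  ultimately show ?thesis using that[of c] z cab pos by auto
qed

text \<open>As n \<ge> 2, sin^n x \<le> (pi - x)^2, so V \<le> - c / (pi - x)^2, and the primitive
  of this bound diverges at pi.\<close>

lemma negative_before_pi:
  fixes U V :: "real \<Rightarrow> real"
  assumes n: "2 \<le> n" and x0: "0 < x0" "x0 < pi" and c: "0 < c"
    and der: "\<And>x. x0 \<le> x \<Longrightarrow> x < pi \<Longrightarrow> (U has_real_derivative V x) (at x)"
    and le: "\<And>x. x0 \<le> x \<Longrightarrow> x < pi \<Longrightarrow> sin x ^ n * V x \<le> - c"
  shows "\<exists>x. x0 < x \<and> x < pi \<and> U x < 0"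
proof -
  \<comment> \<open>A bounds U + c / (pi - x) at x0 and is so large that the point x with c / (pi -
    x) = A + 1 lies to the right of x0; at this point U \<le> -1.\<close>
  define A where "A = max (U x0 + c / (pi - x0)) (2 * c / (pi - x0))"
  have A: "A > 0" unfolding A_def using x0 c by (simp add: less_max_iff_disj)
  define x where "x = pi - c / (A + 1)"
  have Age: "2 * c / (pi - x0) \<le> A" "U x0 + c / (pi - x0) \<le> A" by (auto simp: A_def)
  then have "2 * c \<le> A * (pi - x0)" using x0 by (simp add: field_simps)
  also have "\<dots> \<le> (A + 1) * (pi - x0)" using x0 by (simp add: algebra_simps)
  finally have "c / (A + 1) \<le> (pi - x0) / 2" using A by (simp add: field_simps)
  then have x: "x0 < x" "x < pi" using c A x0 by (auto simp: x_def)
  let ?G = "\<lambda>x. U x + c / (pi - x)"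
  have "?G x \<le> ?G x0"
  proof (rule DERIV_nonpos_imp_nonincreasing[of x0 x ?G])
    show "x0 \<le> x" using x by simp
    fix y assume y: "x0 \<le> y" "y \<le> x"
    then have y': "x0 \<le> y" "y < pi" "pi - y \<noteq> 0" using x by auto
    have s: "0 < sin y" "sin y \<le> 1" using y' x0 by (auto intro!: sin_gt_zero)
    have sl: "sin y \<le> pi - y" using sin_x_le_x[of "pi - y"] y' by simp
    have "sin y ^ n \<le> sin y ^ 2" using n s by (intro power_decreasing) auto
    also have "\<dots> \<le> (pi - y) ^ 2" using s sl by (intro power_mono) auto
    finally have sn: "sin y ^ n \<le> (pi - y) ^ 2" .
    have "V y < 0"
    proof (rule ccontr)
      assume "\<not> V y < 0"
      then have "0 \<le> sin y ^ n * V y" using s by auto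
      then show False using le[of y] y' c by auto
    qed
    then have "(pi - y) ^ 2 * V y \<le> sin y ^ n * V y" using sn by (intro mult_right_mono_neg) auto
    then have "(pi - y) ^ 2 * V y \<le> - c" using le[of y] y' by linarith
    then have "V y + c / (pi - y) ^ 2 \<le> 0" using y' by (simp add: field_simps)
    moreover have "(?G has_real_derivative V y + c / (pi - y) ^ 2) (at y)"
      using y' by (auto intro!: derivative_eq_intros der simp: power2_eq_square)
    ultimately show "\<exists>z. (?G has_real_derivative z) (at y) \<and> z \<le> 0" by blast
  qed
  also have "\<dots> \<le> A" by (rule Age)
  finally have "U x + c / (pi - x) \<le> A" .
  moreover have "c / (pi - x) = A + 1" using c A by (simp add: x_def)
  ultimately have "U x < 0" by linarith
  then show ?thesis using x by blast
qed

locale sphere_problem =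
  fixes N :: nat and p :: real
  assumes N: "3 \<le> N" and pS: "(real N + 2) / (real N - 2) < p"
begin

definition n where "n = N - 1"

lemma n_ge: "2 \<le> n" "0 < n" "real n = real N - 1" using N by (auto simp: n_def)

lemma p_gt_1: "1 < p"
proof -
  have "1 < (real N + 2) / (real N - 2)" using N by (simp add: field_simps)
  then show ?thesis using pS by linarith
qed

abbreviation qs :: "real \<Rightarrow> real" where "qs \<equiv> \<lambda>x. sin x ^ n"
abbreviation qs' :: "real \<Rightarrow> real" where "qs' \<equiv> \<lambda>x. real n * sin x ^ (n - 1) * cos x"

lemma weight_qs: "0 \<le> a \<Longrightarrow> a < b \<Longrightarrow> b < pi \<Longrightarrow> weight qs qs' a b (real n / sin b)"
  using sphere_weight[of n a b] n_ge by simp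

lemma weight_qs0: "0 < b \<Longrightarrow> b < pi \<Longrightarrow> weight qs qs' 0 b (real n / sin b)"
  using weight_qs[of 0 b] by simp

lemma qs'_div: "sin x \<noteq> 0 \<Longrightarrow> qs' x / qs x = real n * (cos x / sin x)"
  using n_ge by (cases n) (auto simp: field_simps)

lemma rhs_eq:
  assumes "sin x \<noteq> 0"
  shows "- qs' x / qs x * v - nl p u = rhs N p x u v"
proof -
  have "- qs' x / qs x * v = - (qs' x / qs x) * v" by simp
  also have "\<dots> = - (real N - 1) * (cos x / sin x) * v"
    by (simp only: qs'_div[OF assms]) (simp add: n_ge(3) algebra_simps diff_divide_distrib)
  finally show ?thesis by (simp add: rhs_def)
qed

definition Us :: "real \<Rightarrow> real \<Rightarrow> real" where
  "Us \<Gamma> = (SOME u. \<forall>b. 0 < b \<and> b < pi \<longrightarrow> volt_sol qs 0 b (\<lambda>_. nl p) (\<lambda>_. \<Gamma>) u)"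

definition Vs :: "real \<Rightarrow> real \<Rightarrow> real" where
  "Vs \<Gamma> x = - wavg qs 0 (\<lambda>r. nl p (Us \<Gamma> r)) x"

lemma Us_volt:
  assumes b: "0 < b" "b < pi"
  shows "volt_sol qs 0 b (\<lambda>_. nl p) (\<lambda>_. \<Gamma>) (Us \<Gamma>)"
proof -
  have "\<exists>u. \<forall>b. 0 < b \<and> b < pi \<longrightarrow> volt_sol qs 0 b (\<lambda>_. nl p) (\<lambda>_. \<Gamma>) u"
    using weight.nl_volt_exists[OF weight_qs0 p_gt_1] weight.nl_volt_unique[OF weight_qs0 p_gt_1]
    by (intro volt_sol_glue) blast+
  from someI_ex[OF this] show ?thesis using b unfolding Us_def by blast
qed

lemma Us_cont: "b < pi \<Longrightarrow> continuous_on {0..b} (Us \<Gamma>)"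
  using Us_volt[of b \<Gamma>] by (cases "0 < b"; cases "b = 0") (auto simp: volt_sol_def)

lemma nl_Us_cont: "b < pi \<Longrightarrow> continuous_on {0..b} (\<lambda>r. nl p (Us \<Gamma> r))"
  by (intro nl_comp_cont p_gt_1 Us_cont)

lemma Us_0 [simp]: "Us \<Gamma> 0 = \<Gamma>"
  using Us_volt[of 1 \<Gamma>] pi_gt3 by (auto simp: volt_sol_def)

lemma Vs_0 [simp]: "Vs \<Gamma> 0 = 0" by (simp add: Vs_def wavg_def)

lemma Vs_cont: assumes "b < pi" shows "continuous_on {0..b} (Vs \<Gamma>)"
proof (cases "0 < b")
  case True
  interpret weight qs qs' 0 b "real n / sin b" using weight_qs0[OF True assms] .
  show ?thesis unfolding Vs_def by (intro continuous_intros wavg_cont nl_Us_cont assms)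
next
  case False
  then show ?thesis by (cases "b = 0") auto
qed

lemma Us_deriv_within:
  assumes "0 \<le> x" "x \<le> b" "0 < b" "b < pi"
  shows "(Us \<Gamma> has_real_derivative Vs \<Gamma> x) (at x within {0..b})"
proof -
  interpret weight qs qs' 0 b "real n / sin b" using weight_qs0 assms by auto
  show ?thesis using volt_sol_deriv(2)[OF Us_volt nl_Us_cont, of x] assms by (simp add: Vs_def)
qed

lemma Us_deriv:
  assumes "0 < x" "x < pi"
  shows "(Us \<Gamma> has_real_derivative Vs \<Gamma> x) (at x)"
proof -
  obtain b where b: "x < b" "b < pi" using dense assms by blast
  then show ?thesis using Us_deriv_within[of x b \<Gamma>] assms by (simp add: at_within_Icc_at)
qed

lemma Vs_deriv:
  assumes "0 < x" "x < pi"
  shows "(Vs \<Gamma> has_real_derivative rhs N p x (Us \<Gamma> x) (Vs \<Gamma> x)) (at x)"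
proof -
  obtain b where b: "x < b" "b < pi" using dense assms by blast
  then have b0: "0 < b" using assms by simp
  interpret weight qs qs' 0 b "real n / sin b" using weight_qs0 b b0 by auto
  have "sin x > 0" using assms by (intro sin_gt_zero) auto
  then have s: "sin x \<noteq> 0" by simp
  have [abs_def]: "- wavg qs 0 (\<lambda>r. nl p (Us \<Gamma> r)) x = Vs \<Gamma> x" for x by (simp add: Vs_def)
  from volt_sol_deriv(3)[OF Us_volt[OF b0 b(2)] nl_Us_cont[OF b(2)] assms(1) b(1), of \<Gamma>,
      unfolded this rhs_eq[OF s]]
  show ?thesis .
qed

lemma ivp_Us: "ivp_sol N p \<Gamma> pi (Us \<Gamma>) (Vs \<Gamma>)"
  unfolding ivp_sol_def
proof (intro conjI ballI)
  show "continuous_on {0..<pi} (Vs \<Gamma>)"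
    unfolding continuous_on_eq_continuous_within
  proof
    fix x assume x: "x \<in> {0..<pi}"
    then obtain b where b: "x < b" "b < pi" using dense[of x pi] by auto
    have "continuous (at x within {0..b}) (Vs \<Gamma>)"
      using Vs_cont[OF b(2)] x b by (auto simp: continuous_on_eq_continuous_within)
    moreover have "at x within {0..b} = at x within {0..<pi}"
      by (rule at_within_nhd[of x "{..<b}"]) (use x b in auto)
    ultimately show "continuous (at x within {0..<pi}) (Vs \<Gamma>)" by simp
  qed
  fix x assume x: "x \<in> {0..<pi}"
  then obtain b where b: "x < b" "b < pi" using dense[of x pi] by auto
  have "at x within {0..b} = at x within {0..<pi}"
    by (rule at_within_nhd[of x "{..<b}"]) (use x b in auto)
  then show "(Us \<Gamma> has_real_derivative Vs \<Gamma> x) (at x within {0..<pi})"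
    using Us_deriv_within[of x b \<Gamma>] x b by auto
qed (use Vs_deriv in auto)

text \<open>Every solution in the sense of \<open>ivp_sol\<close> solves the Volterra equation on
  each smaller interval. Since \<open>first_zero\<close> quantifies over all solutions, this
  identification is what makes the zero well defined.\<close>

lemma ivp_unique:
  assumes ivp: "ivp_sol N p \<Gamma> b U V" and t: "0 \<le> t" "t < b"
  shows "U t = Us \<Gamma> t" "V t = Vs \<Gamma> t"
proof -
  obtain c where c: "t < c" "c < b" using dense t by blast
  have b: "b \<le> pi" using ivp by (simp add: ivp_sol_def)
  have c0: "0 < c" "c < pi" using c t b by auto
  interpret weight qs qs' 0 c "real n / sin c" using weight_qs0 c0 by auto
  have Uc: "continuous_on {0..c} U"
  proof (rule continuous_on_subset)
    show "continuous_on {0..<b} U"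
      by (rule DERIV_continuous_on[where D = V]) (use ivp in \<open>auto simp: ivp_sol_def\<close>)
  qed (use c in auto)
  have Vc: "continuous_on {0..c} V"
    by (rule continuous_on_subset[of "{0..<b}"]) (use ivp c in \<open>auto simp: ivp_sol_def\<close>)
  have U': "(U has_real_derivative V x) (at x)" if x: "0 < x" "x < c" for x
  proof -
    have "at x within {0..<b} = at x" by (rule at_within_nhd[of x "{0<..<b}"]) (use x c in auto)
    moreover have "(U has_real_derivative V x) (at x within {0..<b})"
      using ivp x c by (auto simp: ivp_sol_def)
    ultimately show ?thesis by simp
  qed
  have V': "(V has_real_derivative - qs' x / qs x * V x - nl p (U x)) (at x)" if x: "0 < x" "x < c" for x
  proof -
    have "sin x > 0" using x c0 by (intro sin_gt_zero) auto
    then show ?thesis using rhs_eq[of x "V x" "U x"] ivp x c by (auto simp: ivp_sol_def)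
  qed
  have 0: "U 0 = \<Gamma>" "V 0 = 0" using ivp by (auto simp: ivp_sol_def)
  note v = ode_imp_volterra[OF Uc Vc nl_comp_cont[OF p_gt_1 Uc] U' V' _ 0(2)]
  have "volt_sol qs 0 c (\<lambda>_. nl p) (\<lambda>_. \<Gamma>) U"
    using v(2) 0 by (auto simp: volt_sol_def Uc)
  then have eq: "U x = Us \<Gamma> x" if "x \<in> {0..c}" for x
    using nl_volt_unique[OF p_gt_1 _ Us_volt[OF c0] that] by blast
  show "U t = Us \<Gamma> t" using eq c t by auto
  have "V t = - wavg qs 0 (\<lambda>r. nl p (U r)) t" using v(1)[of t] 0 c t by auto
  also have "\<dots> = Vs \<Gamma> t"
    unfolding Vs_def by (intro arg_cong[of _ _ uminus] wavg_cong) (use eq c t in auto)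
  finally show "V t = Vs \<Gamma> t" .
qed

lemma first_zero_iff:
  "first_zero N p \<Gamma> \<theta> \<longleftrightarrow> 0 < \<theta> \<and> \<theta> < pi \<and> Us \<Gamma> \<theta> = 0 \<and> (\<forall>t\<in>{0..<\<theta>}. 0 < Us \<Gamma> t)"
proof
  assume "first_zero N p \<Gamma> \<theta>"
  then obtain U V b where *: "0 < \<theta>" "\<theta> < b" "ivp_sol N p \<Gamma> b U V" "U \<theta> = 0" "\<forall>t\<in>{0..<\<theta>}. U t > 0"
    by (auto simp: first_zero_def)
  then have "b \<le> pi" by (simp add: ivp_sol_def)
  then show "0 < \<theta> \<and> \<theta> < pi \<and> Us \<Gamma> \<theta> = 0 \<and> (\<forall>t\<in>{0..<\<theta>}. 0 < Us \<Gamma> t)"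
    using * ivp_unique(1)[OF *(3)] by (auto simp: less_le_trans)
qed (use ivp_Us in \<open>auto simp: first_zero_def\<close>)

lemma qV_deriv:
  assumes "0 < x" "x < pi" "(U has_real_derivative V x) (at x)"
    "(V has_real_derivative rhs N p x (U x) (V x)) (at x)"
  shows "((\<lambda>x. qs x * V x) has_real_derivative - qs x * nl p (U x)) (at x)"
proof -
  have s: "sin x > 0" using assms by (intro sin_gt_zero) auto
  have "((\<lambda>x. qs x * V x) has_real_derivative qs' x * V x + rhs N p x (U x) (V x) * qs x) (at x)"
    by (rule DERIV_mult[OF _ assms(4)]) (auto intro!: derivative_eq_intros)
  moreover have "qs' x * V x + rhs N p x (U x) (V x) * qs x = - qs x * nl p (U x)"
    using s unfolding rhs_eq[of x, symmetric, OF less_imp_neq[OF s, symmetric]] by (simp add: field_simps)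
  ultimately show ?thesis by simp
qed

lemma qVs_decreasing:
  assumes x: "0 \<le> x" "x < y" "y < pi" and pos: "\<And>t. x < t \<Longrightarrow> t < y \<Longrightarrow> 0 < Us \<Gamma> t"
  shows "qs y * Vs \<Gamma> y < qs x * Vs \<Gamma> x"
proof (rule DERIV_neg_imp_decreasing_open[OF x(2)])
  show "continuous_on {x..y} (\<lambda>x. qs x * Vs \<Gamma> x)"
    using x by (intro continuous_intros continuous_on_subset[OF Vs_cont[OF x(3)]]) auto
  fix t assume t: "x < t" "t < y"
  then have t': "0 < t" "t < pi" using x by auto
  have "0 < sin t" using t' by (intro sin_gt_zero) auto
  then have "- qs t * nl p (Us \<Gamma> t) < 0" using pos[OF t] by (simp add: nl_pos)
  then show "\<exists>z. ((\<lambda>x. qs x * Vs \<Gamma> x) has_real_derivative z) (at t) \<and> z < 0"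
    using qV_deriv[OF t' Us_deriv[OF t'] Vs_deriv[OF t']] by blast
qed

lemma Vs_neg:
  assumes x: "0 < x" "x < pi" and pos: "\<And>t. 0 < t \<Longrightarrow> t < x \<Longrightarrow> 0 < Us \<Gamma> t"
  shows "Vs \<Gamma> x < 0"
proof -
  have "qs x * Vs \<Gamma> x < qs 0 * Vs \<Gamma> 0" by (rule qVs_decreasing) (use x pos in auto)
  moreover have "0 < sin x" using x by (intro sin_gt_zero) auto
  ultimately show ?thesis by (simp add: mult_less_0_iff)
qed

text \<open>If U stayed positive, sin^n U' would decrease strictly from 0, hence stay below a
  negative constant from pi/2 on, which drives U below 0 before pi.\<close>

lemma Us_zero_exists:
  assumes \<Gamma>: "0 < \<Gamma>"
  obtains \<theta> where "0 < \<theta>" "\<theta> < pi" "Us \<Gamma> \<theta> = 0" "\<And>t. 0 \<le> t \<Longrightarrow> t < \<theta> \<Longrightarrow> 0 < Us \<Gamma> t"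
proof -
  have "\<exists>x. 0 < x \<and> x < pi \<and> Us \<Gamma> x \<le> 0"
  proof (rule ccontr)
    assume "\<not> ?thesis"
    then have pos: "0 < Us \<Gamma> x" if "0 < x" "x < pi" for x using that by force
    define c where "c = - (qs (pi/2) * Vs \<Gamma> (pi/2))"
    have c: "c > 0" using Vs_neg[of "pi/2" \<Gamma>] pos by (simp add: c_def)
    have le: "qs x * Vs \<Gamma> x \<le> - c" if "pi/2 \<le> x" "x < pi" for x
    proof (cases "x = pi/2")
      case True
      show ?thesis unfolding True c_def by simp
    next
      case False
      then have "qs x * Vs \<Gamma> x < qs (pi/2) * Vs \<Gamma> (pi/2)"
        by (intro qVs_decreasing pos) (use that in auto)
      then show ?thesis by (simp add: c_def)
    qed
    have "\<exists>x. pi/2 < x \<and> x < pi \<and> Us \<Gamma> x < 0"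
      by (rule negative_before_pi[OF n_ge(1) _ _ c Us_deriv le]) auto
    then obtain x where "pi/2 < x" "x < pi" "Us \<Gamma> x < 0" by auto
    then show False using pos[of x] by auto
  qed
  then obtain x where x: "0 < x" "x < pi" "Us \<Gamma> x \<le> 0" by auto
  then obtain \<theta> where "0 < \<theta>" "\<theta> \<le> x" "Us \<Gamma> \<theta> = 0" "\<And>t. 0 \<le> t \<Longrightarrow> t < \<theta> \<Longrightarrow> 0 < Us \<Gamma> t"
    using first_root_exists[OF Us_cont[OF x(2)], of \<Gamma>] \<Gamma> by auto
  then show ?thesis using that x by force
qed

lemma first_zero_ex1:
  assumes "0 < \<Gamma>"
  shows "\<exists>!\<theta>. first_zero N p \<Gamma> \<theta>"
proof -
  obtain \<theta> where "0 < \<theta>" "\<theta> < pi" "Us \<Gamma> \<theta> = 0" "\<And>t. 0 \<le> t \<Longrightarrow> t < \<theta> \<Longrightarrow> 0 < Us \<Gamma> t"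
    using Us_zero_exists[OF assms] by blast
  note \<theta> = this
  show ?thesis unfolding first_zero_iff
  proof (rule ex1I[of _ \<theta>])
    fix \<eta> assume \<eta>: "0 < \<eta> \<and> \<eta> < pi \<and> Us \<Gamma> \<eta> = 0 \<and> (\<forall>t\<in>{0..<\<eta>}. 0 < Us \<Gamma> t)"
    then have "\<not> \<eta> < \<theta>" using \<theta>(4)[of \<eta>] by auto
    moreover have "\<not> \<theta> < \<eta>" using \<theta>(1,3) \<eta> by (auto dest!: bspec[of _ _ \<theta>])
    ultimately show "\<eta> = \<theta>" by simp
  qed (use \<theta> in auto)
qed

abbreviation \<Theta> :: "real \<Rightarrow> real" where "\<Theta> \<equiv> Theta N p"

text \<open>The last claim is the transversality at the zero on which the differentiability of
  \<Theta> rests.\<close>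

lemma Theta_props:
  assumes "0 < \<Gamma>"
  shows "0 < \<Theta> \<Gamma>" "\<Theta> \<Gamma> < pi" "Us \<Gamma> (\<Theta> \<Gamma>) = 0" "\<And>t. 0 \<le> t \<Longrightarrow> t < \<Theta> \<Gamma> \<Longrightarrow> 0 < Us \<Gamma> t"
    "Vs \<Gamma> (\<Theta> \<Gamma>) < 0"
proof -
  have "first_zero N p \<Gamma> (\<Theta> \<Gamma>)"
    unfolding Theta_def by (rule theI'[OF first_zero_ex1[OF assms]])
  then show *: "0 < \<Theta> \<Gamma>" "\<Theta> \<Gamma> < pi" "Us \<Gamma> (\<Theta> \<Gamma>) = 0" "\<And>t. 0 \<le> t \<Longrightarrow> t < \<Theta> \<Gamma> \<Longrightarrow> 0 < Us \<Gamma> t"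
    by (auto simp: first_zero_iff)
  show "Vs \<Gamma> (\<Theta> \<Gamma>) < 0" by (rule Vs_neg) (use * in auto)
qed

lemma Theta_le: "0 < \<Gamma> \<Longrightarrow> 0 \<le> x \<Longrightarrow> Us \<Gamma> x \<le> 0 \<Longrightarrow> \<Theta> \<Gamma> \<le> x"
  using Theta_props(4)[of \<Gamma> x] by force

lemma Theta_less: "0 < \<Gamma> \<Longrightarrow> 0 \<le> x \<Longrightarrow> Us \<Gamma> x < 0 \<Longrightarrow> \<Theta> \<Gamma> < x"
  using Theta_le[of \<Gamma> x] Theta_props(3)[of \<Gamma>] by (cases "\<Theta> \<Gamma> = x") auto

lemma Theta_greater: "0 < \<Gamma> \<Longrightarrow> (\<And>t. 0 \<le> t \<Longrightarrow> t \<le> x \<Longrightarrow> 0 < Us \<Gamma> t) \<Longrightarrow> x < \<Theta> \<Gamma>"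
  using Theta_props(1,3)[of \<Gamma>] by (metis less_eq_real_def less_irrefl linorder_not_less)

lemma Us_bound:
  assumes b: "0 < b" "b < pi"
  obtains C where "1 \<le> C" "\<And>\<Gamma> x. 0 \<le> x \<Longrightarrow> x \<le> b \<Longrightarrow> \<bar>Us \<Gamma> x\<bar> \<le> \<bar>\<Gamma>\<bar> * C"
proof -
  interpret weight qs qs' 0 b "real n / sin b" using weight_qs0[OF b] .
  show ?thesis
    using that[of "CM ^ 2"] nl_volt_bound[OF p_gt_1 Us_volt[OF b]] CM_ge_1 by (auto simp: one_le_power)
qed

lemma Us_lip:
  assumes b: "0 < b" "b < pi"
  obtains C where "0 \<le> C" "\<And>\<Gamma> \<Delta> x. \<bar>\<Gamma>\<bar> \<le> M \<Longrightarrow> \<bar>\<Delta>\<bar> \<le> M \<Longrightarrow> 0 \<le> x \<Longrightarrow> x \<le> b \<Longrightarrow>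
    \<bar>Us \<Gamma> x - Us \<Delta> x\<bar> \<le> C * \<bar>\<Gamma> - \<Delta>\<bar>"
proof -
  interpret weight qs qs' 0 b "real n / sin b" using weight_qs0[OF b] .
  show ?thesis
    using nl_volt_dep[OF p_gt_1 Us_volt[OF b] Us_volt[OF b], of _ M]
    by (intro that[of "exp (CM * (b - 0) * (p * (M * CM ^ 2) powr (p - 1)) * (b - 0))"])
      (auto simp: mult.commute)
qed

end

section \<open>Differentiability of the first zero\<close>

text \<open>The moving argument will be the zero \<Theta> \<Delta>, inserted into quantities that
  converge uniformly as \<Delta> tends to \<Gamma>.\<close>

lemma uniform_limit_compose_tendsto:
  fixes f :: "'a \<Rightarrow> real \<Rightarrow> real"
  assumes f: "uniform_limit S f l F" and g: "(g \<longlongrightarrow> a) F" and S: "\<forall>\<^sub>F x in F. g x \<in> S"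
    and l: "isCont l a"
  shows "((\<lambda>x. f x (g x)) \<longlongrightarrow> l a) F"
proof -
  have "((\<lambda>x. f x (g x) - l (g x)) \<longlongrightarrow> 0) F"
  proof (rule tendstoI)
    fix e :: real assume "0 < e"
    with f have "\<forall>\<^sub>F x in F. \<forall>y\<in>S. dist (f x y) (l y) < e" by (auto simp: uniform_limit_iff)
    with S show "\<forall>\<^sub>F x in F. dist (f x (g x) - l (g x)) 0 < e"
      by eventually_elim (auto simp: dist_real_def)
  qed
  from tendsto_add[OF this isCont_tendsto_compose[OF l g]] show ?thesis by simp
qed

context weight
begin

lemma linear_volt_bound:
  assumes c: "continuous_on {a..b} c" "\<And>r. r \<in> {a..b} \<Longrightarrow> \<bar>c r\<bar> \<le> L"
    and u: "volt_sol q a b (\<lambda>r y. c r * y) g u"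
    and g: "\<And>x. x \<in> {a..b} \<Longrightarrow> \<bar>g x\<bar> \<le> A" and x: "x \<in> {a..b}"
  shows "\<bar>u x\<bar> \<le> A * exp (CM * (b - a) * L * (b - a))"
proof -
  have uc: "continuous_on {a..b} u" using u by (simp add: volt_sol_def)
  have L: "0 \<le> L" using c(2)[of a] ab by (auto intro: order_trans[OF abs_ge_zero])
  have "\<bar>u x\<bar> \<le> (A + CM * (b - a) ^ 2 * 0) * exp (CM * (b - a) * L * (b - a))"
    by (rule wavg_gronwall[where H = "\<lambda>r. c r * u r" and g = g, OF uc _ _ g _ L _ x])
      (use u in \<open>auto intro!: continuous_intros c uc mult_right_mono simp: volt_sol_def abs_mult\<close>)
  then show ?thesis by simp
qed

lemma linear_volt_exists:
  assumes c: "continuous_on {a..b} c" and g: "continuous_on {a..b} g"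
  shows "\<exists>u. volt_sol q a b (\<lambda>r y. c r * y) g u"
proof -
  have "bounded (c ` {a..b})" by (intro compact_imp_bounded compact_continuous_image c) auto
  then have "\<exists>L. \<forall>r\<in>{a..b}. \<bar>c r\<bar> \<le> L" by (auto simp: bounded_iff)
  then obtain L where L: "\<And>r. r \<in> {a..b} \<Longrightarrow> \<bar>c r\<bar> \<le> L" by blast
  then have "0 \<le> L" using order_trans[OF abs_ge_zero L[of a]] ab by simp
  moreover have "\<bar>c r * x - c r * y\<bar> \<le> L * \<bar>x - y\<bar>" if "r \<in> {a..b}" for r x y
    using L[OF that] by (simp add: abs_mult mult_right_mono flip: right_diff_distrib)
  moreover have "continuous_on {a..b} (\<lambda>r. c r * u r)" if "continuous_on {a..b} u" for u
    by (intro continuous_intros c that)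
  ultimately obtain u where "continuous_on {a..b} u"
    "\<And>x. x \<in> {a..b} \<Longrightarrow> u x = g x - integral {a..x} (wavg q a (\<lambda>r. c r * u r))"
    using wavg_volterra_exists[OF g, of "\<lambda>r y. c r * y" L] by blast
  then show ?thesis by (auto simp: volt_sol_def)
qed

lemma linear_volt_unique:
  assumes c: "continuous_on {a..b} c"
    and u: "volt_sol q a b (\<lambda>r y. c r * y) g u" and w: "volt_sol q a b (\<lambda>r y. c r * y) g w"
    and x: "x \<in> {a..b}"
  shows "u x = w x"
proof -
  have "bounded (c ` {a..b})" by (intro compact_imp_bounded compact_continuous_image c) auto
  then have "\<exists>L. \<forall>r\<in>{a..b}. \<bar>c r\<bar> \<le> L" by (auto simp: bounded_iff)
  then obtain L where L: "\<And>r. r \<in> {a..b} \<Longrightarrow> \<bar>c r\<bar> \<le> L" by blast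
  have uc: "continuous_on {a..b} u" "continuous_on {a..b} w" using u w by (auto simp: volt_sol_def)
  have "volt_sol q a b (\<lambda>r y. c r * y) (\<lambda>_. 0) (\<lambda>x. u x - w x)"
    unfolding volt_sol_def
  proof (intro conjI ballI)
    fix x assume x: "x \<in> {a..b}"
    have "integral {a..x} (wavg q a (\<lambda>r. c r * u r - c r * w r)) =
        integral {a..x} (wavg q a (\<lambda>r. c r * u r)) - integral {a..x} (wavg q a (\<lambda>r. c r * w r))"
      by (intro integral_wavg_diff continuous_intros c uc x)
    then show "u x - w x = 0 - integral {a..x} (wavg q a (\<lambda>r. c r * (u r - w r)))"
      using u w x by (simp add: volt_sol_def right_diff_distrib)
  qed (intro continuous_intros uc)
  from linear_volt_bound[OF c L this, of 0] x show ?thesis by simp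
qed

end

context sphere_problem
begin

definition cs :: "real \<Rightarrow> real \<Rightarrow> real" where
  "cs \<Gamma> r = p * \<bar>Us \<Gamma> r\<bar> powr (p - 1)"

lemma cs_cont: "b < pi \<Longrightarrow> continuous_on {0..b} (cs \<Gamma>)"
  unfolding cs_def by (intro nl_deriv_cont p_gt_1 Us_cont)

text \<open>The derivative of \<open>Us \<Gamma>\<close> with respect to \<open>\<Gamma>\<close>; its \<open>\<theta>\<close>-derivative is \<open>Ws \<Gamma>\<close>.\<close>
definition ws :: "real \<Rightarrow> real \<Rightarrow> real" where
  "ws \<Gamma> = (SOME u. \<forall>b. 0 < b \<and> b < pi \<longrightarrow> volt_sol qs 0 b (\<lambda>r y. cs \<Gamma> r * y) (\<lambda>_. 1) u)"

definition Ws :: "real \<Rightarrow> real \<Rightarrow> real" where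
  "Ws \<Gamma> x = - wavg qs 0 (\<lambda>r. cs \<Gamma> r * ws \<Gamma> r) x"

lemma ws_volt:
  assumes b: "0 < b" "b < pi"
  shows "volt_sol qs 0 b (\<lambda>r y. cs \<Gamma> r * y) (\<lambda>_. 1) (ws \<Gamma>)"
proof -
  have "\<exists>u. \<forall>b. 0 < b \<and> b < pi \<longrightarrow> volt_sol qs 0 b (\<lambda>r y. cs \<Gamma> r * y) (\<lambda>_. 1) u"
    using weight.linear_volt_exists[OF weight_qs0 cs_cont] weight.linear_volt_unique[OF weight_qs0 cs_cont]
    by (intro volt_sol_glue) (blast intro: continuous_on_const)+
  from someI_ex[OF this] show ?thesis using b unfolding ws_def by blast
qed

lemma ws_cont: "b < pi \<Longrightarrow> continuous_on {0..b} (ws \<Gamma>)"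
  using ws_volt[of b \<Gamma>] by (cases "0 < b"; cases "b = 0") (auto simp: volt_sol_def)

lemma csws_cont: "b < pi \<Longrightarrow> continuous_on {0..b} (\<lambda>r. cs \<Gamma> r * ws \<Gamma> r)"
  by (intro continuous_intros cs_cont ws_cont)

lemma ws_0 [simp]: "ws \<Gamma> 0 = 1"
  using ws_volt[of 1 \<Gamma>] pi_gt3 by (auto simp: volt_sol_def)

lemma ws_deriv:
  assumes "0 < x" "x < pi"
  shows "(ws \<Gamma> has_real_derivative Ws \<Gamma> x) (at x)"
proof -
  obtain b where b: "x < b" "b < pi" using dense assms by blast
  then have b0: "0 < b" using assms by simp
  interpret weight qs qs' 0 b "real n / sin b" using weight_qs0 b b0 by auto
  show ?thesis
    using volt_sol_deriv_at[OF ws_volt[OF b0 b(2)] csws_cont[OF b(2)] assms(1) b(1)] by (simp add: Ws_def)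
qed

lemma qWs_deriv:
  assumes "0 < x" "x < pi"
  shows "((\<lambda>x. qs x * Ws \<Gamma> x) has_real_derivative - qs x * (cs \<Gamma> x * ws \<Gamma> x)) (at x)"
proof -
  obtain b where b: "x < b" "b < pi" using dense assms by blast
  then have b0: "0 < b" using assms by simp
  interpret weight qs qs' 0 b "real n / sin b" using weight_qs0 b b0 by auto
  have s: "sin x > 0" using assms by (intro sin_gt_zero) auto
  have [abs_def]: "- wavg qs 0 (\<lambda>r. cs \<Gamma> r * ws \<Gamma> r) x = Ws \<Gamma> x" for x by (simp add: Ws_def)
  from volt_sol_deriv(3)[OF ws_volt[OF b0 b(2)] csws_cont[OF b(2)] assms(1) b(1), of \<Gamma>, unfolded this]
  have "((\<lambda>x. qs x * Ws \<Gamma> x) has_real_derivative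
     qs' x * Ws \<Gamma> x + (- qs' x / qs x * Ws \<Gamma> x - cs \<Gamma> x * ws \<Gamma> x) * qs x) (at x)"
    by (intro DERIV_mult q_deriv assms(1) b)
  then show ?thesis using s by (simp add: field_simps)
qed

lemma qWs_cont: assumes "b < pi" shows "continuous_on {0..b} (\<lambda>x. qs x * Ws \<Gamma> x)"
proof (cases "0 < b")
  case True
  interpret weight qs qs' 0 b "real n / sin b" using weight_qs0[OF True assms] .
  show ?thesis unfolding Ws_def by (intro continuous_intros wavg_cont csws_cont assms)
next
  case False
  then show ?thesis by (cases "b = 0") auto
qed

lemma uniform_limit_Us:
  assumes b: "0 < b" "b < pi"
  shows "uniform_limit {0..b} Us (Us \<Gamma>) (at \<Gamma>)"
proof -
  obtain C where C: "0 \<le> C" "\<And>\<Gamma>' \<Delta> x. \<bar>\<Gamma>'\<bar> \<le> \<bar>\<Gamma>\<bar> + 1 \<Longrightarrow> \<bar>\<Delta>\<bar> \<le> \<bar>\<Gamma>\<bar> + 1 \<Longrightarrow> 0 \<le> x \<Longrightarrow> x \<le> b \<Longrightarrow>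
    \<bar>Us \<Gamma>' x - Us \<Delta> x\<bar> \<le> C * \<bar>\<Gamma>' - \<Delta>\<bar>" using Us_lip[OF b] by blast
  show ?thesis
  proof (rule uniform_limitI)
    fix e :: real assume e: "0 < e"
    have "dist (Us x y) (Us \<Gamma> y) < e"
      if "dist x \<Gamma> < min 1 (e / (C + 1))" "y \<in> {0..b}" for x y
    proof -
      have d: "\<bar>x - \<Gamma>\<bar> < 1" "\<bar>x - \<Gamma>\<bar> < e / (C + 1)" using that by (auto simp: dist_real_def)
      have "\<bar>Us x y - Us \<Gamma> y\<bar> \<le> C * \<bar>x - \<Gamma>\<bar>" using d that by (intro C(2)) auto
      also have "\<dots> \<le> (C + 1) * \<bar>x - \<Gamma>\<bar>" by (intro mult_right_mono) auto
      also have "\<dots> < e" using d C(1) by (simp add: pos_less_divide_eq mult.commute)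
      finally show ?thesis by (simp add: dist_real_def)
    qed
    moreover have "0 < min 1 (e / (C + 1))" using e C by auto
    ultimately show "\<forall>\<^sub>F x in at \<Gamma>. \<forall>y\<in>{0..b}. dist (Us x y) (Us \<Gamma> y) < e"
      unfolding eventually_at by blast
  qed
qed

text \<open>The intermediate value \<open>z\<close> covers both \<open>cs \<Delta>\<close> and the mean value point of \<open>nl p\<close>.\<close>
lemma cs_close:
  assumes b: "0 < b" "b < pi" and e: "0 < e"
  shows "\<forall>\<^sub>F \<Delta> in at \<Gamma>. \<forall>x\<in>{0..b}. \<forall>z. \<bar>z - Us \<Gamma> x\<bar> \<le> \<bar>Us \<Delta> x - Us \<Gamma> x\<bar> \<longrightarrow>
    \<bar>p * \<bar>z\<bar> powr (p - 1) - cs \<Gamma> x\<bar> \<le> e"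
proof -
  obtain C where C: "1 \<le> C" "\<And>\<Gamma> x. 0 \<le> x \<Longrightarrow> x \<le> b \<Longrightarrow> \<bar>Us \<Gamma> x\<bar> \<le> \<bar>\<Gamma>\<bar> * C"
    using Us_bound[OF b] by blast
  define M where "M = \<bar>\<Gamma>\<bar> * C + 1"
  let ?k = "\<lambda>z. p * \<bar>z\<bar> powr (p - 1)"
  have "uniformly_continuous_on {-M..M} ?k"
    by (intro compact_uniformly_continuous nl_deriv_cont[OF p_gt_1] continuous_on_id) auto
  from this[unfolded uniformly_continuous_on_def, rule_format, OF e]
  obtain d where d: "d > 0" "\<And>x x'. x \<in> {-M..M} \<Longrightarrow> x' \<in> {-M..M} \<Longrightarrow> dist x' x < d \<Longrightarrow>
      dist (?k x') (?k x) < e"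
    by metis
  have "\<forall>\<^sub>F \<Delta> in at \<Gamma>. \<forall>x\<in>{0..b}. dist (Us \<Delta> x) (Us \<Gamma> x) < min d 1"
    using d by (intro uniform_limitD[OF uniform_limit_Us[OF b]]) auto
  then show ?thesis
  proof eventually_elim
    case (elim \<Delta>)
    show ?case
    proof (intro ballI allI impI)
      fix x z assume x: "x \<in> {0..b}" and z: "\<bar>z - Us \<Gamma> x\<bar> \<le> \<bar>Us \<Delta> x - Us \<Gamma> x\<bar>"
      have "\<bar>Us \<Gamma> x\<bar> \<le> M - 1" using C(2)[of x \<Gamma>] x by (simp add: M_def)
      moreover have "\<bar>z - Us \<Gamma> x\<bar> < min d 1" using elim x z by (force simp: dist_real_def)
      ultimately have "dist (?k z) (?k (Us \<Gamma> x)) < e" by (intro d(2)) (auto simp: dist_real_def)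
      then show "\<bar>?k z - cs \<Gamma> x\<bar> \<le> e" by (simp add: dist_real_def cs_def)
    qed
  qed
qed

lemma cs_bound:
  assumes b: "0 < b" "b < pi"
  obtains L where "0 \<le> L" "\<And>\<Gamma> x. \<bar>\<Gamma>\<bar> \<le> M \<Longrightarrow> 0 \<le> x \<Longrightarrow> x \<le> b \<Longrightarrow> \<bar>cs \<Gamma> x\<bar> \<le> L"
proof -
  obtain C where C: "1 \<le> C" "\<And>\<Gamma> x. 0 \<le> x \<Longrightarrow> x \<le> b \<Longrightarrow> \<bar>Us \<Gamma> x\<bar> \<le> \<bar>\<Gamma>\<bar> * C"
    using Us_bound[OF b] by blast
  show ?thesis
  proof (rule that[of "p * (\<bar>M\<bar> * C) powr (p - 1)"])
    fix \<Gamma> x assume *: "\<bar>\<Gamma>\<bar> \<le> M" "0 \<le> x" "x \<le> b"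
    have "\<bar>Us \<Gamma> x\<bar> \<le> \<bar>\<Gamma>\<bar> * C" using C * by auto
    also have "\<dots> \<le> \<bar>M\<bar> * C" using * C by (intro mult_right_mono) auto
    finally show "\<bar>cs \<Gamma> x\<bar> \<le> p * (\<bar>M\<bar> * C) powr (p - 1)"
      unfolding cs_def using p_gt_1 by (auto simp: abs_mult intro!: mult_left_mono powr_mono2)
  qed (use p_gt_1 in auto)
qed

lemma ws_bound:
  assumes b: "0 < b" "b < pi"
  obtains B where "0 \<le> B" "\<And>\<Gamma> x. \<bar>\<Gamma>\<bar> \<le> M \<Longrightarrow> 0 \<le> x \<Longrightarrow> x \<le> b \<Longrightarrow> \<bar>ws \<Gamma> x\<bar> \<le> B"
proof -
  interpret weight qs qs' 0 b "real n / sin b" using weight_qs0[OF b] .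
  obtain L where L: "0 \<le> L" "\<And>\<Gamma> x. \<bar>\<Gamma>\<bar> \<le> M \<Longrightarrow> 0 \<le> x \<Longrightarrow> x \<le> b \<Longrightarrow> \<bar>cs \<Gamma> x\<bar> \<le> L"
    using cs_bound[OF b] by blast
  show ?thesis
  proof (rule that)
    fix \<Gamma> x assume *: "\<bar>\<Gamma>\<bar> \<le> M" "0 \<le> x" "x \<le> b"
    show "\<bar>ws \<Gamma> x\<bar> \<le> 1 * exp (CM * (b - 0) * L * (b - 0))"
      by (rule linear_volt_bound[OF cs_cont[OF b(2)] _ ws_volt[OF b]]) (use * L in auto)
  qed simp
qed

text \<open>The difference satisfies the linear equation with potential cs \<Delta> and the source
  (cs \<Delta> - cs \<Gamma>) * ws \<Gamma>, which \<open>cs_close\<close> makes small.\<close>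

lemma uniform_limit_ws:
  assumes b: "0 < b" "b < pi"
  shows "uniform_limit {0..b} ws (ws \<Gamma>) (at \<Gamma>)"
proof (rule uniform_limitI)
  fix e :: real assume e: "0 < e"
  interpret weight qs qs' 0 b "real n / sin b" using weight_qs0[OF b] .
  obtain L where L: "0 \<le> L" "\<And>\<Delta> x. \<bar>\<Delta>\<bar> \<le> \<bar>\<Gamma>\<bar> + 1 \<Longrightarrow> 0 \<le> x \<Longrightarrow> x \<le> b \<Longrightarrow> \<bar>cs \<Delta> x\<bar> \<le> L"
    using cs_bound[OF b] by blast
  obtain B where B: "0 \<le> B" "\<And>\<Delta> x. \<bar>\<Delta>\<bar> \<le> \<bar>\<Gamma>\<bar> + 1 \<Longrightarrow> 0 \<le> x \<Longrightarrow> x \<le> b \<Longrightarrow> \<bar>ws \<Delta> x\<bar> \<le> B"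
    using ws_bound[OF b] by blast
  define E where "E = exp (CM * (b - 0) * L * (b - 0))"
  \<comment> \<open>k exceeds the amplification factor of the Gronwall estimate by 1, so that
    allowing the error e / k in the potential leaves the result strictly below e.\<close>
  define k where "k = CM * (b - 0) ^ 2 * B * E + 1"
  have k: "k > 0" unfolding k_def E_def using CM_pos B
    by (intro add_nonneg_pos mult_nonneg_nonneg) auto
  have "\<forall>\<^sub>F \<Delta> in at \<Gamma>. dist \<Delta> \<Gamma> < 1" by (auto simp: eventually_at intro!: exI[of _ 1])
  moreover have "e / k > 0" using e k by simp
  note cs_close[OF b this, of \<Gamma>]
  ultimately show "\<forall>\<^sub>F \<Delta> in at \<Gamma>. \<forall>x\<in>{0..b}. dist (ws \<Delta> x) (ws \<Gamma> x) < e"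
  proof eventually_elim
    case (elim \<Delta>)
    have \<Delta>: "\<bar>\<Delta>\<bar> \<le> \<bar>\<Gamma>\<bar> + 1" using elim(1) by (auto simp: dist_real_def)
    have close: "\<bar>cs \<Delta> x - cs \<Gamma> x\<bar> \<le> e / k" if "x \<in> {0..b}" for x
      using elim(2) that by (auto simp: cs_def)
    show ?case
    proof
      fix x assume x: "x \<in> {0..b}"
      have "\<bar>ws \<Delta> x - ws \<Gamma> x\<bar> \<le> (0 + CM * (b - 0) ^ 2 * (e / k * B)) * exp (CM * (b - 0) * L * (b - 0))"
      proof (rule wavg_gronwall[where g = "\<lambda>_. 0" and H = "\<lambda>r. cs \<Delta> r * ws \<Delta> r - cs \<Gamma> r * ws \<Gamma> r", OF _ _ _ _ _ L(1) _ x])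
        fix y assume y: "y \<in> {0..b}"
        show "ws \<Delta> y - ws \<Gamma> y = 0 - integral {0..y} (wavg qs 0 (\<lambda>r. cs \<Delta> r * ws \<Delta> r - cs \<Gamma> r * ws \<Gamma> r))"
          using ws_volt[OF b, of \<Delta>] ws_volt[OF b, of \<Gamma>] y
          unfolding integral_wavg_diff[OF csws_cont[OF b(2)] csws_cont[OF b(2)] y] by (simp add: volt_sol_def)
        have "cs \<Delta> y * ws \<Delta> y - cs \<Gamma> y * ws \<Gamma> y = cs \<Delta> y * (ws \<Delta> y - ws \<Gamma> y) + (cs \<Delta> y - cs \<Gamma> y) * ws \<Gamma> y"
          by (simp add: algebra_simps)
        also have "\<bar>\<dots>\<bar> \<le> \<bar>cs \<Delta> y\<bar> * \<bar>ws \<Delta> y - ws \<Gamma> y\<bar> + \<bar>cs \<Delta> y - cs \<Gamma> y\<bar> * \<bar>ws \<Gamma> y\<bar>"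
          by (metis abs_mult abs_triangle_ineq)
        also have "\<dots> \<le> L * \<bar>ws \<Delta> y - ws \<Gamma> y\<bar> + e / k * B"
          using L(2)[OF \<Delta>] B(2)[of \<Gamma> y] close[OF y] y B(1) e k
          by (intro add_mono mult_right_mono mult_mono) auto
        finally show "\<bar>cs \<Delta> y * ws \<Delta> y - cs \<Gamma> y * ws \<Gamma> y\<bar> \<le> L * \<bar>ws \<Delta> y - ws \<Gamma> y\<bar> + e / k * B" .
      qed (use e k B in \<open>auto intro!: continuous_intros csws_cont ws_cont b\<close>)
      also have "\<dots> = e * ((k - 1) / k)" by (simp add: k_def E_def)
      also have "\<dots> < e" using e k by (simp add: field_simps)
      finally show "dist (ws \<Delta> x) (ws \<Gamma> x) < e" by (simp add: dist_real_def)
    qed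
  qed
qed

text \<open>The remainder Us \<Delta> - Us \<Gamma> - h * ws \<Gamma> satisfies the linearized
  equation up to the source (mean value coefficient minus cs \<Gamma>) times (Us \<Delta> - Us
  \<Gamma>). The first factor is small, the second at most C * |h|, so the error is o(h).\<close>

lemma uniform_limit_Us_quotient:
  assumes b: "0 < b" "b < pi"
  shows "uniform_limit {0..b} (\<lambda>\<Delta> x. (Us \<Delta> x - Us \<Gamma> x) / (\<Delta> - \<Gamma>)) (ws \<Gamma>) (at \<Gamma>)"
proof (rule uniform_limitI)
  fix e :: real assume e: "0 < e"
  interpret weight qs qs' 0 b "real n / sin b" using weight_qs0[OF b] .
  obtain L where L: "0 \<le> L" "\<And>\<Delta> x. \<bar>\<Delta>\<bar> \<le> \<bar>\<Gamma>\<bar> + 1 \<Longrightarrow> 0 \<le> x \<Longrightarrow> x \<le> b \<Longrightarrow> \<bar>cs \<Delta> x\<bar> \<le> L"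
    using cs_bound[OF b] by blast
  obtain C where C: "0 \<le> C" "\<And>\<Gamma>' \<Delta> x. \<bar>\<Gamma>'\<bar> \<le> \<bar>\<Gamma>\<bar> + 1 \<Longrightarrow> \<bar>\<Delta>\<bar> \<le> \<bar>\<Gamma>\<bar> + 1 \<Longrightarrow> 0 \<le> x \<Longrightarrow> x \<le> b \<Longrightarrow>
    \<bar>Us \<Gamma>' x - Us \<Delta> x\<bar> \<le> C * \<bar>\<Gamma>' - \<Delta>\<bar>" using Us_lip[OF b] by blast
  define E where "E = exp (CM * (b - 0) * L * (b - 0))"
  define k where "k = CM * (b - 0) ^ 2 * C * E + 1"
  have k: "k > 0" unfolding k_def E_def using CM_pos C
    by (intro add_nonneg_pos mult_nonneg_nonneg) auto
  have "\<forall>\<^sub>F \<Delta> in at \<Gamma>. dist \<Delta> \<Gamma> < 1 \<and> \<Delta> \<noteq> \<Gamma>" by (auto simp: eventually_at intro!: exI[of _ 1])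
  moreover have "e / k > 0" using e k by simp
  note cs_close[OF b this, of \<Gamma>]
  ultimately show "\<forall>\<^sub>F \<Delta> in at \<Gamma>. \<forall>x\<in>{0..b}. dist ((Us \<Delta> x - Us \<Gamma> x) / (\<Delta> - \<Gamma>)) (ws \<Gamma> x) < e"
  proof eventually_elim
    case (elim \<Delta>)
    define h where "h = \<Delta> - \<Gamma>"
    have \<Delta>: "\<bar>\<Delta>\<bar> \<le> \<bar>\<Gamma>\<bar> + 1" and h: "h \<noteq> 0" using elim(1) by (auto simp: dist_real_def h_def)
    show ?case
    proof
      fix x assume x: "x \<in> {0..b}"
      let ?H = "\<lambda>r. (nl p (Us \<Delta> r) - nl p (Us \<Gamma> r)) - h * (cs \<Gamma> r * ws \<Gamma> r)"
      have c1: "continuous_on {0..b} (\<lambda>r. nl p (Us \<Delta> r) - nl p (Us \<Gamma> r))"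
        and c2: "continuous_on {0..b} (\<lambda>r. h * (cs \<Gamma> r * ws \<Gamma> r))"
        by (intro continuous_intros nl_Us_cont csws_cont b cs_cont ws_cont)+
      have "\<bar>Us \<Delta> x - Us \<Gamma> x - h * ws \<Gamma> x\<bar> \<le> (0 + CM * (b - 0) ^ 2 * (e / k * (C * \<bar>h\<bar>))) * exp (CM * (b - 0) * L * (b - 0))"
      proof (rule wavg_gronwall[where g = "\<lambda>_. 0" and H = ?H, OF _ _ _ _ _ L(1) _ x])
        show "continuous_on {0..b} ?H" by (intro continuous_on_diff c1 c2)
        fix y assume y: "y \<in> {0..b}"
        have "(\<lambda>x. wavg qs 0 (\<lambda>r. h * (cs \<Gamma> r * ws \<Gamma> r)) x) = (\<lambda>x. h * wavg qs 0 (\<lambda>r. cs \<Gamma> r * ws \<Gamma> r) x)"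
          by (intro ext wavg_cmult)
        then have "integral {0..y} (wavg qs 0 (\<lambda>r. h * (cs \<Gamma> r * ws \<Gamma> r))) =
            h * integral {0..y} (wavg qs 0 (\<lambda>r. cs \<Gamma> r * ws \<Gamma> r))" by simp
        then have i: "integral {0..y} (wavg qs 0 ?H) = integral {0..y} (wavg qs 0 (\<lambda>r. nl p (Us \<Delta> r))) -
            integral {0..y} (wavg qs 0 (\<lambda>r. nl p (Us \<Gamma> r))) - h * integral {0..y} (wavg qs 0 (\<lambda>r. cs \<Gamma> r * ws \<Gamma> r))"
          using integral_wavg_diff[OF c1 c2 y] integral_wavg_diff[OF nl_Us_cont[OF b(2)] nl_Us_cont[OF b(2)] y]
          by simp
        have *: "Us \<Delta> y = \<Delta> - integral {0..y} (wavg qs 0 (\<lambda>r. nl p (Us \<Delta> r)))"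
          "Us \<Gamma> y = \<Gamma> - integral {0..y} (wavg qs 0 (\<lambda>r. nl p (Us \<Gamma> r)))"
          "ws \<Gamma> y = 1 - integral {0..y} (wavg qs 0 (\<lambda>r. cs \<Gamma> r * ws \<Gamma> r))"
          using Us_volt[OF b] ws_volt[OF b] y by (auto simp: volt_sol_def)
        show "Us \<Delta> y - Us \<Gamma> y - h * ws \<Gamma> y = 0 - integral {0..y} (wavg qs 0 ?H)"
          unfolding i * by (simp add: h_def algebra_simps)
        obtain z where z: "\<bar>z - Us \<Gamma> y\<bar> \<le> \<bar>Us \<Delta> y - Us \<Gamma> y\<bar>"
          "nl p (Us \<Delta> y) - nl p (Us \<Gamma> y) = p * \<bar>z\<bar> powr (p - 1) * (Us \<Delta> y - Us \<Gamma> y)"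
          using nl_mvt[OF p_gt_1] by metis
        have "?H y = cs \<Gamma> y * (Us \<Delta> y - Us \<Gamma> y - h * ws \<Gamma> y)
            + (p * \<bar>z\<bar> powr (p - 1) - cs \<Gamma> y) * (Us \<Delta> y - Us \<Gamma> y)"
          unfolding z(2) by (simp add: algebra_simps)
        also have "\<bar>\<dots>\<bar> \<le> \<bar>cs \<Gamma> y\<bar> * \<bar>Us \<Delta> y - Us \<Gamma> y - h * ws \<Gamma> y\<bar>
            + \<bar>p * \<bar>z\<bar> powr (p - 1) - cs \<Gamma> y\<bar> * \<bar>Us \<Delta> y - Us \<Gamma> y\<bar>"
          by (metis abs_mult abs_triangle_ineq)
        also have "\<dots> \<le> L * \<bar>Us \<Delta> y - Us \<Gamma> y - h * ws \<Gamma> y\<bar> + e / k * (C * \<bar>h\<bar>)"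
        proof (intro add_mono mult_right_mono mult_mono)
          show "\<bar>p * \<bar>z\<bar> powr (p - 1) - cs \<Gamma> y\<bar> \<le> e / k" using elim(2) y z(1) by blast
          show "\<bar>Us \<Delta> y - Us \<Gamma> y\<bar> \<le> C * \<bar>h\<bar>" using C(2)[OF \<Delta>, of \<Gamma> y] y by (auto simp: h_def)
        qed (use L y e k in auto)
        finally show "\<bar>?H y\<bar> \<le> L * \<bar>Us \<Delta> y - Us \<Gamma> y - h * ws \<Gamma> y\<bar> + e / k * (C * \<bar>h\<bar>)" .
      qed (use e k C in \<open>auto intro!: continuous_intros Us_cont ws_cont b\<close>)
      also have "\<dots> = \<bar>h\<bar> * (e * ((k - 1) / k))" by (simp add: k_def E_def)
      also have "\<dots> < \<bar>h\<bar> * e" using e k h by (intro mult_strict_left_mono) (auto simp: field_simps)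
      finally have "\<bar>Us \<Delta> x - Us \<Gamma> x - h * ws \<Gamma> x\<bar> / \<bar>h\<bar> < e" using h by (simp add: pos_divide_less_eq mult.commute)
      then have A: "\<bar>(Us \<Delta> x - Us \<Gamma> x - h * ws \<Gamma> x) / h\<bar> < e" by (simp add: abs_divide)
      have E: "(Us \<Delta> x - Us \<Gamma> x - h * ws \<Gamma> x) / h = (Us \<Delta> x - Us \<Gamma> x) / h - ws \<Gamma> x"
        using h by (simp add: diff_divide_distrib)
      from A[unfolded E] show "dist ((Us \<Delta> x - Us \<Gamma> x) / (\<Delta> - \<Gamma>)) (ws \<Gamma> x) < e"
        by (simp add: dist_real_def h_def)
    qed
  qed
qed

text \<open>Serves the continuity of \<open>DT\<close>, whose denominator is Vs at the moving
  zero.\<close>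

lemma uniform_limit_Vs:
  assumes b: "0 < b" "b < pi"
  shows "uniform_limit {0..b} Vs (Vs \<Gamma>) (at \<Gamma>)"
proof (rule uniform_limitI)
  fix e :: real assume e: "0 < e"
  interpret weight qs qs' 0 b "real n / sin b" using weight_qs0[OF b] .
  define k where "k = CM * b + 1"
  have k: "k > 0" unfolding k_def using CM_pos b by (intro add_nonneg_pos mult_nonneg_nonneg) auto
  obtain C where C: "1 \<le> C" "\<And>\<Gamma> x. 0 \<le> x \<Longrightarrow> x \<le> b \<Longrightarrow> \<bar>Us \<Gamma> x\<bar> \<le> \<bar>\<Gamma>\<bar> * C"
    using Us_bound[OF b] by blast
  define M where "M = (\<bar>\<Gamma>\<bar> + 1) * C"
  define L where "L = p * M powr (p - 1)"
  have L: "0 \<le> L" using p_gt_1 by (simp add: L_def)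
  have "\<forall>\<^sub>F \<Delta> in at \<Gamma>. dist \<Delta> \<Gamma> < 1" by (auto simp: eventually_at intro!: exI[of _ 1])
  moreover have "0 < e / (k * (L + 1))" using e k L by simp
  note uniform_limitD[OF uniform_limit_Us[OF b] this, of \<Gamma>]
  ultimately show "\<forall>\<^sub>F \<Delta> in at \<Gamma>. \<forall>x\<in>{0..b}. dist (Vs \<Delta> x) (Vs \<Gamma> x) < e"
  proof eventually_elim
    case (elim \<Delta>)
    let ?d = "\<lambda>r. nl p (Us \<Delta> r) - nl p (Us \<Gamma> r)"
    have c: "continuous_on {0..b} ?d" by (intro continuous_intros nl_Us_cont b)
    have ca: "continuous_on {0..b} (\<lambda>r. \<bar>?d r\<bar>)" by (intro continuous_intros c)
    have d: "\<bar>?d r\<bar> \<le> e / k" if r: "r \<in> {0..b}" for r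
    proof -
      have "\<bar>Us \<Delta> r\<bar> \<le> \<bar>\<Delta>\<bar> * C" "\<bar>Us \<Gamma> r\<bar> \<le> \<bar>\<Gamma>\<bar> * C" using C(2) r by auto
      moreover have "\<bar>\<Delta>\<bar> * C \<le> M" "\<bar>\<Gamma>\<bar> * C \<le> M"
        using elim(1) C(1) unfolding M_def by (intro mult_right_mono; auto simp: dist_real_def)+
      ultimately have "\<bar>?d r\<bar> \<le> L * \<bar>Us \<Delta> r - Us \<Gamma> r\<bar>"
        unfolding L_def by (intro nl_lip p_gt_1) auto
      also have "\<dots> \<le> (L + 1) * (e / (k * (L + 1)))"
        using L elim(2) r by (intro mult_mono) (auto simp: dist_real_def less_imp_le)
      also have "\<dots> = e / k"
      proof -
        have "L + 1 \<noteq> 0" using L by simp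
        then show ?thesis by simp
      qed
      finally show ?thesis .
    qed
    show ?case
    proof
      fix x assume x: "x \<in> {0..b}"
      have "Vs \<Delta> x - Vs \<Gamma> x = - wavg qs 0 ?d x"
        unfolding Vs_def wavg_diff[OF nl_Us_cont[OF b(2)] nl_Us_cont[OF b(2)] x] by simp
      also have "\<bar>\<dots>\<bar> \<le> CM * integral {0..x} (\<lambda>r. \<bar>?d r\<bar>)" using wavg_bound[OF c x] by simp
      also have "\<dots> \<le> CM * integral {0..x} (\<lambda>r. e / k)"
        using CM_pos x d by (intro mult_left_mono integral_le int_h[OF ca x]) auto
      also have "\<dots> = CM * x * (e / k)" using x by simp
      also have "\<dots> \<le> CM * b * (e / k)" using x CM_pos e k by (intro mult_right_mono) auto
      also have "\<dots> = e * ((k - 1) / k)" by (simp add: k_def)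
      also have "\<dots> < e" using e k by (simp add: field_simps)
      finally show "dist (Vs \<Delta> x) (Vs \<Gamma> x) < e" by (simp add: dist_real_def)
    qed
  qed
qed

lemma uniform_limit_evD:
  assumes "uniform_limit S f l F" "0 < e"
  shows "\<forall>\<^sub>F x in F. \<forall>y\<in>S. \<bar>f x y - l y\<bar> < (e :: real)"
  using uniform_limitD[OF assms] by (simp add: dist_real_def)

text \<open>From below: Us \<Gamma> has a positive minimum on [0, y] for y < \<Theta> \<Gamma>. From
  above: by transversality Us \<Gamma> is negative at a point just after its zero. Both facts
  survive a small uniform perturbation.\<close>

lemma Theta_tendsto:
  assumes \<Gamma>: "0 < \<Gamma>"
  shows "(\<Theta> \<longlongrightarrow> \<Theta> \<Gamma>) (at \<Gamma>)"
proof (rule order_tendstoI)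
  note T = Theta_props[OF \<Gamma>]
  have ev: "\<forall>\<^sub>F \<Delta> in at \<Gamma>. 0 < \<Delta>"
    using \<Gamma> by (intro order_tendstoD[OF tendsto_ident_at])
  fix y assume y: "y < \<Theta> \<Gamma>"
  show "\<forall>\<^sub>F \<Delta> in at \<Gamma>. y < \<Theta> \<Delta>"
  proof (cases "y \<le> 0")
    case True
    show ?thesis using ev by eventually_elim (use True Theta_props(1) in force)
  next
    case False
    then have b: "0 < y" "y < pi" using y T by auto
    have "continuous_on {0..y} (Us \<Gamma>)" using b by (intro Us_cont)
    then obtain z where z: "z \<in> {0..y}" "\<And>x. x \<in> {0..y} \<Longrightarrow> Us \<Gamma> z \<le> Us \<Gamma> x"
      using continuous_attains_inf[of "{0..y}" "Us \<Gamma>"] b by auto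
    have "0 < Us \<Gamma> z" using z y by (intro T(4)) auto
    from ev uniform_limit_evD[OF uniform_limit_Us[OF b] this] show ?thesis
    proof eventually_elim
      case (elim \<Delta>)
      show ?case
      proof (rule Theta_greater[OF elim(1)])
        fix t assume t: "0 \<le> t" "t \<le> y"
        then have "\<bar>Us \<Delta> t - Us \<Gamma> t\<bar> < Us \<Gamma> z" "Us \<Gamma> z \<le> Us \<Gamma> t" using elim(2) z by auto
        then show "0 < Us \<Delta> t" by linarith
      qed
    qed
  qed
next
  note T = Theta_props[OF \<Gamma>]
  have ev: "\<forall>\<^sub>F \<Delta> in at \<Gamma>. 0 < \<Delta>"
    using \<Gamma> by (intro order_tendstoD[OF tendsto_ident_at])
  fix y assume y: "\<Theta> \<Gamma> < y"
  obtain d where d: "0 < d" "\<And>h. 0 < h \<Longrightarrow> h < d \<Longrightarrow> Us \<Gamma> (\<Theta> \<Gamma> + h) < Us \<Gamma> (\<Theta> \<Gamma>)"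
    using DERIV_neg_dec_right[OF Us_deriv[OF T(1,2)] T(5)] by auto
  define h where "h = min (d/2) (min ((y - \<Theta> \<Gamma>) / 2) ((pi - \<Theta> \<Gamma>) / 2))"
  have h: "0 < h" "h < d" using d y T by (auto simp: h_def)
  have "h \<le> (y - \<Theta> \<Gamma>) / 2" unfolding h_def by (rule min.coboundedI2, rule min.cobounded1)
  moreover have "h \<le> (pi - \<Theta> \<Gamma>) / 2" unfolding h_def by (rule min.coboundedI2, rule min.cobounded2)
  ultimately have x: "\<Theta> \<Gamma> + h < y" "\<Theta> \<Gamma> + h < pi" using y T(2) by (auto simp: field_simps)
  define x where "x = \<Theta> \<Gamma> + h"
  have x: "x < y" "x < pi" "0 < x" "Us \<Gamma> x < 0" using x d(2)[OF h] T h by (auto simp: x_def)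
  have "0 < - Us \<Gamma> x" using x by simp
  from ev uniform_limit_evD[OF uniform_limit_Us[OF x(3,2)] this] show "\<forall>\<^sub>F \<Delta> in at \<Gamma>. \<Theta> \<Delta> < y"
  proof eventually_elim
    case (elim \<Delta>)
    have "\<bar>Us \<Delta> x - Us \<Gamma> x\<bar> < - Us \<Gamma> x" using elim(2) x by auto
    then have "Us \<Delta> x < 0" by linarith
    then show ?case using Theta_less[OF elim(1), of x] x by auto
  qed
qed

definition DT :: "real \<Rightarrow> real" where
  "DT \<Gamma> = - ws \<Gamma> (\<Theta> \<Gamma>) / Vs \<Gamma> (\<Theta> \<Gamma>)"

lemma Theta_near:
  assumes \<Gamma>: "0 < \<Gamma>"
  obtains b where "0 < b" "b < pi" "\<Theta> \<Gamma> < b" "\<forall>\<^sub>F \<Delta> in at \<Gamma>. \<Theta> \<Delta> \<in> {0..b}"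
proof -
  obtain b where b: "\<Theta> \<Gamma> < b" "b < pi" using dense Theta_props(2)[OF \<Gamma>] by blast
  have "\<forall>\<^sub>F \<Delta> in at \<Gamma>. 0 < \<Delta>"
    using \<Gamma> by (intro order_tendstoD[OF tendsto_ident_at])
  moreover have "\<forall>\<^sub>F \<Delta> in at \<Gamma>. \<Theta> \<Delta> < b" using b by (intro order_tendstoD[OF Theta_tendsto[OF \<Gamma>]])
  ultimately have "\<forall>\<^sub>F \<Delta> in at \<Gamma>. \<Theta> \<Delta> \<in> {0..b}"
    by eventually_elim (use Theta_props(1) in force)
  then show ?thesis using that[of b] b Theta_props(1)[OF \<Gamma>] by auto
qed

lemma isCont_Us_Vs_ws:
  assumes "0 < x" "x < pi"
  shows "isCont (Us \<Gamma>) x" "isCont (Vs \<Gamma>) x" "isCont (ws \<Gamma>) x"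
  using DERIV_isCont Us_deriv Vs_deriv ws_deriv assms by blast+

lemma Theta_has_deriv:
  assumes \<Gamma>: "0 < \<Gamma>"
  shows "(\<Theta> has_real_derivative DT \<Gamma>) (at \<Gamma>)"
proof -
  note T = Theta_props[OF \<Gamma>]
  obtain b where b: "0 < b" "b < pi" "\<Theta> \<Gamma> < b" "\<forall>\<^sub>F \<Delta> in at \<Gamma>. \<Theta> \<Delta> \<in> {0..b}"
    using Theta_near[OF \<Gamma>] .
  \<comment> \<open>Caratheodory's form of the derivative avoids a division by \<Theta> \<Delta> -
    \<Theta> \<Gamma>, which may vanish: it splits 0 = Us \<Delta> (\<Theta> \<Delta>) into the
    change in \<Gamma> and g (\<Theta> \<Delta>) * (\<Theta> \<Delta> - \<Theta> \<Gamma>).\<close>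
  obtain g where g: "\<And>z. Us \<Gamma> z - Us \<Gamma> (\<Theta> \<Gamma>) = g z * (z - \<Theta> \<Gamma>)" "isCont g (\<Theta> \<Gamma>)" "g (\<Theta> \<Gamma>) = Vs \<Gamma> (\<Theta> \<Gamma>)"
    using Us_deriv[OF T(1,2), of \<Gamma>] unfolding CARAT_DERIV by blast
  have gl: "((\<lambda>\<Delta>. g (\<Theta> \<Delta>)) \<longlongrightarrow> Vs \<Gamma> (\<Theta> \<Gamma>)) (at \<Gamma>)"
    using isCont_tendsto_compose[OF g(2) Theta_tendsto[OF \<Gamma>]] g(3) by simp
  have ql: "((\<lambda>\<Delta>. (Us \<Delta> (\<Theta> \<Delta>) - Us \<Gamma> (\<Theta> \<Delta>)) / (\<Delta> - \<Gamma>)) \<longlongrightarrow> ws \<Gamma> (\<Theta> \<Gamma>)) (at \<Gamma>)"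
    by (rule uniform_limit_compose_tendsto[OF uniform_limit_Us_quotient[OF b(1,2)] Theta_tendsto[OF \<Gamma>] b(4)
        isCont_Us_Vs_ws(3)[OF T(1,2)]])
  have lim: "((\<lambda>\<Delta>. - ((Us \<Delta> (\<Theta> \<Delta>) - Us \<Gamma> (\<Theta> \<Delta>)) / (\<Delta> - \<Gamma>)) / g (\<Theta> \<Delta>)) \<longlongrightarrow> DT \<Gamma>) (at \<Gamma>)"
    unfolding DT_def using T(5) by (intro tendsto_intros gl ql) auto
  note ev = order_tendstoD(1)[OF tendsto_ident_at[of \<Gamma> UNIV] \<Gamma>] order_tendstoD(2)[OF gl T(5)]
  have "((\<lambda>\<Delta>. (\<Theta> \<Delta> - \<Theta> \<Gamma>) / (\<Delta> - \<Gamma>)) \<longlongrightarrow> DT \<Gamma>) (at \<Gamma>)"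
  proof (rule Lim_transform_eventually[OF lim])
    show "\<forall>\<^sub>F \<Delta> in at \<Gamma>. - ((Us \<Delta> (\<Theta> \<Delta>) - Us \<Gamma> (\<Theta> \<Delta>)) / (\<Delta> - \<Gamma>)) / g (\<Theta> \<Delta>) = (\<Theta> \<Delta> - \<Theta> \<Gamma>) / (\<Delta> - \<Gamma>)"
      using ev
    proof eventually_elim
      case (elim \<Delta>)
      have "Us \<Gamma> (\<Theta> \<Delta>) = g (\<Theta> \<Delta>) * (\<Theta> \<Delta> - \<Theta> \<Gamma>)" using g(1)[of "\<Theta> \<Delta>"] T(3) by simp
      moreover have "Us \<Delta> (\<Theta> \<Delta>) = 0" by (rule Theta_props(3)[OF elim(1)])
      ultimately show ?case using elim(2) by simp
    qed
  qed
  then show ?thesis by (simp add: has_field_derivative_iff)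
qed

lemma DT_cont: "continuous_on {0<..} DT"
  unfolding continuous_on_eq_continuous_at[OF open_greaterThan]
proof
  fix \<Gamma> :: real assume "\<Gamma> \<in> {0<..}"
  then have \<Gamma>: "0 < \<Gamma>" by simp
  note T = Theta_props[OF \<Gamma>]
  obtain b where b: "0 < b" "b < pi" "\<Theta> \<Gamma> < b" "\<forall>\<^sub>F \<Delta> in at \<Gamma>. \<Theta> \<Delta> \<in> {0..b}"
    using Theta_near[OF \<Gamma>] .
  note c = isCont_Us_Vs_ws[OF T(1,2), of \<Gamma>]
  have "((\<lambda>\<Delta>. ws \<Delta> (\<Theta> \<Delta>)) \<longlongrightarrow> ws \<Gamma> (\<Theta> \<Gamma>)) (at \<Gamma>)" "((\<lambda>\<Delta>. Vs \<Delta> (\<Theta> \<Delta>)) \<longlongrightarrow> Vs \<Gamma> (\<Theta> \<Gamma>)) (at \<Gamma>)"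
    by (rule uniform_limit_compose_tendsto[OF _ Theta_tendsto[OF \<Gamma>] b(4)];
        intro uniform_limit_ws uniform_limit_Vs b c)+
  then show "isCont DT \<Gamma>"
    unfolding isCont_def DT_def using T(5) by (intro tendsto_intros) auto
qed

subsection \<open>Small initial values\<close>

text \<open>By homogeneity the nonlinear term has size \<Gamma>^p and the potential cs \<Gamma> size
  \<Gamma>^(p - 1): relative to the constants \<Gamma> and 1 both deviations are of order
  \<Gamma>^(p - 1).\<close>

lemma Us_small:
  assumes b: "0 < b" "b < pi"
  obtains C where "0 < C" "\<And>\<Gamma> x. 0 < \<Gamma> \<Longrightarrow> \<Gamma> \<le> 1 \<Longrightarrow> 0 \<le> x \<Longrightarrow> x \<le> b \<Longrightarrow>
    \<bar>Us \<Gamma> x - \<Gamma>\<bar> \<le> C * \<Gamma> powr (p - 1) * \<Gamma> \<and> \<bar>ws \<Gamma> x - 1\<bar> \<le> C * \<Gamma> powr (p - 1)"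
proof -
  interpret weight qs qs' 0 b "real n / sin b" using weight_qs0[OF b] .
  obtain C where C: "1 \<le> C" "\<And>\<Gamma> x. 0 \<le> x \<Longrightarrow> x \<le> b \<Longrightarrow> \<bar>Us \<Gamma> x\<bar> \<le> \<bar>\<Gamma>\<bar> * C"
    using Us_bound[OF b] by blast
  obtain B where B: "0 \<le> B" "\<And>\<Delta> x. \<bar>\<Delta>\<bar> \<le> 1 \<Longrightarrow> 0 \<le> x \<Longrightarrow> x \<le> b \<Longrightarrow> \<bar>ws \<Delta> x\<bar> \<le> B"
    using ws_bound[OF b] by blast
  define k where "k = C powr (p - 1)"
  have k: "0 < k" using C by (simp add: k_def)
  \<comment> \<open>The sum C + B lets one constant serve both estimates: C bounds Us / \<Gamma>,
    and B bounds ws.\<close>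
  define A where "A = CM * (b - 0) * (p * k * (C + B)) * b"
  have A: "0 < A" unfolding A_def using CM_pos b p_gt_1 k C B by (intro mult_pos_pos add_pos_nonneg) auto
  have est: "\<bar>integral {0..x} (wavg qs 0 h)\<bar> \<le> CM * (b - 0) * e * b"
    if h: "continuous_on {0..b} h" "\<And>r. r \<in> {0..b} \<Longrightarrow> \<bar>h r\<bar> \<le> e" and x: "x \<in> {0..b}" for h e x
  proof -
    have e: "0 \<le> e" using h(2)[of 0] b by (auto intro: order_trans[OF abs_ge_zero])
    have "\<bar>integral {0..x} (wavg qs 0 h)\<bar> \<le> CM * (b - 0) * integral {0..x} (\<lambda>r. \<bar>h r\<bar>)"
      by (rule integral_wavg_bound[OF h(1) x])
    also have "\<dots> \<le> CM * (b - 0) * integral {0..x} (\<lambda>r. e)"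
      using CM_pos b x by (intro mult_left_mono integral_le int_h[OF _ x] continuous_intros h) auto
    also have "\<dots> = CM * (b - 0) * (e * x)" using x by simp
    also have "\<dots> \<le> CM * (b - 0) * (e * b)" using x b e CM_pos by (intro mult_left_mono) auto
    finally show ?thesis by (simp add: mult.assoc)
  qed
  show ?thesis
  proof (rule that[OF A])
    fix \<Gamma> x assume \<Gamma>: "0 < \<Gamma>" "\<Gamma> \<le> (1::real)" and x: "0 \<le> x" "x \<le> b"
    have pw: "\<bar>Us \<Gamma> r\<bar> powr (p - 1) \<le> k * \<Gamma> powr (p - 1)" if "r \<in> {0..b}" for r
    proof -
      have "\<bar>Us \<Gamma> r\<bar> powr (p - 1) \<le> (\<Gamma> * C) powr (p - 1)"
        using C(2)[of r \<Gamma>] that \<Gamma> p_gt_1 by (intro powr_mono2) auto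
      then show ?thesis using \<Gamma> C by (simp add: powr_mult k_def mult.commute)
    qed
    have "\<bar>nl p (Us \<Gamma> r)\<bar> \<le> p * k * (C + B) * \<Gamma> powr (p - 1) * \<Gamma>" if r: "r \<in> {0..b}" for r
    proof -
      have "\<bar>nl p (Us \<Gamma> r)\<bar> = \<bar>Us \<Gamma> r\<bar> powr (p - 1) * \<bar>Us \<Gamma> r\<bar>" by (simp add: nl_def abs_mult)
      also have "\<dots> \<le> (k * \<Gamma> powr (p - 1)) * (\<Gamma> * C)"
        using pw[OF r] C(2)[of r \<Gamma>] r \<Gamma> k by (intro mult_mono) auto
      also have "\<dots> = 1 * (k * C * \<Gamma> powr (p - 1) * \<Gamma>)" by simp
      also have "\<dots> \<le> p * (k * (C + B) * \<Gamma> powr (p - 1) * \<Gamma>)"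
        using p_gt_1 k C B \<Gamma> by (intro mult_mono mult_right_mono mult_left_mono) auto
      finally show ?thesis by (simp add: mult.assoc)
    qed
    from est[OF nl_Us_cont[OF b(2)] this, of x]
    have 1: "\<bar>integral {0..x} (wavg qs 0 (\<lambda>r. nl p (Us \<Gamma> r)))\<bar> \<le> A * \<Gamma> powr (p - 1) * \<Gamma>"
      using x by (simp add: A_def ac_simps)
    have "\<bar>cs \<Gamma> r * ws \<Gamma> r\<bar> \<le> p * k * (C + B) * \<Gamma> powr (p - 1)" if r: "r \<in> {0..b}" for r
    proof -
      have "\<bar>cs \<Gamma> r * ws \<Gamma> r\<bar> = p * \<bar>Us \<Gamma> r\<bar> powr (p - 1) * \<bar>ws \<Gamma> r\<bar>"
        using p_gt_1 by (simp add: cs_def abs_mult)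
      also have "\<dots> \<le> p * (k * \<Gamma> powr (p - 1)) * (C + B)"
        using pw[OF r] B(2)[of \<Gamma> r] r \<Gamma> k p_gt_1 C(1) by (intro mult_mono mult_left_mono) auto
      finally show ?thesis by (simp add: ac_simps)
    qed
    from est[OF csws_cont[OF b(2)] this, of x]
    have 2: "\<bar>integral {0..x} (wavg qs 0 (\<lambda>r. cs \<Gamma> r * ws \<Gamma> r))\<bar> \<le> A * \<Gamma> powr (p - 1)"
      using x by (simp add: A_def ac_simps)
    have "Us \<Gamma> x = \<Gamma> - integral {0..x} (wavg qs 0 (\<lambda>r. nl p (Us \<Gamma> r)))"
      "ws \<Gamma> x = 1 - integral {0..x} (wavg qs 0 (\<lambda>r. cs \<Gamma> r * ws \<Gamma> r))"
      using Us_volt[OF b, of \<Gamma>] ws_volt[OF b, of \<Gamma>] x by (auto simp: volt_sol_def)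
    then show "\<bar>Us \<Gamma> x - \<Gamma>\<bar> \<le> A * \<Gamma> powr (p - 1) * \<Gamma> \<and> \<bar>ws \<Gamma> x - 1\<bar> \<le> A * \<Gamma> powr (p - 1)"
      using 1 2 by linarith
  qed
qed

lemma powr_small:
  assumes "0 < e"
  shows "\<forall>\<^sub>F \<Gamma> in at_right 0. \<Gamma> powr (p - 1) < e"
proof -
  have "((\<lambda>\<Gamma>. \<Gamma> powr (p - 1)) \<longlongrightarrow> 0 powr (p - 1)) (at_right 0)"
    using p_gt_1 by (intro tendsto_powr' tendsto_intros) (auto simp: eventually_at_filter)
  then show ?thesis using assms by (intro order_tendstoD(2)) auto
qed

lemma Theta_tendsto_pi: "(\<Theta> \<longlongrightarrow> pi) (at_right 0)"
proof (rule order_tendstoI)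
  have ev: "\<forall>\<^sub>F \<Gamma> in at_right (0::real). 0 < \<Gamma> \<and> \<Gamma> \<le> 1"
    unfolding eventually_at_right_field by (intro exI[of _ 1]) auto
  show "\<forall>\<^sub>F \<Gamma> in at_right 0. \<Theta> \<Gamma> < y" if "pi < y" for y
    using ev by eventually_elim (use Theta_props(2) that in force)
  fix y assume y: "y < pi"
  define b where "b = max y 1"
  have b: "0 < b" "b < pi" "y \<le> b" using y pi_gt3 by (auto simp: b_def)
  obtain C where C: "0 < C" "\<And>\<Gamma> x. 0 < \<Gamma> \<Longrightarrow> \<Gamma> \<le> 1 \<Longrightarrow> 0 \<le> x \<Longrightarrow> x \<le> b \<Longrightarrow>
    \<bar>Us \<Gamma> x - \<Gamma>\<bar> \<le> C * \<Gamma> powr (p - 1) * \<Gamma> \<and> \<bar>ws \<Gamma> x - 1\<bar> \<le> C * \<Gamma> powr (p - 1)"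
    using Us_small[OF b(1,2)] by blast
  have "1 / C > 0" using C by simp
  from ev powr_small[OF this] show "\<forall>\<^sub>F \<Gamma> in at_right 0. y < \<Theta> \<Gamma>"
  proof eventually_elim
    case (elim \<Gamma>)
    have "C * \<Gamma> powr (p - 1) < 1" using elim C by (simp add: field_simps)
    then have "C * \<Gamma> powr (p - 1) * \<Gamma> < 1 * \<Gamma>" using elim by (intro mult_strict_right_mono) auto
    note less = this
    have "0 < Us \<Gamma> t" if "0 \<le> t" "t \<le> b" for t
    proof -
      have "\<bar>Us \<Gamma> t - \<Gamma>\<bar> \<le> C * \<Gamma> powr (p - 1) * \<Gamma>" using C(2)[of \<Gamma> t] elim that by blast
      then show ?thesis using less by linarith
    qed
    then have "b < \<Theta> \<Gamma>" using elim by (intro Theta_greater) auto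
    then show ?case using b by simp
  qed
qed

end

section \<open>Sturm comparison and the sign of the derivative for small initial values\<close>

lemma DERIV_le_imp_linear_bound:
  fixes f f' :: "real \<Rightarrow> real"
  assumes "a \<le> b" "continuous_on {a..b} f"
    and der: "\<And>x. a < x \<Longrightarrow> x < b \<Longrightarrow> (f has_real_derivative f' x) (at x)"
    and le: "\<And>x. a < x \<Longrightarrow> x < b \<Longrightarrow> f' x \<le> k"
  shows "f b \<le> f a + k * (b - a)"
proof -
  have "f b - k * b \<le> f a - k * a"
    by (rule deriv_nonpos_imp_le[where f = "\<lambda>x. f x - k * x" and f' = "\<lambda>x. f' x - k"])
      (use assms in \<open>auto intro!: continuous_intros derivative_eq_intros\<close>)
  then show ?thesis by (simp add: algebra_simps)
qed

context sphere_problem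
begin

text \<open>Both functions satisfy equations with the same weight, so the mixed terms cancel, and
  only cs U - nl p U = (p - 1) |U|^(p - 1) U remains, times the weight and w.\<close>

lemma Us_ws_wronskian_deriv:
  assumes x: "0 < x" "x < pi"
  shows "((\<lambda>x. qs x * Ws \<Gamma> x * Us \<Gamma> x - ws \<Gamma> x * (qs x * Vs \<Gamma> x)) has_real_derivative
    - ((p - 1) * qs x * \<bar>Us \<Gamma> x\<bar> powr (p - 1) * Us \<Gamma> x * ws \<Gamma> x)) (at x)"
proof -
  have "((\<lambda>x. qs x * Ws \<Gamma> x * Us \<Gamma> x - ws \<Gamma> x * (qs x * Vs \<Gamma> x)) has_real_derivative
    (- qs x * (cs \<Gamma> x * ws \<Gamma> x) * Us \<Gamma> x + Vs \<Gamma> x * (qs x * Ws \<Gamma> x)) -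
    (Ws \<Gamma> x * (qs x * Vs \<Gamma> x) + - qs x * nl p (Us \<Gamma> x) * ws \<Gamma> x)) (at x)"
    by (intro DERIV_diff DERIV_mult qWs_deriv[OF x] Us_deriv[OF x] ws_deriv[OF x]
        qV_deriv[OF x Us_deriv[OF x] Vs_deriv[OF x]])
  then show ?thesis by (simp add: cs_def nl_def algebra_simps)
qed

text \<open>By Sturm comparison with \<open>Us \<Gamma>\<close>, the function \<open>ws \<Gamma>\<close> has a zero before \<open>\<Theta> \<Gamma>\<close> unless it is negative
  there. For small \<open>\<Gamma>\<close> the zero is so close to \<open>pi\<close> that there is no room for \<open>ws \<Gamma>\<close> to turn upwards.\<close>
lemma ws_Theta_neg:
  "\<forall>\<^sub>F \<Gamma> in at_right 0. ws \<Gamma> (\<Theta> \<Gamma>) < 0"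
proof -
  have cancel: "w < 0" if "0 < q" "q * w < 0" for q w :: real
    using that by (simp add: mult_less_0_iff)
  have [simp]: "(0 :: real) ^ n = 0" using n_ge by (simp add: zero_power)
  have b: "0 < pi / 2" "pi / 2 < pi" by auto
  obtain C where C: "0 < C" "\<And>\<Gamma> x. 0 < \<Gamma> \<Longrightarrow> \<Gamma> \<le> 1 \<Longrightarrow> 0 \<le> x \<Longrightarrow> x \<le> pi / 2 \<Longrightarrow>
    \<bar>Us \<Gamma> x - \<Gamma>\<bar> \<le> C * \<Gamma> powr (p - 1) * \<Gamma> \<and> \<bar>ws \<Gamma> x - 1\<bar> \<le> C * \<Gamma> powr (p - 1)"
    using Us_small[OF b] by blast
  \<comment> \<open>With G = \<Gamma>^(p - 1), the product c0 * G bounds from below the amount by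
    which the flux sin^n w' falls on [pi/4, pi/2]; there sin \<ge> 1/2, U \<ge> \<Gamma>/2 and w
    \<ge> 1/2.\<close>
  define c0 where "c0 = (1/2) ^ n * (p * (1/2) powr (p - 1) * (1/2)) * (pi / 4)"
  have c0: "0 < c0" using p_gt_1 by (auto simp: c0_def)
  have ev: "\<forall>\<^sub>F \<Gamma> in at_right (0::real). 0 < \<Gamma> \<and> \<Gamma> \<le> 1"
    unfolding eventually_at_right_field by (intro exI[of _ 1]) auto
  have p3: "0 < p ^ 2 * pi ^ 3" using p_gt_1 by auto
  \<comment> \<open>A later increase of the flux is at most p^2 pi^3 G^2, of second order in G;
    below this threshold for G it cannot compensate the loss c0 * G.\<close>
  then have e: "0 < c0 / (p ^ 2 * pi ^ 3)" using c0 by (intro divide_pos_pos)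
  have e': "0 < 1 / (2 * C)" using C by simp
  from ev powr_small[OF e] powr_small[OF e'] show ?thesis
  proof eventually_elim
    case (elim \<Gamma>)
    then have \<Gamma>: "0 < \<Gamma>" "\<Gamma> \<le> 1" by auto
    define G where "G = \<Gamma> powr (p - 1)"
    have G: "0 < G" using \<Gamma> by (simp add: G_def)
    have G1: "G * (p ^ 2 * pi ^ 3) < c0" using elim(2) p3 by (simp add: G_def pos_less_divide_eq)
    have "C * G \<le> 1 / 2" using elim(3) C by (simp add: G_def field_simps)
    then have half: "\<Gamma> / 2 \<le> Us \<Gamma> x" "1 / 2 \<le> ws \<Gamma> x" if "0 \<le> x" "x \<le> pi / 2" for x
    proof -
      have "\<bar>Us \<Gamma> x - \<Gamma>\<bar> \<le> C * G * \<Gamma>" "\<bar>ws \<Gamma> x - 1\<bar> \<le> C * G"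
        using C(2)[OF \<Gamma> that] by (auto simp: G_def)
      moreover have "C * G * \<Gamma> \<le> 1 / 2 * \<Gamma>" using \<open>C * G \<le> 1 / 2\<close> \<Gamma> by (intro mult_right_mono) auto
      ultimately show "\<Gamma> / 2 \<le> Us \<Gamma> x" "1 / 2 \<le> ws \<Gamma> x" using \<open>C * G \<le> 1 / 2\<close> by linarith+
    qed
    define T where "T = \<Theta> \<Gamma>"
    note T = Theta_props[OF \<Gamma>(1), folded T_def]
    have T2: "pi / 2 < T" unfolding T_def
      using half \<Gamma> by (intro Theta_greater) (auto intro: less_le_trans[of 0 "\<Gamma> / 2"])
    have Vneg: "Vs \<Gamma> x < 0" if "0 < x" "x \<le> T" for x by (rule Vs_neg) (use that T in auto)
    have Ule: "Us \<Gamma> x \<le> \<Gamma>" if x: "0 \<le> x" "x \<le> T" for x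
    proof -
      have "Us \<Gamma> x \<le> Us \<Gamma> 0"
        by (rule deriv_nonpos_imp_le[where f' = "Vs \<Gamma>"])
          (use x T Us_deriv Vneg Us_cont[of x \<Gamma>] in \<open>auto intro: less_imp_le\<close>)
      then show ?thesis by simp
    qed
    have U0: "0 \<le> Us \<Gamma> x" if "0 \<le> x" "x \<le> T" for x using T(3) T(4)[of x] that by (cases "x = T") auto
    have csle: "0 \<le> cs \<Gamma> x" "cs \<Gamma> x \<le> p * G" if "0 \<le> x" "x \<le> T" for x
      unfolding cs_def G_def using p_gt_1 Ule[OF that] U0[OF that] by (auto intro!: mult_left_mono powr_mono2)
    let ?S = "\<lambda>x. qs x * Ws \<Gamma> x"
    have Sc: "continuous_on {a..b} ?S" if "0 \<le> a" "b \<le> T" for a b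
      using that T(2) by (intro continuous_on_subset[OF qWs_cont[OF T(2)]]) auto
    have wc: "continuous_on {a..b} (ws \<Gamma>)" if "0 \<le> a" "b \<le> T" for a b
      using that T(2) by (intro continuous_on_subset[OF ws_cont[OF T(2)]]) auto
    have qpos: "0 < qs x" "qs x \<le> 1" if "0 < x" "x \<le> T" for x
    proof -
      have "0 < sin x" using that T(2) by (intro sin_gt_zero) auto
      then show "0 < qs x" "qs x \<le> 1" by (auto simp: power_le_one)
    qed
    have "ws \<Gamma> T < 0"
    proof (cases "\<forall>x. 0 \<le> x \<and> x < T \<longrightarrow> 0 < ws \<Gamma> x")
      case True
      \<comment> \<open>If w > 0 before T, the Wronskian decreases strictly from 0; as U vanishes at
        T, this leaves w(T) * sin^n(T) * U'(T) > 0, where U'(T) < 0.\<close>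
      let ?P = "\<lambda>x. qs x * Ws \<Gamma> x * Us \<Gamma> x - ws \<Gamma> x * (qs x * Vs \<Gamma> x)"
      have "?P T < ?P 0"
      proof (rule DERIV_neg_imp_decreasing_open[OF T(1)])
        show "continuous_on {0..T} ?P"
          by (intro continuous_intros qWs_cont Us_cont ws_cont Vs_cont T)
        fix x assume x: "0 < x" "x < T"
        have "0 < (p - 1) * qs x * \<bar>Us \<Gamma> x\<bar> powr (p - 1) * Us \<Gamma> x * ws \<Gamma> x"
          using p_gt_1 qpos[of x] T(4)[of x] True x by (intro mult_pos_pos) auto
        then show "\<exists>y. (?P has_real_derivative y) (at x) \<and> y < 0"
          using Us_ws_wronskian_deriv[of x \<Gamma>] x T by force
      qed
      then have "0 < ws \<Gamma> T * (qs T * Vs \<Gamma> T)" using T by simp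
      moreover have "qs T * Vs \<Gamma> T < 0" using qpos[of T] T by (simp add: mult_less_0_iff)
      ultimately show ?thesis
        using mult_nonneg_nonpos[of "ws \<Gamma> T" "qs T * Vs \<Gamma> T"] by linarith
    next
      case False
      then obtain y where y: "0 \<le> y" "y < T" "ws \<Gamma> y \<le> 0" by force
      \<comment> \<open>The first zero of w. Up to pi/2 the function w is at least 1/2, so z lies
        beyond pi/2, where sin^n is decreasing.\<close>
      obtain z where z: "0 < z" "z \<le> y" "ws \<Gamma> z = 0" "\<And>t. 0 \<le> t \<Longrightarrow> t < z \<Longrightarrow> 0 < ws \<Gamma> t"
        using first_root_exists[OF wc[of 0 y] y(1)] y by auto
      have zT: "z < T" using z y by simp
      have z2: "pi / 2 < z" using half(2)[of z] z by force
      have Sneg: "?S x \<le> 0" if x: "0 \<le> x" "x \<le> z" for x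
      proof -
        have "?S x \<le> ?S 0"
        proof (rule deriv_nonpos_imp_le[OF x(1) Sc])
          fix t assume t: "0 < t" "t < x"
          show "(?S has_real_derivative - qs t * (cs \<Gamma> t * ws \<Gamma> t)) (at t)"
            by (rule qWs_deriv) (use t x zT T in auto)
          have "0 \<le> qs t * (cs \<Gamma> t * ws \<Gamma> t)"
            using qpos[of t] csle[of t] z(4)[of t] t x zT by (intro mult_nonneg_nonneg) auto
          then show "- qs t * (cs \<Gamma> t * ws \<Gamma> t) \<le> 0" by simp
        qed (use x zT in auto)
        then show ?thesis by simp
      qed
      have Wneg: "Ws \<Gamma> x \<le> 0" if "0 < x" "x \<le> z" for x
        using Sneg[of x] qpos[of x] that zT by (auto simp: mult_le_0_iff)
      have wle: "ws \<Gamma> x \<le> 1" if x: "0 \<le> x" "x \<le> z" for x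
      proof -
        have "ws \<Gamma> x \<le> ws \<Gamma> 0"
          by (rule deriv_nonpos_imp_le[where f' = "Ws \<Gamma>"])
            (use x zT T wc[of 0 x] in \<open>auto intro!: ws_deriv Wneg\<close>)
        then show ?thesis by simp
      qed
      have "?S (pi/2) \<le> ?S (pi/4) + - ((1/2) ^ n * (p * (1/2) powr (p - 1) * G * (1/2))) * (pi/2 - pi/4)"
      proof (rule DERIV_le_imp_linear_bound[OF _ Sc])
        fix t assume t': "pi/4 < t" "t < pi/2"
        have t: "pi/4 < t" "t < pi/2" "0 < t" using t' pi_gt_zero by linarith+
        show "(?S has_real_derivative - (qs t * (cs \<Gamma> t * ws \<Gamma> t))) (at t)"
          using qWs_deriv[of t \<Gamma>] t by auto
        have "sin (pi/6) \<le> sin t" using t by (intro sin_monotone_2pi_le) auto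
        then have "(1/2) ^ n \<le> qs t" by (intro power_mono) (auto simp: sin_30)
        moreover have "p * (1/2) powr (p - 1) * G \<le> cs \<Gamma> t"
        proof -
          have "(\<Gamma> * (1/2)) powr (p - 1) \<le> \<bar>Us \<Gamma> t\<bar> powr (p - 1)"
            using half(1)[of t] t \<Gamma> p_gt_1 by (intro powr_mono2) auto
          moreover have "(\<Gamma> * (1/2)) powr (p - 1) = G * (1/2) powr (p - 1)"
            unfolding G_def by (rule powr_mult)
          ultimately show ?thesis unfolding cs_def using p_gt_1 by (simp add: mult.assoc mult.commute)
        qed
        moreover have "1/2 \<le> ws \<Gamma> t" using half(2)[of t] t by auto
        ultimately have "(1/2) ^ n * (p * (1/2) powr (p - 1) * G * (1/2)) \<le> qs t * (cs \<Gamma> t * ws \<Gamma> t)"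
          using p_gt_1 G qpos(1)[of t] t T2 csle(1)[of t]
          by (intro mult_mono) (auto intro!: mult_nonneg_nonneg)
        then show "- (qs t * (cs \<Gamma> t * ws \<Gamma> t)) \<le> - ((1/2) ^ n * (p * (1/2) powr (p - 1) * G * (1/2)))" by simp
      qed (use T2 in auto)
      also have "\<dots> = ?S (pi/4) - c0 * G" by (simp add: c0_def algebra_simps)
      also have "\<dots> \<le> - c0 * G"
      proof -
        have "?S (pi/4) \<le> 0" using z2 pi_gt_zero by (intro Sneg) linarith+
        then show ?thesis by simp
      qed
      finally have "?S (pi/2) \<le> - c0 * G" .
      moreover have "?S z \<le> ?S (pi/2)"
      proof (rule deriv_nonpos_imp_le[OF _ Sc])
        fix t assume t': "pi/2 < t" "t < z"
        have t: "pi/2 < t" "t < z" "0 < t" using t' pi_gt_zero by linarith+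
        show "(?S has_real_derivative - qs t * (cs \<Gamma> t * ws \<Gamma> t)) (at t)"
          by (rule qWs_deriv) (use t zT T in auto)
        have "0 \<le> qs t * (cs \<Gamma> t * ws \<Gamma> t)"
          using qpos[of t] csle[of t] z(4)[of t] t zT by (intro mult_nonneg_nonneg) auto
        then show "- qs t * (cs \<Gamma> t * ws \<Gamma> t) \<le> 0" by simp
      qed (use z2 zT in auto)
      ultimately have Sz: "?S z \<le> - c0 * G" by simp
      have "- ?S z \<le> - ?S 0 + p * G * (z - 0)"
      proof (rule DERIV_le_imp_linear_bound)
        show "continuous_on {0..z} (\<lambda>x. - ?S x)" using zT by (intro continuous_on_minus Sc) auto
        fix t assume t: "0 < t" "t < z"
        show "((\<lambda>x. - ?S x) has_real_derivative - (- qs t * (cs \<Gamma> t * ws \<Gamma> t))) (at t)"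
          using t zT T by (intro DERIV_minus qWs_deriv) auto
        have "qs t * (cs \<Gamma> t * ws \<Gamma> t) \<le> 1 * (p * G * 1)"
          using qpos[of t] csle[of t] wle[of t] z(4)[of t] t zT p_gt_1 G by (intro mult_mono) auto
        then show "- (- qs t * (cs \<Gamma> t * ws \<Gamma> t)) \<le> p * G" by simp
      qed (use z in auto)
      also have "\<dots> \<le> p * G * pi" using p_gt_1 G zT T by simp
      finally have Sz': "- (p * G * pi) \<le> ?S z" by simp
      \<comment> \<open>Suppose the flux returns to 0 at \<tau>. Its growth on [z, \<tau>] is fed by
        the negative values of w, and these, weighted with sin^n, are of order G because w starts
        from 0 at z with a flux of order G.\<close>
      have Sneg': "?S x < 0" if x: "z \<le> x" "x \<le> T" for x
      proof (rule ccontr)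
        assume "\<not> ?S x < 0"
        then have Sx: "- ?S x \<le> 0" by simp
        have "- c0 * G < 0" using c0 G by simp
        then have Szn: "0 < - ?S z" using Sz by linarith
        have "continuous_on {z..x} (\<lambda>x. - ?S x)" using x z by (intro continuous_on_minus Sc) auto
        then obtain \<tau> where \<tau>: "z < \<tau>" "\<tau> \<le> x" "- ?S \<tau> = 0" "\<And>t. z \<le> t \<Longrightarrow> t < \<tau> \<Longrightarrow> 0 < - ?S t"
          using first_root_exists[OF _ x(1) Szn Sx] by blast
        have Wn: "Ws \<Gamma> t < 0" if t: "z \<le> t" "t < \<tau>" for t
        proof (rule cancel)
          show "0 < qs t" using qpos(1)[of t] t z \<tau>(2) x by auto
          show "qs t * Ws \<Gamma> t < 0" using \<tau>(4)[OF t] by simp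
        qed
        have wn: "ws \<Gamma> t \<le> 0" if t: "z \<le> t" "t \<le> \<tau>" for t
        proof -
          have "ws \<Gamma> t \<le> ws \<Gamma> z"
            by (rule deriv_nonpos_imp_le[where f' = "Ws \<Gamma>"])
              (use t z zT T x \<tau>(2) wc[of z t] in \<open>auto intro!: ws_deriv less_imp_le[OF Wn]\<close>)
          then show ?thesis using z by simp
        qed
        have Sle: "?S z \<le> ?S t" if t: "z \<le> t" "t \<le> \<tau>" for t
        proof -
          have "- ?S t \<le> - ?S z"
          proof (rule deriv_nonpos_imp_le[OF t(1)])
            show "continuous_on {z..t} (\<lambda>x. - ?S x)"
              using t \<tau>(2) x z by (intro continuous_on_minus Sc) auto
            fix s assume s: "z < s" "s < t"
            show "((\<lambda>x. - ?S x) has_real_derivative - (- qs s * (cs \<Gamma> s * ws \<Gamma> s))) (at s)"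
              using t s zT z x \<tau>(2) T by (intro DERIV_minus qWs_deriv) auto
            show "- (- qs s * (cs \<Gamma> s * ws \<Gamma> s)) \<le> 0"
              using qpos[of s] csle[of s] wn[of s] s t z x \<tau>(2)
              by (auto simp: mult_le_0_iff zero_le_mult_iff)
          qed
          then show ?thesis by simp
        qed
        \<comment> \<open>Only the product sin^n w is bounded in this way: w' may be as large as the
          flux divided by sin^n. As sin^n decreases on [z, \<tau>], its value at t bounds its values
          at earlier times from below.\<close>
        have qw: "- (qs t * ws \<Gamma> t) \<le> p * G * pi * pi" if t: "z \<le> t" "t \<le> \<tau>" for t
        proof -
          have qt: "0 < qs t" using qpos[of t] t z \<tau>(2) x by auto
          have "- ws \<Gamma> t \<le> - ws \<Gamma> z + p * G * pi / qs t * (t - z)"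
          proof (rule DERIV_le_imp_linear_bound[OF t(1)])
            show "continuous_on {z..t} (\<lambda>x. - ws \<Gamma> x)"
              using t \<tau>(2) x z by (intro continuous_on_minus wc) auto
            fix s assume s: "z < s" "s < t"
            show "((\<lambda>x. - ws \<Gamma> x) has_real_derivative - Ws \<Gamma> s) (at s)"
              using t s z x \<tau>(2) T by (intro DERIV_minus ws_deriv) auto
            have "sin (pi - t) \<le> sin (pi - s)"
              using s t z2 \<tau>(2) x T by (intro sin_monotone_2pi_le) auto
            moreover have "0 \<le> sin t" using t z \<tau>(2) x T by (intro sin_ge_zero) auto
            ultimately have "qs t \<le> qs s" by (intro power_mono) auto
            moreover have "Ws \<Gamma> s < 0" using Wn[of s] s t by auto
            ultimately have "- (qs t * Ws \<Gamma> s) \<le> - ?S s" by (simp add: mult_right_mono_neg)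
            also have "\<dots> \<le> - ?S z" using Sle[of s] s t by simp
            also have "\<dots> \<le> p * G * pi" using Sz' by simp
            finally show "- Ws \<Gamma> s \<le> p * G * pi / qs t" using qt by (simp add: pos_le_divide_eq mult.commute)
          qed
          also have "\<dots> = p * G * pi / qs t * (t - z)" using z by simp
          also have "\<dots> \<le> p * G * pi / qs t * pi"
            using t z \<tau>(2) x T p_gt_1 G qt by (intro mult_left_mono) auto
          finally show ?thesis using qt by (simp add: pos_le_divide_eq mult.commute mult.left_commute)
        qed
        have "?S \<tau> \<le> ?S z + p * G * (p * G * pi * pi) * (\<tau> - z)"
        proof (rule DERIV_le_imp_linear_bound)
          show "continuous_on {z..\<tau>} ?S" using \<tau>(2) x z by (intro Sc) auto
          fix t assume t: "z < t" "t < \<tau>"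
          show "(?S has_real_derivative - qs t * (cs \<Gamma> t * ws \<Gamma> t)) (at t)"
            using t zT z x \<tau>(2) T by (intro qWs_deriv) auto
          have "- qs t * (cs \<Gamma> t * ws \<Gamma> t) = cs \<Gamma> t * - (qs t * ws \<Gamma> t)" by simp
          also have "\<dots> \<le> p * G * (p * G * pi * pi)"
          proof (intro mult_mono)
            show "0 \<le> - (qs t * ws \<Gamma> t)"
              using qpos[of t] wn[of t] t z x \<tau>(2) by (auto simp: mult_le_0_iff)
          qed (use csle[of t] qw[of t] t z x \<tau>(2) p_gt_1 G in auto)
          finally show "- qs t * (cs \<Gamma> t * ws \<Gamma> t) \<le> p * G * (p * G * pi * pi)" .
        qed (use \<tau> in auto)
        also have "\<dots> \<le> - c0 * G + p * G * (p * G * pi * pi) * pi"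
          using Sz \<tau>(1,2) x z T p_gt_1 G by (intro add_mono mult_left_mono) auto
        also have "\<dots> = G * (G * (p ^ 2 * pi ^ 3) - c0)"
          by (simp add: power2_eq_square power3_eq_cube algebra_simps)
        also have "\<dots> < 0" using G G1 by (simp add: mult_less_0_iff)
        finally show False using \<tau>(3) by simp
      qed
      have "ws \<Gamma> T < ws \<Gamma> z"
      proof (rule DERIV_neg_imp_decreasing_open[OF zT])
        show "continuous_on {z..T} (ws \<Gamma>)" using z by (intro wc) auto
        fix x assume x: "z < x" "x < T"
        have "Ws \<Gamma> x < 0"
        proof (rule cancel)
          show "0 < qs x" by (rule qpos(1)) (use x z in auto)
          show "?S x < 0" by (rule Sneg') (use x in auto)
        qed
        then show "\<exists>y. (ws \<Gamma> has_real_derivative y) (at x) \<and> y < 0"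
          using ws_deriv[of x \<Gamma>] x z T by (intro exI[of _ "Ws \<Gamma> x"]) simp
      qed
      then show ?thesis using z by simp
    qed
    then show ?case by (simp add: T_def)
  qed
qed

lemma DT_neg: "\<forall>\<^sub>F \<Gamma> in at_right 0. DT \<Gamma> < 0"
proof -
  have "\<forall>\<^sub>F \<Gamma> in at_right (0::real). 0 < \<Gamma>" by (simp add: eventually_at_filter)
  with ws_Theta_neg show ?thesis
  proof eventually_elim
    case (elim \<Gamma>)
    then show ?case using Theta_props(5)[of \<Gamma>] by (simp add: DT_def divide_neg_neg)
  qed
qed

end

section \<open>Emden-Fowler variables\<close>

text \<open>A strict Lyapunov function for \<open>d' = x\<close>, \<open>x' = - \<alpha> x - m d\<close> that tolerates small perturbations \<open>e\<close>.\<close>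
lemma quadratic_lyapunov:
  fixes \<alpha> m :: real
  assumes \<alpha>: "0 < \<alpha>" and m: "0 < m"
  obtains \<delta> c1 c2 \<eta> \<epsilon> C where "0 < c1" "0 < c2" "0 < \<eta>" "0 < \<epsilon>" "0 < C"
    "\<And>d x. c1 * (d^2 + x^2) \<le> x^2/2 + m * d^2/2 + \<delta> * d * x"
    "\<And>d x. x^2/2 + m * d^2/2 + \<delta> * d * x \<le> c2 * (d^2 + x^2)"
    "\<And>d x e h. \<bar>e\<bar> \<le> \<epsilon> * (\<bar>d\<bar> + \<bar>x\<bar>) + h \<Longrightarrow> 0 \<le> h \<Longrightarrow>
      x * (- \<alpha> * x - m * d + e) + m * d * x + \<delta> * (x * x + d * (- \<alpha> * x - m * d + e))
      \<le> - 2 * \<eta> * (x^2/2 + m * d^2/2 + \<delta> * d * x) + C * h^2"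
proof -
  \<comment> \<open>Times \<delta>, this is what the mixed term \<delta> d x adds to the coefficient
    of x^2 in the derivative: 1 from d' x, and \<alpha>^2/(2m) from completing the square in -
    \<delta> \<alpha> d x.\<close>
  define r where "r = 1 + \<alpha>^2 / (2 * m)"
  have r: "0 < r" using m unfolding r_def by (intro add_pos_nonneg divide_nonneg_nonneg) auto
  \<comment> \<open>The three bounds give |x + \<delta> d| \<le> |x| + |d|, the definiteness of the
    form, and \<delta> r \<le> \<alpha>/2, so that half of the friction survives.\<close>
  define \<delta> where "\<delta> = min 1 (min (sqrt m / 2) (\<alpha> / (2 * r)))"
  have \<delta>: "0 < \<delta>" "\<delta> \<le> 1" "\<delta> \<le> sqrt m / 2" "\<delta> \<le> \<alpha> / (2 * r)"
    using \<alpha> m r by (auto simp: \<delta>_def)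
  have "\<delta> ^ 2 \<le> (sqrt m / 2) ^ 2" using \<delta> by (intro power_mono) auto
  then have \<delta>m: "\<delta> ^ 2 \<le> m / 4" using m by (simp add: power_divide)
  have \<delta>r: "\<delta> * r \<le> \<alpha> / 2" using \<delta>(4) r by (simp add: field_simps)
  define c1 where "c1 = min 1 m / 4"
  define c2 where "c2 = max 1 m"
  \<comment> \<open>Coefficient with which d^2 + x^2 is dissipated; the perturbation uses up one
    half of it, and dividing by c2 expresses the other half through the form itself.\<close>
  define \<gamma> where "\<gamma> = min (\<alpha>/2) (\<delta> * m / 2)"
  have c: "0 < c1" "0 < c2" "0 < \<gamma>" using \<alpha> m \<delta> by (auto simp: c1_def c2_def \<gamma>_def)
  have dx: "\<bar>\<delta> * d * x\<bar> \<le> x^2/4 + m * d^2/4" for d x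
  proof -
    have "0 \<le> (\<bar>x\<bar>/2 - \<delta> * \<bar>d\<bar>)^2" by simp
    then have "\<bar>\<delta> * d * x\<bar> \<le> x^2/4 + \<delta>^2 * d^2"
      using \<delta>(1) by (simp add: power2_diff power_mult_distrib power_divide abs_mult algebra_simps)
    also have "\<dots> \<le> x^2/4 + m/4 * d^2" using \<delta>m by (intro add_left_mono mult_right_mono) auto
    finally show ?thesis by simp
  qed
  have up: "x^2/2 + m * d^2/2 + \<delta> * d * x \<le> c2 * (d^2 + x^2)" for d x
  proof -
    have "1 * x^2 \<le> c2 * x^2" "m * d^2 \<le> c2 * d^2"
      by (intro mult_right_mono; simp add: c2_def)+
    moreover have "0 \<le> x^2" "0 \<le> m * d^2" using m by auto
    ultimately show ?thesis using dx[of d x] unfolding distrib_left abs_le_iff by linarith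
  qed
  have lo: "c1 * (d^2 + x^2) \<le> x^2/2 + m * d^2/2 + \<delta> * d * x" for d x
  proof -
    have "c1 * x^2 \<le> 1/4 * x^2" "c1 * d^2 \<le> m/4 * d^2"
      by (intro mult_right_mono; simp add: c1_def)+
    then show ?thesis using dx[of d x] unfolding distrib_left abs_le_iff by linarith
  qed
  define \<eta> where "\<eta> = \<gamma> / (4 * c2)"
  have main: "x * (- \<alpha> * x - m * d + e) + m * d * x + \<delta> * (x * x + d * (- \<alpha> * x - m * d + e))
      \<le> - 2 * \<eta> * (x^2/2 + m * d^2/2 + \<delta> * d * x) + 2 / \<gamma> * h^2"
    if e: "\<bar>e\<bar> \<le> \<gamma> / 8 * (\<bar>d\<bar> + \<bar>x\<bar>) + h" and h: "0 \<le> h" for d x e h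
  proof -
    define s where "s = \<bar>d\<bar> + \<bar>x\<bar>"
    have s: "0 \<le> s" by (simp add: s_def)
    have "0 \<le> (\<bar>d\<bar> - \<bar>x\<bar>)^2" by simp
    then have s2: "s^2 \<le> 2 * (d^2 + x^2)"
      unfolding s_def power2_sum power2_diff power2_abs by (simp add: algebra_simps)
    have "0 \<le> m/2 * (d + \<alpha> / m * x)^2" using m by simp
    also have "\<dots> = m/2 * d^2 + \<alpha> * d * x + \<alpha>^2/(2*m) * x^2"
      using m by (simp add: power2_eq_square field_simps)
    finally have "- (\<alpha> * d * x) \<le> m/2 * d^2 + \<alpha>^2/(2*m) * x^2" by simp
    from mult_left_mono[OF this, of \<delta>] have y: "- (\<delta> * \<alpha> * d * x) \<le> \<delta> * m/2 * d^2 + \<delta> * (\<alpha>^2/(2*m)) * x^2"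
      using \<delta> by (simp add: algebra_simps)
    have "x + \<delta> * d \<le> s" "- (x + \<delta> * d) \<le> s"
    proof -
      have "\<bar>\<delta> * d\<bar> \<le> 1 * \<bar>d\<bar>" using mult_right_mono[OF \<delta>(2), of "\<bar>d\<bar>"] \<delta>(1) by (simp add: abs_mult)
      then show "x + \<delta> * d \<le> s" "- (x + \<delta> * d) \<le> s" by (auto simp: s_def)
    qed
    then have "\<bar>x + \<delta> * d\<bar> \<le> s" by simp
    then have "\<bar>x + \<delta> * d\<bar> * \<bar>e\<bar> \<le> s * (\<gamma>/8 * s + h)"
      using e s by (intro mult_mono) (auto simp: s_def)
    moreover have "(x + \<delta> * d) * e \<le> \<bar>x + \<delta> * d\<bar> * \<bar>e\<bar>" by (metis abs_ge_self abs_mult)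
    ultimately have "(x + \<delta> * d) * e \<le> s * (\<gamma>/8 * s + h)" by linarith
    also have "\<dots> \<le> \<gamma>/8 * s^2 + (\<gamma>/8 * s^2 + 2/\<gamma> * h^2)"
    proof -
      have "0 \<le> \<gamma>/8 * (s - 4/\<gamma> * h)^2" using c by simp
      also have "\<dots> = \<gamma>/8 * s^2 + 2/\<gamma> * h^2 - s * h" using c by (simp add: power2_eq_square field_simps)
      finally show ?thesis by (simp add: power2_eq_square algebra_simps)
    qed
    also have "\<dots> \<le> \<gamma>/2 * (d^2 + x^2) + 2/\<gamma> * h^2"
      using mult_left_mono[OF s2, of "\<gamma>/4"] c by simp
    finally have z: "(x + \<delta> * d) * e \<le> \<gamma>/2 * (d^2 + x^2) + 2/\<gamma> * h^2" .
    have "x * (- \<alpha> * x - m * d + e) + m * d * x + \<delta> * (x * x + d * (- \<alpha> * x - m * d + e))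
      = - \<alpha> * x^2 + \<delta> * x^2 - \<delta> * m * d^2 - \<delta> * \<alpha> * d * x + (x + \<delta> * d) * e"
      by (simp add: power2_eq_square algebra_simps)
    also have "\<dots> \<le> - \<alpha> * x^2 + \<delta> * x^2 - \<delta> * m * d^2 + (\<delta> * m/2 * d^2 + \<delta> * (\<alpha>^2/(2*m)) * x^2)
        + (\<gamma>/2 * (d^2 + x^2) + 2/\<gamma> * h^2)" using y z by linarith
    also have "\<dots> = - (\<alpha> - \<delta> * r) * x^2 - \<delta> * m/2 * d^2 + (\<gamma>/2 * (d^2 + x^2) + 2/\<gamma> * h^2)"
      by (simp add: r_def algebra_simps)
    also have "\<dots> \<le> - \<gamma> * x^2 - \<gamma> * d^2 + (\<gamma>/2 * (d^2 + x^2) + 2/\<gamma> * h^2)"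
    proof -
      have "\<gamma> * x^2 \<le> (\<alpha> - \<delta> * r) * x^2" "\<gamma> * d^2 \<le> \<delta> * m/2 * d^2"
        using \<delta>r by (intro mult_right_mono; simp add: \<gamma>_def)+
      moreover have "- (\<alpha> - \<delta> * r) * x^2 = - ((\<alpha> - \<delta> * r) * x^2)" "- \<delta> * m/2 * d^2 = - (\<delta> * m/2 * d^2)"
        by (simp_all add: algebra_simps)
      ultimately show ?thesis by linarith
    qed
    also have "\<dots> = - 2 * \<eta> * (c2 * (d^2 + x^2)) + 2/\<gamma> * h^2"
      using c by (simp add: \<eta>_def field_simps)
    also have "\<dots> \<le> - 2 * \<eta> * (x^2/2 + m * d^2/2 + \<delta> * d * x) + 2 / \<gamma> * h^2"
      using up[of x d] c by (intro add_right_mono mult_left_mono_neg) (auto simp: \<eta>_def)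
    finally show ?thesis .
  qed
  have "0 < \<eta>" "0 < \<gamma>/8" "0 < 2/\<gamma>" using c by (auto simp: \<eta>_def)
  then show ?thesis using that[of c1 c2 \<eta> "\<gamma>/8" "2/\<gamma>" \<delta>] c lo up main by blast
qed

text \<open>The inhomogeneity H * exp (2t) has the size of the corrections by which the sphere
  differs from flat space; its squared response is of order exp (4t). The constants depend on
  \<alpha> and m only.\<close>

lemma damped_oscillator_decay:
  fixes \<alpha> m :: real
  assumes \<alpha>: "0 < \<alpha>" and m: "0 < m"
  obtains \<eta> \<epsilon> C where "0 < \<eta>" "0 < \<epsilon>" "1 \<le> C"
    "\<And>d x e H a b. a \<le> b \<Longrightarrow>
      (\<And>t. t \<in> {a..b} \<Longrightarrow> (d has_real_derivative x t) (at t)) \<Longrightarrow>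
      (\<And>t. t \<in> {a..b} \<Longrightarrow> (x has_real_derivative - \<alpha> * x t - m * d t + e t) (at t)) \<Longrightarrow>
      (\<And>t. t \<in> {a..b} \<Longrightarrow> \<bar>e t\<bar> \<le> \<epsilon> * (\<bar>d t\<bar> + \<bar>x t\<bar>) + H * exp (2 * t)) \<Longrightarrow> 0 \<le> H \<Longrightarrow>
      d b ^ 2 + x b ^ 2 \<le> C * (d a ^ 2 + x a ^ 2) * exp (- 2 * \<eta> * (b - a)) + C * H^2 * exp (4 * b)"
proof -
  obtain \<delta> c1 c2 \<eta> \<epsilon> C where c: "0 < c1" "0 < c2" "0 < \<eta>" "0 < \<epsilon>" "0 < C"
    and lo: "\<And>d x. c1 * (d^2 + x^2) \<le> x^2/2 + m * d^2/2 + \<delta> * d * x"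
    and up: "\<And>d x. x^2/2 + m * d^2/2 + \<delta> * d * x \<le> c2 * (d^2 + x^2)"
    and main: "\<And>d x e h. \<bar>e\<bar> \<le> \<epsilon> * (\<bar>d\<bar> + \<bar>x\<bar>) + h \<Longrightarrow> 0 \<le> h \<Longrightarrow>
      x * (- \<alpha> * x - m * d + e) + m * d * x + \<delta> * (x * x + d * (- \<alpha> * x - m * d + e))
      \<le> - 2 * \<eta> * (x^2/2 + m * d^2/2 + \<delta> * d * x) + C * h^2"
    using quadratic_lyapunov[OF assms] by metis
  define C' where "C' = max 1 (max (c2 / c1) (C / c1))"
  have C': "1 \<le> C'" "c2 / c1 \<le> C'" "C / c1 \<le> C'" by (auto simp: C'_def)
  show ?thesis
  proof (rule that[of \<eta> \<epsilon> C'])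
    fix d x e :: "real \<Rightarrow> real" and H a b :: real
    assume ab: "a \<le> b" and H: "0 \<le> H"
      and d: "\<And>t. t \<in> {a..b} \<Longrightarrow> (d has_real_derivative x t) (at t)"
      and x: "\<And>t. t \<in> {a..b} \<Longrightarrow> (x has_real_derivative - \<alpha> * x t - m * d t + e t) (at t)"
      and e: "\<And>t. t \<in> {a..b} \<Longrightarrow> \<bar>e t\<bar> \<le> \<epsilon> * (\<bar>d t\<bar> + \<bar>x t\<bar>) + H * exp (2 * t)"
    define Q where "Q t = x t^2/2 + m * d t^2/2 + \<delta> * d t * x t" for t
    \<comment> \<open>Chosen so that subtracting c * exp (4t) from Q leaves a function that
      satisfies the homogeneous inequality with rate - 2 \<eta>.\<close>
    define c where "c = C * H^2 / (4 + 2 * \<eta>)"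
    let ?f = "\<lambda>t. Q t - c * exp (4 * t)"
    define Q' where "Q' t = x t * (- \<alpha> * x t - m * d t + e t) + m * d t * x t + \<delta> * (x t * x t + d t * (- \<alpha> * x t - m * d t + e t))" for t
    have Qd: "(Q has_real_derivative Q' t) (at t)" if "t \<in> {a..b}" for t
      unfolding Q_def[abs_def] Q'_def
      by (auto intro!: derivative_eq_intros d[OF that] x[OF that] simp: field_simps)
    have "?f b \<le> ?f a * exp (- 2 * \<eta> * (b - a))"
    proof (rule gronwall_deriv[OF ab, where y' = "\<lambda>t. Q' t - c * (4 * exp (4 * t))"])
      show "continuous_on {a..b} ?f"
        using Qd by (intro continuous_intros DERIV_continuous_on[where D = Q']) (blast intro: has_field_derivative_at_within)
      fix t assume "a < t" "t < b"
      then have t: "t \<in> {a..b}" by simp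
      show "(?f has_real_derivative Q' t - c * (4 * exp (4 * t))) (at t)"
        by (rule derivative_eq_intros Qd[OF t] refl)+ simp
      have "Q' t \<le> - 2 * \<eta> * Q t + C * (H * exp (2 * t))^2"
        using main[OF e[OF t]] H unfolding Q'_def Q_def by auto
      also have "(H * exp (2 * t))^2 = H^2 * exp (4 * t)"
        by (simp add: power_mult_distrib flip: exp_double)
      also have "C * (H^2 * exp (4 * t)) = c * (4 + 2 * \<eta>) * exp (4 * t)"
        using \<open>0 < \<eta>\<close> by (simp add: c_def)
      finally show "Q' t - c * (4 * exp (4 * t)) \<le> - 2 * \<eta> * ?f t" by (simp add: algebra_simps)
    qed
    also have "\<dots> \<le> Q a * exp (- 2 * \<eta> * (b - a))"
      using \<open>0 < C\<close> \<open>0 < \<eta>\<close> by (intro mult_right_mono) (auto simp: c_def)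
    finally have "Q b \<le> Q a * exp (- 2 * \<eta> * (b - a)) + c * exp (4 * b)" by simp
    also have "\<dots> \<le> c2 * (d a^2 + x a^2) * exp (- 2 * \<eta> * (b - a)) + C * H^2 * exp (4 * b)"
    proof (intro add_mono mult_right_mono)
      show "Q a \<le> c2 * ((d a)\<^sup>2 + (x a)\<^sup>2)" using up[of "x a" "d a"] by (simp add: Q_def)
      have "C * H^2 / (4 + 2 * \<eta>) \<le> C * H^2 / 1"
        using \<open>0 < \<eta>\<close> \<open>0 < C\<close> by (intro divide_left_mono) auto
      then show "c \<le> C * H^2" by (simp add: c_def)
    qed auto
    finally have "c1 * (d b^2 + x b^2) \<le> c2 * (d a^2 + x a^2) * exp (- 2 * \<eta> * (b - a)) + C * H^2 * exp (4 * b)"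
      using lo[of "d b" "x b"] by (simp add: Q_def)
    then have "d b^2 + x b^2 \<le> (c2 * (d a^2 + x a^2) * exp (- 2 * \<eta> * (b - a)) + C * H^2 * exp (4 * b)) / c1"
      using \<open>0 < c1\<close> by (simp add: pos_le_divide_eq mult.commute)
    also have "\<dots> = c2 / c1 * ((d a^2 + x a^2) * exp (- 2 * \<eta> * (b - a))) + C / c1 * (H^2 * exp (4 * b))"
      by (simp add: add_divide_distrib)
    also have "\<dots> \<le> C' * ((d a^2 + x a^2) * exp (- 2 * \<eta> * (b - a))) + C' * (H^2 * exp (4 * b))"
      using C' by (intro add_mono mult_right_mono) auto
    finally show "d b^2 + x b^2 \<le> C' * (d a^2 + x a^2) * exp (- 2 * \<eta> * (b - a)) + C' * H^2 * exp (4 * b)"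
      by (simp add: mult.assoc)
  qed (use c C' in auto)
qed

section \<open>The time variable t = ln (tan (\<theta>/2))\<close>

definition th :: "real \<Rightarrow> real" where "th t = 2 * arctan (exp t)"

lemma th_bounds: "0 < th t" "th t < pi"
  using arctan_bounded[of "exp t"] by (auto simp: th_def)

lemma tan_half_th: "tan (th t / 2) = exp t" by (simp add: th_def tan_arctan)

lemma th_ln_tan: "0 < \<theta> \<Longrightarrow> \<theta> < pi \<Longrightarrow> th (ln (tan (\<theta> / 2))) = \<theta>"
  by (simp add: th_def tan_gt_zero arctan_tan)

lemma sin_th: "sin (th t) = 2 * exp t / (1 + exp t ^ 2)"
  and cos_th: "cos (th t) = (1 - exp t ^ 2) / (1 + exp t ^ 2)"
proof -
  have p: "0 < 1 + exp t ^ 2" by (intro add_pos_nonneg) auto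
  have s: "sin (th t) = 2 * sin (arctan (exp t)) * cos (arctan (exp t))"
    unfolding th_def by (rule sin_double)
  have c: "cos (th t) = cos (arctan (exp t)) ^ 2 - sin (arctan (exp t)) ^ 2"
    unfolding th_def by (rule cos_double)
  show "sin (th t) = 2 * exp t / (1 + exp t ^ 2)"
    unfolding s sin_arctan cos_arctan using p by (simp add: field_simps)
  show "cos (th t) = (1 - exp t ^ 2) / (1 + exp t ^ 2)"
    unfolding c sin_arctan cos_arctan using p by (simp add: power_divide diff_divide_distrib)
qed

lemma sin_th_pos: "0 < sin (th t)" using th_bounds by (intro sin_gt_zero) auto

lemma th_deriv: "(th has_real_derivative sin (th t)) (at t)"
proof -
  have "((\<lambda>t. 2 * arctan (exp t)) has_real_derivative 2 * exp t / (1 + exp t ^ 2)) (at t)"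
    by (auto intro!: derivative_eq_intros simp: field_simps)
  then show ?thesis unfolding sin_th by (simp add: th_def[abs_def])
qed

lemma sin_th_le: "sin (th t) \<le> 2 * exp t"
proof -
  have "2 * exp t / (1 + exp t ^ 2) \<le> 2 * exp t / 1" by (intro divide_left_mono) (auto intro: add_pos_nonneg)
  then show ?thesis by (simp add: sin_th)
qed

lemma sin_th_sq_le: "sin (th t) ^ 2 \<le> 4 * exp (2 * t)"
proof -
  have "sin (th t) ^ 2 \<le> (2 * exp t) ^ 2" using sin_th_le sin_th_pos by (intro power_mono) (auto intro: less_imp_le)
  also have "\<dots> = 4 * exp (2 * t)" by (simp add: power_mult_distrib exp_double)
  finally show ?thesis .
qed

lemma cos_th_bounds: "0 \<le> 1 - cos (th t)" "1 - cos (th t) \<le> 2 * exp (2 * t)"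
proof -
  have p: "0 < 1 + exp t ^ 2" by (intro add_pos_nonneg) auto
  have "1 - cos (th t) = 2 * exp t ^ 2 / (1 + exp t ^ 2)"
    unfolding cos_th using p by (simp add: field_simps)
  also have "\<dots> \<le> 2 * exp t ^ 2 / 1" using p by (intro divide_left_mono) auto
  finally show "1 - cos (th t) \<le> 2 * exp (2 * t)" by (simp add: exp_double)
qed simp

lemma th_strict_mono: "s < t \<Longrightarrow> th s < th t"
  by (simp add: th_def arctan_less_iff)

lemma th_at_bot: "(th \<longlongrightarrow> 0) at_bot"
proof -
  have "((\<lambda>t. 2 * arctan (exp t)) \<longlongrightarrow> 2 * arctan 0) (at_bot :: real filter)"
    by (intro tendsto_intros exp_at_bot)
  then show ?thesis by (simp add: th_def[abs_def])
qed

context sphere_problem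
begin

text \<open>As t tends to minus infinity, the equation for W becomes W'' + \<alpha> W' - \<kappa> W
  + nl p W = 0. Its positive equilibrium A has A^(p - 1) = \<kappa>, and m = p \<kappa> - \<kappa>
  is the coefficient of W - A in the linearization.\<close>

definition \<mu> where "\<mu> = mu p"
definition \<alpha> where "\<alpha> = real N - 2 - 2 * \<mu>"
definition \<kappa> where "\<kappa> = \<mu> * (real N - 2 - \<mu>)"
definition m where "m = (p - 1) * \<kappa>"
definition A where "A = acoef N p"

text \<open>The inequality \<mu> < (N - 2)/2 that makes \<alpha> positive is p > p_S
  rewritten.\<close>

lemma mu_facts: "0 < \<mu>" "\<mu> * (p - 1) = 2" "0 < \<alpha>" "0 < \<kappa>" "0 < m"
proof -
  have "p - 1 \<noteq> 0" using p_gt_1 by simp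
  from nonzero_eq_divide_eq[OF this, of "2 / (p - 1)" 2]
  show \<mu>: "0 < \<mu>" "\<mu> * (p - 1) = 2" using p_gt_1 unfolding \<mu>_def mu_def by simp_all
  have "4 / (real N - 2) < p - 1" using pS N by (simp add: field_simps)
  then have "4 < (p - 1) * (real N - 2)" using N by (simp add: field_simps)
  then have "2 * (\<mu> * (p - 1)) < (p - 1) * (real N - 2)" using \<mu> by simp
  then have "(p - 1) * (2 * \<mu>) < (p - 1) * (real N - 2)" by (simp add: mult.left_commute mult.commute)
  then show \<alpha>: "0 < \<alpha>" using p_gt_1 by (simp add: \<alpha>_def)
  show \<kappa>: "0 < \<kappa>" unfolding \<kappa>_def using \<mu> \<alpha> by (intro mult_pos_pos) (auto simp: \<alpha>_def)
  show "0 < m" unfolding m_def using \<kappa> p_gt_1 by simp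
qed

lemma A_facts: "0 < A" "A powr (p - 1) = \<kappa>" "nl p A = \<kappa> * A" "p * \<kappa> = m + \<kappa>"
proof -
  have A: "A = \<kappa> powr (\<mu> / 2)" by (simp add: A_def acoef_def \<kappa>_def \<mu>_def)
  show "0 < A" using A mu_facts by simp
  have "\<mu> / 2 * (p - 1) = 1" using mu_facts(2) by simp
  then show k: "A powr (p - 1) = \<kappa>" unfolding A powr_powr using mu_facts by simp
  then show "nl p A = \<kappa> * A" using \<open>0 < A\<close> by (simp add: nl_def)
  show "p * \<kappa> = m + \<kappa>" by (simp add: m_def algebra_simps)
qed

text \<open>\<open>EY\<close> is the derivative of \<open>EW\<close> with respect to \<open>t\<close> when \<open>V\<close> is that of \<open>U\<close>.\<close>
definition EW :: "(real \<Rightarrow> real) \<Rightarrow> real \<Rightarrow> real" where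
  "EW U t = sin (th t) powr \<mu> * U (th t)"

definition EY :: "(real \<Rightarrow> real) \<Rightarrow> (real \<Rightarrow> real) \<Rightarrow> real \<Rightarrow> real" where
  "EY U V t = \<mu> * cos (th t) * EW U t + sin (th t) powr (\<mu> + 1) * V (th t)"

text \<open>The exact equation for W on the sphere; the equation of flat space arises by setting cos
  to 1 and sin to 0, which changes the coefficients by O(exp (2t)).\<close>

definition ef_at :: "(real \<Rightarrow> real) \<Rightarrow> (real \<Rightarrow> real) \<Rightarrow> real \<Rightarrow> bool" where
  "ef_at W X t \<longleftrightarrow> (W has_real_derivative X t) (at t) \<and>
    (X has_real_derivative - \<alpha> * cos (th t) * X t + \<kappa> * W t - nl p (W t) - (\<kappa> + \<mu>) * sin (th t) ^ 2 * W t) (at t)"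

lemma ef_at_EW_EY:
  assumes U: "(U has_real_derivative V (th t)) (at (th t))"
    and V: "(V has_real_derivative rhs N p (th t) (U (th t)) (V (th t))) (at (th t))"
  shows "ef_at (EW U) (EY U V) t"
proof -
  define s c where "s = sin (th t)" and "c = cos (th t)"
  have s: "0 < s" by (simp add: s_def sin_th_pos)
  have c2: "c ^ 2 = 1 - s ^ 2" unfolding c_def s_def by (rule cos_squared_eq)
  have ds: "((\<lambda>t. sin (th t)) has_real_derivative c * s) (at t)"
    unfolding c_def s_def by (rule derivative_eq_intros th_deriv refl)+
  have dc: "((\<lambda>t. cos (th t)) has_real_derivative - (s ^ 2)) (at t)"
    unfolding s_def by (auto intro!: derivative_eq_intros th_deriv simp: power2_eq_square)
  have dU: "((\<lambda>t. U (th t)) has_real_derivative V (th t) * s) (at t)"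
    unfolding s_def by (rule DERIV_chain2[OF U th_deriv])
  have dV: "((\<lambda>t. V (th t)) has_real_derivative rhs N p (th t) (U (th t)) (V (th t)) * s) (at t)"
    unfolding s_def by (rule DERIV_chain2[OF V th_deriv])
  have dp: "((\<lambda>t. sin (th t) powr r) has_real_derivative r * c * s powr r) (at t)" for r
    by (rule DERIV_cong[OF has_real_derivative_powr'[OF ds DERIV_const]])
      (use s in \<open>auto simp: s_def[symmetric] powr_diff field_simps\<close>)
  have s1: "s powr (\<mu> + 1) = s powr \<mu> * s" "s powr (1 + \<mu>) = s powr \<mu> * s" using s by (simp_all add: powr_add)
  have dW: "(EW U has_real_derivative EY U V t) (at t)"
    unfolding EW_def[abs_def] EY_def
    by (rule DERIV_cong[OF DERIV_mult[OF dp[of \<mu>] dU]])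
      (simp add: s_def[symmetric] c_def[symmetric] s1 algebra_simps)
  define S where "S = s powr \<mu>"
  have Wt: "EW U t = S * U (th t)" by (simp add: EW_def S_def s_def)
  have Xt: "EY U V t = \<mu> * c * EW U t + S * s * V (th t)" by (simp add: EY_def S_def s1 s_def[symmetric] c_def)
  \<comment> \<open>Because \<mu>(p - 1) = 2, the weight of the nonlinear term matches the factor
    sin^2 produced by two derivatives in t.\<close>
  have "S powr (p - 1) = s powr 2" unfolding S_def powr_powr mu_facts(2) ..
  then have "S powr p = S * s ^ 2"
    using s powr_add[of S "p - 1" 1] by (simp add: S_def)
  then have fW: "nl p (EW U t) = S * s ^ 2 * nl p (U (th t))"
    unfolding Wt using s by (simp add: nl_scale S_def)
  have rhs: "rhs N p (th t) (U (th t)) (V (th t)) * s = - (real N - 1) * c * V (th t) - s * nl p (U (th t))"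
    using s unfolding rhs_def s_def[symmetric] c_def[symmetric] by (simp add: field_simps)
  have "(EY U V has_real_derivative
      (- (s ^ 2) * \<mu>) * EW U t + EY U V t * (\<mu> * c)
      + ((\<mu> + 1) * c * s powr (\<mu> + 1) * V (th t) + rhs N p (th t) (U (th t)) (V (th t)) * s * s powr (\<mu> + 1))) (at t)"
    unfolding EY_def[abs_def]
    by (rule DERIV_cong[OF DERIV_add[OF DERIV_mult[OF DERIV_cmult[OF dc, of \<mu>] dW] DERIV_mult[OF dp[of "\<mu> + 1"] dV]]])
      (simp add: s_def[symmetric] c_def[symmetric] EY_def algebra_simps)
  also have "(- (s ^ 2) * \<mu>) * EW U t + EY U V t * (\<mu> * c)
      + ((\<mu> + 1) * c * s powr (\<mu> + 1) * V (th t) + rhs N p (th t) (U (th t)) (V (th t)) * s * s powr (\<mu> + 1))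
    = - (s ^ 2) * \<mu> * EW U t + \<mu> * c * EY U V t + (\<mu> + 1 - (real N - 1)) * c * (S * s * V (th t)) - nl p (EW U t)"
    unfolding rhs fW s1 S_def[symmetric] by (simp add: power2_eq_square algebra_simps)
  also have "S * s * V (th t) = EY U V t - \<mu> * c * EW U t" by (simp add: Xt)
  also have "- (s ^ 2) * \<mu> * EW U t + \<mu> * c * EY U V t + (\<mu> + 1 - (real N - 1)) * c * (EY U V t - \<mu> * c * EW U t) - nl p (EW U t)
    = - \<alpha> * c * EY U V t + \<kappa> * c ^ 2 * EW U t - \<mu> * s ^ 2 * EW U t - nl p (EW U t)"
    by (simp add: \<alpha>_def \<kappa>_def power2_eq_square algebra_simps)
  also have "\<dots> = - \<alpha> * c * EY U V t + \<kappa> * EW U t - nl p (EW U t) - (\<kappa> + \<mu>) * s ^ 2 * EW U t"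
    unfolding c2 by (simp add: algebra_simps)
  finally show ?thesis using dW by (simp add: ef_at_def s_def c_def)
qed

lemma ef_at_sphere: "ef_at (EW (Us \<Gamma>)) (EY (Us \<Gamma>) (Vs \<Gamma>)) t"
  by (intro ef_at_EW_EY Us_deriv Vs_deriv th_bounds)

text \<open>Near A > 0 the function nl p is twice differentiable with bounded second derivative. The
  form with two points covers both the deviation from A, with z = A, and the difference of two
  solutions.\<close>

lemma nl_near_A:
  obtains K where "0 < K"
    "\<And>y z. \<bar>y - A\<bar> \<le> A/2 \<Longrightarrow> \<bar>z - A\<bar> \<le> A/2 \<Longrightarrow>
      \<bar>nl p y - nl p z - (m + \<kappa>) * (y - z)\<bar> \<le> K * (\<bar>y - A\<bar> + \<bar>z - A\<bar>) * \<bar>y - z\<bar>"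
proof -
  define I where "I = {A/2..3*A/2}"
  have "continuous_on I (\<lambda>z. p * ((p - 1) * z powr (p - 2)))"
    using A_facts(1) by (auto simp: I_def intro!: continuous_intros)
  then have "bounded ((\<lambda>z. p * ((p - 1) * z powr (p - 2))) ` I)"
    by (intro compact_imp_bounded compact_continuous_image) (auto simp: I_def)
  then obtain K0 where K0: "\<forall>z\<in>I. \<bar>p * ((p - 1) * z powr (p - 2))\<bar> \<le> K0"
    by (auto simp: bounded_iff)
  define K where "K = max K0 1"
  have lip: "\<bar>p * z powr (p - 1) - (m + \<kappa>)\<bar> \<le> K * \<bar>z - A\<bar>" if z: "\<bar>z - A\<bar> \<le> A/2" for z
  proof -
    have zI: "z \<in> I" "A \<in> I" using z A_facts(1) unfolding I_def atLeastAtMost_iff by linarith+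
    have "norm (p * z powr (p - 1) - p * A powr (p - 1)) \<le> K * norm (z - A)"
    proof (rule field_differentiable_bound[of I _ "\<lambda>z. p * ((p - 1) * z powr (p - 2))"])
      show "convex I" by (simp add: I_def)
      fix w assume w: "w \<in> I"
      then have "0 < w" using A_facts(1) by (auto simp: I_def)
      then show "((\<lambda>z. p * z powr (p - 1)) has_real_derivative p * ((p - 1) * w powr (p - 2))) (at w within I)"
        by (auto intro!: derivative_eq_intros)
      show "norm (p * ((p - 1) * w powr (p - 2))) \<le> K" using K0 w by (force simp: K_def)
    qed (use zI in auto)
    then show ?thesis using A_facts by simp
  qed
  show ?thesis
  proof (rule that[of K])
    show "0 < K" by (simp add: K_def)
    fix y z assume yz: "\<bar>y - A\<bar> \<le> A/2" "\<bar>z - A\<bar> \<le> A/2"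
    obtain w where w: "min z y \<le> w" "w \<le> max z y" "nl p y - nl p z = p * \<bar>w\<bar> powr (p - 1) * (y - z)"
      using nl_mvt[OF p_gt_1] by metis
    have wA: "\<bar>w - A\<bar> \<le> \<bar>y - A\<bar> + \<bar>z - A\<bar>" "\<bar>w - A\<bar> \<le> A/2" using w(1,2) yz by linarith+
    then have "\<bar>w\<bar> = w" using A_facts(1) by linarith
    have "nl p y - nl p z - (m + \<kappa>) * (y - z) = (p * w powr (p - 1) - (m + \<kappa>)) * (y - z)"
      unfolding w(3) \<open>\<bar>w\<bar> = w\<close> by (simp add: algebra_simps)
    also have "\<bar>\<dots>\<bar> \<le> K * (\<bar>y - A\<bar> + \<bar>z - A\<bar>) * \<bar>y - z\<bar>"
    proof -
      have "0 \<le> K" by (simp add: K_def)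
      then have "\<bar>p * w powr (p - 1) - (m + \<kappa>)\<bar> \<le> K * (\<bar>y - A\<bar> + \<bar>z - A\<bar>)"
        using lip[OF wA(2)] mult_left_mono[OF wA(1), of K] by linarith
      then show ?thesis unfolding abs_mult by (rule mult_right_mono) simp
    qed
    finally show "\<bar>nl p y - nl p z - (m + \<kappa>) * (y - z)\<bar> \<le> K * (\<bar>y - A\<bar> + \<bar>z - A\<bar>) * \<bar>y - z\<bar>" .
  qed
qed

end

section \<open>Stability of the equilibrium\<close>

lemma sum_squares_abs_le:
  fixes d x :: real
  assumes "d^2 + x^2 \<le> r^2" "0 \<le> r"
  shows "\<bar>d\<bar> \<le> r" "\<bar>x\<bar> \<le> r"
  using assms by (auto intro!: power2_le_imp_le[of _ r] simp: order_trans[OF _ assms(1)])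

context sphere_problem
begin

lemma exp2_small:
  fixes \<tau> t :: real
  assumes "0 < \<tau>" "t \<le> ln \<tau> / 2"
  shows "exp (2 * t) \<le> \<tau>"
proof -
  have "exp (2 * t) \<le> exp (ln \<tau>)" unfolding exp_le_cancel_iff using assms by simp
  also have "\<dots> = \<tau>" using assms by simp
  finally show ?thesis .
qed

text \<open>Bootstrap: while |W - A| \<le> \<rho>1, the perturbation stays within the tolerance of
  the Lyapunov function, which then gives back a stricter bound. None of the constants depends on
  the starting time a, which will tend to minus infinity as \<epsilon> tends to 0.\<close>

lemma ef_stable:
  assumes \<rho>: "0 < \<rho>"
  obtains \<rho>0 T0 C \<eta> where "0 < \<rho>0" "1 \<le> C" "0 < \<eta>"
    "\<And>W X a b t. b \<le> T0 \<Longrightarrow> (\<And>t. t \<in> {a..b} \<Longrightarrow> ef_at W X t) \<Longrightarrow>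
      (W a - A)^2 + X a^2 \<le> \<rho>0 \<Longrightarrow> t \<in> {a..b} \<Longrightarrow>
      \<bar>W t - A\<bar> < \<rho> \<and> (W t - A)^2 + X t^2 \<le> C * ((W a - A)^2 + X a^2) * exp (- 2 * \<eta> * (t - a)) + C * exp (4 * t)"
proof -
  obtain \<eta> \<epsilon> C0 where c: "0 < \<eta>" "0 < \<epsilon>" "1 \<le> C0"
    and dec: "\<And>d x e H a b. a \<le> b \<Longrightarrow>
      (\<And>t. t \<in> {a..b} \<Longrightarrow> (d has_real_derivative x t) (at t)) \<Longrightarrow>
      (\<And>t. t \<in> {a..b} \<Longrightarrow> (x has_real_derivative - \<alpha> * x t - m * d t + e t) (at t)) \<Longrightarrow>
      (\<And>t. t \<in> {a..b} \<Longrightarrow> \<bar>e t\<bar> \<le> \<epsilon> * (\<bar>d t\<bar> + \<bar>x t\<bar>) + H * exp (2 * t)) \<Longrightarrow> 0 \<le> H \<Longrightarrow>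
      d b ^ 2 + x b ^ 2 \<le> C0 * (d a ^ 2 + x a ^ 2) * exp (- 2 * \<eta> * (b - a)) + C0 * H^2 * exp (4 * b)"
    apply (rule damped_oscillator_decay[OF mu_facts(3,5)])
    subgoal premises prems by (rule prems(1)[OF prems(2-)])
    done
  obtain K where K: "0 < K"
    "\<And>y z. \<bar>y - A\<bar> \<le> A/2 \<Longrightarrow> \<bar>z - A\<bar> \<le> A/2 \<Longrightarrow>
      \<bar>nl p y - nl p z - (m + \<kappa>) * (y - z)\<bar> \<le> K * (\<bar>y - A\<bar> + \<bar>z - A\<bar>) * \<bar>y - z\<bar>"
    using nl_near_A by blast
  note A0 = A_facts(1)
  \<comment> \<open>The entry A/2 keeps W in the range of \<open>nl_near_A\<close>, and
    \<epsilon>/(2K) makes the quadratic remainder at most half of the tolerance \<epsilon>.\<close>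
  define \<rho>1 where "\<rho>1 = min \<rho> (min (A/2) (\<epsilon> / (2 * K)))"
  have \<rho>1: "0 < \<rho>1" "\<rho>1 \<le> \<rho>" "\<rho>1 \<le> A/2" "K * \<rho>1 \<le> \<epsilon> / 2"
  proof -
    have "\<rho>1 \<le> \<epsilon> / (2 * K)" by (simp add: \<rho>1_def)
    then show "K * \<rho>1 \<le> \<epsilon> / 2" using K by (simp add: field_simps)
  qed (use \<rho> A0 K c in \<open>auto simp: \<rho>1_def\<close>)
  \<comment> \<open>Here 6 = 4 * 3/2, from sin^2 \<le> 4 exp (2t) and |W| \<le> 3A/2.\<close>
  define H where "H = 6 * A * (\<kappa> + \<mu>)"
  have H: "0 < H" using A0 mu_facts by (auto simp: H_def)
  \<comment> \<open>Bound for exp (2t) up to the final time: the first entry absorbs 1 - cos in the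
    friction, the second keeps the response to the forcing below \<rho>1^2/4.\<close>
  define \<tau> where "\<tau> = min (\<epsilon> / (4 * \<alpha>)) (\<rho>1 / (2 * H * C0))"
  have \<tau>: "0 < \<tau>" "\<tau> \<le> \<epsilon> / (4 * \<alpha>)" "\<tau> \<le> \<rho>1 / (2 * H * C0)"
    using c mu_facts \<rho>1 H by (auto simp: \<tau>_def)
  \<comment> \<open>Start and forcing contribute at most \<rho>1^2/4 each, which leaves room for the
    strict inequality of the bootstrap.\<close>
  define \<rho>0 where "\<rho>0 = \<rho>1^2 / (4 * C0)"
  have \<rho>0: "0 < \<rho>0" using \<rho>1 c by (simp add: \<rho>0_def)
  define C where "C = C0 * max 1 (H^2)"
  have C: "1 \<le> C" "C0 \<le> C" "C0 * H^2 \<le> C"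
  proof -
    have "C0 * 1 \<le> C" "C0 * H^2 \<le> C" unfolding C_def using c by (intro mult_left_mono; simp)+
    then show "1 \<le> C" "C0 \<le> C" "C0 * H^2 \<le> C" using c by auto
  qed
  have main: "\<bar>W t - A\<bar> < \<rho>1 \<and> (W t - A)^2 + X t^2 \<le> C0 * ((W a - A)^2 + X a^2) * exp (- 2 * \<eta> * (t - a)) + C0 * H^2 * exp (4 * t)"
    if b: "b \<le> ln \<tau> / 2" and ef: "\<And>t. t \<in> {a..b} \<Longrightarrow> ef_at W X t"
      and ini: "(W a - A)^2 + X a^2 \<le> \<rho>0" and t: "t \<in> {a..b}" for W X a b t
  proof -
    define e where "e t = \<alpha> * (1 - cos (th t)) * X t - (nl p (W t) - nl p A - (m + \<kappa>) * (W t - A)) - (\<kappa> + \<mu>) * sin (th t)^2 * W t" for t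
    have est: "(W y - A)^2 + X y^2 \<le> C0 * ((W a - A)^2 + X a^2) * exp (- 2 * \<eta> * (y - a)) + C0 * H^2 * exp (4 * y)"
      if y: "y \<in> {a..b}" and le: "\<And>s. s \<in> {a..y} \<Longrightarrow> \<bar>W s - A\<bar> \<le> \<rho>1" for y
    proof (rule dec[where d = "\<lambda>t. W t - A" and x = X and e = e and H = H])
      show "a \<le> y" using y by simp
      show "0 \<le> H" using H by simp
      fix s assume s: "s \<in> {a..y}"
      then have sb: "s \<in> {a..b}" using y by auto
      show "((\<lambda>t. W t - A) has_real_derivative X s) (at s)"
        using ef[OF sb] by (auto simp: ef_at_def intro!: derivative_eq_intros)
      have "- \<alpha> * X s - m * (W s - A) + e s = - \<alpha> * cos (th s) * X s + \<kappa> * W s - nl p (W s) - (\<kappa> + \<mu>) * sin (th s) ^ 2 * W s"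
        by (simp add: e_def A_facts(3) algebra_simps)
      then show "(X has_real_derivative - \<alpha> * X s - m * (W s - A) + e s) (at s)"
        using ef[OF sb] by (simp add: ef_at_def)
      have exs: "exp (2 * s) \<le> \<tau>" using sb b by (intro exp2_small \<tau>) auto
      have d: "\<bar>W s - A\<bar> \<le> \<rho>1" by (rule le[OF s])
      have "\<bar>nl p (W s) - nl p A - (m + \<kappa>) * (W s - A)\<bar> \<le> K * (\<bar>W s - A\<bar> + \<bar>A - A\<bar>) * \<bar>W s - A\<bar>"
        using d \<rho>1 A0 by (intro K(2)) auto
      also have "\<dots> \<le> \<epsilon>/2 * \<bar>W s - A\<bar>"
      proof (rule mult_right_mono)
        show "K * (\<bar>W s - A\<bar> + \<bar>A - A\<bar>) \<le> \<epsilon>/2"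
          using mult_left_mono[OF d less_imp_le[OF K(1)]] \<rho>1(4) by simp
      qed simp
      finally have 1: "\<bar>nl p (W s) - nl p A - (m + \<kappa>) * (W s - A)\<bar> \<le> \<epsilon>/2 * \<bar>W s - A\<bar>" .
      have "1 - cos (th s) \<le> 2 * (\<epsilon> / (4 * \<alpha>))" using cos_th_bounds(2)[of s] exs \<tau> by linarith
      then have "\<alpha> * (1 - cos (th s)) \<le> \<epsilon>/2" using mu_facts(3) by (simp add: field_simps)
      from mult_right_mono[OF this, of "\<bar>X s\<bar>"]
      have 2: "\<bar>\<alpha> * (1 - cos (th s)) * X s\<bar> \<le> \<epsilon>/2 * \<bar>X s\<bar>"
        using mu_facts(3) cos_th_bounds(1)[of s] by (simp add: abs_mult)
      have "\<bar>W s\<bar> \<le> 3/2 * A" using d \<rho>1 by linarith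
      then have "(\<kappa> + \<mu>) * sin (th s)^2 * \<bar>W s\<bar> \<le> (\<kappa> + \<mu>) * (4 * exp (2 * s)) * (3/2 * A)"
        using mu_facts sin_th_sq_le[of s] by (intro mult_mono) auto
      moreover have "(\<kappa> + \<mu>) * (4 * exp (2 * s)) * (3/2 * A) = H * exp (2 * s)" by (simp add: H_def)
      moreover have "\<bar>(\<kappa> + \<mu>) * sin (th s)^2 * W s\<bar> = (\<kappa> + \<mu>) * sin (th s)^2 * \<bar>W s\<bar>"
        using mu_facts by (simp add: abs_mult)
      ultimately have 3: "\<bar>(\<kappa> + \<mu>) * sin (th s)^2 * W s\<bar> \<le> H * exp (2 * s)" by linarith
      have 4: "0 \<le> \<epsilon>/2 * \<bar>W s - A\<bar>" "0 \<le> \<epsilon>/2 * \<bar>X s\<bar>" using c by auto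
      show "\<bar>e s\<bar> \<le> \<epsilon> * (\<bar>W s - A\<bar> + \<bar>X s\<bar>) + H * exp (2 * s)"
        using 1 2 3 4 unfolding e_def distrib_left by linarith
    qed
    have bd: "\<bar>W y - A\<bar> < \<rho>1" if y: "y \<in> {a..b}" for y
    proof (rule bootstrap_bound[of a b "\<lambda>y. \<bar>W y - A\<bar>", OF _ _ _ y])
      have "continuous_on {a..b} W"
        by (rule DERIV_continuous_on[where D = X]) (use ef in \<open>auto simp: ef_at_def intro: has_field_derivative_at_within\<close>)
      then show "continuous_on {a..b} (\<lambda>y. \<bar>W y - A\<bar>)" by (intro continuous_intros)
      have q: "\<rho>0 \<le> \<rho>1^2" using c \<rho>1 by (simp add: \<rho>0_def field_simps)
      show "\<bar>W a - A\<bar> \<le> \<rho>1"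
        by (rule sum_squares_abs_le(1)[of _ "X a"]) (use ini q \<rho>1 in auto)
      fix y assume y: "y \<in> {a..b}" and le: "\<And>s. s \<in> {a..y} \<Longrightarrow> \<bar>W s - A\<bar> \<le> \<rho>1"
      have "(W y - A)^2 + X y^2 \<le> C0 * ((W a - A)^2 + X a^2) * exp (- 2 * \<eta> * (y - a)) + C0 * H^2 * exp (4 * y)"
        by (rule est[OF y le])
      also have "\<dots> \<le> C0 * \<rho>0 * 1 + C0 * (H * exp (2 * y))^2"
      proof (rule add_mono)
        have "exp (- 2 * \<eta> * (y - a)) \<le> 1" using c y by (auto simp: mult_nonpos_nonneg)
        then show "C0 * ((W a - A)^2 + X a^2) * exp (- 2 * \<eta> * (y - a)) \<le> C0 * \<rho>0 * 1"
          using ini \<rho>0 c by (intro mult_mono) auto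
        show "C0 * H^2 * exp (4 * y) \<le> C0 * (H * exp (2 * y))^2"
          by (simp add: power_mult_distrib flip: exp_double)
      qed
      also have "\<dots> \<le> \<rho>1^2/4 + C0 * (\<rho>1 / (2 * C0))^2"
      proof -
        have "exp (2 * y) \<le> \<rho>1 / (2 * H * C0)" using exp2_small[OF \<tau>(1), of y] \<tau>(3) y b by auto
        then have "H * exp (2 * y) \<le> \<rho>1 / (2 * C0)" using H c by (simp add: field_simps)
        then have "(H * exp (2 * y))^2 \<le> (\<rho>1 / (2 * C0))^2" using H by (intro power_mono) auto
        then show ?thesis using c by (intro add_mono mult_left_mono) (auto simp: \<rho>0_def)
      qed
      also have "C0 * (\<rho>1 / (2 * C0))^2 = \<rho>1^2/4 * (1 / C0)" using c by (simp add: power2_eq_square field_simps)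
      also have "\<rho>1^2/4 + \<rho>1^2/4 * (1 / C0) \<le> \<rho>1^2/4 + \<rho>1^2/4 * 1"
        using c by (intro add_left_mono mult_left_mono) auto
      also have "\<dots> < \<rho>1^2" using \<rho>1 by simp
      finally have "(W y - A)^2 < \<rho>1^2" using zero_le_power2[of "X y"] by linarith
      then have "\<bar>W y - A\<bar>^2 < \<rho>1^2" by simp
      then show "\<bar>W y - A\<bar> < \<rho>1" by (rule power2_less_imp_less) (use \<rho>1 in simp)
    qed
    show ?thesis using bd[OF t] est[OF t] bd t by (force intro: less_imp_le)
  qed
  show ?thesis
  proof (rule that[OF \<rho>0 C(1) c(1)], rule conjI)
    fix W X :: "real \<Rightarrow> real" and a b t
    assume *: "b \<le> ln \<tau> / 2" "\<And>t. t \<in> {a..b} \<Longrightarrow> ef_at W X t" "(W a - A)^2 + X a^2 \<le> \<rho>0" "t \<in> {a..b}"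
    note main = main[OF *]
    show "\<bar>W t - A\<bar> < \<rho>" using main \<rho>1 by simp
    have "(W t - A)^2 + X t^2 \<le> C0 * (((W a - A)^2 + X a^2) * exp (- 2 * \<eta> * (t - a))) + C0 * H^2 * exp (4 * t)"
      using main by (simp add: mult.assoc)
    also have "\<dots> \<le> C * (((W a - A)^2 + X a^2) * exp (- 2 * \<eta> * (t - a))) + C * exp (4 * t)"
      using C by (intro add_mono mult_right_mono) auto
    finally show "(W t - A)^2 + X t^2 \<le> C * ((W a - A)^2 + X a^2) * exp (- 2 * \<eta> * (t - a)) + C * exp (4 * t)"
      by (simp add: mult.assoc)
  qed
qed

text \<open>In the difference of two solutions the corrections of order exp (2t) multiply the
  difference itself, so they count towards the tolerance and no forcing remains: the decay is purely
  exponential.\<close>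

lemma ef_diff_decay:
  obtains \<rho> T0 C \<eta> where "0 < \<rho>" "\<rho> \<le> A/2" "1 \<le> C" "0 < \<eta>"
    "\<And>W X W' X' a b. a \<le> b \<Longrightarrow> b \<le> T0 \<Longrightarrow> (\<And>t. t \<in> {a..b} \<Longrightarrow> ef_at W X t) \<Longrightarrow>
      (\<And>t. t \<in> {a..b} \<Longrightarrow> ef_at W' X' t) \<Longrightarrow>
      (\<And>t. t \<in> {a..b} \<Longrightarrow> \<bar>W t - A\<bar> \<le> \<rho>) \<Longrightarrow> (\<And>t. t \<in> {a..b} \<Longrightarrow> \<bar>W' t - A\<bar> \<le> \<rho>) \<Longrightarrow>
      (W b - W' b)^2 + (X b - X' b)^2 \<le> C * ((W a - W' a)^2 + (X a - X' a)^2) * exp (- 2 * \<eta> * (b - a))"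
proof -
  obtain \<eta> \<epsilon> C0 where c: "0 < \<eta>" "0 < \<epsilon>" "1 \<le> C0"
    and dec: "\<And>d x e H a b. a \<le> b \<Longrightarrow>
      (\<And>t. t \<in> {a..b} \<Longrightarrow> (d has_real_derivative x t) (at t)) \<Longrightarrow>
      (\<And>t. t \<in> {a..b} \<Longrightarrow> (x has_real_derivative - \<alpha> * x t - m * d t + e t) (at t)) \<Longrightarrow>
      (\<And>t. t \<in> {a..b} \<Longrightarrow> \<bar>e t\<bar> \<le> \<epsilon> * (\<bar>d t\<bar> + \<bar>x t\<bar>) + H * exp (2 * t)) \<Longrightarrow> 0 \<le> H \<Longrightarrow>
      d b ^ 2 + x b ^ 2 \<le> C0 * (d a ^ 2 + x a ^ 2) * exp (- 2 * \<eta> * (b - a)) + C0 * H^2 * exp (4 * b)"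
    apply (rule damped_oscillator_decay[OF mu_facts(3,5)])
    subgoal premises prems by (rule prems(1)[OF prems(2-)])
    done
  obtain K where K: "0 < K"
    "\<And>y z. \<bar>y - A\<bar> \<le> A/2 \<Longrightarrow> \<bar>z - A\<bar> \<le> A/2 \<Longrightarrow>
      \<bar>nl p y - nl p z - (m + \<kappa>) * (y - z)\<bar> \<le> K * (\<bar>y - A\<bar> + \<bar>z - A\<bar>) * \<bar>y - z\<bar>"
    using nl_near_A by blast
  note A0 = A_facts(1)
  define \<rho> where "\<rho> = min (A/2) (\<epsilon> / (4 * K))"
  have \<rho>: "0 < \<rho>" "\<rho> \<le> A/2" "K * (\<rho> + \<rho>) \<le> \<epsilon> / 2"
  proof -
    have "\<rho> \<le> \<epsilon> / (4 * K)" by (simp add: \<rho>_def)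
    then show "K * (\<rho> + \<rho>) \<le> \<epsilon> / 2" using K by (simp add: field_simps)
  qed (use A0 K c in \<open>auto simp: \<rho>_def\<close>)
  have km: "0 < \<kappa> + \<mu>" using mu_facts by simp
  define \<tau> where "\<tau> = min (\<epsilon> / (4 * \<alpha>)) (\<epsilon> / (8 * (\<kappa> + \<mu>)))"
  have \<tau>: "0 < \<tau>" "\<tau> \<le> \<epsilon> / (4 * \<alpha>)" "\<tau> \<le> \<epsilon> / (8 * (\<kappa> + \<mu>))"
    using c mu_facts km by (auto simp: \<tau>_def)
  show ?thesis
  proof (rule that[OF \<rho>(1,2) c(3,1), of "ln \<tau> / 2"])
    fix W X W' X' :: "real \<Rightarrow> real" and a b
    assume ab: "a \<le> b" and b: "b \<le> ln \<tau> / 2"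
      and ef: "\<And>t. t \<in> {a..b} \<Longrightarrow> ef_at W X t" "\<And>t. t \<in> {a..b} \<Longrightarrow> ef_at W' X' t"
      and near: "\<And>t. t \<in> {a..b} \<Longrightarrow> \<bar>W t - A\<bar> \<le> \<rho>" "\<And>t. t \<in> {a..b} \<Longrightarrow> \<bar>W' t - A\<bar> \<le> \<rho>"
    define e where "e t = \<alpha> * (1 - cos (th t)) * (X t - X' t) - (nl p (W t) - nl p (W' t) - (m + \<kappa>) * (W t - W' t))
       - (\<kappa> + \<mu>) * sin (th t)^2 * (W t - W' t)" for t
    have "(W b - W' b)^2 + (X b - X' b)^2 \<le> C0 * ((W a - W' a)^2 + (X a - X' a)^2) * exp (- 2 * \<eta> * (b - a)) + C0 * 0^2 * exp (4 * b)"
    proof (rule dec[where d = "\<lambda>t. W t - W' t" and x = "\<lambda>t. X t - X' t" and e = e, OF ab])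
      fix s assume s: "s \<in> {a..b}"
      show "((\<lambda>t. W t - W' t) has_real_derivative X s - X' s) (at s)"
        using ef[OF s] by (auto simp: ef_at_def intro!: derivative_eq_intros)
      have "((\<lambda>t. X t - X' t) has_real_derivative
         (- \<alpha> * cos (th s) * X s + \<kappa> * W s - nl p (W s) - (\<kappa> + \<mu>) * sin (th s) ^ 2 * W s) -
         (- \<alpha> * cos (th s) * X' s + \<kappa> * W' s - nl p (W' s) - (\<kappa> + \<mu>) * sin (th s) ^ 2 * W' s)) (at s)"
        using ef[OF s] by (intro DERIV_diff) (auto simp: ef_at_def)
      moreover have "(- \<alpha> * cos (th s) * X s + \<kappa> * W s - nl p (W s) - (\<kappa> + \<mu>) * sin (th s) ^ 2 * W s) -
         (- \<alpha> * cos (th s) * X' s + \<kappa> * W' s - nl p (W' s) - (\<kappa> + \<mu>) * sin (th s) ^ 2 * W' s)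
        = - \<alpha> * (X s - X' s) - m * (W s - W' s) + e s"
        by (simp add: e_def algebra_simps)
      ultimately show "((\<lambda>t. X t - X' t) has_real_derivative - \<alpha> * (X s - X' s) - m * (W s - W' s) + e s) (at s)"
        by simp
      have exs: "exp (2 * s) \<le> \<tau>" using s b by (intro exp2_small \<tau>) auto
      have "\<bar>nl p (W s) - nl p (W' s) - (m + \<kappa>) * (W s - W' s)\<bar> \<le> K * (\<bar>W s - A\<bar> + \<bar>W' s - A\<bar>) * \<bar>W s - W' s\<bar>"
        using near[OF s] \<rho> by (intro K(2)) auto
      also have "\<dots> \<le> \<epsilon>/2 * \<bar>W s - W' s\<bar>"
      proof (rule mult_right_mono)
        have "K * (\<bar>W s - A\<bar> + \<bar>W' s - A\<bar>) \<le> K * (\<rho> + \<rho>)"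
          using near[OF s] K by (intro mult_left_mono) auto
        then show "K * (\<bar>W s - A\<bar> + \<bar>W' s - A\<bar>) \<le> \<epsilon>/2" using \<rho> by linarith
      qed simp
      finally have 1: "\<bar>nl p (W s) - nl p (W' s) - (m + \<kappa>) * (W s - W' s)\<bar> \<le> \<epsilon>/2 * \<bar>W s - W' s\<bar>" .
      have "1 - cos (th s) \<le> 2 * (\<epsilon> / (4 * \<alpha>))" using cos_th_bounds(2)[of s] exs \<tau> by linarith
      then have "\<alpha> * (1 - cos (th s)) \<le> \<epsilon>/2" using mu_facts(3) by (simp add: field_simps)
      from mult_right_mono[OF this, of "\<bar>X s - X' s\<bar>"]
      have 2: "\<bar>\<alpha> * (1 - cos (th s)) * (X s - X' s)\<bar> \<le> \<epsilon>/2 * \<bar>X s - X' s\<bar>"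
        using mu_facts(3) cos_th_bounds(1)[of s] by (simp add: abs_mult)
      have "sin (th s)^2 \<le> 4 * (\<epsilon> / (8 * (\<kappa> + \<mu>)))" using sin_th_sq_le[of s] exs \<tau> by linarith
      then have "(\<kappa> + \<mu>) * sin (th s)^2 \<le> (\<kappa> + \<mu>) * (4 * (\<epsilon> / (8 * (\<kappa> + \<mu>))))"
        using km by (intro mult_left_mono) auto
      moreover have "k * (4 * (\<epsilon> / (8 * k))) = \<epsilon>/2" if "0 < k" for k :: real using that by simp
      from this[OF km] have "(\<kappa> + \<mu>) * (4 * (\<epsilon> / (8 * (\<kappa> + \<mu>)))) = \<epsilon>/2" .
      ultimately have "(\<kappa> + \<mu>) * sin (th s)^2 \<le> \<epsilon>/2" by linarith
      from mult_right_mono[OF this, of "\<bar>W s - W' s\<bar>"]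
      have 3: "\<bar>(\<kappa> + \<mu>) * sin (th s)^2 * (W s - W' s)\<bar> \<le> \<epsilon>/2 * \<bar>W s - W' s\<bar>"
        using km by (simp add: abs_mult)
      have 4: "0 \<le> \<epsilon>/2 * \<bar>X s - X' s\<bar>" using c by auto
      show "\<bar>e s\<bar> \<le> \<epsilon> * (\<bar>W s - W' s\<bar> + \<bar>X s - X' s\<bar>) + 0 * exp (2 * s)"
        using 1 2 3 4 unfolding e_def distrib_left by linarith
    qed simp
    then show "(W b - W' b)^2 + (X b - X' b)^2 \<le> C0 * ((W a - W' a)^2 + (X a - X' a)^2) * exp (- 2 * \<eta> * (b - a))"
      by simp
  qed
qed

section \<open>Dependence on initial data in the interior\<close>

definition sol_at :: "(real \<Rightarrow> real) \<Rightarrow> (real \<Rightarrow> real) \<Rightarrow> real \<Rightarrow> bool" where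
  "sol_at U V x \<longleftrightarrow> (U has_real_derivative V x) (at x) \<and> (V has_real_derivative rhs N p x (U x) (V x)) (at x)"

lemma sol_at_Us: "0 < x \<Longrightarrow> x < pi \<Longrightarrow> sol_at (Us \<Gamma>) (Vs \<Gamma>) x"
  by (simp add: sol_at_def Us_deriv Vs_deriv)

lemma ef_at_sol: "sol_at U V (th t) \<Longrightarrow> ef_at (EW U) (EY U V) t"
  by (simp add: sol_at_def ef_at_EW_EY)

lemma cot_bound:
  assumes "0 < a" "c < pi"
  obtains B where "0 \<le> B" "\<And>x. a \<le> x \<Longrightarrow> x \<le> c \<Longrightarrow> \<bar>(real N - 1) * (cos x / sin x)\<bar> \<le> B"
proof -
  have "continuous_on {a..c} (\<lambda>x. (real N - 1) * (cos x / sin x))"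
  proof (intro continuous_intros ballI)
    fix x assume "x \<in> {a..c}"
    then have "0 < sin x" using assms by (intro sin_gt_zero) auto
    then show "sin x \<noteq> 0" by simp
  qed
  then have "bounded ((\<lambda>x. (real N - 1) * (cos x / sin x)) ` {a..c})"
    by (intro compact_imp_bounded compact_continuous_image) auto
  then obtain B where "\<forall>x\<in>{a..c}. \<bar>(real N - 1) * (cos x / sin x)\<bar> \<le> B" by (auto simp: bounded_iff)
  then show ?thesis by (intro that[of "max B 0"]) (auto simp: le_max_iff_disj)
qed

text \<open>The rate L depends only on the interval and on the bound M, so it applies to all members
  of a family of solutions at once.\<close>

lemma interior_dep:
  assumes a: "0 < a" and c: "c < pi"
  obtains L where "0 \<le> L"
    "\<And>U V U' V' x. a \<le> x \<Longrightarrow> x \<le> c \<Longrightarrow> (\<And>t. t \<in> {a..x} \<Longrightarrow> sol_at U V t) \<Longrightarrow> (\<And>t. t \<in> {a..x} \<Longrightarrow> sol_at U' V' t) \<Longrightarrow>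
      (\<And>t. t \<in> {a..x} \<Longrightarrow> \<bar>U t\<bar> \<le> M) \<Longrightarrow> (\<And>t. t \<in> {a..x} \<Longrightarrow> \<bar>U' t\<bar> \<le> M) \<Longrightarrow>
      (U x - U' x)^2 + (V x - V' x)^2 \<le> ((U a - U' a)^2 + (V a - V' a)^2) * exp (L * (x - a))"
proof -
  obtain B where B: "0 \<le> B" "\<And>x. a \<le> x \<Longrightarrow> x \<le> c \<Longrightarrow> \<bar>(real N - 1) * (cos x / sin x)\<bar> \<le> B"
    using cot_bound[OF assms] by blast
  define Lf where "Lf = p * M powr (p - 1)"
  have Lf: "0 \<le> Lf" using p_gt_1 by (simp add: Lf_def)
  show ?thesis
  proof (rule that[of "1 + Lf + 2 * B"])
    fix U V U' V' :: "real \<Rightarrow> real" and x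
    assume x: "a \<le> x" "x \<le> c" and s: "\<And>t. t \<in> {a..x} \<Longrightarrow> sol_at U V t" "\<And>t. t \<in> {a..x} \<Longrightarrow> sol_at U' V' t"
      and M: "\<And>t. t \<in> {a..x} \<Longrightarrow> \<bar>U t\<bar> \<le> M" "\<And>t. t \<in> {a..x} \<Longrightarrow> \<bar>U' t\<bar> \<le> M"
    let ?y = "\<lambda>t. (U t - U' t)^2 + (V t - V' t)^2"
    let ?y' = "\<lambda>t. 2 * (U t - U' t) * (V t - V' t) + 2 * (V t - V' t) * (rhs N p t (U t) (V t) - rhs N p t (U' t) (V' t))"
    have d: "(?y has_real_derivative ?y' t) (at t)" if "t \<in> {a..x}" for t
      using s[OF that] by (auto simp: sol_at_def algebra_simps intro!: derivative_eq_intros)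
    show "?y x \<le> ?y a * exp ((1 + Lf + 2 * B) * (x - a))"
    proof (rule gronwall_deriv[OF x(1), where y' = ?y'])
      show "continuous_on {a..x} ?y"
        by (rule DERIV_continuous_on[where D = ?y']) (use d in \<open>blast intro: has_field_derivative_at_within\<close>)
      fix t assume "a < t" "t < x"
      then have t: "t \<in> {a..x}" by simp
      show "(?y has_real_derivative ?y' t) (at t)" by (rule d[OF t])
      define z v k where "z = U t - U' t" and "v = V t - V' t" and "k = (real N - 1) * (cos t / sin t)"
      have n1: "\<bar>nl p (U t) - nl p (U' t)\<bar> \<le> Lf * \<bar>z\<bar>"
        unfolding Lf_def z_def using M[OF t] by (intro nl_lip p_gt_1)
      have k1: "\<bar>k\<bar> \<le> B" unfolding k_def using B(2)[of t] t x by auto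
      have rr: "rhs N p t (U t) (V t) - rhs N p t (U' t) (V' t) = - k * v - (nl p (U t) - nl p (U' t))"
      proof -
        have r: "rhs N p t u w = - k * w - nl p u" for u w by (simp only: rhs_def k_def mult_minus_left)
        show ?thesis unfolding r by (simp add: v_def algebra_simps)
      qed
      have *: "?y' t = 2 * (z * v) + 2 * (- k * v^2) - 2 * (v * (nl p (U t) - nl p (U' t)))"
        unfolding rr z_def[symmetric] v_def[symmetric] by (simp add: power2_eq_square algebra_simps)
      have kb: "\<bar>k\<bar> * v^2 \<le> B * v^2" by (rule mult_right_mono[OF k1]) simp
      have "\<bar>v\<bar> * \<bar>nl p (U t) - nl p (U' t)\<bar> \<le> \<bar>v\<bar> * (Lf * \<bar>z\<bar>)" by (rule mult_left_mono[OF n1]) simp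
      moreover have "- (v * (nl p (U t) - nl p (U' t))) \<le> \<bar>v\<bar> * \<bar>nl p (U t) - nl p (U' t)\<bar>"
        by (metis abs_ge_minus_self abs_mult)
      moreover have "\<bar>v\<bar> * (Lf * \<bar>z\<bar>) = Lf * (\<bar>v\<bar> * \<bar>z\<bar>)" by simp
      ultimately have nb: "- (v * (nl p (U t) - nl p (U' t))) \<le> Lf * (\<bar>v\<bar> * \<bar>z\<bar>)" by linarith
      have "0 \<le> (\<bar>v\<bar> - \<bar>z\<bar>)^2" by simp
      then have vz: "2 * (\<bar>v\<bar> * \<bar>z\<bar>) \<le> z^2 + v^2" by (simp add: power2_diff)
      have "z * v \<le> \<bar>v\<bar> * \<bar>z\<bar>" by (metis abs_ge_self abs_mult mult.commute)
      moreover have "- k * v^2 \<le> B * v^2"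
        using kb mult_right_mono[OF abs_ge_minus_self[of k] zero_le_power2[of v]] by linarith
      moreover have "2 * (Lf * (\<bar>v\<bar> * \<bar>z\<bar>)) \<le> Lf * (z^2 + v^2)"
        using mult_left_mono[OF vz Lf] by simp
      ultimately have "?y' t \<le> (z^2 + v^2) + 2 * (B * v^2) + Lf * (z^2 + v^2)"
        using * nb vz by linarith
      also have "\<dots> \<le> (1 + Lf + 2 * B) * (z^2 + v^2)"
        using B(1) by (simp add: algebra_simps)
      finally show "?y' t \<le> (1 + Lf + 2 * B) * ?y t" by (simp add: z_def v_def)
    qed
  qed (use B Lf in auto)
qed

lemma interior_unique:
  assumes a: "0 < a" and ac: "a \<le> c" and c: "c < pi"
    and s: "\<And>t. t \<in> {a..c} \<Longrightarrow> sol_at U V t" "\<And>t. t \<in> {a..c} \<Longrightarrow> sol_at U' V' t"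
    and eq: "U a = U' a" "V a = V' a"
  shows "U c = U' c" "V c = V' c"
proof -
  have "continuous_on {a..c} U" "continuous_on {a..c} U'"
    by (rule DERIV_continuous_on, use s in \<open>auto simp: sol_at_def intro: has_field_derivative_at_within\<close>)+
  then have "bounded (U ` {a..c})" "bounded (U' ` {a..c})"
    by (auto intro: compact_imp_bounded compact_continuous_image)
  then obtain B B' where B: "\<forall>t\<in>{a..c}. \<bar>U t\<bar> \<le> B" "\<forall>t\<in>{a..c}. \<bar>U' t\<bar> \<le> B'" by (auto simp: bounded_iff)
  obtain L where "(U c - U' c)^2 + (V c - V' c)^2 \<le> ((U a - U' a)^2 + (V a - V' a)^2) * exp (L * (c - a))"
  proof (rule interior_dep[OF a c, of "max B B'"])
    fix L assume *: "\<And>U V U' V' x. a \<le> x \<Longrightarrow> x \<le> c \<Longrightarrow> (\<And>t. t \<in> {a..x} \<Longrightarrow> sol_at U V t) \<Longrightarrow> (\<And>t. t \<in> {a..x} \<Longrightarrow> sol_at U' V' t) \<Longrightarrow>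
      (\<And>t. t \<in> {a..x} \<Longrightarrow> \<bar>U t\<bar> \<le> max B B') \<Longrightarrow> (\<And>t. t \<in> {a..x} \<Longrightarrow> \<bar>U' t\<bar> \<le> max B B') \<Longrightarrow>
      (U x - U' x)^2 + (V x - V' x)^2 \<le> ((U a - U' a)^2 + (V a - V' a)^2) * exp (L * (x - a))"
    show thesis
      by (rule that[of L], rule *[OF ac order_refl]) (use s B in \<open>auto simp: le_max_iff_disj\<close>)
  qed
  then have "(U c - U' c)^2 + (V c - V' c)^2 \<le> 0" using eq by simp
  then show "U c = U' c" "V c = V' c"
    by (smt (verit) zero_le_power2 power2_less_0 zero_eq_power2 right_minus_eq)+
qed

end

section \<open>The limit equation\<close>

lemma volt_sol_glue_unbounded:
  assumes ex: "\<And>b. a < b \<Longrightarrow> \<exists>u. volt_sol q a b F g u"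
    and un: "\<And>b u w x. a < b \<Longrightarrow> volt_sol q a b F g u \<Longrightarrow> volt_sol q a b F g w \<Longrightarrow>
      x \<in> {a..b} \<Longrightarrow> u x = w x"
  shows "\<exists>u. \<forall>b>a. volt_sol q a b F g u"
proof -
  obtain U where U: "\<And>b. a < b \<Longrightarrow> volt_sol q a b F g (U b)" using ex by metis
  define u where "u x = U (x + 1) x" for x
  have "volt_sol q a b F g u" if b: "a < b" for b
  proof (rule volt_sol_cong[OF U[OF b]])
    fix x assume x: "x \<in> {a..b}"
    have c: "a < x + 1" "x \<le> x + 1" using x b by auto
    have m: "a < min b (x + 1)" using b c by auto
    show "U b x = u x" unfolding u_def
      by (rule un[OF m volt_sol_subset[OF U[OF b] min.cobounded1] volt_sol_subset[OF U[OF c(1)] min.cobounded2]])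
        (use x c in auto)
  qed
  then show ?thesis by blast
qed

lemma power_weight:
  assumes n: "0 < n" and b: "0 < (b::real)"
  shows "weight (\<lambda>x. x ^ n) (\<lambda>x. real n * x ^ (n - 1)) 0 b 0"
  by standard (use assms in \<open>auto intro!: continuous_intros derivative_eq_intros simp: zero_power\<close>)

context sphere_problem
begin

abbreviation q0 :: "real \<Rightarrow> real" where "q0 \<equiv> \<lambda>x. x ^ n"
abbreviation q0' :: "real \<Rightarrow> real" where "q0' \<equiv> \<lambda>x. real n * x ^ (n - 1)"

text \<open>The entire solution of the Lane-Emden equation \<open>y'' + n / r y' + nl p y = 0\<close> with \<open>y 0 = 1\<close>.\<close>
definition y0 :: "real \<Rightarrow> real" where
  "y0 = (SOME u. \<forall>b>0. volt_sol q0 0 b (\<lambda>_. nl p) (\<lambda>_. 1) u)"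

definition v0 :: "real \<Rightarrow> real" where
  "v0 x = - wavg q0 0 (\<lambda>r. nl p (y0 r)) x"

lemma weight_q0: "0 < b \<Longrightarrow> weight q0 q0' 0 b 0"
  by (rule power_weight[OF n_ge(2)])

lemma y0_volt: "0 < b \<Longrightarrow> volt_sol q0 0 b (\<lambda>_. nl p) (\<lambda>_. 1) y0"
proof -
  have "\<exists>u. \<forall>b>0. volt_sol q0 0 b (\<lambda>_. nl p) (\<lambda>_. 1) u"
    using weight.nl_volt_exists[OF weight_q0 p_gt_1] weight.nl_volt_unique[OF weight_q0 p_gt_1]
    by (intro volt_sol_glue_unbounded) blast+
  from someI_ex[OF this] show "0 < b \<Longrightarrow> ?thesis" unfolding y0_def by blast
qed

lemma y0_cont: "continuous_on {0..b} y0"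
  using y0_volt[of b] by (cases "0 < b"; cases "b = 0") (auto simp: volt_sol_def)

lemma nl_y0_cont: "continuous_on {0..b} (\<lambda>r. nl p (y0 r))"
  by (intro nl_comp_cont p_gt_1 y0_cont)

lemma y0_0 [simp]: "y0 0 = 1"
  using y0_volt[of 1] by (auto simp: volt_sol_def)

lemma v0_0 [simp]: "v0 0 = 0" by (simp add: v0_def wavg_def)

lemma v0_cont: "continuous_on {0..b} v0"
proof (cases "0 < b")
  case True
  interpret weight q0 q0' 0 b 0 using weight_q0[OF True] .
  show ?thesis unfolding v0_def by (intro continuous_intros wavg_cont nl_y0_cont)
next
  case False
  then show ?thesis by (cases "b = 0") auto
qed

lemma y0_deriv:
  assumes x: "0 < x"
  shows "(y0 has_real_derivative v0 x) (at x)"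
    "(v0 has_real_derivative - (real n / x) * v0 x - nl p (y0 x)) (at x)"
proof -
  have b: "0 < x + 1" "x < x + 1" using x by auto
  interpret weight q0 q0' 0 "x + 1" 0 using weight_q0[OF b(1)] .
  show "(y0 has_real_derivative v0 x) (at x)"
    using volt_sol_deriv_at[OF y0_volt[OF b(1)] nl_y0_cont x b(2)] by (simp add: v0_def)
  have [abs_def]: "- wavg q0 0 (\<lambda>r. nl p (y0 r)) x = v0 x" for x by (simp add: v0_def)
  note D = volt_sol_deriv(3)[OF y0_volt[OF b(1)] nl_y0_cont x b(2), unfolded this]
  have "x ^ n = x ^ (n - 1) * x" using n_ge by (cases n) auto
  then have "- q0' x / q0 x = - (real n / x)" using x by simp
  then show "(v0 has_real_derivative - (real n / x) * v0 x - nl p (y0 x)) (at x)" using D by simp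
qed

text \<open>The weight r^n is increasing, so the energy does not grow and the constant
  \<open>CM\<close> is 1.\<close>

lemma y0_bound: "0 \<le> x \<Longrightarrow> \<bar>y0 x\<bar> \<le> 1"
proof -
  assume x: "0 \<le> x"
  interpret weight q0 q0' 0 "x + 1" 0 using weight_q0 x by simp
  have "CM = 1" by (simp add: CM_def)
  then show ?thesis using nl_volt_bound[OF p_gt_1 y0_volt, of x] x by simp
qed

section \<open>The Lane-Emden orbit in Emden-Fowler variables\<close>

definition W0 :: "real \<Rightarrow> real" where "W0 t = exp (\<mu> * t) * y0 (exp t)"
definition X0 :: "real \<Rightarrow> real" where "X0 t = \<mu> * W0 t + exp (\<mu> * t) * exp t * v0 (exp t)"

lemma W0_deriv: "(W0 has_real_derivative X0 t) (at t)"
  and X0_deriv: "(X0 has_real_derivative - \<alpha> * X0 t + \<kappa> * W0 t - nl p (W0 t)) (at t)"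
proof -
  define S s where "S = exp (\<mu> * t)" and "s = exp t"
  have s: "0 < s" "0 < S" by (auto simp: s_def S_def)
  have dy: "((\<lambda>t. y0 (exp t)) has_real_derivative v0 s * s) (at t)"
    unfolding s_def by (intro DERIV_chain2[OF y0_deriv(1)]) auto
  have dv: "((\<lambda>t. v0 (exp t)) has_real_derivative (- (real n / s) * v0 s - nl p (y0 s)) * s) (at t)"
    unfolding s_def by (intro DERIV_chain2[OF y0_deriv(2)]) auto
  have dS: "((\<lambda>t. exp (\<mu> * t)) has_real_derivative \<mu> * S) (at t)"
    unfolding S_def by (auto intro!: derivative_eq_intros)
  have ds: "((\<lambda>t. exp t) has_real_derivative s) (at t)" unfolding s_def by (auto intro!: derivative_eq_intros)
  have Wt: "W0 t = S * y0 s" and Xt: "X0 t = \<mu> * W0 t + S * s * v0 s"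
    by (simp_all add: W0_def X0_def S_def s_def)
  show dW: "(W0 has_real_derivative X0 t) (at t)"
    unfolding W0_def[abs_def]
    by (rule DERIV_cong[OF DERIV_mult[OF dS dy]]) (simp add: Xt Wt S_def s_def algebra_simps)
  have "S powr (p - 1) = s ^ 2"
    using mu_facts(2) by (simp add: S_def s_def powr_def exp_double[symmetric] mult.commute mult.left_commute)
  then have "S powr p = S * s ^ 2" using s powr_add[of S "p - 1" 1] by simp
  then have fW: "nl p (W0 t) = S * s ^ 2 * nl p (y0 s)" unfolding Wt using s by (simp add: nl_scale)
  have "(X0 has_real_derivative \<mu> * X0 t + ((\<mu> * S * s + s * S) * v0 s
      + (- (real n / s) * v0 s - nl p (y0 s)) * s * (S * s))) (at t)"
    unfolding X0_def[abs_def]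
    by (rule DERIV_cong[OF DERIV_add[OF DERIV_cmult[OF dW, of \<mu>] DERIV_mult[OF DERIV_mult[OF dS ds] dv]]])
      (fold S_def s_def, simp add: Xt algebra_simps)
  also have "\<mu> * X0 t + ((\<mu> * S * s + s * S) * v0 s + (- (real n / s) * v0 s - nl p (y0 s)) * s * (S * s))
    = \<mu> * X0 t + (\<mu> + 1 - real n) * (S * s * v0 s) - nl p (W0 t)"
    unfolding fW using s by (simp add: field_simps power2_eq_square)
  also have "S * s * v0 s = X0 t - \<mu> * W0 t" by (simp add: Xt)
  also have "\<mu> * X0 t + (\<mu> + 1 - real n) * (X0 t - \<mu> * W0 t) - nl p (W0 t) = - \<alpha> * X0 t + \<kappa> * W0 t - nl p (W0 t)"
    unfolding n_ge(3) by (simp add: \<alpha>_def \<kappa>_def algebra_simps)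
  finally show "(X0 has_real_derivative - \<alpha> * X0 t + \<kappa> * W0 t - nl p (W0 t)) (at t)" .
qed

definition E0 :: "real \<Rightarrow> real" where
  "E0 t = X0 t ^ 2 / 2 + nlpot p (W0 t) - \<kappa> * W0 t ^ 2 / 2"

lemma E0_deriv: "(E0 has_real_derivative - \<alpha> * X0 t ^ 2) (at t)"
proof -
  have "((\<lambda>t. nlpot p (W0 t)) has_real_derivative nl p (W0 t) * X0 t) (at t)"
    by (rule DERIV_chain2[OF nlpot_deriv[OF p_gt_1] W0_deriv])
  then show ?thesis unfolding E0_def[abs_def]
    by (auto intro!: derivative_eq_intros W0_deriv X0_deriv simp: field_simps power2_eq_square)
qed

lemma E0_decreasing: "s \<le> t \<Longrightarrow> E0 t \<le> E0 s"
  by (rule DERIV_nonpos_imp_nonincreasing[of s t E0]) (use E0_deriv mu_facts in \<open>auto intro!: exI[of _ "- \<alpha> * X0 _ ^ 2"] mult_nonneg_nonneg\<close>)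

text \<open>As t tends to minus infinity, E0 behaves like exp (2 \<mu> t) (\<mu>^2 - \<kappa>)/2,
  and \<kappa> - \<mu>^2 = \<mu> \<alpha> is positive; afterwards E0 does not increase.\<close>

lemma E0_neg: "E0 t < 0"
proof -
  have y: "((\<lambda>t. y0 (exp t)) \<longlongrightarrow> 1) at_bot" and v: "((\<lambda>t. v0 (exp t)) \<longlongrightarrow> 0) at_bot"
  proof -
    have ex: "filterlim exp (at 0 within {0..1}) (at_bot :: real filter)"
      unfolding filterlim_at using exp_at_bot by (auto simp: eventually_at_bot_linorder intro!: exI[of _ 0])
    have "(y0 \<longlongrightarrow> y0 0) (at 0 within {0..1})" "(v0 \<longlongrightarrow> v0 0) (at 0 within {0..1})"
      by (rule bspec[OF y0_cont[of 1, unfolded continuous_on_def]], simp)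
        (rule bspec[OF v0_cont[of 1, unfolded continuous_on_def]], simp)
    from this[THEN filterlim_compose, OF ex] show "((\<lambda>t. y0 (exp t)) \<longlongrightarrow> 1) at_bot" "((\<lambda>t. v0 (exp t)) \<longlongrightarrow> 0) at_bot"
      by simp_all
  qed
  \<comment> \<open>E0 without its factor exp (\<mu> t)^2: this has a negative limit, while E0
    itself tends to 0.\<close>
  let ?r = "\<lambda>t. (\<mu> * y0 (exp t) + exp t * v0 (exp t))^2 / 2 + exp t ^ 2 * nlpot p (y0 (exp t)) - \<kappa> * y0 (exp t) ^ 2 / 2"
  have "isCont (nlpot p) 1" using nlpot_deriv[OF p_gt_1] DERIV_isCont by blast
  then have "((\<lambda>t. nlpot p (y0 (exp t))) \<longlongrightarrow> nlpot p 1) at_bot" by (rule isCont_tendsto_compose[OF _ y])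
  then have "(?r \<longlongrightarrow> (\<mu> * 1 + 0 * 0)^2 / 2 + 0 ^ 2 * nlpot p 1 - \<kappa> * 1 ^ 2 / 2) at_bot"
    by (intro tendsto_intros y v exp_at_bot) auto
  moreover have "\<kappa> - \<mu>^2 = \<mu> * \<alpha>" by (simp add: \<kappa>_def \<alpha>_def power2_eq_square algebra_simps)
  then have "\<mu>^2 < \<kappa>" using mu_facts by (smt (verit) mult_pos_pos)
  ultimately have "\<forall>\<^sub>F s in at_bot. ?r s < 0" by (intro order_tendstoD(2)) auto
  then have "\<forall>\<^sub>F s in at_bot. s \<le> t \<and> ?r s < 0" by (intro eventually_conj eventually_le_at_bot)
  then obtain s where s: "s \<le> t" "?r s < 0" by (auto dest: eventually_happens)
  have "E0 s = exp (\<mu> * s)^2 * ?r s"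
  proof -
    have e: "exp (\<mu> * s) powr (p + 1) = exp (\<mu> * s)^2 * exp s ^ 2"
    proof -
      have "exp (\<mu> * s) powr (p + 1) = exp ((p + 1) * (\<mu> * s))" by (simp add: powr_def)
      also have "(p + 1) * (\<mu> * s) = 2 * (\<mu> * s) + 2 * s"
        using mu_facts(2) by (simp add: algebra_simps)
      finally show ?thesis by (simp add: exp_add exp_double)
    qed
    have "nlpot p (W0 s) = exp (\<mu> * s)^2 * exp s ^ 2 * nlpot p (y0 (exp s))"
      by (simp add: nlpot_def W0_def abs_mult powr_mult e)
    then show ?thesis by (simp add: E0_def X0_def W0_def power2_eq_square field_simps)
  qed
  then have "E0 s < 0" using s(2) by (simp add: mult_less_0_iff)
  then show ?thesis using E0_decreasing[OF s(1)] by simp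
qed

text \<open>At a zero of y0 the energy would be X0^2/2 \<ge> 0, against its negative sign.\<close>

lemma y0_pos: assumes "0 \<le> x" shows "0 < y0 x"
proof (rule ccontr)
  assume "\<not> 0 < y0 x"
  then obtain z where z: "0 \<le> z" "z \<le> x" "y0 z = 0"
    using IVT2'[of y0 x 0 0] assms y0_cont[of x] by auto
  then have "0 < z" by (cases "z = 0") auto
  then have "W0 (ln z) = 0" using z by (simp add: W0_def)
  then have "0 \<le> E0 (ln z)" by (simp add: E0_def)
  then show False using E0_neg[of "ln z"] by simp
qed

lemma W0_pos: "0 < W0 t" by (simp add: W0_def y0_pos)

text \<open>From E0 \<le> E0 0 < 0 for t \<ge> 0: the term \<kappa> W0^2/2 must outweigh the
  positive amount - E0 0, which bounds W0 from below, and also the potential of order W0^(p + 1),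
  which bounds W0 from above.\<close>

lemma W0_bounds:
  obtains w1 w2 where "0 < w1" "\<And>t. 0 \<le> t \<Longrightarrow> w1 \<le> W0 t" "\<And>t. 0 \<le> t \<Longrightarrow> W0 t \<le> w2"
    "\<And>t. 0 \<le> t \<Longrightarrow> X0 t ^ 2 \<le> \<kappa> * w2 ^ 2"
proof -
  define e where "e = - E0 0"
  have e: "0 < e" using E0_neg[of 0] by (simp add: e_def)
  have \<kappa>: "0 < \<kappa>" using mu_facts by simp
  define w2 where "w2 = (\<kappa> * (p + 1) / 2) powr (1 / (p - 1))"
  have le: "X0 t ^ 2 / 2 + nlpot p (W0 t) + e \<le> \<kappa> * W0 t ^ 2 / 2" if "0 \<le> t" for t
    using E0_decreasing[OF that] by (simp add: E0_def e_def)
  have w: "sqrt (2 * e / \<kappa>) \<le> W0 t" "W0 t \<le> w2" "X0 t ^ 2 \<le> \<kappa> * w2 ^ 2" if t: "0 \<le> t" for t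
  proof -
    have W: "0 < W0 t" by (rule W0_pos)
    have n0: "0 \<le> nlpot p (W0 t)" by (rule nlpot_nonneg[OF p_gt_1])
    have "2 * e \<le> \<kappa> * W0 t ^ 2" using le[OF t] n0 zero_le_power2[of "X0 t"] by linarith
    then have "2 * e / \<kappa> \<le> W0 t ^ 2" using \<kappa> by (simp add: pos_divide_le_eq mult.commute)
    then show "sqrt (2 * e / \<kappa>) \<le> W0 t" using W by (intro real_le_lsqrt) auto
    have "W0 t powr (p + 1) = W0 t powr (p - 1) * W0 t powr 2"
      using powr_add[of "W0 t" "p - 1" 2] by (simp add: algebra_simps)
    then have "nlpot p (W0 t) = W0 t powr (p - 1) * W0 t ^ 2 / (p + 1)" using W by (simp add: nlpot_def)
    moreover have "nlpot p (W0 t) \<le> \<kappa> * W0 t ^ 2 / 2" using le[OF t] e zero_le_power2[of "X0 t"] by linarith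
    ultimately have "W0 t powr (p - 1) * W0 t ^ 2 / (p + 1) \<le> \<kappa> / 2 * W0 t ^ 2" by simp
    then have "W0 t powr (p - 1) * W0 t ^ 2 \<le> \<kappa> * (p + 1) / 2 * W0 t ^ 2"
      using p_gt_1 by (simp add: field_simps)
    then have "W0 t powr (p - 1) \<le> \<kappa> * (p + 1) / 2" using W by simp
    then have "(W0 t powr (p - 1)) powr (1 / (p - 1)) \<le> w2"
      unfolding w2_def using p_gt_1 by (intro powr_mono2) auto
    then show W2: "W0 t \<le> w2" using p_gt_1 W by (simp add: powr_powr)
    have "X0 t ^ 2 \<le> \<kappa> * W0 t ^ 2" using le[OF t] n0 e by linarith
    also have "\<dots> \<le> \<kappa> * w2 ^ 2" using W W2 \<kappa> by (intro mult_left_mono power_mono) auto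
    finally show "X0 t ^ 2 \<le> \<kappa> * w2 ^ 2" .
  qed
  have "0 < sqrt (2 * e / \<kappa>)" using e \<kappa> by simp
  then show ?thesis using that w by blast
qed

text \<open>The function \<open>E0 + \<delta> X0 g\<close> with \<open>g = nl p W0 - \<kappa> W0\<close> is a strict Lyapunov function, so the orbit cannot
  stay away from the only equilibrium it may approach.\<close>
lemma W0_near_A:
  assumes \<zeta>: "0 < \<zeta>"
  obtains t where "0 \<le> t" "(W0 t - A)^2 + X0 t^2 < \<zeta>"
proof -
  obtain w1 w2 where w: "0 < w1" "\<And>t. 0 \<le> t \<Longrightarrow> w1 \<le> W0 t" "\<And>t. 0 \<le> t \<Longrightarrow> W0 t \<le> w2"
    "\<And>t. 0 \<le> t \<Longrightarrow> X0 t ^ 2 \<le> \<kappa> * w2 ^ 2" using W0_bounds by blast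
  define g where "g u = nl p u - \<kappa> * u" for u
  define \<sigma> where "\<sigma> = sqrt (\<zeta> / 2)"
  have \<sigma>: "0 < \<sigma>" "\<sigma>^2 = \<zeta> / 2" using \<zeta> by (auto simp: \<sigma>_def)
  have gc: "continuous_on S g" for S unfolding g_def by (intro continuous_intros nl_cont p_gt_1)
  \<comment> \<open>A is the only positive zero of g, so |g| has a positive minimum on the compact
    set of values at distance at least \<sigma> from A; the case of an empty set is
    separate.\<close>
  obtain k where k: "0 < k" "\<And>u. w1 \<le> u \<Longrightarrow> u \<le> w2 \<Longrightarrow> \<sigma> \<le> \<bar>u - A\<bar> \<Longrightarrow> k \<le> \<bar>g u\<bar>"
  proof (cases "{w1..w2} \<inter> {u. \<sigma> \<le> \<bar>u - A\<bar>} = {}")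
    case True
    then show ?thesis by (intro that[of 1]) auto
  next
    case False
    have "closed {u. \<sigma> \<le> \<bar>u - A\<bar>}" by (intro closed_Collect_le continuous_intros)
    then have "compact ({w1..w2} \<inter> {u. \<sigma> \<le> \<bar>u - A\<bar>})" by (intro compact_Int_closed) auto
    moreover have "continuous_on ({w1..w2} \<inter> {u. \<sigma> \<le> \<bar>u - A\<bar>}) (\<lambda>u. \<bar>g u\<bar>)"
      by (intro continuous_on_rabs gc)
    ultimately obtain z where z: "z \<in> {w1..w2} \<inter> {u. \<sigma> \<le> \<bar>u - A\<bar>}" "\<And>u. u \<in> {w1..w2} \<inter> {u. \<sigma> \<le> \<bar>u - A\<bar>} \<Longrightarrow> \<bar>g z\<bar> \<le> \<bar>g u\<bar>"
      using continuous_attains_inf[OF _ False] by blast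
    have z0: "0 < z" using z(1) w(1) by auto
    have "g z \<noteq> 0"
    proof
      assume "g z = 0"
      then have "z powr (p - 1) = A powr (p - 1)" using z0 A_facts by (simp add: g_def nl_def)
      then have "(z powr (p - 1)) powr (1 / (p - 1)) = (A powr (p - 1)) powr (1 / (p - 1))" by simp
      then have "z = A" using z0 A_facts(1) p_gt_1 by (simp add: powr_powr)
      then show False using z(1) \<sigma> by simp
    qed
    then show ?thesis using z by (intro that[of "\<bar>g z\<bar>"]) auto
  qed
  define G where "G = p * w2 powr (p - 1) + \<kappa>"
  have G: "0 < G" using p_gt_1 mu_facts by (auto simp: G_def intro: add_nonneg_pos)
  have w2: "0 < w2" using w(1) w(2)[of 0] w(3)[of 0] by simp
  \<comment> \<open>The derivative of \<delta> X0 g costs at most \<delta> (G + \<alpha>^2/2) X0^2,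
    which this choice makes half of the dissipation \<alpha> X0^2, and it yields - \<delta>/2
    g^2.\<close>
  define \<delta> where "\<delta> = \<alpha> / (2 * (G + \<alpha>^2 / 2))"
  have G2: "0 < G + \<alpha>^2 / 2" using G by (intro add_pos_nonneg) auto
  have \<delta>: "0 < \<delta>" "\<delta> * (G + \<alpha>^2/2) = \<alpha> / 2" using mu_facts G2 by (auto simp: \<delta>_def field_simps)
  define c where "c = min (\<alpha>/2) (\<delta>/2)"
  have c: "0 < c" "c \<le> \<alpha>/2" "c \<le> \<delta>/2" using \<delta> mu_facts by (auto simp: c_def)
  define L where "L t = E0 t + \<delta> * (X0 t * g (W0 t))" for t
  define L' where "L' t = - \<alpha> * X0 t ^ 2 + \<delta> * (X0 t * ((p * \<bar>W0 t\<bar> powr (p - 1) - \<kappa>) * X0 t) + (- \<alpha> * X0 t - g (W0 t)) * g (W0 t))" for t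
  have Ld: "(L has_real_derivative L' t) (at t)" for t
  proof -
    have "((\<lambda>t. nl p (W0 t)) has_real_derivative p * \<bar>W0 t\<bar> powr (p - 1) * X0 t) (at t)"
      by (rule DERIV_chain2[OF nl_deriv[OF p_gt_1] W0_deriv])
    then have dg: "((\<lambda>t. g (W0 t)) has_real_derivative (p * \<bar>W0 t\<bar> powr (p - 1) - \<kappa>) * X0 t) (at t)"
      unfolding g_def by (auto intro!: derivative_eq_intros W0_deriv simp: algebra_simps)
    have "(X0 has_real_derivative - \<alpha> * X0 t - g (W0 t)) (at t)"
      using X0_deriv[of t] by (simp add: g_def algebra_simps)
    from DERIV_add[OF E0_deriv DERIV_cmult[OF DERIV_mult[OF this dg], of \<delta>]]
    show ?thesis unfolding L_def[abs_def] L'_def by (simp add: algebra_simps)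
  qed
  have L': "L' t \<le> - c * (X0 t ^ 2 + g (W0 t) ^ 2)" if t: "0 \<le> t" for t
  proof -
    define x \<gamma> where "x = X0 t" and "\<gamma> = g (W0 t)"
    have "\<bar>W0 t\<bar> powr (p - 1) \<le> w2 powr (p - 1)"
      using w(3)[OF t] W0_pos[of t] p_gt_1 by (intro powr_mono2) auto
    then have "p * \<bar>W0 t\<bar> powr (p - 1) \<le> p * w2 powr (p - 1)" using p_gt_1 by (intro mult_left_mono) auto
    then have "p * \<bar>W0 t\<bar> powr (p - 1) - \<kappa> \<le> G" using mu_facts by (simp add: G_def)
    then have 1: "(p * \<bar>W0 t\<bar> powr (p - 1) - \<kappa>) * x^2 \<le> G * x^2" by (intro mult_right_mono) auto
    have "0 \<le> (\<alpha> * x + \<gamma>)^2" by simp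
    then have 2: "- (\<alpha> * x * \<gamma>) \<le> \<gamma>^2/2 + \<alpha>^2/2 * x^2"
      by (simp add: power2_sum power_mult_distrib)
    have "L' t = - \<alpha> * x^2 + \<delta> * ((p * \<bar>W0 t\<bar> powr (p - 1) - \<kappa>) * x^2 + (- (\<alpha> * x * \<gamma>)) - \<gamma>^2)"
      by (simp add: L'_def x_def \<gamma>_def power2_eq_square algebra_simps)
    also have "\<dots> \<le> - \<alpha> * x^2 + \<delta> * (G * x^2 + (\<gamma>^2/2 + \<alpha>^2/2 * x^2) - \<gamma>^2)"
      using 1 2 \<delta> by (intro add_left_mono mult_left_mono diff_right_mono add_mono) auto
    also have "\<dots> = - \<alpha> * x^2 + (\<delta> * (G + \<alpha>^2/2)) * x^2 - \<delta>/2 * \<gamma>^2"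
      by (simp add: algebra_simps)
    also have "\<dots> = - (\<alpha>/2 * x^2) - \<delta>/2 * \<gamma>^2" unfolding \<delta>(2) by simp
    also have "\<dots> \<le> - (c * x^2) - c * \<gamma>^2"
      using c by (intro diff_mono le_imp_neg_le mult_right_mono) auto
    finally show ?thesis by (simp add: x_def \<gamma>_def algebra_simps)
  qed
  have X0b: "\<bar>X0 t\<bar> \<le> sqrt (\<kappa> * w2^2)" if "0 \<le> t" for t
    using real_sqrt_le_mono[OF w(4)[OF that]] by simp
  have "bounded (g ` {w1..w2})" by (intro compact_imp_bounded compact_continuous_image gc) auto
  then obtain B where B: "\<forall>u\<in>{w1..w2}. \<bar>g u\<bar> \<le> B" by (auto simp: bounded_iff)
  define Lm where "Lm = - \<kappa> * w2^2 / 2 - \<delta> * (sqrt (\<kappa> * w2^2) * B)"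
  have Llo: "Lm \<le> L t" if t: "0 \<le> t" for t
  proof -
    have "\<kappa> * W0 t^2 \<le> \<kappa> * w2^2" using w(3)[OF t] W0_pos[of t] mu_facts by (intro mult_left_mono power_mono) auto
    then have "- \<kappa> * w2^2 / 2 \<le> E0 t"
      using nlpot_nonneg[OF p_gt_1, of "W0 t"] zero_le_power2[of "X0 t"] unfolding E0_def by linarith
    moreover have "\<bar>X0 t * g (W0 t)\<bar> \<le> sqrt (\<kappa> * w2^2) * B"
      unfolding abs_mult using X0b[OF t] B w(2,3)[OF t] mu_facts by (intro mult_mono) auto
    then have "\<delta> * - (X0 t * g (W0 t)) \<le> \<delta> * (sqrt (\<kappa> * w2^2) * B)" using \<delta> by (intro mult_left_mono) auto
    ultimately show ?thesis unfolding L_def Lm_def by simp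
  qed
  define \<eta> where "\<eta> = min (\<zeta>/2) (k^2)"
  have \<eta>: "0 < \<eta>" using \<zeta> k by (simp add: \<eta>_def)
  have "\<exists>t\<ge>0. X0 t^2 + g (W0 t)^2 < \<eta>"
  proof (rule ccontr)
    assume "\<not> ?thesis"
    then have ge: "\<eta> \<le> X0 t^2 + g (W0 t)^2" if "0 \<le> t" for t using that by force
    \<comment> \<open>If X0^2 + g^2 stayed above \<eta>, then L would be at most Lm - 1 at this
      time, although Lm is a lower bound for L.\<close>
    define T where "T = (L 0 - Lm + 1) / (c * \<eta>)"
    have T: "0 \<le> T" using Llo[of 0] c \<eta> by (simp add: T_def)
    have "L T \<le> L 0 + - (c * \<eta>) * (T - 0)"
    proof (rule DERIV_le_imp_linear_bound[OF T _ Ld])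
      show "continuous_on {0..T} L"
        by (rule DERIV_continuous_on[where D = L']) (use Ld in \<open>blast intro: has_field_derivative_at_within\<close>)
      fix t assume "0 < t" "t < T"
      then have "L' t \<le> - c * (X0 t^2 + g (W0 t)^2)" "\<eta> \<le> X0 t^2 + g (W0 t)^2" using L' ge by auto
      moreover from this(2) have "c * \<eta> \<le> c * (X0 t^2 + g (W0 t)^2)" using c by (intro mult_left_mono) auto
      ultimately show "L' t \<le> - (c * \<eta>)" by simp
    qed
    also have "\<dots> = Lm - 1" using c \<eta> by (simp add: T_def)
    finally show False using Llo[OF T] by simp
  qed
  then obtain t where t: "0 \<le> t" "X0 t^2 + g (W0 t)^2 < \<eta>" by blast
  have "X0 t^2 < \<zeta>/2" "g (W0 t)^2 < k^2"
    using t(2) zero_le_power2[of "X0 t"] zero_le_power2[of "g (W0 t)"] unfolding \<eta>_def by linarith+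
  then have "\<bar>g (W0 t)\<bar> < k" using k(1) by (intro power2_less_imp_less[of "\<bar>g (W0 t)\<bar>"]) auto
  then have "\<bar>W0 t - A\<bar> < \<sigma>" using k(2)[of "W0 t"] w(2,3)[OF t(1)] by force
  then have "\<bar>W0 t - A\<bar>^2 < \<sigma>^2" by (intro power_strict_mono) auto
  then have "(W0 t - A)^2 < \<zeta>/2" using \<sigma> by simp
  then show ?thesis using that[OF t(1)] \<open>X0 t^2 < \<zeta>/2\<close> by linarith
qed

text \<open>Backward uniqueness: an equilibrium at one time persists at all earlier times, but W0
  \<le> exp (\<mu> t) tends to 0 there. This will provide a nonzero amplitude for the
  oscillation.\<close>

lemma W0_not_equilibrium: "W0 t \<noteq> A \<or> X0 t \<noteq> 0"
proof (rule ccontr)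
  assume "\<not> ?thesis"
  then have eq: "W0 t = A" "X0 t = 0" by auto
  have W: "\<bar>W0 s\<bar> \<le> exp (\<mu> * s)" for s using y0_bound[of "exp s"] by (simp add: W0_def abs_mult)
  define M where "M = max (exp (\<mu> * t)) A"
  define Lg where "Lg = p * M powr (p - 1) + \<kappa>"
  have Lg: "0 \<le> Lg" using p_gt_1 mu_facts by (simp add: Lg_def)
  define D where "D s = (W0 s - A)^2 + X0 s^2" for s
  have D0: "D s \<le> 0" if s: "s \<le> t" for s
  proof -
    let ?D' = "\<lambda>r. 2 * (W0 r - A) * X0 r + 2 * X0 r * (- \<alpha> * X0 r + \<kappa> * W0 r - nl p (W0 r))"
    have d: "(D has_real_derivative ?D' r) (at r)" for r
      unfolding D_def[abs_def] by (auto intro!: derivative_eq_intros W0_deriv X0_deriv simp: algebra_simps)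
    have "D s \<le> D t * exp ((1 + Lg + 2 * \<alpha>) * (t - s))"
    proof (rule gronwall_deriv_backward[OF s _ d])
      show "continuous_on {s..t} D"
        by (rule DERIV_continuous_on[where D = ?D']) (use d in \<open>blast intro: has_field_derivative_at_within\<close>)
      fix r assume r: "s < r" "r < t"
      define z x where "z = W0 r - A" and "x = X0 r"
      have "exp (\<mu> * r) \<le> exp (\<mu> * t)" using r mu_facts by simp
      then have "\<bar>W0 r\<bar> \<le> exp (\<mu> * t)" using W[of r] by linarith
      then have "\<bar>W0 r\<bar> \<le> M" "\<bar>A\<bar> \<le> M" using A_facts(1) by (simp_all add: M_def le_max_iff_disj)
      then have "\<bar>nl p (W0 r) - nl p A\<bar> \<le> p * M powr (p - 1) * \<bar>z\<bar>" unfolding z_def by (rule nl_lip[OF p_gt_1])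
      moreover have "\<kappa> * W0 r - nl p (W0 r) = \<kappa> * z - (nl p (W0 r) - nl p A)"
        using A_facts(3) by (simp add: z_def algebra_simps)
      moreover have "\<bar>\<kappa> * z\<bar> = \<kappa> * \<bar>z\<bar>" using mu_facts by (simp add: abs_mult)
      ultimately have g: "\<bar>\<kappa> * W0 r - nl p (W0 r)\<bar> \<le> Lg * \<bar>z\<bar>"
        unfolding Lg_def distrib_right by linarith
      have "0 \<le> (\<bar>x\<bar> - \<bar>z\<bar>)^2" by simp
      then have xz: "2 * (\<bar>x\<bar> * \<bar>z\<bar>) \<le> z^2 + x^2" by (simp add: power2_diff)
      have "- (z * x) \<le> \<bar>x\<bar> * \<bar>z\<bar>" by (metis abs_ge_minus_self abs_mult mult.commute)
      moreover have "- (x * (\<kappa> * W0 r - nl p (W0 r))) \<le> \<bar>x\<bar> * \<bar>\<kappa> * W0 r - nl p (W0 r)\<bar>"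
        by (metis abs_ge_minus_self abs_mult)
      moreover have "\<bar>x\<bar> * \<bar>\<kappa> * W0 r - nl p (W0 r)\<bar> \<le> Lg * (\<bar>x\<bar> * \<bar>z\<bar>)"
        using mult_left_mono[OF g, of "\<bar>x\<bar>"] by (simp add: mult.left_commute)
      moreover have "2 * (Lg * (\<bar>x\<bar> * \<bar>z\<bar>)) \<le> Lg * (z^2 + x^2)" using mult_left_mono[OF xz Lg] by simp
      moreover have "?D' r = 2 * (z * x) + 2 * (x * (\<kappa> * W0 r - nl p (W0 r))) - 2 * (\<alpha> * x^2)"
        by (simp add: z_def x_def power2_eq_square algebra_simps)
      moreover have "0 \<le> \<alpha> * z^2" using mu_facts by simp
      moreover have "(1 + Lg + 2 * \<alpha>) * (z^2 + x^2) = (z^2 + x^2) + Lg * (z^2 + x^2) + 2 * (\<alpha> * z^2) + 2 * (\<alpha> * x^2)"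
        by (simp add: algebra_simps)
      ultimately have "- ((1 + Lg + 2 * \<alpha>) * (z^2 + x^2)) \<le> ?D' r" using xz by linarith
      then show "- (1 + Lg + 2 * \<alpha>) * D r \<le> ?D' r" by (simp only: D_def z_def x_def mult_minus_left)
    qed
    then show ?thesis using eq by (simp add: D_def)
  qed
  have "W0 s = A" if "s \<le> t" for s
    using D0[OF that] by (simp add: D_def sum_power2_le_zero_iff)
  moreover have "((\<lambda>s. exp (\<mu> * s)) \<longlongrightarrow> 0) at_bot"
    using mu_facts by (intro filterlim_compose[OF exp_at_bot] filterlim_tendsto_pos_mult_at_bot[OF tendsto_const] filterlim_ident)
  then have "\<forall>\<^sub>F s in at_bot. exp (\<mu> * s) < A" using A_facts(1) by (rule order_tendstoD)
  then have "\<forall>\<^sub>F s in at_bot. exp (\<mu> * s) < A \<and> s \<le> t" by (intro eventually_conj eventually_le_at_bot)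
  then obtain s where "exp (\<mu> * s) < A" "s \<le> t" by (auto dest: eventually_happens)
  ultimately show False using W[of s] by force
qed

end

section \<open>Convergence of the rescaled solutions\<close>

lemma sin_ge_linear:
  fixes \<tau> :: real
  assumes "0 < \<tau>"
  obtains z0 where "0 < z0" "\<And>z. 0 \<le> z \<Longrightarrow> z \<le> z0 \<Longrightarrow> (1 - \<tau>) * z \<le> sin z"
proof -
  have "(sin has_real_derivative 1) (at 0)" using DERIV_sin[of "0::real"] by simp
  then have "((\<lambda>h. sin h / h) \<longlongrightarrow> 1) (at (0::real))" by (simp add: DERIV_def)
  then have "\<forall>\<^sub>F h in at (0::real). 1 - \<tau> < sin h / h" using assms by (intro order_tendstoD(1)) auto
  then obtain d where d: "0 < d" "\<And>h. h \<noteq> 0 \<Longrightarrow> dist h 0 < d \<Longrightarrow> 1 - \<tau> < sin h / (h::real)"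
    by (auto simp: eventually_at)
  show ?thesis
  proof (rule that[of "d/2"])
    fix z assume z: "0 \<le> z" "z \<le> d/2"
    show "(1 - \<tau>) * z \<le> sin z"
    proof (cases "z = 0")
      case False
      then have "1 - \<tau> < sin z / z" using d z by (intro d(2)) (auto simp: dist_real_def)
      then show ?thesis using z False by (simp add: pos_less_divide_eq less_imp_le)
    qed simp
  qed (use d in simp)
qed

text \<open>The averaging operator contains the weights only as quotients, and these converge
  uniformly down to x = 0 although numerator and denominator vanish there.\<close>

lemma sin_ratio_near:
  fixes R \<tau> :: real
  assumes R: "0 < R" and \<tau>: "0 < \<tau>"
  shows "\<forall>\<^sub>F \<epsilon> in at_right 0. \<forall>r x. 0 \<le> r \<and> r \<le> x \<and> 0 < x \<and> x \<le> R \<longrightarrow>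
    \<bar>sin (\<epsilon> * r) ^ n / sin (\<epsilon> * x) ^ n - r ^ n / x ^ n\<bar> \<le> real n * \<tau>"
proof -
  obtain z0 where z0: "0 < z0" "\<And>z. 0 \<le> z \<Longrightarrow> z \<le> z0 \<Longrightarrow> (1 - \<tau>) * z \<le> sin z"
    using sin_ge_linear[OF \<tau>] by blast
  define d where "d = min z0 (pi/2) / R"
  have d: "0 < d" using z0 R by (simp add: d_def)
  have "\<forall>\<^sub>F \<epsilon> in at_right 0. 0 < \<epsilon> \<and> \<epsilon> < d" using d by (auto simp: eventually_at_right_field)
  then show ?thesis
  proof eventually_elim
    case (elim \<epsilon>)
    show ?case
    proof (intro allI impI)
      fix r x assume *: "0 \<le> r \<and> r \<le> x \<and> 0 < x \<and> x \<le> R"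
      define u a where "u = r / x" and "a = sin (\<epsilon> * r) / sin (\<epsilon> * x)"
      have "\<epsilon> * x \<le> d * R" using * elim R by (intro mult_mono) auto
      then have ex: "0 < \<epsilon> * x" "\<epsilon> * x \<le> z0" "\<epsilon> * x \<le> pi/2" using R * elim by (auto simp: d_def)
      have "\<epsilon> * r \<le> \<epsilon> * x" using * elim by (intro mult_left_mono) auto
      moreover have "0 \<le> \<epsilon> * r" using * elim by simp
      ultimately have er: "0 \<le> \<epsilon> * r" "\<epsilon> * r \<le> z0" "\<epsilon> * r \<le> \<epsilon> * x" using ex by linarith+
      have sx: "0 < sin (\<epsilon> * x)" using ex pi_gt_zero by (intro sin_gt_zero) linarith+
      have sr: "0 \<le> sin (\<epsilon> * r)" "sin (\<epsilon> * r) \<le> sin (\<epsilon> * x)"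
        using er ex pi_gt_zero by (auto intro!: sin_ge_zero sin_monotone_2pi_le)
      have a: "0 \<le> a" "a \<le> 1" using sx sr by (auto simp: a_def)
      have u: "0 \<le> u" "u \<le> 1" using * by (auto simp: u_def)
      have "(1 - \<tau>) * (\<epsilon> * r) \<le> sin (\<epsilon> * r)" by (rule z0(2)[OF er(1,2)])
      moreover have "sin (\<epsilon> * x) \<le> \<epsilon> * x" using ex by (intro sin_x_le_x) simp
      then have "a * sin (\<epsilon> * x) \<le> a * (\<epsilon> * x)" by (intro mult_left_mono a)
      then have "sin (\<epsilon> * r) \<le> a * (\<epsilon> * x)" using sx by (simp add: a_def)
      ultimately have "(1 - \<tau>) * (\<epsilon> * r) \<le> a * (\<epsilon> * x)" by linarith
      moreover have ur: "u * (\<epsilon> * x) = \<epsilon> * r" using * by (simp add: u_def)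
      ultimately have "(1 - \<tau>) * (u * (\<epsilon> * x)) \<le> a * (\<epsilon> * x)" by (simp only: ur)
      then have "((1 - \<tau>) * u) * (\<epsilon> * x) \<le> a * (\<epsilon> * x)" by (simp add: mult.assoc)
      then have "(1 - \<tau>) * u \<le> a" using ex(1) by (rule mult_right_le_imp_le)
      moreover have "\<tau> * u \<le> \<tau> * 1" using u \<tau> by (intro mult_left_mono) auto
      ultimately have 1: "u - a \<le> \<tau>" by (simp add: algebra_simps)
      have "(1 - \<tau>) * (\<epsilon> * x) \<le> sin (\<epsilon> * x)" using ex by (intro z0(2)) auto
      then have "a * ((1 - \<tau>) * (\<epsilon> * x)) \<le> a * sin (\<epsilon> * x)" by (intro mult_left_mono a)
      also have "\<dots> = sin (\<epsilon> * r)" using sx by (simp add: a_def)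
      also have "\<dots> \<le> \<epsilon> * r" using er by (intro sin_x_le_x) simp
      also have "\<dots> = u * (\<epsilon> * x)" using * by (simp add: u_def)
      finally have "(a * (1 - \<tau>)) * (\<epsilon> * x) \<le> u * (\<epsilon> * x)" by (simp add: mult.assoc)
      then have "a * (1 - \<tau>) \<le> u" using ex(1) by (rule mult_right_le_imp_le)
      moreover have "\<tau> * a \<le> \<tau> * 1" using a \<tau> by (intro mult_left_mono) auto
      ultimately have 2: "a - u \<le> \<tau>" by (simp add: algebra_simps)
      have "norm (a ^ n - u ^ n) \<le> real n * norm (a - u)"
        using a u by (intro norm_power_diff) auto
      also have "\<dots> \<le> real n * \<tau>" using 1 2 by (intro mult_left_mono) auto
      finally show "\<bar>sin (\<epsilon> * r) ^ n / sin (\<epsilon> * x) ^ n - r ^ n / x ^ n\<bar> \<le> real n * \<tau>"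
        by (simp add: a_def u_def power_divide)
    qed
  qed
qed

lemma wavg_near:
  fixes h :: "real \<Rightarrow> real"
  assumes q: "continuous_on {0..x} q" "continuous_on {0..x} q'" and h: "continuous_on {0..x} h"
    and hb: "\<And>r. r \<in> {0..x} \<Longrightarrow> \<bar>h r\<bar> \<le> 1" and x: "0 \<le> x"
    and near: "\<And>r. r \<in> {0..x} \<Longrightarrow> 0 < x \<Longrightarrow> \<bar>q r / q x - q' r / q' x\<bar> \<le> \<tau>"
  shows "\<bar>wavg q 0 h x - wavg q' 0 h x\<bar> \<le> \<tau> * x"
proof (cases "x = 0")
  case False
  then have x0: "0 < x" using x by simp
  have i: "(\<lambda>r. q r / q x * h r) integrable_on {0..x}" "(\<lambda>r. q' r / q' x * h r) integrable_on {0..x}"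
    by (intro integrable_continuous_interval continuous_on_mult h; simp add: divide_inverse; intro continuous_on_mult_right q)+
  have "wavg q 0 h x = integral {0..x} (\<lambda>r. q r / q x * h r)" "wavg q' 0 h x = integral {0..x} (\<lambda>r. q' r / q' x * h r)"
    unfolding wavg_def by (simp_all flip: integral_divide)
  then have "\<bar>wavg q 0 h x - wavg q' 0 h x\<bar> = \<bar>integral {0..x} (\<lambda>r. q r / q x * h r - q' r / q' x * h r)\<bar>"
    by (simp only: integral_diff[OF i])
  also have "\<dots> \<le> integral {0..x} (\<lambda>_. \<tau>)"
  proof (rule integral_norm_bound_integral[where 'a = real, unfolded real_norm_def])
    show "(\<lambda>r. q r / q x * h r - q' r / q' x * h r) integrable_on {0..x}" by (intro integrable_diff i)
    fix r assume r: "r \<in> {0..x}"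
    have "\<bar>(q r / q x - q' r / q' x) * h r\<bar> \<le> \<tau> * 1"
      unfolding abs_mult using near[OF r x0] hb[OF r] by (intro mult_mono) auto
    then show "\<bar>q r / q x * h r - q' r / q' x * h r\<bar> \<le> \<tau>" by (simp add: left_diff_distrib)
  qed auto
  also have "\<dots> = \<tau> * x" using x by simp
  finally show ?thesis .
qed (simp add: wavg_def)

context sphere_problem
begin

text \<open>The scaling under which the Lane-Emden equation is invariant: it normalizes the initial
  value to 1, and the sphere survives only in the weight sin^n (\<epsilon> r).\<close>

definition ye :: "real \<Rightarrow> real \<Rightarrow> real" where "ye \<epsilon> r = \<epsilon> powr \<mu> * Us (\<epsilon> powr (- \<mu>)) (\<epsilon> * r)"
definition ve :: "real \<Rightarrow> real \<Rightarrow> real" where "ve \<epsilon> r = \<epsilon> powr (\<mu> + 1) * Vs (\<epsilon> powr (- \<mu>)) (\<epsilon> * r)"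

text \<open>The condition \<epsilon> * R \<le> pi/2 keeps the weight increasing, so \<open>K\<close>
  = 0 and the constants of the Volterra estimates do not depend on \<epsilon>.\<close>

lemma weight_scaled:
  assumes \<epsilon>: "0 < \<epsilon>" and R: "0 < R" "\<epsilon> * R \<le> pi / 2"
  shows "weight (\<lambda>x. sin (\<epsilon> * x) ^ n) (\<lambda>x. real n * sin (\<epsilon> * x) ^ (n - 1) * cos (\<epsilon> * x) * \<epsilon>) 0 R 0"
proof
  fix x :: real assume x: "0 < x"
  { assume "x \<le> R"
    then have "\<epsilon> * x \<le> \<epsilon> * R" using \<epsilon> by (intro mult_left_mono) auto
    then have "\<epsilon> * x \<le> pi / 2" using R by linarith
    then have "0 < \<epsilon> * x" "\<epsilon> * x \<le> pi / 2" using \<epsilon> x by simp_all }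
  note ex = this
  show pos: "0 < sin (\<epsilon> * x) ^ n" if "x \<le> R"
    using ex[OF that] pi_gt_zero by (intro zero_less_power sin_gt_zero) linarith+
  show "((\<lambda>x. sin (\<epsilon> * x) ^ n) has_real_derivative real n * sin (\<epsilon> * x) ^ (n - 1) * cos (\<epsilon> * x) * \<epsilon>) (at x)"
    by (auto intro!: derivative_eq_intros)
  assume "x < R"
  then have "0 \<le> sin (\<epsilon> * x)" "0 \<le> cos (\<epsilon> * x)"
    using ex pi_gt_zero by (auto intro!: sin_ge_zero cos_ge_zero)
  then show "- 0 * sin (\<epsilon> * x) ^ n \<le> real n * sin (\<epsilon> * x) ^ (n - 1) * cos (\<epsilon> * x) * \<epsilon>"
    using \<epsilon> by simp
qed (use R n_ge in \<open>auto intro!: continuous_intros simp: zero_power\<close>)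

lemma ye_volt:
  assumes \<epsilon>: "0 < \<epsilon>" and R: "0 < R" "\<epsilon> * R \<le> pi / 2"
  shows "volt_sol (\<lambda>x. sin (\<epsilon> * x) ^ n) 0 R (\<lambda>_. nl p) (\<lambda>_. 1) (ye \<epsilon>)"
    "\<And>x. x \<in> {0..R} \<Longrightarrow> ve \<epsilon> x = - wavg (\<lambda>x. sin (\<epsilon> * x) ^ n) 0 (\<lambda>r. nl p (ye \<epsilon> r)) x"
proof -
  interpret weight "\<lambda>x. sin (\<epsilon> * x) ^ n" "\<lambda>x. real n * sin (\<epsilon> * x) ^ (n - 1) * cos (\<epsilon> * x) * \<epsilon>" 0 R 0
    by (rule weight_scaled[OF assms])
  define \<Gamma> where "\<Gamma> = \<epsilon> powr (- \<mu>)"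
  have \<Gamma>: "\<epsilon> powr \<mu> * \<Gamma> = 1" using \<epsilon> by (simp add: \<Gamma>_def powr_minus)
  have eR: "\<epsilon> * R < pi" using R pi_gt_zero by linarith
  have map: "continuous_on {0..R} (\<lambda>r. \<epsilon> * r)" "(\<lambda>r. \<epsilon> * r) ` {0..R} \<subseteq> {0..\<epsilon> * R}"
    using \<epsilon> by (auto intro!: continuous_intros mult_left_mono)
  have yc: "continuous_on {0..R} (ye \<epsilon>)"
    unfolding ye_def by (intro continuous_intros continuous_on_compose2[OF Us_cont[OF eR] map(1)] map(2))
  have vc: "continuous_on {0..R} (ve \<epsilon>)"
    unfolding ve_def by (intro continuous_intros continuous_on_compose2[OF Vs_cont[OF eR] map(1)] map(2))
  have d: "(ye \<epsilon> has_real_derivative ve \<epsilon> x) (at x)"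
      "(ve \<epsilon> has_real_derivative - (real n * sin (\<epsilon> * x) ^ (n - 1) * cos (\<epsilon> * x) * \<epsilon>) / sin (\<epsilon> * x) ^ n * ve \<epsilon> x - nl p (ye \<epsilon> x)) (at x)"
    if x: "0 < x" "x < R" for x
  proof -
    have "\<epsilon> * x < \<epsilon> * R" using \<epsilon> x by simp
    then have "\<epsilon> * x < pi" using eR by linarith
    moreover have "0 < \<epsilon> * x" using x \<epsilon> by simp
    ultimately have ex: "0 < \<epsilon> * x" "\<epsilon> * x < pi" by simp_all
    have s: "0 < sin (\<epsilon> * x)" by (rule sin_gt_zero[OF ex])
    have l: "((\<lambda>r. \<epsilon> * r) has_real_derivative \<epsilon>) (at x)" by (auto intro!: derivative_eq_intros)
    have e1: "\<epsilon> powr (\<mu> + 1) = \<epsilon> powr \<mu> * \<epsilon>" using \<epsilon> by (simp add: powr_add)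
    show "(ye \<epsilon> has_real_derivative ve \<epsilon> x) (at x)"
      unfolding ye_def[abs_def] \<Gamma>_def[symmetric]
      by (rule DERIV_cong[OF DERIV_cmult[OF DERIV_chain2[OF Us_deriv[OF ex] l]]]) (simp add: ve_def e1 \<Gamma>_def)
    have U: "Us \<Gamma> (\<epsilon> * x) = \<Gamma> * ye \<epsilon> x" using \<Gamma> by (simp add: ye_def \<Gamma>_def mult.assoc[symmetric] mult.commute)
    have "0 < \<Gamma>" using \<epsilon> by (simp add: \<Gamma>_def)
    then have f: "nl p (Us \<Gamma> (\<epsilon> * x)) = \<Gamma> powr p * nl p (ye \<epsilon> x)" unfolding U by (rule nl_scale)
    \<comment> \<open>The scaling identity \<mu> p = \<mu> + 2 cancels the powers of \<epsilon> in
      the nonlinear term.\<close>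
    have "\<mu> + 2 + - \<mu> * p = 0" using mu_facts(2) by (simp add: algebra_simps)
    then have "\<epsilon> powr (\<mu> + 2) * \<Gamma> powr p = 1"
      using \<epsilon> by (simp add: \<Gamma>_def powr_powr powr_add[symmetric])
    moreover have "\<epsilon> powr (\<mu> + 2) = \<epsilon> powr (\<mu> + 1) * \<epsilon>" using \<epsilon> powr_add[of \<epsilon> "\<mu> + 1" 1] by (simp add: add.commute)
    ultimately have ef: "\<epsilon> powr (\<mu> + 1) * \<epsilon> * nl p (Us \<Gamma> (\<epsilon> * x)) = nl p (ye \<epsilon> x)"
      unfolding f by (simp add: mult.assoc[symmetric])
    have r: "rhs N p (\<epsilon> * x) (Us \<Gamma> (\<epsilon> * x)) (Vs \<Gamma> (\<epsilon> * x))
      = - qs' (\<epsilon> * x) / qs (\<epsilon> * x) * Vs \<Gamma> (\<epsilon> * x) - nl p (Us \<Gamma> (\<epsilon> * x))"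
      using s by (intro rhs_eq[symmetric]) simp
    have "(ve \<epsilon> has_real_derivative \<epsilon> powr (\<mu> + 1) * (rhs N p (\<epsilon> * x) (Us \<Gamma> (\<epsilon> * x)) (Vs \<Gamma> (\<epsilon> * x)) * \<epsilon>)) (at x)"
      unfolding ve_def[abs_def] \<Gamma>_def[symmetric]
      by (rule DERIV_cmult[OF DERIV_chain2[OF Vs_deriv[OF ex] l]])
    also have "\<epsilon> powr (\<mu> + 1) * (rhs N p (\<epsilon> * x) (Us \<Gamma> (\<epsilon> * x)) (Vs \<Gamma> (\<epsilon> * x)) * \<epsilon>)
      = - (real n * sin (\<epsilon> * x) ^ (n - 1) * cos (\<epsilon> * x) * \<epsilon>) / sin (\<epsilon> * x) ^ n * (\<epsilon> powr (\<mu> + 1) * Vs \<Gamma> (\<epsilon> * x))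
        - \<epsilon> powr (\<mu> + 1) * \<epsilon> * nl p (Us \<Gamma> (\<epsilon> * x))"
      unfolding r using s by (simp add: field_simps)
    finally show "(ve \<epsilon> has_real_derivative - (real n * sin (\<epsilon> * x) ^ (n - 1) * cos (\<epsilon> * x) * \<epsilon>) / sin (\<epsilon> * x) ^ n * ve \<epsilon> x - nl p (ye \<epsilon> x)) (at x)"
      unfolding ef by (simp add: ve_def[abs_def] \<Gamma>_def)
  qed
  have 0: "ye \<epsilon> 0 = 1" "ve \<epsilon> 0 = 0" using \<Gamma> by (simp_all add: ye_def ve_def \<Gamma>_def)
  note o = ode_imp_volterra[OF yc vc nl_comp_cont[OF p_gt_1 yc] d _ 0(2)]
  show "volt_sol (\<lambda>x. sin (\<epsilon> * x) ^ n) 0 R (\<lambda>_. nl p) (\<lambda>_. 1) (ye \<epsilon>)"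
    using o(2) 0 by (auto simp: volt_sol_def yc)
  show "ve \<epsilon> x = - wavg (\<lambda>x. sin (\<epsilon> * x) ^ n) 0 (\<lambda>r. nl p (ye \<epsilon> r)) x" if "x \<in> {0..R}" for x
    by (rule o(1)) (use that 0 in auto)
qed

text \<open>With the source nl p (y0) kept fixed, exchanging the averaging operator causes a
  uniformly small error; the rest is a Lipschitz term for the Gronwall estimate. All solutions are
  bounded by 1, which makes p a Lipschitz constant.\<close>

lemma ye_uniform_limit:
  assumes R: "0 < R"
  shows "uniform_limit {0..R} ye y0 (at_right 0)" "uniform_limit {0..R} ve v0 (at_right 0)"
proof -
  have np: "0 < real n" using n_ge by simp
  have main: "\<forall>\<^sub>F \<epsilon> in at_right 0. \<forall>x\<in>{0..R}. \<bar>ye \<epsilon> x - y0 x\<bar> \<le> real n * \<tau> * R^2 * exp (R * p * R) \<and>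
      \<bar>ve \<epsilon> x - v0 x\<bar> \<le> p * (real n * \<tau> * R^2 * exp (R * p * R)) * R + real n * \<tau> * R"
    if \<tau>: "0 < \<tau>" for \<tau>
  proof -
    have "0 < pi / 2 / R" using R by simp
    then have "\<forall>\<^sub>F \<epsilon> in at_right 0. 0 < \<epsilon> \<and> \<epsilon> < pi / 2 / R" unfolding eventually_at_right_field by blast
    with sin_ratio_near[OF R \<tau>, of n] show ?thesis
    proof eventually_elim
      case (elim \<epsilon>)
      have \<epsilon>: "0 < \<epsilon>" "\<epsilon> * R \<le> pi / 2" using elim(2) R by (auto simp: pos_less_divide_eq)
      let ?q = "\<lambda>x. sin (\<epsilon> * x) ^ n"
      interpret weight ?q "\<lambda>x. real n * sin (\<epsilon> * x) ^ (n - 1) * cos (\<epsilon> * x) * \<epsilon>" 0 R 0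
        by (rule weight_scaled[OF \<epsilon>(1) R \<epsilon>(2)])
      have CM1: "CM = 1" by (simp add: CM_def)
      note yv = ye_volt[OF \<epsilon>(1) R \<epsilon>(2)]
      have yc: "continuous_on {0..R} (ye \<epsilon>)" using yv(1) by (simp add: volt_sol_def)
      have yb: "\<bar>ye \<epsilon> r\<bar> \<le> 1" if "r \<in> {0..R}" for r
        using nl_volt_bound[OF p_gt_1 yv(1) that] by (simp add: CM1)
      have y0b: "\<bar>y0 r\<bar> \<le> 1" if "r \<in> {0..R}" for r using y0_bound[of r] that by simp
      let ?f = "\<lambda>r. nl p (ye \<epsilon> r)" and ?g = "\<lambda>r. nl p (y0 r)"
      have fc: "continuous_on {0..R} ?f" and gc: "continuous_on {0..R} ?g"
        by (intro nl_comp_cont p_gt_1 yc y0_cont)+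
      have gb: "\<bar>?g r\<bar> \<le> 1" if "r \<in> {0..R}" for r
      proof -
        have "\<bar>y0 r\<bar> powr (p - 1) \<le> 1 powr (p - 1)" using y0b[OF that] p_gt_1 by (intro powr_mono2) auto
        then have "\<bar>y0 r\<bar> powr (p - 1) * \<bar>y0 r\<bar> \<le> 1 * 1" using y0b[OF that] by (intro mult_mono) auto
        then show ?thesis by (simp add: nl_def abs_mult)
      qed
      have near: "\<bar>wavg ?q 0 ?g x - wavg q0 0 ?g x\<bar> \<le> real n * \<tau> * x" if x: "x \<in> {0..R}" for x
      proof (rule wavg_near)
        show "continuous_on {0..x} ?q" "continuous_on {0..x} q0" by (intro continuous_intros)+
        show "continuous_on {0..x} ?g" using x by (intro continuous_on_subset[OF gc]) auto
        fix r assume r: "r \<in> {0..x}"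
        show "\<bar>?g r\<bar> \<le> 1" using gb r x by auto
        show "0 < x \<Longrightarrow> \<bar>?q r / ?q x - q0 r / q0 x\<bar> \<le> real n * \<tau>" using elim(1) r x by auto
      qed (use x in auto)
      interpret w0: weight q0 q0' 0 R 0 by (rule weight_q0[OF R])
      define G where "G x = integral {0..x} (wavg q0 0 ?g) - integral {0..x} (wavg ?q 0 ?g)" for x
      have Gb: "\<bar>G x\<bar> \<le> real n * \<tau> * R^2" if x: "x \<in> {0..R}" for x
      proof -
        have "\<bar>G x\<bar> = \<bar>integral {0..x} (\<lambda>r. wavg q0 0 ?g r - wavg ?q 0 ?g r)\<bar>"
          unfolding G_def by (simp add: integral_diff[OF w0.int_h[OF w0.wavg_cont[OF gc] x] int_h[OF wavg_cont[OF gc] x]])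
        also have "\<dots> \<le> integral {0..x} (\<lambda>_. real n * \<tau> * R)"
        proof (rule integral_norm_bound_integral[where 'a = real, unfolded real_norm_def])
          show "(\<lambda>r. wavg q0 0 ?g r - wavg ?q 0 ?g r) integrable_on {0..x}"
            by (intro integrable_diff w0.int_h[OF w0.wavg_cont[OF gc] x] int_h[OF wavg_cont[OF gc] x])
          fix r assume r: "r \<in> {0..x}"
          have "real n * \<tau> * r \<le> real n * \<tau> * R" using r x \<tau> by (intro mult_left_mono) auto
          then show "\<bar>wavg q0 0 ?g r - wavg ?q 0 ?g r\<bar> \<le> real n * \<tau> * R"
            using near[of r] r x by (simp add: abs_minus_commute)
        qed auto
        also have "\<dots> = real n * \<tau> * R * x" using x by simp
        also have "\<dots> \<le> real n * \<tau> * R * R" using x \<tau> R by (intro mult_left_mono) auto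
        finally show ?thesis by (simp add: power2_eq_square)
      qed
      have D: "\<bar>ye \<epsilon> x - y0 x\<bar> \<le> real n * \<tau> * R^2 * exp (R * p * R)" if x: "x \<in> {0..R}" for x
      proof -
        have "\<bar>ye \<epsilon> x - y0 x\<bar> \<le> (real n * \<tau> * R^2 + CM * (R - 0)^2 * 0) * exp (CM * (R - 0) * p * (R - 0))"
        proof (rule wavg_gronwall[where g = G and H = "\<lambda>r. ?f r - ?g r", OF _ _ _ Gb _ _ _ x])
          fix r assume r: "r \<in> {0..R}"
          show "ye \<epsilon> r - y0 r = G r - integral {0..r} (wavg ?q 0 (\<lambda>r. ?f r - ?g r))"
            unfolding integral_wavg_diff[OF fc gc r] G_def using yv(1) y0_volt[OF R] r by (simp add: volt_sol_def)
          show "\<bar>?f r - ?g r\<bar> \<le> p * \<bar>ye \<epsilon> r - y0 r\<bar> + 0"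
            using nl_lip[OF p_gt_1 yb[OF r] y0b[OF r]] by simp
        qed (use p_gt_1 in \<open>auto intro!: continuous_intros yc y0_cont fc gc\<close>)
        then show ?thesis by (simp add: CM1)
      qed
      show ?case
      proof (intro ballI conjI)
        fix x assume x: "x \<in> {0..R}"
        show "\<bar>ye \<epsilon> x - y0 x\<bar> \<le> real n * \<tau> * R^2 * exp (R * p * R)" by (rule D[OF x])
        define k where "k = real n * \<tau> * R^2 * exp (R * p * R)"
        have dc: "continuous_on {0..R} (\<lambda>r. ?f r - ?g r)" by (intro continuous_intros fc gc)
        have k: "0 \<le> k" using \<tau> by (simp add: k_def)
        have "ve \<epsilon> x - v0 x = - wavg ?q 0 (\<lambda>r. ?f r - ?g r) x - (wavg ?q 0 ?g x - wavg q0 0 ?g x)"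
          unfolding yv(2)[OF x] v0_def wavg_diff[OF fc gc x] by simp
        moreover have "\<bar>wavg ?q 0 (\<lambda>r. ?f r - ?g r) x\<bar> \<le> p * k * R"
        proof -
          have "\<bar>wavg ?q 0 (\<lambda>r. ?f r - ?g r) x\<bar> \<le> CM * integral {0..x} (\<lambda>r. \<bar>?f r - ?g r\<bar>)"
            by (rule wavg_bound[OF dc x])
          also have "\<dots> \<le> CM * integral {0..x} (\<lambda>r. p * k)"
          proof (intro mult_left_mono integral_le int_h[OF _ x])
            fix r assume r: "r \<in> {0..x}"
            then have r': "r \<in> {0..R}" using x by auto
            have "\<bar>?f r - ?g r\<bar> \<le> p * \<bar>ye \<epsilon> r - y0 r\<bar>"
              using nl_lip[OF p_gt_1 yb[OF r'] y0b[OF r']] by simp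
            also have "\<dots> \<le> p * k" unfolding k_def using D[OF r'] p_gt_1 by (intro mult_left_mono) auto
            finally show "\<bar>?f r - ?g r\<bar> \<le> p * k" .
          qed (use CM_pos dc in \<open>auto intro!: continuous_intros\<close>)
          also have "\<dots> = p * k * x" using x CM1 by simp
          also have "\<dots> \<le> p * k * R" using x k p_gt_1 by (intro mult_left_mono) auto
          finally show ?thesis .
        qed
        moreover have "real n * \<tau> * x \<le> real n * \<tau> * R" using x \<tau> by (intro mult_left_mono) auto
        ultimately show "\<bar>ve \<epsilon> x - v0 x\<bar> \<le> p * (real n * \<tau> * R^2 * exp (R * p * R)) * R + real n * \<tau> * R"
          using near[OF x] unfolding k_def by linarith
      qed
    qed
  qed
  have lim: "uniform_limit {0..R} f l (at_right 0)"
    if "0 < c" "\<And>\<tau>. 0 < \<tau> \<Longrightarrow> \<forall>\<^sub>F \<epsilon> in at_right 0. \<forall>x\<in>{0..R}. \<bar>f \<epsilon> x - l x\<bar> \<le> c * \<tau>"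
    for f :: "real \<Rightarrow> real \<Rightarrow> real" and l c
  proof (rule uniform_limitI)
    fix e :: real assume e: "0 < e"
    have "0 < e / (2 * c)" using e that by simp
    from that(2)[OF this] show "\<forall>\<^sub>F \<epsilon> in at_right 0. \<forall>x\<in>{0..R}. dist (f \<epsilon> x) (l x) < e"
    proof eventually_elim
      case (elim \<epsilon>)
      have "c * (e / (2 * c)) < e" using e that by simp
      then show ?case using elim by (force simp: dist_real_def)
    qed
  qed
  define c where "c = real n * R^2 * exp (R * p * R)"
  have c: "0 < c" using np R by (simp add: c_def)
  show "uniform_limit {0..R} ye y0 (at_right 0)"
  proof (rule lim[OF c])
    fix \<tau> :: real assume "0 < \<tau>"
    from main[OF this] show "\<forall>\<^sub>F \<epsilon> in at_right 0. \<forall>x\<in>{0..R}. \<bar>ye \<epsilon> x - y0 x\<bar> \<le> c * \<tau>"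
      by eventually_elim (auto simp: c_def mult.commute mult.left_commute)
  qed
  have c': "0 < p * c * R + real n * R" using c np R p_gt_1 by (intro add_pos_pos mult_pos_pos) auto
  show "uniform_limit {0..R} ve v0 (at_right 0)"
  proof (rule lim[OF c'])
    fix \<tau> :: real assume "0 < \<tau>"
    from main[OF this] show "\<forall>\<^sub>F \<epsilon> in at_right 0. \<forall>x\<in>{0..R}. \<bar>ve \<epsilon> x - v0 x\<bar> \<le> (p * c * R + real n * R) * \<tau>"
      by eventually_elim (auto simp: c_def algebra_simps)
  qed
qed

section \<open>Matching with the Lane-Emden orbit\<close>

definition tl :: "real \<Rightarrow> real" where "tl \<theta> = ln (tan (\<theta> / 2))"

lemma th_tl: "0 < \<theta> \<Longrightarrow> \<theta> < pi \<Longrightarrow> th (tl \<theta>) = \<theta>"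
  unfolding tl_def by (rule th_ln_tan)

lemma tl_th: "tl (th t) = t"
  by (simp add: tl_def tan_half_th)

lemma tl_le_iff: "0 < \<theta> \<Longrightarrow> \<theta> < pi \<Longrightarrow> tl \<theta> \<le> t \<longleftrightarrow> \<theta> \<le> th t"
  by (metis th_tl th_strict_mono linorder_not_le order_le_less)

lemma tl_at_bot: "filterlim tl at_bot (at_right 0)"
  unfolding filterlim_at_bot
proof
  fix Z
  have "\<forall>\<^sub>F \<theta> in at_right 0. 0 < \<theta> \<and> \<theta> < th Z"
    unfolding eventually_at_right_field using th_bounds by blast
  then show "\<forall>\<^sub>F \<theta> in at_right 0. tl \<theta> \<le> Z"
    by eventually_elim (use tl_le_iff th_bounds[of Z] in force)
qed

text \<open>At \<theta> = \<epsilon> R the factor (sin (\<epsilon> R) / \<epsilon>)^\<mu> tends to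
  R^\<mu>, so in the limit the sphere solution enters the outer region at the point of the
  Lane-Emden orbit with time ln R.\<close>

lemma EW_rescaled:
  assumes R: "0 < R"
  shows "((\<lambda>\<epsilon>. EW (Us (\<epsilon> powr (- \<mu>))) (tl (\<epsilon> * R))) \<longlongrightarrow> W0 (ln R)) (at_right 0)"
    "((\<lambda>\<epsilon>. EY (Us (\<epsilon> powr (- \<mu>))) (Vs (\<epsilon> powr (- \<mu>))) (tl (\<epsilon> * R))) \<longlongrightarrow> X0 (ln R)) (at_right 0)"
proof -
  have "(sin has_real_derivative 1) (at 0)" using DERIV_sin[of "0::real"] by simp
  then have s: "((\<lambda>h. sin h / h) \<longlongrightarrow> 1) (at (0::real))" by (simp add: DERIV_def)
  have eR: "filterlim (\<lambda>\<epsilon>. \<epsilon> * R) (at 0) (at_right 0)"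
    unfolding filterlim_at using R by (auto intro!: tendsto_eq_intros simp: eventually_at_filter)
  have "((\<lambda>\<epsilon>. R * (sin (\<epsilon> * R) / (\<epsilon> * R))) \<longlongrightarrow> R * 1) (at_right 0)"
    by (intro tendsto_intros filterlim_compose[OF s eR])
  then have sl: "((\<lambda>\<epsilon>. sin (\<epsilon> * R) / \<epsilon>) \<longlongrightarrow> R) (at_right 0)" using R by simp
  have yl: "((\<lambda>\<epsilon>. ye \<epsilon> R) \<longlongrightarrow> y0 R) (at_right 0)" "((\<lambda>\<epsilon>. ve \<epsilon> R) \<longlongrightarrow> v0 R) (at_right 0)"
    using tendsto_uniform_limitI[OF ye_uniform_limit(1)[OF R]] tendsto_uniform_limitI[OF ye_uniform_limit(2)[OF R]] R by auto
  have cl: "((\<lambda>\<epsilon>. cos (\<epsilon> * R)) \<longlongrightarrow> 1) (at_right 0)" by (auto intro!: tendsto_eq_intros)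
  have lim1: "((\<lambda>\<epsilon>. (sin (\<epsilon> * R) / \<epsilon>) powr \<mu> * ye \<epsilon> R) \<longlongrightarrow> R powr \<mu> * y0 R) (at_right 0)"
    using R by (intro tendsto_intros sl yl) auto
  have W: "R powr \<mu> * y0 R = W0 (ln R)" using R by (simp add: W0_def powr_def)
  have lim2: "((\<lambda>\<epsilon>. \<mu> * cos (\<epsilon> * R) * ((sin (\<epsilon> * R) / \<epsilon>) powr \<mu> * ye \<epsilon> R) + (sin (\<epsilon> * R) / \<epsilon>) powr (\<mu> + 1) * ve \<epsilon> R)
      \<longlongrightarrow> \<mu> * 1 * (R powr \<mu> * y0 R) + R powr (\<mu> + 1) * v0 R) (at_right 0)"
    using R by (intro tendsto_intros sl yl cl) auto
  have X: "\<mu> * 1 * (R powr \<mu> * y0 R) + R powr (\<mu> + 1) * v0 R = X0 (ln R)"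
    unfolding W X0_def using R by (simp add: powr_def distrib_right exp_add)
  have "0 < pi / R" using R by simp
  then have ev: "\<forall>\<^sub>F \<epsilon> in at_right 0. 0 < \<epsilon> \<and> \<epsilon> < pi / R" unfolding eventually_at_right_field by blast
  have eq: "\<forall>\<^sub>F \<epsilon> in at_right 0. (sin (\<epsilon> * R) / \<epsilon>) powr \<mu> * ye \<epsilon> R = EW (Us (\<epsilon> powr (- \<mu>))) (tl (\<epsilon> * R))"
    using ev
  proof eventually_elim
    case (elim \<epsilon>)
    then have e: "0 < \<epsilon>" "0 < \<epsilon> * R" "\<epsilon> * R < pi" using R by (auto simp: pos_less_divide_eq)
    have "0 < sin (\<epsilon> * R)" by (rule sin_gt_zero[OF e(2,3)])
    then show ?case using e by (simp add: EW_def th_tl ye_def powr_divide)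
  qed
  show "((\<lambda>\<epsilon>. EW (Us (\<epsilon> powr (- \<mu>))) (tl (\<epsilon> * R))) \<longlongrightarrow> W0 (ln R)) (at_right 0)"
    using Lim_transform_eventually[OF lim1 eq] unfolding W .
  from eq ev have eq2: "\<forall>\<^sub>F \<epsilon> in at_right 0. \<mu> * cos (\<epsilon> * R) * ((sin (\<epsilon> * R) / \<epsilon>) powr \<mu> * ye \<epsilon> R) + (sin (\<epsilon> * R) / \<epsilon>) powr (\<mu> + 1) * ve \<epsilon> R
     = EY (Us (\<epsilon> powr (- \<mu>))) (Vs (\<epsilon> powr (- \<mu>))) (tl (\<epsilon> * R))"
  proof eventually_elim
    case (elim \<epsilon>)
    then have e: "0 < \<epsilon>" "0 < \<epsilon> * R" "\<epsilon> * R < pi" using R by (auto simp: pos_less_divide_eq)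
    have "0 < sin (\<epsilon> * R)" by (rule sin_gt_zero[OF e(2,3)])
    then have "(sin (\<epsilon> * R) / \<epsilon>) powr (\<mu> + 1) * ve \<epsilon> R = sin (\<epsilon> * R) powr (\<mu> + 1) * Vs (\<epsilon> powr (- \<mu>)) (\<epsilon> * R)"
      using e by (simp add: ve_def powr_divide)
    then show ?case using e elim(1) by (simp add: EY_def th_tl)
  qed
  show "((\<lambda>\<epsilon>. EY (Us (\<epsilon> powr (- \<mu>))) (Vs (\<epsilon> powr (- \<mu>))) (tl (\<epsilon> * R))) \<longlongrightarrow> X0 (ln R)) (at_right 0)"
    using Lim_transform_eventually[OF lim2 eq2] unfolding X .
qed

end

section \<open>The singular solution\<close>

lemma abs_le_imp_square_le: "\<bar>x\<bar> \<le> y \<Longrightarrow> x^2 \<le> (y::real)^2"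
  by (metis abs_ge_zero power2_abs power_mono)

lemma derivative_uniform_limit:
  fixes f g :: "nat \<Rightarrow> real \<Rightarrow> real"
  assumes x: "a < x" "x < b"
    and d: "\<And>n y. y \<in> {a..b} \<Longrightarrow> (f n has_real_derivative g n y) (at y)"
    and g: "uniform_limit {a..b} g g' sequentially"
    and f: "\<And>y. y \<in> {a..b} \<Longrightarrow> (\<lambda>n. f n y) \<longlonglongrightarrow> f' y"
  shows "(f' has_real_derivative g' x) (at x)"
proof -
  have "\<exists>h. \<forall>y\<in>{a..b}. (\<lambda>n. f n y) \<longlonglongrightarrow> h y \<and> (h has_derivative (*) (g' y)) (at y within {a..b})"
  proof (rule has_derivative_sequence)
    show "convex {a..b}" by simp
    show "(f n has_derivative (*) (g n y)) (at y within {a..b})" if "y \<in> {a..b}" for n y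
      using d[OF that] by (auto simp: has_field_derivative_def intro: has_derivative_at_withinI)
    show "x \<in> {a..b}" using x by simp
    then show "(\<lambda>n. f n x) \<longlonglongrightarrow> f' x" by (rule f)
    fix e :: real assume "0 < e"
    from uniform_limitD[OF g this]
    show "\<forall>\<^sub>F n in sequentially. \<forall>y\<in>{a..b}. \<forall>h. norm (g n y * h - g' y * h) \<le> e * norm h"
    proof eventually_elim
      case (elim n)
      show ?case
      proof (intro ballI allI)
        fix y h assume "y \<in> {a..b}"
        then have "\<bar>g n y - g' y\<bar> \<le> e" using elim by (auto simp: dist_real_def less_imp_le)
        then have "\<bar>g n y - g' y\<bar> * \<bar>h\<bar> \<le> e * \<bar>h\<bar>" by (rule mult_right_mono) simp
        then show "norm (g n y * h - g' y * h) \<le> e * norm h" by (simp add: abs_mult flip: left_diff_distrib)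
      qed
    qed
  qed
  then obtain h where h: "\<And>y. y \<in> {a..b} \<Longrightarrow> (\<lambda>n. f n y) \<longlonglongrightarrow> h y"
    "\<And>y. y \<in> {a..b} \<Longrightarrow> (h has_derivative (*) (g' y)) (at y within {a..b})" by blast
  have eq: "h y = f' y" if "y \<in> {a..b}" for y using LIMSEQ_unique[OF h(1)[OF that] f[OF that]] .
  have hd: "(h has_real_derivative g' x) (at x within {a..b})"
    using h(2)[of x] x by (simp add: has_field_derivative_def)
  have "(f' has_real_derivative g' x) (at x within {a..b})"
    by (rule has_field_derivative_transform_within[OF hd zero_less_one]) (use x eq in auto)
  then show ?thesis using x by (simp add: at_within_Icc_at)
qed

context sphere_problem
begin

text \<open>Since sin \<theta> = 2 tan (\<theta>/2) cos^2 (\<theta>/2), the prescribed profile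
  becomes A cos (\<theta>/2)^(-\<alpha>) in the variable W: the asymptotics of U at the pole say
  precisely that W tends to A.\<close>

lemma sin_powr_profile:
  assumes "0 < \<theta>" "\<theta> < pi"
  shows "sin \<theta> powr \<mu> * sing_profile N p \<theta> = A * cos (\<theta>/2) powr (- \<alpha>)"
proof -
  define c T where "c = cos (\<theta>/2)" and "T = 2 * tan (\<theta>/2)"
  have c: "0 < c" unfolding c_def using assms by (intro cos_gt_zero) auto
  have T: "0 < T" unfolding T_def using assms by (simp add: tan_gt_zero)
  have "sin \<theta> = 2 * sin (\<theta>/2) * cos (\<theta>/2)" using sin_double[of "\<theta>/2"] by simp
  also have "\<dots> = T * c powr 2" using c by (simp add: T_def c_def tan_def power2_eq_square)
  finally have "sin \<theta> powr \<mu> = T powr \<mu> * c powr (2 * \<mu>)"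
    using T by (simp add: powr_mult powr_powr)
  then have "sin \<theta> powr \<mu> * sing_profile N p \<theta> = A * (c powr (- (real N - 2)) * c powr (2 * \<mu>)) * (T powr \<mu> * T powr (- \<mu>))"
    by (simp add: sing_profile_def A_def \<mu>_def c_def T_def)
  also have "c powr (- (real N - 2)) * c powr (2 * \<mu>) = c powr (- \<alpha>)"
  proof -
    have "- (real N - 2) + 2 * \<mu> = - \<alpha>" by (simp add: \<alpha>_def)
    then show ?thesis by (simp only: powr_add[symmetric])
  qed
  also have "T powr \<mu> * T powr (- \<mu>) = 1" using T by (simp flip: powr_add)
  finally show ?thesis by (simp add: c_def)
qed

lemma sing_profile_pos: "0 < \<theta> \<Longrightarrow> \<theta> < pi \<Longrightarrow> 0 < sing_profile N p \<theta>"
proof -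
  assume \<theta>: "0 < \<theta>" "\<theta> < pi"
  have "0 < cos (\<theta>/2)" using \<theta> by (intro cos_gt_zero) auto
  moreover have "0 < tan (\<theta>/2)" using \<theta> by (simp add: tan_gt_zero)
  ultimately show ?thesis using A_facts(1) by (auto simp: sing_profile_def A_def[symmetric])
qed

lemma th_at_right: "filterlim th (at_right 0) at_bot"
  unfolding filterlim_at using th_at_bot th_bounds by (auto intro!: always_eventually) (metis less_irrefl)

lemma cos_half_th: "((\<lambda>t. cos (th t / 2) powr r) \<longlongrightarrow> 1) at_bot"
proof -
  have "((\<lambda>t. cos (th t / 2) powr r) \<longlongrightarrow> cos (0 / 2) powr r) at_bot"
    by (intro tendsto_intros th_at_bot) auto
  then show ?thesis by simp
qed

lemma EW_eq_profile: "EW U t = U (th t) / sing_profile N p (th t) * (A * cos (th t / 2) powr (- \<alpha>))"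
  using sin_powr_profile[OF th_bounds, of t] sing_profile_pos[OF th_bounds, of t]
  by (simp add: EW_def field_simps)

lemma EW_tendsto_A:
  assumes "sing_sol N p b U V"
  shows "(EW U \<longlongrightarrow> A) at_bot"
proof -
  have "((\<lambda>t. U t / sing_profile N p t) \<longlongrightarrow> 1) (at_right 0)" using assms by (simp add: sing_sol_def)
  from filterlim_compose[OF this th_at_right]
  have "((\<lambda>t. U (th t) / sing_profile N p (th t) * (A * cos (th t / 2) powr (- \<alpha>))) \<longlongrightarrow> 1 * (A * 1)) at_bot"
    by (intro tendsto_intros cos_half_th)
  then show ?thesis by (simp add: EW_eq_profile[abs_def])
qed

lemma profile_tendsto:
  assumes "(EW U \<longlongrightarrow> A) at_bot"
  shows "((\<lambda>t. U t / sing_profile N p t) \<longlongrightarrow> 1) (at_right 0)"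
proof -
  have "((\<lambda>t. EW U t / (A * cos (th t / 2) powr (- \<alpha>))) \<longlongrightarrow> A / (A * 1)) at_bot"
    using A_facts(1) by (intro tendsto_intros cos_half_th assms) auto
  from filterlim_compose[OF this tl_at_bot]
  have "((\<lambda>\<theta>. EW U (tl \<theta>) / (A * cos (th (tl \<theta>) / 2) powr (- \<alpha>))) \<longlongrightarrow> 1) (at_right 0)"
    using A_facts(1) by simp
  moreover have "\<forall>\<^sub>F \<theta> in at_right 0. 0 < \<theta> \<and> \<theta> < pi" unfolding eventually_at_right_field by (rule exI[of _ pi]) simp
  then have "\<forall>\<^sub>F \<theta> in at_right 0. EW U (tl \<theta>) / (A * cos (th (tl \<theta>) / 2) powr (- \<alpha>)) = U \<theta> / sing_profile N p \<theta>"
  proof eventually_elim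
    case (elim \<theta>)
    then have "0 < cos (\<theta>/2)" by (intro cos_gt_zero) auto
    then show ?case using elim A_facts(1) by (simp add: EW_eq_profile th_tl)
  qed
  ultimately show ?thesis by (rule Lim_transform_eventually)
qed

lemma sing_sol_at: "sing_sol N p b U V \<Longrightarrow> 0 < x \<Longrightarrow> x < b \<Longrightarrow> sol_at U V x"
  by (simp add: sing_sol_def sol_at_def)

lemma EW_EY_inject:
  assumes "EW U t = EW U' t" "EY U V t = EY U' V' t"
  shows "U (th t) = U' (th t)" "V (th t) = V' (th t)"
proof -
  have "0 < sin (th t) powr \<mu>" "0 < sin (th t) powr (\<mu> + 1)" using sin_th_pos[of t] by auto
  then show "U (th t) = U' (th t)" "V (th t) = V' (th t)" using assms by (auto simp: EW_def EY_def)
qed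

text \<open>Backwards in time the difference of two solutions grows exponentially while staying near \<open>A\<close>. The mean value
  theorem provides times at which the derivative of the difference is bounded as well.\<close>
lemma sing_unique:
  assumes s: "sing_sol N p b U V" "sing_sol N p b' U' V'" and x: "0 < x" "x < b" "x < b'"
  shows "U x = U' x" "V x = V' x"
proof -
  obtain \<rho> T0 C \<eta> where c: "0 < \<rho>" "\<rho> \<le> A/2" "1 \<le> C" "0 < \<eta>"
    and dec: "\<And>W X W' X' a b. a \<le> b \<Longrightarrow> b \<le> T0 \<Longrightarrow> (\<And>t. t \<in> {a..b} \<Longrightarrow> ef_at W X t) \<Longrightarrow>
      (\<And>t. t \<in> {a..b} \<Longrightarrow> ef_at W' X' t) \<Longrightarrow>
      (\<And>t. t \<in> {a..b} \<Longrightarrow> \<bar>W t - A\<bar> \<le> \<rho>) \<Longrightarrow> (\<And>t. t \<in> {a..b} \<Longrightarrow> \<bar>W' t - A\<bar> \<le> \<rho>) \<Longrightarrow>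
      (W b - W' b)^2 + (X b - X' b)^2 \<le> C * ((W a - W' a)^2 + (X a - X' a)^2) * exp (- 2 * \<eta> * (b - a))"
    apply (rule ef_diff_decay)
    subgoal premises prems by (rule prems(1)[OF prems(2-)])
    done
  have bp: "b \<le> pi" "b' \<le> pi" using s by (auto simp: sing_sol_def)
  have "\<forall>\<^sub>F t in at_bot. dist (EW U t) A < \<rho> \<and> dist (EW U' t) A < \<rho> \<and> th t < x \<and> t \<le> T0"
    using c x tendstoD[OF EW_tendsto_A[OF s(1)]] tendstoD[OF EW_tendsto_A[OF s(2)]] order_tendstoD(2)[OF th_at_bot]
    by (intro eventually_conj eventually_le_at_bot) auto
  then obtain T where T: "\<And>t. t \<le> T \<Longrightarrow> \<bar>EW U t - A\<bar> < \<rho>" "\<And>t. t \<le> T \<Longrightarrow> \<bar>EW U' t - A\<bar> < \<rho>"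
    "\<And>t. t \<le> T \<Longrightarrow> th t < x" "T \<le> T0"
    unfolding eventually_at_bot_linorder dist_real_def by (metis order_refl)
  have so: "sol_at U V (th t)" "sol_at U' V' (th t)" if "t \<le> T" for t
    using sing_sol_at[OF s(1) th_bounds(1)] sing_sol_at[OF s(2) th_bounds(1)] T(3)[OF that] x by auto
  let ?W = "EW U" and ?X = "EY U V" and ?W' = "EW U'" and ?X' = "EY U' V'"
  have ef: "ef_at ?W ?X t" "ef_at ?W' ?X' t" if "t \<le> T" for t using so[OF that] by (auto intro: ef_at_sol)
  define D where "D t = (?W t - ?W' t)^2 + (?X t - ?X' t)^2" for t
  have bound: "D T \<le> C * (20 * \<rho>^2) * exp (- 2 * \<eta> * (T - t))" if t: "t \<le> T" for t
  proof -
    have "((\<lambda>t. ?W t - ?W' t) has_real_derivative ?X r - ?X' r) (at r)" if "r \<le> T" for r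
      using ef[OF that] by (auto simp: ef_at_def intro!: derivative_eq_intros)
    \<comment> \<open>The differences of W at both ends of [t - 1, t] are at most 2 \<rho>, so that
      of X at r is at most 4 \<rho>; hence the constant 20 = 4^2 + 2^2 below.\<close>
    then obtain r where r: "t - 1 < r" "r < t" "(?W t - ?W' t) - (?W (t - 1) - ?W' (t - 1)) = (t - (t - 1)) * (?X r - ?X' r)"
      using MVT2[of "t - 1" t "\<lambda>t. ?W t - ?W' t" "\<lambda>r. ?X r - ?X' r"] t by auto
    have w: "\<bar>?W s - ?W' s\<bar> \<le> 2 * \<rho>" if "s \<le> T" for s using T(1,2)[OF that] by linarith
    have "\<bar>?X r - ?X' r\<bar> \<le> 4 * \<rho>" using r(3) w[of t] w[of "t - 1"] t by simp
    then have "(?X r - ?X' r)^2 \<le> (4 * \<rho>)^2" by (rule abs_le_imp_square_le)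
    moreover have "\<bar>?W r - ?W' r\<bar> \<le> 2 * \<rho>" using w r t by auto
    then have "(?W r - ?W' r)^2 \<le> (2 * \<rho>)^2" by (rule abs_le_imp_square_le)
    ultimately have Dr: "D r \<le> 20 * \<rho>^2" by (simp add: D_def power_mult_distrib)
    have "D T \<le> C * D r * exp (- 2 * \<eta> * (T - r))"
      unfolding D_def by (rule dec) (use r t T ef in \<open>auto intro: less_imp_le\<close>)
    also have "\<dots> \<le> C * (20 * \<rho>^2) * exp (- 2 * \<eta> * (T - t))"
      using Dr c r by (intro mult_mono) (auto simp: D_def)
    finally show ?thesis .
  qed
  have "((\<lambda>t. exp (2 * \<eta> * t)) \<longlongrightarrow> 0) at_bot"
    using c by (intro filterlim_compose[OF exp_at_bot] filterlim_tendsto_pos_mult_at_bot[OF tendsto_const] filterlim_ident) auto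
  then have "((\<lambda>t. C * (20 * \<rho>^2) * (exp (- 2 * \<eta> * T) * exp (2 * \<eta> * t))) \<longlongrightarrow> C * (20 * \<rho>^2) * (exp (- 2 * \<eta> * T) * 0)) at_bot"
    by (intro tendsto_intros)
  moreover have "exp (- 2 * \<eta> * T) * exp (2 * \<eta> * t) = exp (- 2 * \<eta> * (T - t))" for t
    by (simp add: algebra_simps flip: exp_add)
  ultimately have "((\<lambda>t. C * (20 * \<rho>^2) * exp (- 2 * \<eta> * (T - t))) \<longlongrightarrow> 0) at_bot" by simp
  then have "D T \<le> 0"
    by (rule tendsto_lowerbound) (use bound in \<open>auto simp: eventually_at_bot_linorder intro!: exI[of _ T]\<close>)
  then have "?W T = ?W' T" "?X T = ?X' T" by (auto simp: D_def sum_power2_le_zero_iff)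
  note eq = EW_EY_inject[OF this]
  show "U x = U' x" "V x = V' x"
    using interior_unique[of "th T" x U V U' V'] eq th_bounds(1)[of T] T(3)[of T] x bp
      sing_sol_at[OF s(1)] sing_sol_at[OF s(2)] by force+
qed

text \<open>Provides the a priori bound on U that \<open>interior_dep\<close> asks for; the damping
  coefficient is bounded on [a, c], so the energy grows at most exponentially.\<close>

lemma interior_energy:
  assumes a: "0 < a" and c: "c < pi"
  obtains L where "0 \<le> L"
    "\<And>U V x. a \<le> x \<Longrightarrow> x \<le> c \<Longrightarrow> (\<And>t. t \<in> {a..x} \<Longrightarrow> sol_at U V t) \<Longrightarrow>
      V x^2/2 + nlpot p (U x) \<le> (V a^2/2 + nlpot p (U a)) * exp (L * (x - a))"
proof -
  obtain B where B: "0 \<le> B" "\<And>x. a \<le> x \<Longrightarrow> x \<le> c \<Longrightarrow> \<bar>(real N - 1) * (cos x / sin x)\<bar> \<le> B"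
    using cot_bound[OF assms] by blast
  show ?thesis
  proof (rule that[of "2 * B"])
    fix U V :: "real \<Rightarrow> real" and x
    assume x: "a \<le> x" "x \<le> c" and s: "\<And>t. t \<in> {a..x} \<Longrightarrow> sol_at U V t"
    let ?E = "\<lambda>t. V t^2/2 + nlpot p (U t)"
    let ?E' = "\<lambda>t. - ((real N - 1) * (cos t / sin t)) * V t^2"
    have d: "(?E has_real_derivative ?E' t) (at t)" if "t \<in> {a..x}" for t
    proof -
      have "((\<lambda>t. nlpot p (U t)) has_real_derivative nl p (U t) * V t) (at t)"
        using s[OF that] by (intro DERIV_chain2[OF nlpot_deriv[OF p_gt_1]]) (auto simp: sol_at_def)
      moreover have "((\<lambda>t. V t^2/2) has_real_derivative V t * rhs N p t (U t) (V t)) (at t)"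
        using s[OF that] by (auto simp: sol_at_def intro!: derivative_eq_intros)
      ultimately have "(?E has_real_derivative V t * rhs N p t (U t) (V t) + nl p (U t) * V t) (at t)"
        by (rule DERIV_add[rotated])
      moreover have r: "rhs N p t (U t) (V t) = - ((real N - 1) * (cos t / sin t)) * V t - nl p (U t)"
        by (simp only: rhs_def mult_minus_left)
      ultimately show ?thesis unfolding r by (simp add: power2_eq_square algebra_simps)
    qed
    show "?E x \<le> ?E a * exp (2 * B * (x - a))"
    proof (rule gronwall_deriv[OF x(1), where y' = ?E'])
      show "continuous_on {a..x} ?E"
        by (rule DERIV_continuous_on[where D = ?E']) (use d in \<open>blast intro: has_field_derivative_at_within\<close>)
      fix t assume "a < t" "t < x"
      then have t: "t \<in> {a..x}" by simp
      show "(?E has_real_derivative ?E' t) (at t)" by (rule d[OF t])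
      have "- ((real N - 1) * (cos t / sin t)) \<le> B" using B(2)[of t] t x by (simp only: abs_le_iff) auto
      then have "?E' t \<le> B * V t^2" by (rule mult_right_mono) simp
      also have "\<dots> \<le> 2 * B * ?E t"
        using mult_left_mono[OF nlpot_nonneg[OF p_gt_1, of "U t"], of "2 * B"] B(1) by (simp add: algebra_simps)
      finally show "?E' t \<le> 2 * B * ?E t" .
    qed
  qed (use B in simp)
qed

lemma nlpot_le_imp_bound:
  assumes "nlpot p u \<le> E"
  shows "\<bar>u\<bar> \<le> ((p + 1) * E) powr (1 / (p + 1))"
proof -
  have "\<bar>u\<bar> powr (p + 1) \<le> (p + 1) * E" using assms p_gt_1 by (simp add: nlpot_def field_simps)
  then have "(\<bar>u\<bar> powr (p + 1)) powr (1 / (p + 1)) \<le> ((p + 1) * E) powr (1 / (p + 1))"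
    using p_gt_1 by (intro powr_mono2) auto
  then show ?thesis using p_gt_1 by (simp add: powr_powr)
qed

section \<open>Uniform control of the family as \<epsilon> tends to 0\<close>

definition Ue :: "real \<Rightarrow> real \<Rightarrow> real" where "Ue \<epsilon> = Us (\<epsilon> powr (- \<mu>))"
definition Ve :: "real \<Rightarrow> real \<Rightarrow> real" where "Ve \<epsilon> = Vs (\<epsilon> powr (- \<mu>))"
abbreviation We :: "real \<Rightarrow> real \<Rightarrow> real" where "We \<epsilon> \<equiv> EW (Ue \<epsilon>)"
abbreviation Xe :: "real \<Rightarrow> real \<Rightarrow> real" where "Xe \<epsilon> \<equiv> EY (Ue \<epsilon>) (Ve \<epsilon>)"

lemma sol_at_Ue: "0 < x \<Longrightarrow> x < pi \<Longrightarrow> sol_at (Ue \<epsilon>) (Ve \<epsilon>) x"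
  by (simp add: Ue_def Ve_def sol_at_Us)

lemma ef_at_We: "ef_at (We \<epsilon>) (Xe \<epsilon>) t"
  by (simp add: Ue_def Ve_def ef_at_sphere)

text \<open>T0, C and \<eta> are fixed before \<zeta>: choosing R such that the Lane-Emden orbit is
  close to the equilibrium at time ln R brings the starting point within any \<zeta>, without moving
  the final time T0 of the estimate.\<close>

lemma ef_family:
  assumes \<rho>: "0 < \<rho>"
  obtains T0 C \<eta> where "1 \<le> C" "0 < \<eta>"
    "\<And>\<zeta>. 0 < \<zeta> \<Longrightarrow> \<exists>R>0. (W0 (ln R) - A)^2 + X0 (ln R)^2 < \<zeta> \<and>
      (\<forall>\<^sub>F \<epsilon> in at_right 0. \<forall>t\<in>{tl (\<epsilon> * R)..T0}. \<bar>We \<epsilon> t - A\<bar> < \<rho> \<and>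
        (We \<epsilon> t - A)^2 + Xe \<epsilon> t^2 \<le> C * \<zeta> * exp (- 2 * \<eta> * (t - tl (\<epsilon> * R))) + C * exp (4 * t))"
proof -
  obtain \<rho>0 T0 C \<eta> where c: "0 < \<rho>0" "1 \<le> C" "0 < \<eta>"
    and st: "\<And>W X a b t. b \<le> T0 \<Longrightarrow> (\<And>t. t \<in> {a..b} \<Longrightarrow> ef_at W X t) \<Longrightarrow>
      (W a - A)^2 + X a^2 \<le> \<rho>0 \<Longrightarrow> t \<in> {a..b} \<Longrightarrow>
      \<bar>W t - A\<bar> < \<rho> \<and> (W t - A)^2 + X t^2 \<le> C * ((W a - A)^2 + X a^2) * exp (- 2 * \<eta> * (t - a)) + C * exp (4 * t)"
    apply (rule ef_stable[OF \<rho>])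
    subgoal premises prems by (rule prems(1)[OF prems(2-)])
    done
  show ?thesis
  proof (rule that[OF c(2,3), of T0])
    fix \<zeta> :: real assume \<zeta>: "0 < \<zeta>"
    then have m: "0 < min \<zeta> \<rho>0" using c by simp
    obtain t where t: "(W0 t - A)^2 + X0 t^2 < min \<zeta> \<rho>0" using W0_near_A[OF m] by blast
    define R where "R = exp t"
    have R: "0 < R" "ln R = t" by (auto simp: R_def)
    have "((\<lambda>\<epsilon>. (We \<epsilon> (tl (\<epsilon> * R)) - A)^2 + Xe \<epsilon> (tl (\<epsilon> * R))^2) \<longlongrightarrow> (W0 t - A)^2 + X0 t^2) (at_right 0)"
      using EW_rescaled[OF R(1)] unfolding R(2) Ue_def Ve_def by (intro tendsto_intros)
    from order_tendstoD(2)[OF this t]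
    have "\<forall>\<^sub>F \<epsilon> in at_right 0. \<forall>t\<in>{tl (\<epsilon> * R)..T0}. \<bar>We \<epsilon> t - A\<bar> < \<rho> \<and>
        (We \<epsilon> t - A)^2 + Xe \<epsilon> t^2 \<le> C * \<zeta> * exp (- 2 * \<eta> * (t - tl (\<epsilon> * R))) + C * exp (4 * t)"
    proof eventually_elim
      case (elim \<epsilon>)
      show ?case
      proof
        fix t assume t: "t \<in> {tl (\<epsilon> * R)..T0}"
        let ?a = "tl (\<epsilon> * R)"
        have "\<bar>We \<epsilon> t - A\<bar> < \<rho> \<and> (We \<epsilon> t - A)^2 + Xe \<epsilon> t^2 \<le>
            C * ((We \<epsilon> ?a - A)^2 + Xe \<epsilon> ?a^2) * exp (- 2 * \<eta> * (t - ?a)) + C * exp (4 * t)"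
          by (rule st[OF order_refl ef_at_We _ t]) (use elim in simp)
        moreover have "C * ((We \<epsilon> ?a - A)^2 + Xe \<epsilon> ?a^2) * exp (- 2 * \<eta> * (t - ?a)) \<le> C * \<zeta> * exp (- 2 * \<eta> * (t - ?a))"
          using elim c by (intro mult_right_mono mult_left_mono) auto
        ultimately show "\<bar>We \<epsilon> t - A\<bar> < \<rho> \<and>
          (We \<epsilon> t - A)^2 + Xe \<epsilon> t^2 \<le> C * \<zeta> * exp (- 2 * \<eta> * (t - ?a)) + C * exp (4 * t)" by linarith
      qed
    qed
    then show "\<exists>R>0. (W0 (ln R) - A)^2 + X0 (ln R)^2 < \<zeta> \<and>
      (\<forall>\<^sub>F \<epsilon> in at_right 0. \<forall>t\<in>{tl (\<epsilon> * R)..T0}. \<bar>We \<epsilon> t - A\<bar> < \<rho> \<and>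
        (We \<epsilon> t - A)^2 + Xe \<epsilon> t^2 \<le> C * \<zeta> * exp (- 2 * \<eta> * (t - tl (\<epsilon> * R))) + C * exp (4 * t))"
      using R t by (intro exI[of _ R]) auto
  qed
qed

lemma tl_scaled_at_bot:
  assumes "0 < R"
  shows "filterlim (\<lambda>\<epsilon>. tl (\<epsilon> * R)) at_bot (at_right 0)"
proof (rule filterlim_compose[OF tl_at_bot])
  show "filterlim (\<lambda>\<epsilon>. \<epsilon> * R) (at_right 0) (at_right 0)"
    unfolding filterlim_at using assms by (auto intro!: tendsto_eq_intros simp: eventually_at_filter)
qed

lemma eventually_at_right_0D:
  assumes "\<forall>\<^sub>F \<epsilon> in at_right (0::real). P \<epsilon>"
  obtains d where "0 < d" "\<And>\<epsilon>. 0 < \<epsilon> \<Longrightarrow> \<epsilon> < d \<Longrightarrow> P \<epsilon>"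
  using assms unfolding eventually_at_right_field by blast

text \<open>For two parameters the later of the two starting times, s, still tends to minus
  infinity; from there the difference, bounded at s, has the time T - s to decay, which grows
  without limit.\<close>

lemma WX_cauchy:
  obtains T0 C where "T0 \<le> 0" "1 \<le> C"
    "\<And>t. t \<le> T0 \<Longrightarrow> \<forall>\<^sub>F \<epsilon> in at_right 0. (We \<epsilon> t - A)^2 + Xe \<epsilon> t^2 \<le> C"
    "\<And>t e. t \<le> T0 \<Longrightarrow> 0 < e \<Longrightarrow> \<forall>\<^sub>F \<epsilon> in at_right 0. (We \<epsilon> t - A)^2 + Xe \<epsilon> t^2 \<le> e + C * exp (4 * t)"
    "\<And>T e. T \<le> T0 \<Longrightarrow> 0 < e \<Longrightarrow> \<exists>d>0. \<forall>\<epsilon> \<epsilon>'. 0 < \<epsilon> \<longrightarrow> \<epsilon> < d \<longrightarrow> 0 < \<epsilon>' \<longrightarrow> \<epsilon>' < d \<longrightarrow>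
      (\<forall>t\<in>{T..T0}. (We \<epsilon> t - We \<epsilon>' t)^2 + (Xe \<epsilon> t - Xe \<epsilon>' t)^2 \<le> e^2)"
    "\<exists>R>0. \<forall>\<^sub>F \<epsilon> in at_right 0. \<forall>t\<in>{tl (\<epsilon> * R)..T0}. 0 < We \<epsilon> t"
proof -
  obtain \<rho> T1 C1 \<eta>1 where c1: "0 < \<rho>" "\<rho> \<le> A/2" "1 \<le> C1" "0 < \<eta>1"
    and dec: "\<And>W X W' X' a b. a \<le> b \<Longrightarrow> b \<le> T1 \<Longrightarrow> (\<And>t. t \<in> {a..b} \<Longrightarrow> ef_at W X t) \<Longrightarrow>
      (\<And>t. t \<in> {a..b} \<Longrightarrow> ef_at W' X' t) \<Longrightarrow>
      (\<And>t. t \<in> {a..b} \<Longrightarrow> \<bar>W t - A\<bar> \<le> \<rho>) \<Longrightarrow> (\<And>t. t \<in> {a..b} \<Longrightarrow> \<bar>W' t - A\<bar> \<le> \<rho>) \<Longrightarrow>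
      (W b - W' b)^2 + (X b - X' b)^2 \<le> C1 * ((W a - W' a)^2 + (X a - X' a)^2) * exp (- 2 * \<eta>1 * (b - a))"
    apply (rule ef_diff_decay)
    subgoal premises prems by (rule prems(1)[OF prems(2-)])
    done
  obtain T2 C \<eta> where c: "1 \<le> C" "0 < \<eta>"
    and fam: "\<And>\<zeta>. 0 < \<zeta> \<Longrightarrow> \<exists>R>0. (W0 (ln R) - A)^2 + X0 (ln R)^2 < \<zeta> \<and>
      (\<forall>\<^sub>F \<epsilon> in at_right 0. \<forall>t\<in>{tl (\<epsilon> * R)..T2}. \<bar>We \<epsilon> t - A\<bar> < \<rho> \<and>
        (We \<epsilon> t - A)^2 + Xe \<epsilon> t^2 \<le> C * \<zeta> * exp (- 2 * \<eta> * (t - tl (\<epsilon> * R))) + C * exp (4 * t))"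
    apply (rule ef_family[OF c1(1)])
    subgoal premises prems by (rule prems(1)[OF prems(2-)])
    done
  define T0 where "T0 = min T1 (min T2 0)"
  have T0: "T0 \<le> T1" "T0 \<le> T2" "T0 \<le> 0" by (auto simp: T0_def)
  obtain R where R: "0 < R" and ev: "\<forall>\<^sub>F \<epsilon> in at_right 0. \<forall>t\<in>{tl (\<epsilon> * R)..T2}. \<bar>We \<epsilon> t - A\<bar> < \<rho> \<and>
        (We \<epsilon> t - A)^2 + Xe \<epsilon> t^2 \<le> C * 1 * exp (- 2 * \<eta> * (t - tl (\<epsilon> * R))) + C * exp (4 * t)"
    using fam[of 1] by auto
  have evpi: "\<forall>\<^sub>F \<epsilon> in at_right 0. 0 < \<epsilon> * R \<and> \<epsilon> * R < pi"
    unfolding eventually_at_right_field by (rule exI[of _ "pi / R"]) (use R in \<open>auto simp: pos_less_divide_eq\<close>)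
  from eventually_conj[OF ev evpi] obtain d1 where d1: "0 < d1"
    "\<And>\<epsilon> t. 0 < \<epsilon> \<Longrightarrow> \<epsilon> < d1 \<Longrightarrow> t \<in> {tl (\<epsilon> * R)..T2} \<Longrightarrow> \<bar>We \<epsilon> t - A\<bar> < \<rho>"
    "\<And>\<epsilon> t. 0 < \<epsilon> \<Longrightarrow> \<epsilon> < d1 \<Longrightarrow> t \<in> {tl (\<epsilon> * R)..T2} \<Longrightarrow>
        (We \<epsilon> t - A)^2 + Xe \<epsilon> t^2 \<le> C * 1 * exp (- 2 * \<eta> * (t - tl (\<epsilon> * R))) + C * exp (4 * t)"
    "\<And>\<epsilon>. 0 < \<epsilon> \<Longrightarrow> \<epsilon> < d1 \<Longrightarrow> 0 < \<epsilon> * R \<and> \<epsilon> * R < pi"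
    by (rule eventually_at_right_0D) blast
  have b2: "(We \<epsilon> t - A)^2 + Xe \<epsilon> t^2 \<le> 2 * C" if "0 < \<epsilon>" "\<epsilon> < d1" "t \<in> {tl (\<epsilon> * R)..T0}" for \<epsilon> t
  proof -
    have "exp (- 2 * \<eta> * (t - tl (\<epsilon> * R))) \<le> 1" "exp (4 * t) \<le> 1"
      using that c T0 by (auto simp: mult_nonpos_nonneg)
    then have "C * 1 * exp (- 2 * \<eta> * (t - tl (\<epsilon> * R))) + C * exp (4 * t) \<le> C * 1 * 1 + C * 1"
      using c by (intro add_mono mult_left_mono) auto
    then show ?thesis using d1(3)[OF that(1,2), of t] that(3) T0 by auto
  qed
  note tlb = tl_scaled_at_bot[OF R, unfolded filterlim_at_bot, rule_format]
  have ev0: "\<forall>\<^sub>F \<epsilon> in at_right 0. 0 < \<epsilon> \<and> \<epsilon> < d1" using d1(1) unfolding eventually_at_right_field by blast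
  show ?thesis
  proof (rule that[OF T0(3), of "2 * C"])
    show "1 \<le> 2 * C" using c by simp
    fix t assume t: "t \<le> T0"
    show "\<forall>\<^sub>F \<epsilon> in at_right 0. (We \<epsilon> t - A)^2 + Xe \<epsilon> t^2 \<le> 2 * C"
      using ev0 tlb[of t] by eventually_elim (use b2 t in auto)
    fix e :: real assume e: "0 < e"
    have "filterlim (\<lambda>\<epsilon>. 2 * \<eta> * tl (\<epsilon> * R)) at_bot (at_right 0)"
      using c by (intro filterlim_tendsto_pos_mult_at_bot[OF tendsto_const] tl_scaled_at_bot R) auto
    from filterlim_compose[OF exp_at_bot this]
    have "((\<lambda>\<epsilon>. C * 1 * exp (- 2 * \<eta> * t) * exp (2 * \<eta> * tl (\<epsilon> * R))) \<longlongrightarrow> C * 1 * exp (- 2 * \<eta> * t) * 0) (at_right 0)"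
      by (intro tendsto_intros)
    then have "\<forall>\<^sub>F \<epsilon> in at_right 0. C * 1 * exp (- 2 * \<eta> * t) * exp (2 * \<eta> * tl (\<epsilon> * R)) < e"
      using e by (intro order_tendstoD(2)) auto
    with ev0 tlb[of t] show "\<forall>\<^sub>F \<epsilon> in at_right 0. (We \<epsilon> t - A)^2 + Xe \<epsilon> t^2 \<le> e + 2 * C * exp (4 * t)"
    proof eventually_elim
      case (elim \<epsilon>)
      have "(We \<epsilon> t - A)^2 + Xe \<epsilon> t^2 \<le> C * 1 * exp (- 2 * \<eta> * (t - tl (\<epsilon> * R))) + C * exp (4 * t)"
        using elim t T0 by (intro d1(3)) auto
      moreover have "exp (- 2 * \<eta> * (t - tl (\<epsilon> * R))) = exp (- 2 * \<eta> * t) * exp (2 * \<eta> * tl (\<epsilon> * R))"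
        by (simp add: algebra_simps flip: exp_add)
      moreover have "C * exp (4 * t) \<le> 2 * C * exp (4 * t)" using c by simp
      ultimately show ?case using elim(3) by (simp add: mult.assoc)
    qed
  next
    fix T e :: real assume T: "T \<le> T0" and e: "0 < e"
    have "((\<lambda>s. exp (2 * \<eta>1 * s)) \<longlongrightarrow> 0) at_bot"
      using c1 by (intro filterlim_compose[OF exp_at_bot] filterlim_tendsto_pos_mult_at_bot[OF tendsto_const] filterlim_ident) auto
    then have "((\<lambda>s. C1 * (8 * C) * exp (- 2 * \<eta>1 * T) * exp (2 * \<eta>1 * s)) \<longlongrightarrow> C1 * (8 * C) * exp (- 2 * \<eta>1 * T) * 0) at_bot"
      by (intro tendsto_intros)
    then have "\<forall>\<^sub>F s in at_bot. C1 * (8 * C) * exp (- 2 * \<eta>1 * T) * exp (2 * \<eta>1 * s) < e^2"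
      using e by (intro order_tendstoD(2)) auto
    then obtain S where S: "\<And>s. s \<le> S \<Longrightarrow> C1 * (8 * C) * exp (- 2 * \<eta>1 * T) * exp (2 * \<eta>1 * s) < e^2"
      by (auto simp: eventually_at_bot_linorder)
    from eventually_conj[OF ev0 tlb[of "min S T"]] obtain d where d: "0 < d"
      "\<And>\<epsilon>. 0 < \<epsilon> \<Longrightarrow> \<epsilon> < d \<Longrightarrow> \<epsilon> < d1" "\<And>\<epsilon>. 0 < \<epsilon> \<Longrightarrow> \<epsilon> < d \<Longrightarrow> tl (\<epsilon> * R) \<le> min S T"
      by (rule eventually_at_right_0D) blast
    show "\<exists>d>0. \<forall>\<epsilon> \<epsilon>'. 0 < \<epsilon> \<longrightarrow> \<epsilon> < d \<longrightarrow> 0 < \<epsilon>' \<longrightarrow> \<epsilon>' < d \<longrightarrow>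
      (\<forall>t\<in>{T..T0}. (We \<epsilon> t - We \<epsilon>' t)^2 + (Xe \<epsilon> t - Xe \<epsilon>' t)^2 \<le> e^2)"
    proof (intro exI[of _ d] conjI d(1) allI impI ballI)
      fix \<epsilon> \<epsilon>' t assume \<epsilon>: "0 < \<epsilon>" "\<epsilon> < d" "0 < \<epsilon>'" "\<epsilon>' < d" and t: "t \<in> {T..T0}"
      define s where "s = max (tl (\<epsilon> * R)) (tl (\<epsilon>' * R))"
      have s: "s \<le> S" "s \<le> T" "tl (\<epsilon> * R) \<le> s" "tl (\<epsilon>' * R) \<le> s"
        using d(3)[OF \<epsilon>(1,2)] d(3)[OF \<epsilon>(3,4)] by (auto simp: s_def)
      note dd = d(2)[OF \<epsilon>(1,2)] d(2)[OF \<epsilon>(3,4)]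
      have "(We \<epsilon> t - We \<epsilon>' t)^2 + (Xe \<epsilon> t - Xe \<epsilon>' t)^2 \<le>
          C1 * ((We \<epsilon> s - We \<epsilon>' s)^2 + (Xe \<epsilon> s - Xe \<epsilon>' s)^2) * exp (- 2 * \<eta>1 * (t - s))"
      proof (rule dec[OF _ _ ef_at_We ef_at_We])
        fix r assume r: "r \<in> {s..t}"
        show "\<bar>We \<epsilon> r - A\<bar> \<le> \<rho>" using d1(2)[OF \<epsilon>(1) dd(1), of r] r s t T0 by auto
        show "\<bar>We \<epsilon>' r - A\<bar> \<le> \<rho>" using d1(2)[OF \<epsilon>(3) dd(2), of r] r s t T0 by auto
      qed (use s t T0 in auto)
      also have "\<dots> \<le> C1 * (8 * C) * exp (- 2 * \<eta>1 * (t - s))"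
      proof (intro mult_right_mono mult_left_mono)
        \<comment> \<open>Comparison through a third point z; with the bound 2C for each solution
          the two squares add up to at most 2 * (2C + 2C).\<close>
        have q: "(x - y)^2 \<le> 2 * ((x - z)^2 + (y - z)^2)" for x y z :: real
          using zero_le_power2[of "x + y - 2 * z"] by (simp add: power2_eq_square algebra_simps)
        have "(We \<epsilon> s - A)^2 + Xe \<epsilon> s^2 \<le> 2 * C" "(We \<epsilon>' s - A)^2 + Xe \<epsilon>' s^2 \<le> 2 * C"
          using s T by (auto intro!: b2 \<epsilon> dd)
        then show "(We \<epsilon> s - We \<epsilon>' s)^2 + (Xe \<epsilon> s - Xe \<epsilon>' s)^2 \<le> 8 * C"
          using q[of "We \<epsilon> s" "We \<epsilon>' s" A] q[of "Xe \<epsilon> s" "Xe \<epsilon>' s" 0] by simp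
      qed (use c1 in auto)
      also have "\<dots> \<le> C1 * (8 * C) * exp (- 2 * \<eta>1 * (T - s))"
        using c1 c t by (intro mult_left_mono) auto
      also have "exp (- 2 * \<eta>1 * (T - s)) = exp (- 2 * \<eta>1 * T) * exp (2 * \<eta>1 * s)"
        by (simp add: algebra_simps flip: exp_add)
      finally show "(We \<epsilon> t - We \<epsilon>' t)^2 + (Xe \<epsilon> t - Xe \<epsilon>' t)^2 \<le> e^2"
        using S[OF s(1)] by (simp add: mult.assoc)
    qed
  next
    show "\<exists>R>0. \<forall>\<^sub>F \<epsilon> in at_right 0. \<forall>t\<in>{tl (\<epsilon> * R)..T0}. 0 < We \<epsilon> t"
    proof (intro exI[of _ R] conjI R)
      show "\<forall>\<^sub>F \<epsilon> in at_right 0. \<forall>t\<in>{tl (\<epsilon> * R)..T0}. 0 < We \<epsilon> t"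
        using ev0
      proof eventually_elim
        case (elim \<epsilon>)
        show ?case
        proof
          fix t assume "t \<in> {tl (\<epsilon> * R)..T0}"
          then have "\<bar>We \<epsilon> t - A\<bar> < \<rho>" using elim T0 by (intro d1(2)) auto
          then show "0 < We \<epsilon> t" using c1 A_facts(1) by linarith
        qed
      qed
    qed
  qed
qed

lemma th_0: "th 0 = pi / 2" by (simp add: th_def)

lemma U_of_W:
  "U (th t) = sin (th t) powr (- \<mu>) * EW U t"
  "V (th t) = sin (th t) powr (- (\<mu> + 1)) * (EY U V t - \<mu> * cos (th t) * EW U t)"
proof -
  show "U (th t) = sin (th t) powr (- \<mu>) * EW U t"
    using sin_th_pos[of t] by (simp add: EW_def powr_minus)
  have e: "sin (th t) powr (- (\<mu> + 1)) * sin (th t) powr (\<mu> + 1) = 1"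
    using sin_th_pos[of t] by (simp only: powr_add[symmetric]) simp
  show "V (th t) = sin (th t) powr (- (\<mu> + 1)) * (EY U V t - \<mu> * cos (th t) * EW U t)"
    unfolding EY_def by (simp only: add_diff_cancel_left' mult.assoc[symmetric] e mult_1_left)
qed

text \<open>Times t \<le> 0 mean \<theta> \<le> pi/2, where sin increases, so the negative powers of
  sin are largest at T.\<close>

lemma UV_le_WX:
  assumes T: "T \<le> 0"
  obtains K where "1 \<le> K" "\<And>U V U' V' t r. T \<le> t \<Longrightarrow> t \<le> 0 \<Longrightarrow> \<bar>EW U t - EW U' t\<bar> \<le> r \<Longrightarrow> \<bar>EY U V t - EY U' V' t\<bar> \<le> r \<Longrightarrow>
    \<bar>U (th t) - U' (th t)\<bar> \<le> K * r \<and> \<bar>V (th t) - V' (th t)\<bar> \<le> K * r"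
proof -
  define s where "s = sin (th T)"
  have s: "0 < s" "s \<le> 1" using sin_th_pos[of T] by (auto simp: s_def)
  define K where "K = s powr (- (\<mu> + 1)) * (1 + \<mu>)"
  have "1 \<le> s powr (- (\<mu> + 1))" using s mu_facts powr_mono'[of "- (\<mu> + 1)" 0 s] by simp
  then have "1 * 1 \<le> K" unfolding K_def using mu_facts by (intro mult_mono) auto
  then have K1: "1 \<le> K" by simp
  show ?thesis
  proof (rule that[OF K1], rule conjI)
    fix U V U' V' :: "real \<Rightarrow> real" and t r
    assume t: "T \<le> t" "t \<le> 0" and W: "\<bar>EW U t - EW U' t\<bar> \<le> r" and X: "\<bar>EY U V t - EY U' V' t\<bar> \<le> r"
    have r: "0 \<le> r" using W by (rule order_trans[OF abs_ge_zero])
    have "th T \<le> th t" "th t \<le> pi / 2"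
      using th_strict_mono[of T t] th_strict_mono[of t 0] t th_0 by (auto simp: le_less)
    then have st: "s \<le> sin (th t)" unfolding s_def using th_bounds(1)[of T] by (intro sin_monotone_2pi_le) auto
    have p1: "sin (th t) powr (- \<mu>) \<le> s powr (- \<mu>)" "sin (th t) powr (- (\<mu> + 1)) \<le> s powr (- (\<mu> + 1))"
      using st s mu_facts by (auto intro!: powr_mono2')
    have "s powr (- \<mu>) \<le> s powr (- (\<mu> + 1))" using s mu_facts by (intro powr_mono') auto
    also have "\<dots> \<le> K" unfolding K_def using mu_facts s by (simp add: mult_le_cancel_left1)
    finally have p2: "sin (th t) powr (- \<mu>) \<le> K" using p1 by simp
    have "\<bar>U (th t) - U' (th t)\<bar> = sin (th t) powr (- \<mu>) * \<bar>EW U t - EW U' t\<bar>"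
      unfolding U_of_W(1)[of U] U_of_W(1)[of U'] by (simp add: abs_mult flip: right_diff_distrib)
    also have "\<dots> \<le> K * r" using p2 W K1 by (intro mult_mono) auto
    finally show "\<bar>U (th t) - U' (th t)\<bar> \<le> K * r" .
    have "x * (y - k * w) - x * (y' - k * w') = x * ((y - y') - k * (w - w'))" for x y k w y' w' :: real
      by (simp add: algebra_simps)
    then have "V (th t) - V' (th t) = sin (th t) powr (- (\<mu> + 1)) *
        ((EY U V t - EY U' V' t) - \<mu> * cos (th t) * (EW U t - EW U' t))"
      unfolding U_of_W(2)[of V t U] U_of_W(2)[of V' t U'] .
    then have "\<bar>V (th t) - V' (th t)\<bar> = sin (th t) powr (- (\<mu> + 1)) *
        \<bar>(EY U V t - EY U' V' t) - \<mu> * cos (th t) * (EW U t - EW U' t)\<bar>"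
      by (simp add: abs_mult)
    also have "\<dots> \<le> s powr (- (\<mu> + 1)) * ((1 + \<mu>) * r)"
    proof (intro mult_mono p1)
      have "\<bar>\<mu> * cos (th t) * (EW U t - EW U' t)\<bar> \<le> (\<mu> * 1) * r"
        unfolding abs_mult using mu_facts W abs_cos_le_one[of "th t"] by (intro mult_mono) auto
      then show "\<bar>(EY U V t - EY U' V' t) - \<mu> * cos (th t) * (EW U t - EW U' t)\<bar> \<le> (1 + \<mu>) * r"
        using X by (simp add: algebra_simps)
    qed auto
    finally show "\<bar>V (th t) - V' (th t)\<bar> \<le> K * r" by (simp add: K_def mult.assoc)
  qed
qed

text \<open>Up to th T0 the estimate is inherited from the Emden-Fowler variables; from there it is
  carried to b by continuous dependence, with a common bound M that comes from the energy.\<close>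

lemma UV_cauchy:
  assumes a: "0 < a" and b: "b < pi" and e: "0 < e"
  shows "\<exists>d>0. \<forall>\<epsilon> \<epsilon>'. 0 < \<epsilon> \<longrightarrow> \<epsilon> < d \<longrightarrow> 0 < \<epsilon>' \<longrightarrow> \<epsilon>' < d \<longrightarrow>
    (\<forall>x\<in>{a..b}. \<bar>Ue \<epsilon> x - Ue \<epsilon>' x\<bar> \<le> e \<and> \<bar>Ve \<epsilon> x - Ve \<epsilon>' x\<bar> \<le> e)"
proof (cases "a \<le> b")
  case False
  then show ?thesis by (intro exI[of _ 1]) auto
next
  case True
  then have ap: "a < pi" using b by simp
  obtain T0 C where T0: "T0 \<le> 0" and C: "1 \<le> C"
    and bd: "\<And>t. t \<le> T0 \<Longrightarrow> \<forall>\<^sub>F \<epsilon> in at_right 0. (We \<epsilon> t - A)^2 + Xe \<epsilon> t^2 \<le> C"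
    and cau: "\<And>T e. T \<le> T0 \<Longrightarrow> 0 < e \<Longrightarrow> \<exists>d>0. \<forall>\<epsilon> \<epsilon>'. 0 < \<epsilon> \<longrightarrow> \<epsilon> < d \<longrightarrow> 0 < \<epsilon>' \<longrightarrow> \<epsilon>' < d \<longrightarrow>
      (\<forall>t\<in>{T..T0}. (We \<epsilon> t - We \<epsilon>' t)^2 + (Xe \<epsilon> t - Xe \<epsilon>' t)^2 \<le> e^2)"
    by (rule WX_cauchy) blast
  define T where "T = min (tl a) T0"
  define \<theta>0 where "\<theta>0 = th T0"
  define c where "c = max b \<theta>0"
  have \<theta>0: "0 < \<theta>0" "\<theta>0 < pi" using th_bounds by (auto simp: \<theta>0_def)
  have c: "c < pi" "\<theta>0 \<le> c" "b \<le> c" using b \<theta>0 by (auto simp: c_def)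
  have T: "T \<le> 0" "T \<le> T0" "T \<le> tl a" using T0 by (auto simp: T_def)
  obtain K where K: "1 \<le> K" "\<And>U V U' V' t r. T \<le> t \<Longrightarrow> t \<le> 0 \<Longrightarrow> \<bar>EW U t - EW U' t\<bar> \<le> r \<Longrightarrow> \<bar>EY U V t - EY U' V' t\<bar> \<le> r \<Longrightarrow>
    \<bar>U (th t) - U' (th t)\<bar> \<le> K * r \<and> \<bar>V (th t) - V' (th t)\<bar> \<le> K * r"
    using UV_le_WX[OF T(1)] by blast
  obtain L1 where L1: "0 \<le> L1" "\<And>U V x. \<theta>0 \<le> x \<Longrightarrow> x \<le> c \<Longrightarrow> (\<And>t. t \<in> {\<theta>0..x} \<Longrightarrow> sol_at U V t) \<Longrightarrow>
      V x^2/2 + nlpot p (U x) \<le> (V \<theta>0^2/2 + nlpot p (U \<theta>0)) * exp (L1 * (x - \<theta>0))"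
    using interior_energy[OF \<theta>0(1) c(1)] by blast
  define k where "k = K * (A + C)"
  have k: "0 \<le> k" using K A_facts C by (simp add: k_def)
  define E1 where "E1 = (k^2/2 + nlpot p k) * exp (L1 * (c - \<theta>0))"
  define M where "M = ((p + 1) * E1) powr (1 / (p + 1))"
  have UM: "\<bar>Ue \<epsilon> x\<bar> \<le> M" if \<epsilon>: "(We \<epsilon> T0 - A)^2 + Xe \<epsilon> T0^2 \<le> C" and x: "\<theta>0 \<le> x" "x \<le> c" for \<epsilon> x
  proof -
    have "C \<le> C^2" using C by (simp add: power2_eq_square)
    then have q: "(We \<epsilon> T0 - A)^2 + Xe \<epsilon> T0^2 \<le> C^2" using \<epsilon> by linarith
    note sq = sum_squares_abs_le[OF q]
    \<comment> \<open>Comparing with the zero function turns the Lipschitz estimate of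
      \<open>UV_le_WX\<close> into a bound for the values at \<theta>0.\<close>
    have z: "EW (\<lambda>_. 0) T0 = 0" "EY (\<lambda>_. 0) (\<lambda>_. 0) T0 = 0" by (simp_all add: EW_def EY_def)
    have "\<bar>We \<epsilon> T0 - EW (\<lambda>_. 0) T0\<bar> \<le> A + C" "\<bar>Xe \<epsilon> T0 - EY (\<lambda>_. 0) (\<lambda>_. 0) T0\<bar> \<le> A + C"
      unfolding z using sq C A_facts(1) by auto
    from K(2)[OF T(2) T0 this] have "\<bar>Ue \<epsilon> \<theta>0\<bar> \<le> k" "\<bar>Ve \<epsilon> \<theta>0\<bar> \<le> k" by (auto simp: \<theta>0_def k_def)
    then have "Ve \<epsilon> \<theta>0^2 \<le> k^2" "nlpot p (Ue \<epsilon> \<theta>0) \<le> nlpot p k"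
      using p_gt_1 by (auto simp: nlpot_def intro!: abs_le_imp_square_le divide_right_mono powr_mono2)
    then have "Ve \<epsilon> \<theta>0^2/2 + nlpot p (Ue \<epsilon> \<theta>0) \<le> k^2/2 + nlpot p k" by simp
    then have "(Ve \<epsilon> \<theta>0^2/2 + nlpot p (Ue \<epsilon> \<theta>0)) * exp (L1 * (x - \<theta>0)) \<le> E1"
      unfolding E1_def using x L1(1) nlpot_nonneg[OF p_gt_1] by (intro mult_mono) (auto intro!: mult_left_mono add_nonneg_nonneg)
    moreover have "Ve \<epsilon> x^2/2 + nlpot p (Ue \<epsilon> x) \<le> (Ve \<epsilon> \<theta>0^2/2 + nlpot p (Ue \<epsilon> \<theta>0)) * exp (L1 * (x - \<theta>0))"
      by (rule L1(2)[OF x]) (use x c \<theta>0 in \<open>auto intro!: sol_at_Ue\<close>)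
    ultimately have "nlpot p (Ue \<epsilon> x) \<le> E1" using zero_le_power2[of "Ve \<epsilon> x"] by linarith
    then show ?thesis unfolding M_def by (rule nlpot_le_imp_bound)
  qed
  obtain L2 where L2: "0 \<le> L2" "\<And>U V U' V' x. \<theta>0 \<le> x \<Longrightarrow> x \<le> c \<Longrightarrow> (\<And>t. t \<in> {\<theta>0..x} \<Longrightarrow> sol_at U V t) \<Longrightarrow> (\<And>t. t \<in> {\<theta>0..x} \<Longrightarrow> sol_at U' V' t) \<Longrightarrow>
      (\<And>t. t \<in> {\<theta>0..x} \<Longrightarrow> \<bar>U t\<bar> \<le> M) \<Longrightarrow> (\<And>t. t \<in> {\<theta>0..x} \<Longrightarrow> \<bar>U' t\<bar> \<le> M) \<Longrightarrow>
      (U x - U' x)^2 + (V x - V' x)^2 \<le> ((U \<theta>0 - U' \<theta>0)^2 + (V \<theta>0 - V' \<theta>0)^2) * exp (L2 * (x - \<theta>0))"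
    apply (rule interior_dep[OF \<theta>0(1) c(1), of M])
    subgoal premises prems by (rule prems(1)[OF prems(2-)])
    done
  define F where "F = 2 * K^2 * exp (L2 * (c - \<theta>0))"
  have "1 * 1 \<le> exp (L2 * (c - \<theta>0)) * 2" using L2 c by (intro mult_mono) auto
  then have "K^2 * (1 * 1) \<le> K^2 * (exp (L2 * (c - \<theta>0)) * 2)" by (intro mult_left_mono) auto
  then have KF: "K^2 \<le> F" by (simp add: F_def mult.commute mult.left_commute)
  have F: "0 < F" using KF K(1) by (smt (verit) one_le_power)
  \<comment> \<open>Makes F * e1^2 \<le> e^2; as F also dominates K^2, the same e1 works on both
    sides of \<theta>0.\<close>
  define e1 where "e1 = e / (F + 1)"
  have e1: "0 < e1" using e F by (simp add: e1_def)
  have Fe: "F * e1^2 \<le> e^2"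
  proof -
    have "F * e1^2 = e^2 * (F / (F + 1)^2)" by (simp add: e1_def power_divide)
    also have "\<dots> \<le> e^2 * 1" using F by (intro mult_left_mono) (auto simp: power2_eq_square divide_le_eq algebra_simps)
    finally show ?thesis by simp
  qed
  have Ke: "K * e1 \<le> e"
  proof (rule power2_le_imp_le)
    have "K^2 * e1^2 \<le> F * e1^2" using KF by (intro mult_right_mono) auto
    then show "(K * e1)^2 \<le> e^2" using Fe by (simp add: power_mult_distrib)
  qed (use e in simp)
  obtain d1 where d1: "0 < d1" "\<And>\<epsilon> \<epsilon>' t. 0 < \<epsilon> \<Longrightarrow> \<epsilon> < d1 \<Longrightarrow> 0 < \<epsilon>' \<Longrightarrow> \<epsilon>' < d1 \<Longrightarrow> t \<in> {T..T0} \<Longrightarrow>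
      (We \<epsilon> t - We \<epsilon>' t)^2 + (Xe \<epsilon> t - Xe \<epsilon>' t)^2 \<le> e1^2"
    using cau[OF T(2) e1] by blast
  obtain d2 where d2: "0 < d2" "\<And>\<epsilon>. 0 < \<epsilon> \<Longrightarrow> \<epsilon> < d2 \<Longrightarrow> (We \<epsilon> T0 - A)^2 + Xe \<epsilon> T0^2 \<le> C"
    using eventually_at_right_0D[OF bd[OF order_refl]] by blast
  show ?thesis
  proof (intro exI[of _ "min d1 d2"] conjI allI impI ballI)
    show "0 < min d1 d2" using d1 d2 by simp
    fix \<epsilon> \<epsilon>' x assume \<epsilon>: "0 < \<epsilon>" "\<epsilon> < min d1 d2" "0 < \<epsilon>'" "\<epsilon>' < min d1 d2" and x: "x \<in> {a..b}"
    have near: "\<bar>Ue \<epsilon> (th t) - Ue \<epsilon>' (th t)\<bar> \<le> K * e1 \<and> \<bar>Ve \<epsilon> (th t) - Ve \<epsilon>' (th t)\<bar> \<le> K * e1" if t: "t \<in> {T..T0}" for t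
    proof -
      have "(We \<epsilon> t - We \<epsilon>' t)^2 + (Xe \<epsilon> t - Xe \<epsilon>' t)^2 \<le> e1^2" using \<epsilon> by (intro d1(2) t) auto
      from sum_squares_abs_le[OF this] show ?thesis using e1 t T0 by (intro K(2)) auto
    qed
    have "\<bar>Ue \<epsilon> x - Ue \<epsilon>' x\<bar> \<le> e \<and> \<bar>Ve \<epsilon> x - Ve \<epsilon>' x\<bar> \<le> e"
    proof (cases "x \<le> \<theta>0")
      case True
      have xp: "0 < x" "x < pi" using x a b by auto
      have "tl x \<in> {T..T0}"
        using tl_le_iff[OF xp, of T0] True T(3) tl_le_iff[OF a ap, of "tl x"] th_tl[OF xp] x by (auto simp: \<theta>0_def)
      from near[OF this] show ?thesis unfolding th_tl[OF xp] using Ke by linarith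
    next
      case False
      then have xc: "\<theta>0 \<le> x" "x \<le> c" using x c by auto
      have "T0 \<in> {T..T0}" using T by simp
      from near[OF this] have n0: "\<bar>Ue \<epsilon> \<theta>0 - Ue \<epsilon>' \<theta>0\<bar> \<le> K * e1" "\<bar>Ve \<epsilon> \<theta>0 - Ve \<epsilon>' \<theta>0\<bar> \<le> K * e1"
        by (auto simp: \<theta>0_def)
      have "(Ue \<epsilon> x - Ue \<epsilon>' x)^2 + (Ve \<epsilon> x - Ve \<epsilon>' x)^2 \<le>
          ((Ue \<epsilon> \<theta>0 - Ue \<epsilon>' \<theta>0)^2 + (Ve \<epsilon> \<theta>0 - Ve \<epsilon>' \<theta>0)^2) * exp (L2 * (x - \<theta>0))"
        by (rule L2(2)[OF xc]) (use xc c \<theta>0 \<epsilon> in \<open>auto intro!: sol_at_Ue UM d2(2)\<close>)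
      also have "\<dots> \<le> ((K * e1)^2 + (K * e1)^2) * exp (L2 * (c - \<theta>0))"
        using n0 xc L2(1) by (intro mult_mono add_mono abs_le_imp_square_le) (auto intro!: mult_left_mono)
      also have "\<dots> = F * e1^2" by (simp add: F_def power_mult_distrib)
      also have "\<dots> \<le> e^2" by (rule Fe)
      finally show ?thesis using sum_squares_abs_le e by (metis less_imp_le)
    qed
    then show "\<bar>Ue \<epsilon> x - Ue \<epsilon>' x\<bar> \<le> e" "\<bar>Ve \<epsilon> x - Ve \<epsilon>' x\<bar> \<le> e" by auto
  qed
qed

section \<open>Construction of the singular solution\<close>

definition Ust :: "real \<Rightarrow> real" where "Ust x = lim (\<lambda>k. Ue (inverse (real (Suc k))) x)"
definition Vst :: "real \<Rightarrow> real" where "Vst x = lim (\<lambda>k. Ve (inverse (real (Suc k))) x)"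

lemma eps_seq: "filterlim (\<lambda>k. inverse (real (Suc k))) (at_right 0) sequentially"
  unfolding filterlim_at using LIMSEQ_inverse_real_of_nat by auto

lemma Ust_limit:
  assumes x: "0 < x" "x < pi"
  shows "(\<lambda>k. Ue (inverse (real (Suc k))) x) \<longlonglongrightarrow> Ust x" "(\<lambda>k. Ve (inverse (real (Suc k))) x) \<longlonglongrightarrow> Vst x"
proof -
  have "\<exists>N. \<forall>j\<ge>N. \<forall>k\<ge>N. \<bar>Ue (inverse (real (Suc j))) x - Ue (inverse (real (Suc k))) x\<bar> \<le> e
      \<and> \<bar>Ve (inverse (real (Suc j))) x - Ve (inverse (real (Suc k))) x\<bar> \<le> e" if e: "0 < e" for e
  proof -
    obtain d where d: "0 < d" "\<And>\<epsilon> \<epsilon>'. 0 < \<epsilon> \<Longrightarrow> \<epsilon> < d \<Longrightarrow> 0 < \<epsilon>' \<Longrightarrow> \<epsilon>' < d \<Longrightarrow>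
      \<bar>Ue \<epsilon> x - Ue \<epsilon>' x\<bar> \<le> e \<and> \<bar>Ve \<epsilon> x - Ve \<epsilon>' x\<bar> \<le> e"
      using UV_cauchy[OF x e] by auto
    have "\<forall>\<^sub>F k in sequentially. inverse (real (Suc k)) < d"
      using LIMSEQ_inverse_real_of_nat d(1) by (rule order_tendstoD)
    then obtain N where "\<And>k. N \<le> k \<Longrightarrow> inverse (real (Suc k)) < d" by (auto simp: eventually_sequentially)
    then show ?thesis by (intro exI[of _ N] allI impI d(2)) auto
  qed
  note cau = this
  have "Cauchy (\<lambda>k. Ue (inverse (real (Suc k))) x)" "Cauchy (\<lambda>k. Ve (inverse (real (Suc k))) x)"
  proof -
    { fix e :: real assume e: "0 < e"
      then have "0 < e / 2" by simp
      from cau[OF this] obtain N where N: "\<And>j k. N \<le> j \<Longrightarrow> N \<le> k \<Longrightarrow>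
          \<bar>Ue (inverse (real (Suc j))) x - Ue (inverse (real (Suc k))) x\<bar> \<le> e / 2
          \<and> \<bar>Ve (inverse (real (Suc j))) x - Ve (inverse (real (Suc k))) x\<bar> \<le> e / 2" by blast
      have "\<bar>Ue (inverse (real (Suc j))) x - Ue (inverse (real (Suc k))) x\<bar> < e
          \<and> \<bar>Ve (inverse (real (Suc j))) x - Ve (inverse (real (Suc k))) x\<bar> < e" if "N \<le> j" "N \<le> k" for j k
        using N[OF that] e by linarith
      then have "\<exists>N. \<forall>j\<ge>N. \<forall>k\<ge>N. \<bar>Ue (inverse (real (Suc j))) x - Ue (inverse (real (Suc k))) x\<bar> < e
          \<and> \<bar>Ve (inverse (real (Suc j))) x - Ve (inverse (real (Suc k))) x\<bar> < e" by blast }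
    then show "Cauchy (\<lambda>k. Ue (inverse (real (Suc k))) x)" "Cauchy (\<lambda>k. Ve (inverse (real (Suc k))) x)"
      unfolding Cauchy_def dist_real_def by blast+
  qed
  then show "(\<lambda>k. Ue (inverse (real (Suc k))) x) \<longlonglongrightarrow> Ust x" "(\<lambda>k. Ve (inverse (real (Suc k))) x) \<longlonglongrightarrow> Vst x"
    unfolding Ust_def Vst_def by (simp_all add: real_Cauchy_convergent convergent_LIMSEQ_iff[symmetric])
qed

text \<open>Ust is defined through one sequence of parameters; the Cauchy estimate in \<epsilon>
  upgrades this to convergence along all \<epsilon>.\<close>

lemma Ust_near:
  assumes a: "0 < a" and b: "b < pi" and e: "0 < e"
  shows "\<forall>\<^sub>F \<epsilon> in at_right 0. \<forall>x\<in>{a..b}. \<bar>Ue \<epsilon> x - Ust x\<bar> \<le> e \<and> \<bar>Ve \<epsilon> x - Vst x\<bar> \<le> e"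
proof -
  obtain d where d: "0 < d" "\<And>\<epsilon> \<epsilon>' x. 0 < \<epsilon> \<Longrightarrow> \<epsilon> < d \<Longrightarrow> 0 < \<epsilon>' \<Longrightarrow> \<epsilon>' < d \<Longrightarrow> x \<in> {a..b} \<Longrightarrow>
      \<bar>Ue \<epsilon> x - Ue \<epsilon>' x\<bar> \<le> e \<and> \<bar>Ve \<epsilon> x - Ve \<epsilon>' x\<bar> \<le> e"
    using UV_cauchy[OF assms] by blast
  have ev: "\<forall>\<^sub>F k in sequentially. inverse (real (Suc k)) < d"
    using LIMSEQ_inverse_real_of_nat d(1) by (rule order_tendstoD)
  have "\<bar>Ue \<epsilon> x - Ust x\<bar> \<le> e \<and> \<bar>Ve \<epsilon> x - Vst x\<bar> \<le> e" if \<epsilon>: "0 < \<epsilon>" "\<epsilon> < d" and x: "x \<in> {a..b}" for \<epsilon> x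
  proof
    have xp: "0 < x" "x < pi" using x a b by auto
    have l: "(\<lambda>k. \<bar>Ue \<epsilon> x - Ue (inverse (real (Suc k))) x\<bar>) \<longlonglongrightarrow> \<bar>Ue \<epsilon> x - Ust x\<bar>"
      by (intro tendsto_intros Ust_limit xp)
    have "\<forall>\<^sub>F k in sequentially. \<bar>Ue \<epsilon> x - Ue (inverse (real (Suc k))) x\<bar> \<le> e"
      using ev by eventually_elim (use d(2)[OF \<epsilon> _ _ x] in auto)
    from tendsto_upperbound[OF l this] show "\<bar>Ue \<epsilon> x - Ust x\<bar> \<le> e" by simp
    have l: "(\<lambda>k. \<bar>Ve \<epsilon> x - Ve (inverse (real (Suc k))) x\<bar>) \<longlonglongrightarrow> \<bar>Ve \<epsilon> x - Vst x\<bar>"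
      by (intro tendsto_intros Ust_limit xp)
    have "\<forall>\<^sub>F k in sequentially. \<bar>Ve \<epsilon> x - Ve (inverse (real (Suc k))) x\<bar> \<le> e"
      using ev by eventually_elim (use d(2)[OF \<epsilon> _ _ x] in auto)
    from tendsto_upperbound[OF l this] show "\<bar>Ve \<epsilon> x - Vst x\<bar> \<le> e" by simp
  qed
  then show ?thesis using d(1) unfolding eventually_at_right_field by blast
qed

lemma uniform_limit_Ust:
  assumes a: "0 < a" and b: "b < pi"
  shows "uniform_limit {a..b} Ue Ust (at_right 0)" "uniform_limit {a..b} Ve Vst (at_right 0)"
proof -
  have "\<forall>\<^sub>F \<epsilon> in at_right 0. \<forall>x\<in>{a..b}. dist (Ue \<epsilon> x) (Ust x) < e \<and> dist (Ve \<epsilon> x) (Vst x) < e" if e: "0 < e" for e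
  proof -
    have "0 < e / 2" using e by simp
    from Ust_near[OF assms this] show ?thesis
      by eventually_elim (use e in \<open>force simp: dist_real_def\<close>)
  qed
  note ev = this
  show "uniform_limit {a..b} Ue Ust (at_right 0)"
    unfolding uniform_limit_iff by (intro allI impI eventually_mono[OF ev]) auto
  show "uniform_limit {a..b} Ve Vst (at_right 0)"
    unfolding uniform_limit_iff by (intro allI impI eventually_mono[OF ev]) auto
qed

text \<open>The equation passes to the limit once the right-hand sides converge uniformly; they do
  because cot is bounded on [a, b] and nl p is Lipschitz on the bounded range of the
  solutions.\<close>

lemma sol_at_Ust:
  assumes x: "0 < x" "x < pi"
  shows "sol_at Ust Vst x"
proof -
  obtain a where a: "0 < a" "a < x" using dense x by blast
  obtain b where b: "x < b" "b < pi" using dense x by blast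
  define e where "e k = inverse (real (Suc k))" for k
  have e: "filterlim e (at_right 0) sequentially" unfolding e_def by (rule eps_seq)
  have uU: "uniform_limit {a..b} (\<lambda>k. Ue (e k)) Ust sequentially"
    and uV: "uniform_limit {a..b} (\<lambda>k. Ve (e k)) Vst sequentially"
    using filterlim_compose[OF uniform_limit_Ust(1)[OF a(1) b(2)] e] filterlim_compose[OF uniform_limit_Ust(2)[OF a(1) b(2)] e] by auto
  have s: "sol_at (Ue (e k)) (Ve (e k)) y" if "y \<in> {a..b}" for k y
    using that a b by (intro sol_at_Ue) auto
  have 1: "(Ust has_real_derivative Vst x) (at x)"
    by (rule derivative_uniform_limit[OF a(2) b(1) _ uV])
      (use s a b Ust_limit in \<open>auto simp: sol_at_def e_def\<close>)
  have "continuous_on {a..b} (Ue (e k))" for k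
    by (rule DERIV_continuous_on[where D = "Ve (e k)"]) (use s in \<open>auto simp: sol_at_def intro: has_field_derivative_at_within\<close>)
  then have "continuous_on {a..b} Ust"
    by (intro uniform_limit_theorem[OF _ uU]) auto
  then have "bounded (Ust ` {a..b})" by (intro compact_imp_bounded compact_continuous_image) auto
  then obtain M0 where M0: "\<forall>y\<in>{a..b}. \<bar>Ust y\<bar> \<le> M0" by (auto simp: bounded_iff)
  define Lf where "Lf = p * (M0 + 1) powr (p - 1)"
  have Lf: "0 \<le> Lf" using p_gt_1 by (simp add: Lf_def)
  obtain B where B: "0 \<le> B" "\<And>y. a \<le> y \<Longrightarrow> y \<le> b \<Longrightarrow> \<bar>(real N - 1) * (cos y / sin y)\<bar> \<le> B"
    using cot_bound[OF a(1) b(2)] by blast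
  have "uniform_limit {a..b} (\<lambda>k y. rhs N p y (Ue (e k) y) (Ve (e k) y)) (\<lambda>y. rhs N p y (Ust y) (Vst y)) sequentially"
  proof (rule uniform_limitI)
    fix r :: real assume r: "0 < r"
    define r' where "r' = min 1 (r / (B + Lf + 1))"
    have BL: "0 < B + Lf + 1" using B Lf by simp
    have r': "0 < r'" "r' \<le> 1" "r' * (B + Lf + 1) \<le> r"
    proof -
      have "r' \<le> r / (B + Lf + 1)" by (simp add: r'_def)
      then show "r' * (B + Lf + 1) \<le> r" using BL by (simp add: pos_le_divide_eq)
    qed (use r BL in \<open>auto simp: r'_def\<close>)
    from uniform_limitD[OF uU r'(1)] uniform_limitD[OF uV r'(1)]
    show "\<forall>\<^sub>F k in sequentially. \<forall>y\<in>{a..b}. dist (rhs N p y (Ue (e k) y) (Ve (e k) y)) (rhs N p y (Ust y) (Vst y)) < r"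
    proof eventually_elim
      case (elim k)
      show ?case
      proof
        fix y assume y: "y \<in> {a..b}"
        define q where "q = (real N - 1) * (cos y / sin y)"
        have d: "\<bar>Ue (e k) y - Ust y\<bar> < r'" "\<bar>Ve (e k) y - Vst y\<bar> < r'" using elim y by (auto simp: dist_real_def)
        have M: "\<bar>Ust y\<bar> \<le> M0 + 1" "\<bar>Ue (e k) y\<bar> \<le> M0 + 1" using M0 y d(1) r'(2) by force+
        have rr: "rhs N p y u v = - (q * v) - nl p u" for u v by (simp only: rhs_def q_def mult_minus_left)
        have "rhs N p y (Ue (e k) y) (Ve (e k) y) - rhs N p y (Ust y) (Vst y) =
          - (q * (Ve (e k) y - Vst y)) - (nl p (Ue (e k) y) - nl p (Ust y))"
          unfolding rr by (simp add: algebra_simps)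
        moreover have "\<bar>q\<bar> \<le> B" unfolding q_def by (rule B(2)) (use y in auto)
        then have "\<bar>q * (Ve (e k) y - Vst y)\<bar> \<le> B * r'"
          unfolding abs_mult using B(1) d by (intro mult_mono) auto
        moreover have "\<bar>nl p (Ue (e k) y) - nl p (Ust y)\<bar> \<le> Lf * \<bar>Ue (e k) y - Ust y\<bar>"
          unfolding Lf_def by (intro nl_lip p_gt_1 M)
        moreover have "Lf * \<bar>Ue (e k) y - Ust y\<bar> \<le> Lf * r'" using d Lf by (intro mult_left_mono) auto
        moreover have "B * r' + Lf * r' < r" using r'(1,3) by (simp add: algebra_simps)
        ultimately show "dist (rhs N p y (Ue (e k) y) (Ve (e k) y)) (rhs N p y (Ust y) (Vst y)) < r"
          unfolding dist_real_def by linarith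
      qed
    qed
  qed
  note ul = this
  have 2: "(Vst has_real_derivative rhs N p x (Ust x) (Vst x)) (at x)"
    by (rule derivative_uniform_limit[OF a(2) b(1) _ ul])
      (use s a b Ust_limit in \<open>auto simp: sol_at_def e_def\<close>)
  show ?thesis using 1 2 by (simp add: sol_at_def)
qed

lemma Ue_tendsto: "0 < x \<Longrightarrow> x < pi \<Longrightarrow> ((\<lambda>\<epsilon>. Ue \<epsilon> x) \<longlongrightarrow> Ust x) (at_right 0)"
  "0 < x \<Longrightarrow> x < pi \<Longrightarrow> ((\<lambda>\<epsilon>. Ve \<epsilon> x) \<longlongrightarrow> Vst x) (at_right 0)"
  using tendsto_uniform_limitI[OF uniform_limit_Ust(1)[of x x]] tendsto_uniform_limitI[OF uniform_limit_Ust(2)[of x x]] by auto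

abbreviation Wst :: "real \<Rightarrow> real" where "Wst \<equiv> EW Ust"
abbreviation Xst :: "real \<Rightarrow> real" where "Xst \<equiv> EY Ust Vst"

lemma We_tendsto: "((\<lambda>\<epsilon>. We \<epsilon> t) \<longlongrightarrow> Wst t) (at_right 0)" "((\<lambda>\<epsilon>. Xe \<epsilon> t) \<longlongrightarrow> Xst t) (at_right 0)"
  unfolding EW_def EY_def by (intro tendsto_intros Ue_tendsto th_bounds)+

text \<open>At a fixed time the contribution of the start decays to 0 with \<epsilon>, and only the
  curvature term is left. The resulting rate exp (2t) for W - A makes this deviation integrable near
  minus infinity.\<close>

lemma Wst_near_A:
  obtains T0 C where "1 \<le> C" "\<And>t. t \<le> T0 \<Longrightarrow> (Wst t - A)^2 + Xst t^2 \<le> C * exp (4 * t)"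
proof -
  obtain T0 C where C: "1 \<le> C"
    and bd: "\<And>t e. t \<le> T0 \<Longrightarrow> 0 < e \<Longrightarrow> \<forall>\<^sub>F \<epsilon> in at_right 0. (We \<epsilon> t - A)^2 + Xe \<epsilon> t^2 \<le> e + C * exp (4 * t)"
    by (rule WX_cauchy) blast
  show ?thesis
  proof (rule that[OF C])
    fix t assume t: "t \<le> T0"
    show "(Wst t - A)^2 + Xst t^2 \<le> C * exp (4 * t)"
    proof (rule field_le_epsilon)
      fix e :: real assume e: "0 < e"
      have "((\<lambda>\<epsilon>. (We \<epsilon> t - A)^2 + Xe \<epsilon> t^2) \<longlongrightarrow> (Wst t - A)^2 + Xst t^2) (at_right 0)"
        by (intro tendsto_intros We_tendsto)
      then have "(Wst t - A)^2 + Xst t^2 \<le> e + C * exp (4 * t)"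
        by (rule tendsto_upperbound[OF _ bd[OF t e]]) simp
      then show "(Wst t - A)^2 + Xst t^2 \<le> C * exp (4 * t) + e" by simp
    qed
  qed
qed

lemma Wst_tendsto: "(Wst \<longlongrightarrow> A) at_bot" "(Xst \<longlongrightarrow> 0) at_bot"
proof -
  obtain T0 C where C: "1 \<le> C" "\<And>t. t \<le> T0 \<Longrightarrow> (Wst t - A)^2 + Xst t^2 \<le> C * exp (4 * t)"
    apply (rule Wst_near_A)
    subgoal premises prems by (rule prems(1)[OF prems(2-)])
    done
  have "((\<lambda>t. exp (4 * t)) \<longlongrightarrow> 0) (at_bot :: real filter)"
    by (intro filterlim_compose[OF exp_at_bot] filterlim_tendsto_pos_mult_at_bot[OF tendsto_const] filterlim_ident) auto
  then have "((\<lambda>t. sqrt (C * exp (4 * t))) \<longlongrightarrow> sqrt (C * 0)) at_bot" by (intro tendsto_intros)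
  then have l: "((\<lambda>t. sqrt (C * exp (4 * t))) \<longlongrightarrow> 0) at_bot" by simp
  have b: "\<bar>Wst t - A\<bar> \<le> sqrt (C * exp (4 * t))" "\<bar>Xst t\<bar> \<le> sqrt (C * exp (4 * t))" if "t \<le> T0" for t
  proof -
    have "\<bar>Wst t - A\<bar>^2 \<le> C * exp (4 * t)" "\<bar>Xst t\<bar>^2 \<le> C * exp (4 * t)"
      using C(2)[OF that] zero_le_power2[of "Wst t - A"] zero_le_power2[of "Xst t"]
      unfolding power2_abs by linarith+
    then show "\<bar>Wst t - A\<bar> \<le> sqrt (C * exp (4 * t))" "\<bar>Xst t\<bar> \<le> sqrt (C * exp (4 * t))"
      by (auto intro!: real_le_rsqrt)
  qed
  have "((\<lambda>t. Wst t - A) \<longlongrightarrow> 0) at_bot"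
    by (rule Lim_null_comparison[OF _ l]) (use b in \<open>auto simp: eventually_at_bot_linorder\<close>)
  then show "(Wst \<longlongrightarrow> A) at_bot" by (simp add: LIM_zero_iff)
  show "(Xst \<longlongrightarrow> 0) at_bot"
    by (rule Lim_null_comparison[OF _ l]) (use b in \<open>auto simp: eventually_at_bot_linorder\<close>)
qed

section \<open>The first zero of the singular solution and the limit of \<Theta>\<close>

lemma sing_sol_Ust: "sing_sol N p pi Ust Vst"
  unfolding sing_sol_def using sol_at_Ust profile_tendsto[OF Wst_tendsto(1)] by (auto simp: sol_at_def)

lemma sing_first_zero_iff:
  "sing_first_zero N p \<theta> \<longleftrightarrow> 0 < \<theta> \<and> \<theta> < pi \<and> Ust \<theta> = 0 \<and> (\<forall>t\<in>{0<..<\<theta>}. 0 < Ust t)"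
proof
  assume "sing_first_zero N p \<theta>"
  then obtain U V b where *: "0 < \<theta>" "\<theta> < b" "sing_sol N p b U V" "U \<theta> = 0" "\<forall>t\<in>{0<..<\<theta>}. U t > 0"
    by (auto simp: sing_first_zero_def)
  then have b: "b \<le> pi" by (simp add: sing_sol_def)
  have "U t = Ust t" if "0 < t" "t \<le> \<theta>" for t
    using that * b by (intro sing_unique(1)[OF *(3) sing_sol_Ust]) auto
  then show "0 < \<theta> \<and> \<theta> < pi \<and> Ust \<theta> = 0 \<and> (\<forall>t\<in>{0<..<\<theta>}. 0 < Ust t)" using * b by auto
qed (use sing_sol_Ust in \<open>auto simp: sing_first_zero_def\<close>)

text \<open>U' is a positive multiple of X - \<mu> cos \<theta> W, which tends to - \<mu> A; this
  negative slope near the pole takes the place of the condition U' = 0 of the regular case.\<close>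

lemma Ust_start:
  obtains x0 where "0 < x0" "x0 < pi" "\<And>x. 0 < x \<Longrightarrow> x \<le> x0 \<Longrightarrow> 0 < Ust x \<and> Vst x < 0"
proof -
  have "((\<lambda>t. Xst t - \<mu> * cos (th t) * Wst t) \<longlongrightarrow> 0 - \<mu> * cos 0 * A) at_bot"
    by (intro tendsto_intros Wst_tendsto th_at_bot)
  then have "\<forall>\<^sub>F t in at_bot. Xst t - \<mu> * cos (th t) * Wst t < 0"
    using mu_facts A_facts(1) by (intro order_tendstoD(2)) auto
  moreover have "\<forall>\<^sub>F t in at_bot. 0 < Wst t" by (rule order_tendstoD(1)[OF Wst_tendsto(1) A_facts(1)])
  ultimately have "\<forall>\<^sub>F t in at_bot. 0 < Wst t \<and> Xst t - \<mu> * cos (th t) * Wst t < 0" by (rule eventually_conj[rotated])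
  then obtain T where T: "\<And>t. t \<le> T \<Longrightarrow> 0 < Wst t \<and> Xst t - \<mu> * cos (th t) * Wst t < 0"
    by (auto simp: eventually_at_bot_linorder)
  show ?thesis
  proof (rule that[OF th_bounds, of T])
    fix x assume x: "0 < x" "x \<le> th T"
    then have xp: "x < pi" using th_bounds[of T] by simp
    have "tl x \<le> T" using tl_le_iff[OF x(1) xp] x by simp
    from T[OF this] show "0 < Ust x \<and> Vst x < 0"
      using U_of_W(1)[of Ust "tl x"] U_of_W(2)[of Vst "tl x" Ust] sin_th_pos[of "tl x"]
      by (simp add: th_tl[OF x(1) xp] mult_pos_neg)
  qed
qed

lemma Ust_cont:
  assumes "0 < a" "b < pi"
  shows "continuous_on {a..b} Ust" "continuous_on {a..b} Vst"
proof -
  have d: "(Ust has_real_derivative Vst x) (at x within {a..b})"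
    "(Vst has_real_derivative rhs N p x (Ust x) (Vst x)) (at x within {a..b})" if "x \<in> {a..b}" for x
    using sol_at_Ust[of x] that assms by (auto simp: sol_at_def intro: has_field_derivative_at_within)
  show "continuous_on {a..b} Ust" by (rule DERIV_continuous_on[OF d(1)])
  show "continuous_on {a..b} Vst" by (rule DERIV_continuous_on[OF d(2)])
qed

lemma qVst_decreasing:
  assumes x: "0 < x" "x < y" "y < pi" and pos: "\<And>t. x < t \<Longrightarrow> t < y \<Longrightarrow> 0 < Ust t"
  shows "qs y * Vst y < qs x * Vst x"
proof (rule DERIV_neg_imp_decreasing_open[OF x(2)])
  show "continuous_on {x..y} (\<lambda>x. qs x * Vst x)" using x by (intro continuous_intros Ust_cont) auto
  fix t assume t: "x < t" "t < y"
  then have t': "0 < t" "t < pi" using x by auto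
  have "0 < sin t" using t' by (intro sin_gt_zero) auto
  then have "- qs t * nl p (Ust t) < 0" using pos[OF t] by (simp add: nl_pos)
  then show "\<exists>z. ((\<lambda>x. qs x * Vst x) has_real_derivative z) (at t) \<and> z < 0"
    using qV_deriv[OF t', of Ust Vst] sol_at_Ust[OF t'] unfolding sol_at_def by blast
qed

text \<open>As for regular solutions, but the flux sin^n U' starts from its negative value at x0
  instead of the value 0 at the pole.\<close>

lemma Ust_zero_exists:
  obtains \<theta> where "0 < \<theta>" "\<theta> < pi" "Ust \<theta> = 0" "\<And>t. 0 < t \<Longrightarrow> t < \<theta> \<Longrightarrow> 0 < Ust t" "Vst \<theta> < 0"
proof -
  obtain x0 where x0: "0 < x0" "x0 < pi" "\<And>x. 0 < x \<Longrightarrow> x \<le> x0 \<Longrightarrow> 0 < Ust x \<and> Vst x < 0"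
    using Ust_start by blast
  have s0: "0 < sin x0" using x0 by (intro sin_gt_zero)
  define c where "c = - (qs x0 * Vst x0)"
  have c: "0 < c" using x0(3)[of x0] x0(1) s0 by (simp add: c_def mult_pos_neg)
  have le: "qs x * Vst x \<le> - c" if "x0 \<le> x" "x < pi" "\<And>t. x0 < t \<Longrightarrow> t < x \<Longrightarrow> 0 < Ust t" for x
  proof (cases "x = x0")
    case False
    then have "qs x * Vst x < qs x0 * Vst x0" using that x0 by (intro qVst_decreasing) auto
    then show ?thesis by (simp add: c_def)
  qed (simp add: c_def)
  have "\<exists>x. x0 < x \<and> x < pi \<and> Ust x \<le> 0"
  proof (rule ccontr)
    assume neg: "\<not> ?thesis"
    then have pos: "0 < Ust t" if "x0 < t" "t < pi" for t using that by (meson not_le)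
    have "\<exists>x. x0 < x \<and> x < pi \<and> Ust x < 0"
      by (rule negative_before_pi[OF n_ge(1) x0(1,2) c, of Ust Vst])
        (use x0 sol_at_Ust le pos in \<open>auto simp: sol_at_def\<close>)
    then show False using neg by force
  qed
  then obtain x where x: "x0 < x" "x < pi" "Ust x \<le> 0" by blast
  obtain \<theta> where \<theta>: "x0 < \<theta>" "\<theta> \<le> x" "Ust \<theta> = 0" "\<And>t. x0 \<le> t \<Longrightarrow> t < \<theta> \<Longrightarrow> 0 < Ust t"
    using first_root_exists[OF Ust_cont(1)[OF x0(1) x(2)] less_imp_le[OF x(1)] _ x(3)] x0(3)[OF x0(1) order_refl]
    by blast
  have pos: "0 < Ust t" if "0 < t" "t < \<theta>" for t
    using x0(3)[of t] \<theta>(4)[of t] that by (cases "t \<le> x0") auto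
  have "qs \<theta> * Vst \<theta> \<le> - c" using \<theta> x pos x0 by (intro le) auto
  then have "qs \<theta> * Vst \<theta> < 0" using c by simp
  moreover have "0 < sin \<theta>" using \<theta> x x0 by (intro sin_gt_zero) auto
  ultimately have "Vst \<theta> < 0" by (simp add: mult_less_0_iff)
  then show ?thesis using that[of \<theta>] \<theta> x x0 pos by auto
qed

lemma sing_first_zero_ex1: "\<exists>!\<theta>. sing_first_zero N p \<theta>"
proof -
  obtain \<theta> where \<theta>: "0 < \<theta>" "\<theta> < pi" "Ust \<theta> = 0" "\<And>t. 0 < t \<Longrightarrow> t < \<theta> \<Longrightarrow> 0 < Ust t"
    apply (rule Ust_zero_exists)
    subgoal premises prems by (rule prems(1)[OF prems(2-5)])
    done
  show ?thesis unfolding sing_first_zero_iff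
  proof (rule ex1I[of _ \<theta>])
    fix \<eta> assume \<eta>: "0 < \<eta> \<and> \<eta> < pi \<and> Ust \<eta> = 0 \<and> (\<forall>t\<in>{0<..<\<eta>}. 0 < Ust t)"
    then have "\<not> \<eta> < \<theta>" using \<theta>(4)[of \<eta>] by auto
    moreover have "\<not> \<theta> < \<eta>" using \<theta>(1,3) \<eta> by (auto dest!: bspec[of _ _ \<theta>])
    ultimately show "\<eta> = \<theta>" by simp
  qed (use \<theta> in auto)
qed

abbreviation \<Theta>s :: real where "\<Theta>s \<equiv> Theta_star N p"

lemma Theta_star_props:
  "0 < \<Theta>s" "\<Theta>s < pi" "Ust \<Theta>s = 0" "\<And>t. 0 < t \<Longrightarrow> t < \<Theta>s \<Longrightarrow> 0 < Ust t" "Vst \<Theta>s < 0"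
proof -
  have z: "sing_first_zero N p \<Theta>s" unfolding Theta_star_def by (rule theI'[OF sing_first_zero_ex1])
  then show "0 < \<Theta>s" "\<Theta>s < pi" "Ust \<Theta>s = 0" "\<And>t. 0 < t \<Longrightarrow> t < \<Theta>s \<Longrightarrow> 0 < Ust t"
    by (auto simp: sing_first_zero_iff)
  obtain \<theta> where \<theta>: "0 < \<theta>" "\<theta> < pi" "Ust \<theta> = 0" "\<And>t. 0 < t \<Longrightarrow> t < \<theta> \<Longrightarrow> 0 < Ust t" "Vst \<theta> < 0"
    apply (rule Ust_zero_exists)
    subgoal premises prems by (rule prems(1)[OF prems(2-)])
    done
  then have "sing_first_zero N p \<theta>" by (auto simp: sing_first_zero_iff)
  then have "\<theta> = \<Theta>s" using z sing_first_zero_ex1 by blast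
  then show "Vst \<Theta>s < 0" using \<theta> by simp
qed

text \<open>Convergence from below needs positivity on all of [0, y], where no single limit is
  uniform: the inner region follows the positive Lane-Emden solution, in the transition W stays
  positive near A, and the outer region is close to Ust.\<close>

lemma Theta_eps_tendsto: "((\<lambda>\<epsilon>. \<Theta> (\<epsilon> powr (- \<mu>))) \<longlongrightarrow> \<Theta>s) (at_right 0)"
proof (rule order_tendstoI)
  have evp: "\<forall>\<^sub>F \<epsilon> in at_right (0::real). 0 < \<epsilon>" by (simp add: eventually_at_filter)
  fix y assume y: "y < \<Theta>s"
  show "\<forall>\<^sub>F \<epsilon> in at_right 0. y < \<Theta> (\<epsilon> powr (- \<mu>))"
  proof -
    obtain T0 where pos: "\<exists>R>0. \<forall>\<^sub>F \<epsilon> in at_right 0. \<forall>t\<in>{tl (\<epsilon> * R)..T0}. 0 < We \<epsilon> t"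
      by (rule WX_cauchy) blast
    then obtain R where R: "0 < R" and ev1: "\<forall>\<^sub>F \<epsilon> in at_right 0. \<forall>t\<in>{tl (\<epsilon> * R)..T0}. 0 < We \<epsilon> t" by blast
    obtain r where r: "r \<in> {0..R}" "\<And>x. x \<in> {0..R} \<Longrightarrow> y0 r \<le> y0 x"
      using continuous_attains_inf[of "{0..R}" y0] y0_cont R by auto
    have k: "0 < y0 r" using r y0_pos by auto
    note ev2 = uniform_limit_evD[OF ye_uniform_limit(1)[OF R] k]
    define a b where "a = th T0" and "b = max y a"
    have a: "0 < a" "a < pi" using th_bounds by (auto simp: a_def)
    have "\<forall>\<^sub>F \<epsilon> in at_right 0. \<forall>x\<in>{a..y}. 0 < Ue \<epsilon> x"
    proof (cases "a \<le> y")
      case True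
      have yp: "y < pi" using y Theta_star_props(2) by simp
      obtain z where z: "z \<in> {a..y}" "\<And>x. x \<in> {a..y} \<Longrightarrow> Ust z \<le> Ust x"
        using continuous_attains_inf[OF compact_Icc _ Ust_cont(1)[OF a(1) yp]] True by auto
      have "0 < Ust z" using z(1) a y by (intro Theta_star_props(4)) auto
      from uniform_limit_evD[OF uniform_limit_Ust(1)[OF a(1) yp] this] show ?thesis
      proof eventually_elim
        case (elim \<epsilon>)
        show ?case
        proof
          fix x assume x: "x \<in> {a..y}"
          then have "\<bar>Ue \<epsilon> x - Ust x\<bar> < Ust z" "Ust z \<le> Ust x" using elim z by auto
          then show "0 < Ue \<epsilon> x" by linarith
        qed
      qed
    qed simp
    with evp ev1 ev2 show ?thesis
    proof eventually_elim
      case (elim \<epsilon>)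
      show ?case
      proof (cases "y < 0")
        case True
        have "0 < \<Theta> (\<epsilon> powr (- \<mu>))" using elim(1) by (intro Theta_props(1)) auto
        then show ?thesis using True by simp
      next
        case False
        show ?thesis
        proof (rule Theta_greater)
          show "0 < \<epsilon> powr (- \<mu>)" using elim(1) by simp
          fix x assume x: "0 \<le> x" "x \<le> y"
          consider "x \<le> \<epsilon> * R" | "\<epsilon> * R < x" "x < a" | "a \<le> x" by linarith
          then have "0 < Ue \<epsilon> x"
          proof cases
            case 1
            then have "x / \<epsilon> \<in> {0..R}" using x elim(1) by (auto simp: divide_le_eq mult.commute)
            then have "\<bar>ye \<epsilon> (x / \<epsilon>) - y0 (x / \<epsilon>)\<bar> < y0 r" "y0 r \<le> y0 (x / \<epsilon>)" using elim(3) r by auto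
            then have "0 < ye \<epsilon> (x / \<epsilon>)" by linarith
            then show ?thesis using elim(1) by (simp add: ye_def Ue_def zero_less_mult_iff)
          next
            case 2
            then have eR: "0 < \<epsilon> * R" "0 < x" "x < pi" using elim(1) R a by (auto intro: less_trans[of 0 "\<epsilon> * R"])
            have "tl x \<le> T0" using tl_le_iff[OF eR(2,3), of T0] 2 by (simp add: a_def)
            moreover have "tl (\<epsilon> * R) \<le> tl x" using tl_le_iff[OF eR(1), of "tl x"] 2 eR by (simp add: th_tl)
            ultimately have "0 < We \<epsilon> (tl x)" using elim(2) by auto
            then show ?thesis unfolding EW_def th_tl[OF eR(2,3)] by (simp add: zero_less_mult_iff)
          next
            case 3
            then show ?thesis using elim(4) x by auto
          qed
          then show "0 < Us (\<epsilon> powr (- \<mu>)) x" by (simp add: Ue_def)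
        qed
      qed
    qed
  qed
next
  have evp: "\<forall>\<^sub>F \<epsilon> in at_right (0::real). 0 < \<epsilon>" by (simp add: eventually_at_filter)
  fix y assume y: "\<Theta>s < y"
  note T = Theta_star_props
  have "(Ust has_real_derivative Vst \<Theta>s) (at \<Theta>s)" using sol_at_Ust[OF T(1,2)] by (simp add: sol_at_def)
  from DERIV_neg_dec_right[OF this T(5)]
  obtain d where d: "0 < d" "\<And>h. 0 < h \<Longrightarrow> h < d \<Longrightarrow> Ust (\<Theta>s + h) < Ust \<Theta>s" by auto
  define h where "h = min (d/2) (min ((y - \<Theta>s) / 2) ((pi - \<Theta>s) / 2))"
  have h: "0 < h" "h < d" using d y T by (auto simp: h_def)
  have "h \<le> (y - \<Theta>s) / 2" unfolding h_def by (rule min.coboundedI2, rule min.cobounded1)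
  moreover have "h \<le> (pi - \<Theta>s) / 2" unfolding h_def by (rule min.coboundedI2, rule min.cobounded2)
  ultimately have x: "\<Theta>s + h < y" "\<Theta>s + h < pi" using y T(2) by (auto simp: field_simps)
  have x0: "0 < \<Theta>s + h" "Ust (\<Theta>s + h) < 0" using T h d(2)[OF h] by auto
  from evp order_tendstoD(2)[OF Ue_tendsto(1)[OF x0(1) x(2)] x0(2)]
  show "\<forall>\<^sub>F \<epsilon> in at_right 0. \<Theta> (\<epsilon> powr (- \<mu>)) < y"
  proof eventually_elim
    case (elim \<epsilon>)
    have "\<Theta> (\<epsilon> powr (- \<mu>)) < \<Theta>s + h"
      using elim x0 by (intro Theta_less) (auto simp: Ue_def)
    then show ?case using x by simp
  qed
qed

lemma Theta_tendsto_star: "(\<Theta> \<longlongrightarrow> \<Theta>s) at_top"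
proof -
  have "filterlim (\<lambda>\<Gamma>. \<Gamma> powr (- 1 / \<mu>)) (at_right 0) at_top"
    unfolding filterlim_at using mu_facts
    by (auto intro!: tendsto_neg_powr filterlim_ident eventually_mono[OF eventually_gt_at_top[of 0]])
  from filterlim_compose[OF Theta_eps_tendsto this]
  have "((\<lambda>\<Gamma>. \<Theta> ((\<Gamma> powr (- 1 / \<mu>)) powr (- \<mu>))) \<longlongrightarrow> \<Theta>s) at_top" .
  moreover have "\<forall>\<^sub>F \<Gamma> in at_top. \<Theta> ((\<Gamma> powr (- 1 / \<mu>)) powr (- \<mu>)) = \<Theta> \<Gamma>"
    using eventually_gt_at_top[of 0] by eventually_elim (use mu_facts in \<open>simp add: powr_powr\<close>)
  ultimately show ?thesis by (rule Lim_transform_eventually)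
qed

text \<open>A positive value at the fixed point \<Theta>s does not by itself exclude an earlier
  zero. But for small \<epsilon> the function Ve is negative on a fixed interval to the left of
  \<Theta>s, and \<Theta> exceeds the left end of it, so a zero before \<Theta>s would force a value
  \<le> 0 at \<Theta>s.\<close>

lemma Theta_sign:
  "\<forall>\<^sub>F \<epsilon> in at_right 0. (Ue \<epsilon> \<Theta>s < 0 \<longrightarrow> \<Theta> (\<epsilon> powr (- \<mu>)) < \<Theta>s) \<and> (0 < Ue \<epsilon> \<Theta>s \<longrightarrow> \<Theta>s < \<Theta> (\<epsilon> powr (- \<mu>)))"
proof -
  note T = Theta_star_props
  have "isCont Vst \<Theta>s" using sol_at_Ust[OF T(1,2)] DERIV_isCont by (auto simp: sol_at_def)
  then have "(Vst \<longlongrightarrow> Vst \<Theta>s) (at \<Theta>s)" by (simp add: isCont_def)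
  from order_tendstoD(2)[OF this, of "Vst \<Theta>s / 2"] T(5)
  obtain d where d: "0 < d" "\<And>x. x \<noteq> \<Theta>s \<Longrightarrow> dist x \<Theta>s < d \<Longrightarrow> Vst x < Vst \<Theta>s / 2"
    by (auto simp: eventually_at)
  define a where "a = max (\<Theta>s / 2) (\<Theta>s - d / 2)"
  have a: "0 < a" "a < \<Theta>s" "\<Theta>s - d < a" using T d by (auto simp: a_def)
  have V: "Vst x < Vst \<Theta>s / 2" if "x \<in> {a..\<Theta>s}" for x
    using d(2)[of x] that a T(5) by (cases "x = \<Theta>s") (auto simp: dist_real_def)
  have evp: "\<forall>\<^sub>F \<epsilon> in at_right (0::real). 0 < \<epsilon>" by (simp add: eventually_at_filter)
  have "0 < - Vst \<Theta>s / 2" using T by simp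
  from evp uniform_limit_evD[OF uniform_limit_Ust(2)[OF a(1) T(2)] this] order_tendstoD(1)[OF Theta_eps_tendsto a(2)]
  show ?thesis
  proof eventually_elim
    case (elim \<epsilon>)
    define \<Gamma> where "\<Gamma> = \<epsilon> powr (- \<mu>)"
    have \<Gamma>: "0 < \<Gamma>" using elim by (simp add: \<Gamma>_def)
    have "\<Theta>s < \<Theta> \<Gamma>" if p: "0 < Ue \<epsilon> \<Theta>s"
    proof (rule ccontr)
      assume "\<not> \<Theta>s < \<Theta> \<Gamma>"
      then have le: "\<Theta> \<Gamma> \<le> \<Theta>s" by simp
      have "Ue \<epsilon> \<Theta>s \<le> Ue \<epsilon> (\<Theta> \<Gamma>)"
      proof (rule DERIV_nonpos_imp_nonincreasing[OF le, of "Ue \<epsilon>"])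
        fix x assume x: "\<Theta> \<Gamma> \<le> x" "x \<le> \<Theta>s"
        then have xa: "x \<in> {a..\<Theta>s}" using elim(3) by (auto simp: \<Gamma>_def)
        have "\<bar>Ve \<epsilon> x - Vst x\<bar> < - Vst \<Theta>s / 2" "Vst x < Vst \<Theta>s / 2" using elim(2) xa V by auto
        then have "Ve \<epsilon> x \<le> 0" by linarith
        moreover have "(Ue \<epsilon> has_real_derivative Ve \<epsilon> x) (at x)"
          using sol_at_Ue[of x \<epsilon>] xa a T by (auto simp: sol_at_def)
        ultimately show "\<exists>y. (Ue \<epsilon> has_real_derivative y) (at x) \<and> y \<le> 0" by blast
      qed
      also have "\<dots> = 0" using Theta_props(3)[OF \<Gamma>] by (simp add: Ue_def \<Gamma>_def)
      finally show False using p by simp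
    qed
    moreover have "\<Theta> \<Gamma> < \<Theta>s" if "Ue \<epsilon> \<Theta>s < 0"
      using that T by (intro Theta_less \<Gamma>) (auto simp: Ue_def \<Gamma>_def)
    ultimately show ?case by (simp add: \<Gamma>_def)
  qed
qed

end

section \<open>The linearization along the singular solution\<close>

text \<open>The function k = v0 q(a) / q solves (q k)' = 0; its primitive is put into the forcing,
  so the Volterra theory for zero slope covers an arbitrary initial slope.\<close>

lemma (in weight) linear_ode_exists:
  assumes qa: "0 < q a" and c: "continuous_on {a..b} c"
  obtains w v where "w a = w0" "v a = v0" "continuous_on {a..b} w" "continuous_on {a..b} v"
    "\<And>x. a < x \<Longrightarrow> x < b \<Longrightarrow> (w has_real_derivative v x) (at x)"
    "\<And>x. a < x \<Longrightarrow> x < b \<Longrightarrow> (v has_real_derivative - q' x / q x * v x - c x * w x) (at x)"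
proof -
  have qn: "q x \<noteq> 0" if "x \<in> {a..b}" for x using q_pos[of x] qa that by (cases "x = a") auto
  define k where "k x = v0 * q a / q x" for x
  have kc: "continuous_on {a..b} k" unfolding k_def by (intro continuous_intros q_cont) (use qn in auto)
  define g where "g x = w0 + integral {a..x} k" for x
  have gc: "continuous_on {a..b} g" unfolding g_def by (intro continuous_intros integral_cont kc)
  obtain w where w: "volt_sol q a b (\<lambda>r y. c r * y) g w" using linear_volt_exists[OF c gc] by blast
  then have wc: "continuous_on {a..b} w" and weq: "\<And>x. x \<in> {a..b} \<Longrightarrow> w x = g x - integral {a..x} (wavg q a (\<lambda>r. c r * w r))"
    by (auto simp: volt_sol_def)
  have cw: "continuous_on {a..b} (\<lambda>r. c r * w r)" by (intro continuous_intros c wc)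
  define v where "v x = k x - wavg q a (\<lambda>r. c r * w r) x" for x
  show ?thesis
  proof (rule that[of w v])
    show "w a = w0" using weq[of a] ab by (simp add: g_def)
    show "v a = v0" using qa by (simp add: v_def k_def wavg_def)
    show "continuous_on {a..b} w" by (rule wc)
    show "continuous_on {a..b} v" unfolding v_def by (intro continuous_intros kc wavg_cont cw)
    fix x assume x: "a < x" "x < b"
    have "((\<lambda>x. g x - integral {a..x} (wavg q a (\<lambda>r. c r * w r))) has_real_derivative v x) (at x)"
      unfolding g_def v_def
      by (rule DERIV_cong[OF DERIV_diff[OF DERIV_add[OF DERIV_const integral_has_deriv[OF kc x]]
            integral_has_deriv[OF wavg_cont[OF cw] x]]]) simp
    then show "(w has_real_derivative v x) (at x)"
      by (rule has_field_derivative_transform_within_open[of _ _ _ "{a<..<b}"]) (use x weq in auto)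
    have q0: "q x \<noteq> 0" using qn x by simp
    have "(k has_real_derivative - q' x / q x * k x) (at x)"
      unfolding k_def by (rule DERIV_cong[OF DERIV_divide[OF DERIV_const q_deriv[OF x] q0]]) (use q0 in \<open>simp add: field_simps\<close>)
    from DERIV_diff[OF this wavg_deriv[OF cw x]]
    show "(v has_real_derivative - q' x / q x * v x - c x * w x) (at x)"
      unfolding v_def[abs_def] by (simp add: algebra_simps)
  qed
qed

context sphere_problem
begin

text \<open>The coefficients are the values at b of the fundamental solutions of the equation
  linearized at Ust; they do not both vanish because the weighted Wronskian is constant. The error
  is small relative to the data at a, since the remainder is driven only by the difference of the
  solutions times a small coefficient.\<close>

lemma linear_functional:
  assumes a: "0 < a" "a < b" and b: "b < pi"
  obtains a1 a2 where "a1 \<noteq> 0 \<or> a2 \<noteq> 0"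
    "\<And>e. 0 < e \<Longrightarrow> \<forall>\<^sub>F \<epsilon> in at_right 0.
      \<bar>(Ue \<epsilon> b - Ust b) - (a1 * (Ue \<epsilon> a - Ust a) + a2 * (Ve \<epsilon> a - Vst a))\<bar>
      \<le> e * (\<bar>Ue \<epsilon> a - Ust a\<bar> + \<bar>Ve \<epsilon> a - Vst a\<bar>)"
proof -
  interpret weight qs qs' a b "real n / sin b" using weight_qs[of a b] assms by simp
  have qa: "0 < qs a" using a b by (intro zero_less_power sin_gt_zero) auto
  define cst where "cst x = p * \<bar>Ust x\<bar> powr (p - 1)" for x
  have Uc: "continuous_on {a..b} Ust" by (rule Ust_cont(1)[OF a(1) b])
  have cc: "continuous_on {a..b} cst" unfolding cst_def by (rule nl_deriv_cont[OF p_gt_1 Uc])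
  obtain w1 v1 where w1: "w1 a = 1" "v1 a = 0" "continuous_on {a..b} w1" "continuous_on {a..b} v1"
    "\<And>x. a < x \<Longrightarrow> x < b \<Longrightarrow> (w1 has_real_derivative v1 x) (at x)"
    "\<And>x. a < x \<Longrightarrow> x < b \<Longrightarrow> (v1 has_real_derivative - qs' x / qs x * v1 x - cst x * w1 x) (at x)"
    by (rule linear_ode_exists[OF qa cc]) blast
  obtain w2 v2 where w2: "w2 a = 0" "v2 a = 1" "continuous_on {a..b} w2" "continuous_on {a..b} v2"
    "\<And>x. a < x \<Longrightarrow> x < b \<Longrightarrow> (w2 has_real_derivative v2 x) (at x)"
    "\<And>x. a < x \<Longrightarrow> x < b \<Longrightarrow> (v2 has_real_derivative - qs' x / qs x * v2 x - cst x * w2 x) (at x)"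
    by (rule linear_ode_exists[OF qa cc]) blast
  have nz: "w1 b \<noteq> 0 \<or> w2 b \<noteq> 0"
  proof (rule ccontr)
    assume "\<not> ?thesis"
    then have z: "w1 b = 0" "w2 b = 0" by auto
    \<comment> \<open>The Wronskian is shown to be constant by monotonicity in both directions; with
      this sign its value at a is - sin^n a.\<close>
    let ?P = "\<lambda>x. - (qs x * (w1 x * v2 x - w2 x * v1 x))"
    have "?P b \<le> ?P a"
    proof (rule deriv_nonpos_imp_le[where f = ?P and f' = "\<lambda>_. 0"])
      show "continuous_on {a..b} ?P" by (intro continuous_intros q_cont w1 w2)
      fix x assume x: "a < x" "x < b"
      have q0: "sin x \<noteq> 0" using sin_gt_zero[of x] x a b by simp
      show "(?P has_real_derivative 0) (at x)"
        by (rule DERIV_cong[OF DERIV_minus[OF DERIV_mult[OF q_deriv[OF x]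
              DERIV_diff[OF DERIV_mult[OF w1(5)[OF x] w2(6)[OF x]] DERIV_mult[OF w2(5)[OF x] w1(6)[OF x]]]]]])
          (use q0 in \<open>simp add: field_simps\<close>)
    qed (use a in auto)
    moreover have "?P b \<ge> ?P a"
    proof -
      have "- ?P b \<le> - ?P a"
      proof (rule deriv_nonpos_imp_le[where f = "\<lambda>x. - ?P x" and f' = "\<lambda>_. 0"])
        show "continuous_on {a..b} (\<lambda>x. - ?P x)" by (intro continuous_intros q_cont w1 w2)
        fix x assume x: "a < x" "x < b"
        have q0: "sin x \<noteq> 0" using sin_gt_zero[of x] x a b by simp
        show "((\<lambda>x. - ?P x) has_real_derivative 0) (at x)"
          by (rule DERIV_cong[OF DERIV_minus[OF DERIV_minus[OF DERIV_mult[OF q_deriv[OF x]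
                DERIV_diff[OF DERIV_mult[OF w1(5)[OF x] w2(6)[OF x]] DERIV_mult[OF w2(5)[OF x] w1(6)[OF x]]]]]]])
            (use q0 in \<open>simp add: field_simps\<close>)
      qed (use a in auto)
      then show ?thesis by simp
    qed
    ultimately show False using z w1 w2 qa by simp
  qed
  have "bounded (Ust ` {a..b})" by (intro compact_imp_bounded compact_continuous_image Uc) auto
  then obtain M0 where M0: "\<forall>x\<in>{a..b}. \<bar>Ust x\<bar> \<le> M0" by (auto simp: bounded_iff)
  define M where "M = M0 + 1"
  have "bounded (cst ` {a..b})" by (intro compact_imp_bounded compact_continuous_image cc) auto
  then obtain Lc where Lc: "\<forall>x\<in>{a..b}. \<bar>cst x\<bar> \<le> Lc" by (auto simp: bounded_iff)
  from bspec[OF Lc, of a] have Lc0: "0 \<le> Lc" using a abs_ge_zero[of "cst a"] by simp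
  obtain L2 where L2: "0 \<le> L2" "\<And>U V U' V' x. a \<le> x \<Longrightarrow> x \<le> b \<Longrightarrow> (\<And>t. t \<in> {a..x} \<Longrightarrow> sol_at U V t) \<Longrightarrow> (\<And>t. t \<in> {a..x} \<Longrightarrow> sol_at U' V' t) \<Longrightarrow>
      (\<And>t. t \<in> {a..x} \<Longrightarrow> \<bar>U t\<bar> \<le> M) \<Longrightarrow> (\<And>t. t \<in> {a..x} \<Longrightarrow> \<bar>U' t\<bar> \<le> M) \<Longrightarrow>
      (U x - U' x)^2 + (V x - V' x)^2 \<le> ((U a - U' a)^2 + (V a - V' a)^2) * exp (L2 * (x - a))"
    apply (rule interior_dep[OF a(1) b, of M])
    subgoal premises prems by (rule prems(1)[OF prems(2-)])
    done
  define B where "B = exp (L2 * (b - a))"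
  have B: "1 \<le> B" using L2 a by (simp add: B_def)
  define D where "D = CM * (b - a)^2 * B * exp (CM * (b - a) * Lc * (b - a))"
  have D: "0 < D" unfolding D_def using CM_pos a B by (intro mult_pos_pos) auto
  let ?k = "\<lambda>z. p * \<bar>z\<bar> powr (p - 1)"
  show ?thesis
  proof (rule that[OF nz])
    fix e :: real assume e: "0 < e"
    define e' where "e' = e / D"
    have e': "0 < e'" using e D by (simp add: e'_def)
    have "uniformly_continuous_on {-M..M} ?k"
      by (intro compact_uniformly_continuous nl_deriv_cont[OF p_gt_1] continuous_on_id) auto
    from this[unfolded uniformly_continuous_on_def, rule_format, OF e']
    obtain d where d: "d > 0" "\<And>x x'. x \<in> {-M..M} \<Longrightarrow> x' \<in> {-M..M} \<Longrightarrow> dist x' x < d \<Longrightarrow> dist (?k x') (?k x) < e'"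
      by metis
    have dm: "0 < min d 1" using d by simp
    from uniform_limit_evD[OF uniform_limit_Ust(1)[OF a(1) b] dm]
    show "\<forall>\<^sub>F \<epsilon> in at_right 0.
      \<bar>(Ue \<epsilon> b - Ust b) - (w1 b * (Ue \<epsilon> a - Ust a) + w2 b * (Ve \<epsilon> a - Vst a))\<bar>
      \<le> e * (\<bar>Ue \<epsilon> a - Ust a\<bar> + \<bar>Ve \<epsilon> a - Vst a\<bar>)"
    proof eventually_elim
      case (elim \<epsilon>)
      define z y where "z x = Ue \<epsilon> x - Ust x" and "y x = Ve \<epsilon> x - Vst x" for x
      define za where "za = \<bar>z a\<bar> + \<bar>y a\<bar>"
      have near: "\<bar>z x\<bar> < d" "\<bar>z x\<bar> < 1" if "x \<in> {a..b}" for x using elim that by (auto simp: z_def)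
      have bdM: "\<bar>Ust x\<bar> \<le> M" "\<bar>Ue \<epsilon> x\<bar> \<le> M" if x: "x \<in> {a..b}" for x
        using M0 near(2)[OF x] x unfolding M_def z_def by force+
      have s: "sol_at (Ue \<epsilon>) (Ve \<epsilon>) x" "sol_at Ust Vst x" if "x \<in> {a..b}" for x
        using that a b by (auto intro!: sol_at_Ue sol_at_Ust)
      have zb: "\<bar>z x\<bar> \<le> B * za" if x: "x \<in> {a..b}" for x
      proof -
        have "(z x)^2 + (y x)^2 \<le> ((z a)^2 + (y a)^2) * exp (L2 * (x - a))"
          unfolding z_def y_def by (rule L2(2)) (use x s bdM in auto)
        also have "\<dots> \<le> za^2 * B^2"
        proof (rule mult_mono)
          show "(z a)^2 + (y a)^2 \<le> za^2" by (simp add: za_def power2_sum)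
          have "exp (L2 * (x - a)) \<le> B" unfolding B_def using x L2 by (auto intro!: mult_left_mono)
          also have "\<dots> \<le> B^2" using B by (simp add: power2_eq_square)
          finally show "exp (L2 * (x - a)) \<le> B^2" .
        qed auto
        also have "\<dots> = (B * za)^2" by (simp add: power_mult_distrib)
        finally show ?thesis by (rule sum_squares_abs_le) (use B in \<open>simp add: za_def\<close>)
      qed
      define r where "r x = z x - (w1 x * z a + w2 x * y a)" for x
      define v where "v x = y x - (v1 x * z a + v2 x * y a)" for x
      \<comment> \<open>The source in the equation for the remainder r: its part cst * r is handled
        by Gronwall, and the rest is the mean value coefficient minus cst, times z.\<close>
      define h where "h x = (nl p (Ue \<epsilon> x) - nl p (Ust x)) - cst x * (w1 x * z a + w2 x * y a)" for x
      have c4: "isCont (Ue \<epsilon>) x" "isCont (Ve \<epsilon>) x" "isCont Ust x" "isCont Vst x" if "x \<in> {a..b}" for x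
        using s[OF that] unfolding sol_at_def by (blast dest: DERIV_isCont)+
      have zc: "continuous_on {a..b} z" "continuous_on {a..b} y"
        unfolding z_def y_def by (auto intro!: continuous_at_imp_continuous_on continuous_intros c4)
      have Uec: "continuous_on {a..b} (Ue \<epsilon>)"
        using continuous_on_add[OF zc(1) Uc] by (simp add: z_def)
      have rc: "continuous_on {a..b} r" "continuous_on {a..b} v" "continuous_on {a..b} h"
        unfolding r_def v_def h_def by (intro continuous_intros zc w1 w2 nl_comp_cont p_gt_1 Uec Uc cc)+
      have ra: "r a = 0" "v a = 0" by (simp_all add: r_def v_def w1 w2)
      have rd: "(r has_real_derivative v x) (at x)"
        "(v has_real_derivative - qs' x / qs x * v x - h x) (at x)" if x: "a < x" "x < b" for x
      proof -
        have xab: "x \<in> {a..b}" using x by simp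
        have sx: "sin x \<noteq> 0" using x a b sin_gt_zero[of x] by auto
        have dz: "(z has_real_derivative y x) (at x)"
          unfolding z_def[abs_def] y_def using s[OF xab] by (intro DERIV_diff) (auto simp: sol_at_def)
        have dy: "(y has_real_derivative (- qs' x / qs x * Ve \<epsilon> x - nl p (Ue \<epsilon> x)) - (- qs' x / qs x * Vst x - nl p (Ust x))) (at x)"
          unfolding y_def[abs_def] rhs_eq[OF sx] using s[OF xab] by (intro DERIV_diff) (auto simp: sol_at_def)
        show "(r has_real_derivative v x) (at x)"
          unfolding r_def[abs_def] v_def
          by (rule DERIV_cong[OF DERIV_diff[OF dz DERIV_add[OF DERIV_cmult_right[OF w1(5)[OF x]] DERIV_cmult_right[OF w2(5)[OF x]]]]]) simp
        show "(v has_real_derivative - qs' x / qs x * v x - h x) (at x)"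
          unfolding v_def[abs_def]
          by (rule DERIV_cong[OF DERIV_diff[OF dy DERIV_add[OF DERIV_cmult_right[OF w1(6)[OF x]] DERIV_cmult_right[OF w2(6)[OF x]]]]])
            (simp add: h_def y_def algebra_simps diff_divide_distrib add_divide_distrib)
      qed
      have "\<bar>r b\<bar> \<le> (0 + CM * (b - a)^2 * (e' * (B * za))) * exp (CM * (b - a) * Lc * (b - a))"
      proof (rule wavg_gronwall[where g = "\<lambda>_. 0" and H = h, OF rc(1) rc(3)])
        fix x assume x: "x \<in> {a..b}"
        show "r x = 0 - integral {a..x} (wavg qs a h)"
          using ode_imp_volterra(2)[OF rc rd _ ra(2) x] ra by simp
        obtain w where w: "\<bar>w - Ust x\<bar> \<le> \<bar>Ue \<epsilon> x - Ust x\<bar>" "min (Ust x) (Ue \<epsilon> x) \<le> w" "w \<le> max (Ust x) (Ue \<epsilon> x)"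
          "nl p (Ue \<epsilon> x) - nl p (Ust x) = ?k w * (Ue \<epsilon> x - Ust x)"
          using nl_mvt[OF p_gt_1] by metis
        have "dist (?k w) (?k (Ust x)) < e'"
          using bdM[OF x] w near(1)[OF x] by (intro d(2)) (auto simp: dist_real_def z_def)
        then have kw: "\<bar>?k w - cst x\<bar> \<le> e'" by (simp add: dist_real_def cst_def)
        have "h x = cst x * r x + (?k w - cst x) * z x"
          unfolding h_def w(4) r_def z_def by (simp add: algebra_simps)
        also have "\<bar>\<dots>\<bar> \<le> \<bar>cst x\<bar> * \<bar>r x\<bar> + \<bar>?k w - cst x\<bar> * \<bar>z x\<bar>" by (metis abs_mult abs_triangle_ineq)
        also have "\<dots> \<le> Lc * \<bar>r x\<bar> + e' * (B * za)"
          using Lc x kw zb[OF x] e' by (intro add_mono mult_mono mult_right_mono) auto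
        finally show "\<bar>h x\<bar> \<le> Lc * \<bar>r x\<bar> + e' * (B * za)" .
      qed (use a Lc0 e' B in \<open>auto simp: za_def\<close>)
      also have "\<dots> = e' * D * za" by (simp add: D_def)
      also have "\<dots> = e * za" using D by (simp add: e'_def)
      finally show ?case by (simp add: r_def z_def y_def za_def)
    qed
  qed
qed

end

section \<open>Rotation of the difference of two solutions\<close>

text \<open>For a solution of the unperturbed equation the pair (w + \<alpha>/2 u, \<beta> u)
  rotates at speed \<beta> and shrinks like exp (- \<alpha>/2 t). \<open>spiral\<close> undoes both
  and takes the component in a direction given by \<phi>; \<open>srad\<close> is the length of the
  pair.\<close>

definition spiral :: "real \<Rightarrow> real \<Rightarrow> real \<Rightarrow> real \<Rightarrow> real \<Rightarrow> real \<Rightarrow> real" where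
  "spiral \<alpha> \<beta> \<phi> t u w = exp (\<alpha> / 2 * t) * (cos (\<beta> * t + \<phi>) * (w + \<alpha> / 2 * u) + sin (\<beta> * t + \<phi>) * (\<beta> * u))"

definition srad :: "real \<Rightarrow> real \<Rightarrow> real \<Rightarrow> real \<Rightarrow> real" where
  "srad \<alpha> \<beta> u w = sqrt ((w + \<alpha> / 2 * u)^2 + (\<beta> * u)^2)"

text \<open>\<open>spiral\<close> is constant along the solutions of the unperturbed oscillator \<open>d'' + \<alpha> d' + m d = 0\<close>.\<close>
lemma spiral_almost_constant:
  fixes \<alpha> \<beta> m a b :: real and d x e h H :: "real \<Rightarrow> real"
  defines "c \<equiv> 1 + (1 + \<alpha> / 2) / \<beta>"
  assumes \<alpha>: "0 < \<alpha>" and \<beta>: "0 < \<beta>" "m = \<alpha>^2 / 4 + \<beta>^2" and ab: "a \<le> b"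
    and d: "\<And>t. t \<in> {a..b} \<Longrightarrow> (d has_real_derivative x t) (at t)"
    and x: "\<And>t. t \<in> {a..b} \<Longrightarrow> (x has_real_derivative - \<alpha> * x t - m * d t + e t) (at t)"
    and e: "\<And>t. t \<in> {a..b} \<Longrightarrow> \<bar>e t\<bar> \<le> h t * (\<bar>d t\<bar> + \<bar>x t\<bar>)" and h: "\<And>t. t \<in> {a..b} \<Longrightarrow> 0 \<le> h t"
    and H: "\<And>t. t \<in> {a..b} \<Longrightarrow> (H has_real_derivative h t) (at t)"
  shows "\<bar>spiral \<alpha> \<beta> \<phi> b (d b) (x b) - spiral \<alpha> \<beta> \<phi> a (d a) (x a)\<bar>
      \<le> exp (\<alpha> / 2 * a) * srad \<alpha> \<beta> (d a) (x a) * (exp (c * (H b - H a)) - 1)"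
    and "\<bar>d b\<bar> + \<bar>x b\<bar> \<le> c * (exp (- \<alpha> / 2 * (b - a)) * srad \<alpha> \<beta> (d a) (x a) * exp (c * (H b - H a)))"
proof -
  define z1 where "z1 u w = w + \<alpha> / 2 * u" for u w :: real
  define z2 where "z2 u = \<beta> * u" for u :: real
  define Y1 where "Y1 u w t = exp (\<alpha> / 2 * t) * (cos (\<beta> * t) * z1 u w + sin (\<beta> * t) * z2 u)" for u w t
  define Y2 where "Y2 u w t = exp (\<alpha> / 2 * t) * (cos (\<beta> * t) * z2 u - sin (\<beta> * t) * z1 u w)" for u w t
  define S where "S t = sqrt (z1 (d t) (x t)^2 + z2 (d t)^2)" for t
  define Y y where "Y t = Y1 (d t) (x t) t" and "y t = Y2 (d t) (x t) t" for t
  define N where "N t = Y t^2 + y t^2" for t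
  have c: "0 < c" unfolding c_def using \<alpha> \<beta> by (intro add_pos_nonneg) auto
  \<comment> \<open>The counter-rotation is an isometry, so N is the squared length of the pair
    times the square of the exponential.\<close>
  have NS: "N t = (exp (\<alpha> / 2 * t) * S t)^2" for t
  proof -
    define C s where "C = cos (\<beta> * t)" and "s = sin (\<beta> * t)"
    have cs: "C^2 + s^2 = 1" by (simp add: C_def s_def)
    have "(C * p + s * q)^2 + (C * q - s * p)^2 = (C^2 + s^2) * (p^2 + q^2)" for p q :: real
      by (simp add: power2_eq_square algebra_simps)
    then have r: "(C * p + s * q)^2 + (C * q - s * p)^2 = p^2 + q^2" for p q :: real by (simp add: cs)
    have "N t = exp (\<alpha> / 2 * t)^2 * ((C * z1 (d t) (x t) + s * z2 (d t))^2 + (C * z2 (d t) - s * z1 (d t) (x t))^2)"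
      by (simp add: N_def Y_def y_def Y1_def Y2_def C_def s_def power_mult_distrib del: distrib_left_numeral flip: distrib_left)
    then show ?thesis unfolding r by (simp add: S_def power_mult_distrib)
  qed
  have S0: "0 \<le> S t" for t by (simp add: S_def)
  have z1d: "((\<lambda>t. z1 (d t) (x t)) has_real_derivative - (\<alpha> / 2) * z1 (d t) (x t) - \<beta> * z2 (d t) + e t) (at t)"
    and z2d: "((\<lambda>t. z2 (d t)) has_real_derivative \<beta> * z1 (d t) (x t) - (\<alpha> / 2) * z2 (d t)) (at t)" if t: "t \<in> {a..b}" for t
  proof -
    show "((\<lambda>t. z1 (d t) (x t)) has_real_derivative - (\<alpha> / 2) * z1 (d t) (x t) - \<beta> * z2 (d t) + e t) (at t)"
      unfolding z1_def z2_def
      by (rule DERIV_cong[OF DERIV_add[OF x[OF t] DERIV_cmult[OF d[OF t]]]])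
        (simp add: \<beta>(2) power2_eq_square field_simps)
    show "((\<lambda>t. z2 (d t)) has_real_derivative \<beta> * z1 (d t) (x t) - (\<alpha> / 2) * z2 (d t)) (at t)"
      unfolding z1_def z2_def
      by (rule DERIV_cong[OF DERIV_cmult[OF d[OF t]]]) (simp add: algebra_simps)
  qed
  have Yd: "(Y has_real_derivative exp (\<alpha> / 2 * t) * cos (\<beta> * t) * e t) (at t)"
    and yd: "(y has_real_derivative - (exp (\<alpha> / 2 * t) * sin (\<beta> * t) * e t)) (at t)" if t: "t \<in> {a..b}" for t
  proof -
    have E: "((\<lambda>t. exp (\<alpha> / 2 * t)) has_real_derivative \<alpha> / 2 * exp (\<alpha> / 2 * t)) (at t)"
      and C: "((\<lambda>t. cos (\<beta> * t)) has_real_derivative - \<beta> * sin (\<beta> * t)) (at t)"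
      and s: "((\<lambda>t. sin (\<beta> * t)) has_real_derivative \<beta> * cos (\<beta> * t)) (at t)"
      by (auto intro!: derivative_eq_intros)
    show "(Y has_real_derivative exp (\<alpha> / 2 * t) * cos (\<beta> * t) * e t) (at t)"
      unfolding Y_def[abs_def] Y1_def
      by (rule DERIV_cong[OF DERIV_mult[OF E DERIV_add[OF DERIV_mult[OF C z1d[OF t]] DERIV_mult[OF s z2d[OF t]]]]])
        (simp add: algebra_simps)
    show "(y has_real_derivative - (exp (\<alpha> / 2 * t) * sin (\<beta> * t) * e t)) (at t)"
      unfolding y_def[abs_def] Y2_def
      by (rule DERIV_cong[OF DERIV_mult[OF E DERIV_diff[OF DERIV_mult[OF C z2d[OF t]] DERIV_mult[OF s z1d[OF t]]]]])
        (simp add: algebra_simps)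
  qed
  \<comment> \<open>Inverting the map from (d, x) to (z1, z2) gives the constant c: |d| \<le>
    S/\<beta> and |x| \<le> S + \<alpha>/2 * S/\<beta>.\<close>
  have dxS: "\<bar>d t\<bar> + \<bar>x t\<bar> \<le> c * S t" for t
  proof -
    have 1: "\<bar>z1 (d t) (x t)\<bar> \<le> S t" "\<bar>z2 (d t)\<bar> \<le> S t"
      by (auto simp: S_def intro!: real_le_rsqrt)
    have dS: "\<bar>d t\<bar> \<le> S t / \<beta>" using 1(2) \<beta> by (simp add: z2_def abs_mult pos_le_divide_eq mult.commute)
    have "\<bar>\<alpha> / 2 * d t\<bar> \<le> \<alpha> / 2 * (S t / \<beta>)"
      using mult_left_mono[OF dS, of "\<alpha> / 2"] \<alpha> by (simp add: abs_mult)
    then have "\<bar>x t\<bar> \<le> S t + \<alpha> / 2 * (S t / \<beta>)" using 1(1) unfolding z1_def by linarith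
    then have "\<bar>d t\<bar> + \<bar>x t\<bar> \<le> S t / \<beta> + (S t + \<alpha> / 2 * (S t / \<beta>))" using dS by linarith
    also have "\<dots> = c * S t" unfolding c_def using \<beta>(1) by (simp add: field_simps)
    finally show ?thesis .
  qed
  have eb: "exp (\<alpha> / 2 * t) * \<bar>e t\<bar> \<le> c * h t * sqrt (N t)" if t: "t \<in> {a..b}" for t
  proof -
    have "h t * (\<bar>d t\<bar> + \<bar>x t\<bar>) \<le> h t * (c * S t)" by (rule mult_left_mono[OF dxS h[OF t]])
    then have "\<bar>e t\<bar> \<le> h t * (c * S t)" using e[OF t] by linarith
    then have "exp (\<alpha> / 2 * t) * \<bar>e t\<bar> \<le> exp (\<alpha> / 2 * t) * (h t * (c * S t))" by (rule mult_left_mono) simp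
    moreover have "sqrt (N t) = exp (\<alpha> / 2 * t) * S t" unfolding NS using S0 by simp
    ultimately show ?thesis by (simp add: mult.left_commute mult.commute)
  qed
  have cont: "continuous_on {a..t} Y" "continuous_on {a..t} y" "continuous_on {a..t} H" if "t \<in> {a..b}" for t
    using that by (auto intro!: DERIV_continuous_on[OF has_field_derivative_at_within[OF Yd]]
       DERIV_continuous_on[OF has_field_derivative_at_within[OF yd]]
       DERIV_continuous_on[OF has_field_derivative_at_within[OF H]])
  have Nb: "sqrt (N t) \<le> sqrt (N a) * exp (c * (H t - H a))" if t: "t \<in> {a..b}" for t
  proof -
    let ?f = "\<lambda>t. N t * exp (- 2 * c * H t)"
    let ?N' = "\<lambda>t. 2 * Y t * (exp (\<alpha> / 2 * t) * cos (\<beta> * t) * e t) + 2 * y t * (- (exp (\<alpha> / 2 * t) * sin (\<beta> * t) * e t))"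
    have "?f t \<le> ?f a"
    proof (rule deriv_nonpos_imp_le[where f = ?f and f' = "\<lambda>t. (?N' t - 2 * c * h t * N t) * exp (- 2 * c * H t)"])
      show "a \<le> t" using t by simp
      show "continuous_on {a..t} ?f" unfolding N_def by (intro continuous_intros cont t)
      fix s assume "a < s" "s < t"
      then have s: "s \<in> {a..b}" using t by simp
      have Nd: "(N has_real_derivative ?N' s) (at s)"
        unfolding N_def[abs_def]
        by (rule DERIV_cong[OF DERIV_add[OF DERIV_power[OF Yd[OF s]] DERIV_power[OF yd[OF s]]]]) simp
      have Ed: "((\<lambda>t. exp (- 2 * c * H t)) has_real_derivative exp (- 2 * c * H s) * (- 2 * c * h s)) (at s)"
        by (rule DERIV_chain2[OF DERIV_exp DERIV_cmult[OF H[OF s]]])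
      show "(?f has_real_derivative (?N' s - 2 * c * h s * N s) * exp (- 2 * c * H s)) (at s)"
        by (rule DERIV_cong[OF DERIV_mult[OF Nd Ed]]) (simp only: left_diff_distrib, simp)
      \<comment> \<open>Cauchy-Schwarz with a unit vector; the missing square is exhibited
        explicitly.\<close>
      have "(Y s * cos (\<beta> * s) - y s * sin (\<beta> * s))^2 \<le> N s"
      proof -
        have "N s * (C^2 + S'^2) - (Y s * C - y s * S')^2 = (Y s * S' + y s * C)^2" for C S'
          unfolding N_def power2_eq_square by (simp add: algebra_simps)
        from this[of "cos (\<beta> * s)" "sin (\<beta> * s)"]
        have "N s - (Y s * cos (\<beta> * s) - y s * sin (\<beta> * s))^2 = (Y s * sin (\<beta> * s) + y s * cos (\<beta> * s))^2" by simp
        then show ?thesis using zero_le_power2[of "Y s * sin (\<beta> * s) + y s * cos (\<beta> * s)"] by linarith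
      qed
      then have "\<bar>Y s * cos (\<beta> * s) - y s * sin (\<beta> * s)\<bar> \<le> sqrt (N s)" by (intro real_le_rsqrt) simp
      then have "exp (\<alpha> / 2 * s) * \<bar>e s\<bar> * \<bar>Y s * cos (\<beta> * s) - y s * sin (\<beta> * s)\<bar> \<le> (c * h s * sqrt (N s)) * sqrt (N s)"
        by (rule mult_mono[OF eb[OF s]]) (use c h[OF s] in \<open>auto simp: N_def intro!: mult_nonneg_nonneg\<close>)
      also have "\<dots> = c * h s * N s" by (simp add: N_def mult.assoc)
      finally have 1: "exp (\<alpha> / 2 * s) * \<bar>e s\<bar> * \<bar>Y s * cos (\<beta> * s) - y s * sin (\<beta> * s)\<bar> \<le> c * h s * N s" .
      have "?N' s = 2 * (exp (\<alpha> / 2 * s) * e s * (Y s * cos (\<beta> * s) - y s * sin (\<beta> * s)))"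
        by (simp add: algebra_simps)
      also have "exp (\<alpha> / 2 * s) * e s * (Y s * cos (\<beta> * s) - y s * sin (\<beta> * s)) \<le> \<bar>exp (\<alpha> / 2 * s) * e s * (Y s * cos (\<beta> * s) - y s * sin (\<beta> * s))\<bar>"
        by (rule abs_ge_self)
      also have "\<dots> = exp (\<alpha> / 2 * s) * \<bar>e s\<bar> * \<bar>Y s * cos (\<beta> * s) - y s * sin (\<beta> * s)\<bar>" by (simp add: abs_mult)
      finally have "?N' s \<le> 2 * (c * h s * N s)" using 1 by simp
      then show "(?N' s - 2 * c * h s * N s) * exp (- 2 * c * H s) \<le> 0" by (intro mult_nonpos_nonneg) auto
    qed
    then have "N t * exp (- 2 * c * H t) * exp (2 * c * H t) \<le> N a * exp (- 2 * c * H a) * exp (2 * c * H t)"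
      by (intro mult_right_mono) auto
    then have "N t \<le> N a * exp (2 * (c * (H t - H a)))"
      by (simp add: mult.assoc algebra_simps flip: exp_add)
    then have "sqrt (N t) \<le> sqrt (N a * exp (2 * (c * (H t - H a))))" by (rule real_sqrt_le_mono)
    also have "\<dots> = sqrt (N a) * exp (c * (H t - H a))" by (simp add: real_sqrt_mult exp_double)
    finally show ?thesis .
  qed
  have sN: "sqrt (N t) = exp (\<alpha> / 2 * t) * S t" for t unfolding NS using S0 by simp
  \<comment> \<open>Mean value estimate against a majorant with known primitive: the integral of c h
    exp (c (H - H a)) is exp (c (H b - H a)) - 1, which keeps the error proportional to the initial
    amplitude.\<close>
  have inc: "\<bar>F b - F a\<bar> \<le> sqrt (N a) * (exp (c * (H b - H a)) - 1)"
    if F: "\<And>t. t \<in> {a..b} \<Longrightarrow> (F has_real_derivative F' t) (at t)"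
      and F': "\<And>t. t \<in> {a..b} \<Longrightarrow> \<bar>F' t\<bar> \<le> exp (\<alpha> / 2 * t) * \<bar>e t\<bar>" for F F' :: "real \<Rightarrow> real"
  proof (cases "a = b")
    case False
    then have "a < b" using ab by simp
    let ?\<phi> = "\<lambda>t. sqrt (N a) * exp (c * (H t - H a))"
    have "norm (F b - F a) \<le> ?\<phi> b - ?\<phi> a"
    proof (rule differentiable_bound_general[OF \<open>a < b\<close>, where f' = F' and \<phi>' = "\<lambda>t. sqrt (N a) * (exp (c * (H t - H a)) * (c * h t))"])
      show "continuous_on {a..b} F" by (rule DERIV_continuous_on[OF has_field_derivative_at_within[OF F]])
      show "continuous_on {a..b} ?\<phi>" using ab by (intro continuous_intros cont) auto
      fix t assume "a < t" "t < b"
      then have t: "t \<in> {a..b}" by simp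
      show "(F has_vector_derivative F' t) (at t)"
        using F[OF t] by (simp add: has_real_derivative_iff_has_vector_derivative)
      show "(?\<phi> has_vector_derivative sqrt (N a) * (exp (c * (H t - H a)) * (c * h t))) (at t)"
        unfolding has_real_derivative_iff_has_vector_derivative[symmetric]
        by (auto intro!: derivative_eq_intros H[OF t])
      have "\<bar>F' t\<bar> \<le> c * h t * sqrt (N t)" using F'[OF t] eb[OF t] by linarith
      also have "\<dots> \<le> c * h t * (sqrt (N a) * exp (c * (H t - H a)))"
        using Nb[OF t] c h[OF t] by (intro mult_left_mono) auto
      finally show "norm (F' t) \<le> sqrt (N a) * (exp (c * (H t - H a)) * (c * h t))" by (simp add: mult.commute mult.left_commute)
    qed
    then show ?thesis by (simp add: algebra_simps)
  qed simp
  have Fd: "((\<lambda>t. spiral \<alpha> \<beta> \<phi> t (d t) (x t)) has_real_derivative exp (\<alpha> / 2 * t) * cos (\<beta> * t + \<phi>) * e t) (at t)"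
    if t: "t \<in> {a..b}" for t
  proof -
    have "spiral \<alpha> \<beta> \<phi> t (d t) (x t) = cos \<phi> * Y t + sin \<phi> * y t" for t
      by (simp add: spiral_def Y_def y_def Y1_def Y2_def z1_def z2_def cos_add sin_add algebra_simps)
    then show ?thesis
      by simp (rule DERIV_cong[OF DERIV_add[OF DERIV_cmult[OF Yd[OF t]] DERIV_cmult[OF yd[OF t]]]],
        simp add: cos_add algebra_simps)
  qed
  have "\<bar>exp (\<alpha> / 2 * t) * cos (\<beta> * t + \<phi>) * e t\<bar> \<le> exp (\<alpha> / 2 * t) * \<bar>e t\<bar>" for t
    using mult_right_mono[OF abs_cos_le_one[of "\<beta> * t + \<phi>"], of "exp (\<alpha> / 2 * t) * \<bar>e t\<bar>"] by (simp add: abs_mult mult.commute mult.left_commute)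
  from inc[OF Fd this]
  show "\<bar>spiral \<alpha> \<beta> \<phi> b (d b) (x b) - spiral \<alpha> \<beta> \<phi> a (d a) (x a)\<bar>
      \<le> exp (\<alpha> / 2 * a) * srad \<alpha> \<beta> (d a) (x a) * (exp (c * (H b - H a)) - 1)"
    by (simp add: sN S_def z1_def z2_def srad_def)
  have "exp (\<alpha> / 2 * b) * S b \<le> exp (\<alpha> / 2 * a) * S a * exp (c * (H b - H a))"
    using Nb[of b] ab by (simp add: sN)
  then have "exp (- \<alpha> / 2 * b) * (exp (\<alpha> / 2 * b) * S b) \<le> exp (- \<alpha> / 2 * b) * (exp (\<alpha> / 2 * a) * S a * exp (c * (H b - H a)))"
    by (intro mult_left_mono) auto
  moreover have e1: "exp (- \<alpha> / 2 * b) * exp (\<alpha> / 2 * b) = 1" by (simp flip: exp_add)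
  moreover have e2: "exp (- \<alpha> / 2 * b) * exp (\<alpha> / 2 * a) = exp (- \<alpha> / 2 * (b - a))"
    by (simp add: algebra_simps diff_divide_distrib flip: exp_add)
  ultimately have "S b \<le> exp (- \<alpha> / 2 * (b - a)) * S a * exp (c * (H b - H a))"
    by (simp only: mult.assoc[symmetric] e1 e2 mult_1_left)
  then have "c * S b \<le> c * (exp (- \<alpha> / 2 * (b - a)) * S a * exp (c * (H b - H a)))" using c by simp
  then show "\<bar>d b\<bar> + \<bar>x b\<bar> \<le> c * (exp (- \<alpha> / 2 * (b - a)) * srad \<alpha> \<beta> (d a) (x a) * exp (c * (H b - H a)))"
    using dxS[of b] by (simp add: S_def z1_def z2_def srad_def)
qed

lemma polar_pos:
  fixes x y :: real
  assumes "x \<noteq> 0 \<or> y \<noteq> 0"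
  obtains r a where "0 < r" "x = r * cos a" "y = r * sin a"
proof -
  obtain r a where ra: "x = r * cos a" "y = r * sin a" using polar_Ex by blast
  show thesis
  proof (cases "0 < r")
    case True
    then show thesis using ra that by blast
  next
    case False
    then have "0 < - r" using assms ra by (cases "r = 0") auto
    moreover have "x = - r * cos (a + pi)" "y = - r * sin (a + pi)" using ra by auto
    ultimately show thesis by (rule that)
  qed
qed

text \<open>A nonzero linear functional of (u, w) is a positive multiple of \<open>spiral\<close>
  for a suitable phase. Hence passing to the linear part of the value of U at \<Theta>s only shifts
  the phase and rescales the amplitude.\<close>

lemma spiral_functional:
  assumes \<beta>: "\<beta> \<noteq> 0" and k: "k1 \<noteq> 0 \<or> k2 \<noteq> 0"
  obtains r \<phi> where "0 < r" "\<And>u w. k1 * u + k2 * w = r * spiral \<alpha> \<beta> \<phi> b u w"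
proof -
  define k1' where "k1' = (k1 - \<alpha> / 2 * k2) / \<beta>"
  have "k2 \<noteq> 0 \<or> k1' \<noteq> 0" using k \<beta> by (auto simp: k1'_def)
  then obtain r \<psi> where r: "0 < r" "k2 = r * cos \<psi>" "k1' = r * sin \<psi>" by (rule polar_pos)
  have e: "exp (- (\<alpha> / 2 * b)) * exp (\<alpha> / 2 * b) = 1" by (simp flip: exp_add)
  show thesis
  proof (rule that[of "r * exp (- (\<alpha> / 2 * b))" "\<psi> - \<beta> * b"])
    fix u w
    have "k1 * u + k2 * w = k2 * (w + \<alpha> / 2 * u) + k1' * (\<beta> * u)"
      using \<beta> by (simp add: k1'_def field_simps)
    also have "\<dots> = r * (exp (- (\<alpha> / 2 * b)) * exp (\<alpha> / 2 * b)) * (cos \<psi> * (w + \<alpha> / 2 * u) + sin \<psi> * (\<beta> * u))"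
      unfolding r(2,3) e by (simp add: algebra_simps)
    also have "\<dots> = r * exp (- (\<alpha> / 2 * b)) * spiral \<alpha> \<beta> (\<psi> - \<beta> * b) b u w"
      by (simp add: spiral_def)
    finally show "k1 * u + k2 * w = r * exp (- (\<alpha> / 2 * b)) * spiral \<alpha> \<beta> (\<psi> - \<beta> * b) b u w" .
  qed (use r in simp)
qed

context sphere_problem
begin

text \<open>With m = 2(N - 2 - \<mu>) the claim reads (\<alpha> - 2)^2 < 4(N - 1). The lower bound
  for \<alpha> - 2 holds since \<alpha> > 0 and r \<ge> 1; the upper bound is B < 2\<mu>, which for
  B > 0 means p < 1 + 4/B, while B \<le> 0 if N \<le> 10.\<close>

lemma below_JL_oscillatory:
  assumes "below_JL N p"
  shows "\<alpha>^2 < 4 * m"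
proof -
  define r B where "r = sqrt (real N - 1)" and "B = real N - 4 - 2 * r"
  have r: "r^2 = real N - 1" "0 \<le> r" using N by (simp_all add: r_def)
  have r1: "1 \<le> r" using N by (simp add: r_def)
  have m2: "m = 2 * (real N - 2 - \<mu>)" using mu_facts(2) unfolding m_def \<kappa>_def by (simp add: mult.assoc[symmetric] mult.commute)
  have "B < 2 * \<mu>"
  proof (cases "B \<le> 0")
    case True
    then show ?thesis using mu_facts by simp
  next
    case False
    have "\<not> N \<le> 10"
    proof
      assume "N \<le> 10"
      then have "(real N - 2) * (real N - 10) \<le> 0" using N by (intro mult_nonneg_nonpos) auto
      then have "(real N - 4)^2 \<le> (2 * r)^2" using r(1) by (simp add: power_mult_distrib) (simp add: power2_eq_square algebra_simps)
      then have "real N - 4 \<le> 2 * r" by (rule power2_le_imp_le) (use r in simp)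
      then show False using False by (simp add: B_def)
    qed
    then have "p - 1 < 4 / B" using assms by (simp add: below_JL_def B_def r_def)
    then have "B * (p - 1) < 2 * \<mu> * (p - 1)" using False mu_facts(2) by (simp add: field_simps)
    then show ?thesis using p_gt_1 by simp
  qed
  then have "\<alpha> - 2 < 2 * r" "- 2 * r < \<alpha> - 2" using mu_facts(3) r1 by (auto simp: \<alpha>_def B_def)
  then have "\<bar>\<alpha> - 2\<bar> < 2 * r" by linarith
  then have "\<bar>\<alpha> - 2\<bar>^2 < (2 * r)^2" by (intro power_strict_mono) auto
  then have "(\<alpha> - 2)^2 < (2 * r)^2" by simp
  then have "\<alpha>^2 - 4 * \<alpha> + 4 < 4 * (real N - 1)" using r(1) by (simp add: power_mult_distrib power2_diff)
  then show ?thesis by (simp add: m2 \<alpha>_def)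
qed

text \<open>Up to a time \<open>T\<close> that does not depend on \<open>\<epsilon>\<close>, the difference between the regular and the singular solution
  spirals like a solution of \<open>d'' + \<alpha> d' + m d = 0\<close>: the total perturbation is small, since both solutions are
  close to \<open>A\<close> except for terms which are integrable uniformly in \<open>\<epsilon>\<close>.\<close>
lemma spiral_family:
  assumes osc: "\<alpha>^2 < 4 * m"
  defines "\<beta> \<equiv> sqrt (m - \<alpha>^2 / 4)"
  obtains T R C where "T \<le> T1" "0 < R" "0 < C"
    "\<forall>\<^sub>F \<epsilon> in at_right 0. \<forall>\<phi>.
      \<bar>spiral \<alpha> \<beta> \<phi> T (We \<epsilon> T - Wst T) (Xe \<epsilon> T - Xst T)
        - spiral \<alpha> \<beta> \<phi> (tl (\<epsilon> * R)) (We \<epsilon> (tl (\<epsilon> * R)) - Wst (tl (\<epsilon> * R))) (Xe \<epsilon> (tl (\<epsilon> * R)) - Xst (tl (\<epsilon> * R)))\<bar>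
      \<le> exp (\<alpha> / 2 * tl (\<epsilon> * R)) * srad \<alpha> \<beta> (We \<epsilon> (tl (\<epsilon> * R)) - Wst (tl (\<epsilon> * R))) (Xe \<epsilon> (tl (\<epsilon> * R)) - Xst (tl (\<epsilon> * R))) / 4
      \<and> \<bar>We \<epsilon> T - Wst T\<bar> + \<bar>Xe \<epsilon> T - Xst T\<bar>
      \<le> C * (exp (\<alpha> / 2 * tl (\<epsilon> * R)) * srad \<alpha> \<beta> (We \<epsilon> (tl (\<epsilon> * R)) - Wst (tl (\<epsilon> * R))) (Xe \<epsilon> (tl (\<epsilon> * R)) - Xst (tl (\<epsilon> * R))))"
proof -
  have \<beta>: "0 < \<beta>" "m = \<alpha>^2 / 4 + \<beta>^2" using osc by (simp_all add: \<beta>_def)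
  define c where "c = 1 + (1 + \<alpha> / 2) / \<beta>"
  have c: "0 < c" unfolding c_def using mu_facts \<beta> by (intro add_pos_nonneg) auto
  obtain K where K: "0 < K" "\<And>y z. \<bar>y - A\<bar> \<le> A/2 \<Longrightarrow> \<bar>z - A\<bar> \<le> A/2 \<Longrightarrow>
      \<bar>nl p y - nl p z - (m + \<kappa>) * (y - z)\<bar> \<le> K * (\<bar>y - A\<bar> + \<bar>z - A\<bar>) * \<bar>y - z\<bar>"
    by (rule nl_near_A) blast
  have A2: "0 < A / 2" using A_facts by simp
  obtain T0 C \<eta> where C: "1 \<le> C" "0 < \<eta>" and fam: "\<And>\<zeta>. 0 < \<zeta> \<Longrightarrow> \<exists>R>0. (W0 (ln R) - A)^2 + X0 (ln R)^2 < \<zeta> \<and>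
      (\<forall>\<^sub>F \<epsilon> in at_right 0. \<forall>t\<in>{tl (\<epsilon> * R)..T0}. \<bar>We \<epsilon> t - A\<bar> < A / 2 \<and>
        (We \<epsilon> t - A)^2 + Xe \<epsilon> t^2 \<le> C * \<zeta> * exp (- 2 * \<eta> * (t - tl (\<epsilon> * R))) + C * exp (4 * t))"
    by (rule ef_family[OF A2]) blast
  obtain T0' C' where C': "1 \<le> C'" and st: "\<And>t. t \<le> T0' \<Longrightarrow> (Wst t - A)^2 + Xst t^2 \<le> C' * exp (4 * t)"
    by (rule Wst_near_A) blast
  \<comment> \<open>Coefficients of the bound h = a0 exp (2t) + b0 z exp (- \<eta> (t - t1)): a0
    collects the corrections of friction and curvature and the part of the quadratic term of order
    exp (2t), b0 the initial distance of the family from A.\<close>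
  define a0 b0 where "a0 = 2 * \<alpha> + K * (C + C') + 4 * (\<kappa> + \<mu>)" and "b0 = K * C"
  have a0: "0 < a0" unfolding a0_def using mu_facts K C C' by (intro add_pos_pos mult_pos_pos) auto
  have b0: "0 < b0" using K C by (simp add: b0_def)
  \<comment> \<open>Budget for c times the integral of h: exp \<tau> = 5/4 leaves a relative error
    of 1/4.\<close>
  define \<tau> :: real where "\<tau> = ln (5/4)"
  have \<tau>: "0 < \<tau>" by (simp add: \<tau>_def)
  \<comment> \<open>The exponentially decaying part of h has integral at most b0 z / \<eta>,
    whatever the length of the interval; this z makes its share \<tau>/2.\<close>
  define z where "z = \<tau> * \<eta> / (2 * c * b0)"
  have z: "0 < z" using \<tau> C c b0 by (simp add: z_def)
  \<comment> \<open>Bounds for exp (2T): \<tau>1 keeps Wst within A/2 of A, and \<tau>2 gives the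
    part a0 exp (2t) the other half of the budget.\<close>
  define \<tau>1 \<tau>2 where "\<tau>1 = A / 2 / C'" and "\<tau>2 = \<tau> / (c * a0)"
  have \<tau>12: "0 < \<tau>1" "0 < \<tau>2" using A2 C' \<tau> c a0 by (simp_all add: \<tau>1_def \<tau>2_def)
  define T where "T = min T1 (min T0 (min T0' (min (ln \<tau>1 / 2) (ln \<tau>2 / 2))))"
  have T: "T \<le> T1" "T \<le> T0" "T \<le> T0'" "T \<le> ln \<tau>1 / 2" "T \<le> ln \<tau>2 / 2"
    by (simp_all add: T_def)
  \<comment> \<open>\<open>ef_family\<close> bounds squared distances, hence the square of z
    here.\<close>
  have "0 < z^2" using z by simp
  from fam[OF this] obtain R where R: "0 < R"
    and ev: "\<forall>\<^sub>F \<epsilon> in at_right 0. \<forall>t\<in>{tl (\<epsilon> * R)..T0}. \<bar>We \<epsilon> t - A\<bar> < A / 2 \<and>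
        (We \<epsilon> t - A)^2 + Xe \<epsilon> t^2 \<le> C * z^2 * exp (- 2 * \<eta> * (t - tl (\<epsilon> * R))) + C * exp (4 * t)"
    by blast
  have stA: "\<bar>Wst t - A\<bar> \<le> C' * exp (2 * t)" if t: "t \<le> T" for t
  proof (rule sum_squares_abs_le(1))
    have "(Wst t - A)^2 + Xst t^2 \<le> C' * exp (4 * t)" using st t T by simp
    also have "\<dots> \<le> C'^2 * exp (4 * t)" using C' by (intro mult_right_mono) (auto simp: power2_eq_square)
    also have "\<dots> = (C' * exp (2 * t))^2" by (simp add: power_mult_distrib flip: exp_double)
    finally show "(Wst t - A)^2 + Xst t^2 \<le> (C' * exp (2 * t))^2" .
  qed (use C' in simp)
  have stA2: "\<bar>Wst t - A\<bar> \<le> A / 2" if t: "t \<le> T" for t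
  proof -
    have "exp (2 * t) \<le> \<tau>1" using exp2_small[OF \<tau>12(1)] t T by simp
    then have "C' * exp (2 * t) \<le> C' * \<tau>1" using C' by simp
    also have "\<dots> = A / 2" using C' by (simp add: \<tau>1_def)
    finally show ?thesis using stA[OF t] by simp
  qed
  define C2 where "C2 = c * exp (- \<alpha> / 2 * T) * (5 / 4)"
  have C2: "0 < C2" using c by (simp add: C2_def)
  have evT: "\<forall>\<^sub>F \<epsilon> in at_right 0. tl (\<epsilon> * R) \<le> T"
    using tl_scaled_at_bot[OF R] by (simp add: filterlim_at_bot)
  show thesis
  proof (rule that[OF T(1) R C2])
    from ev evT show "\<forall>\<^sub>F \<epsilon> in at_right 0. \<forall>\<phi>.
      \<bar>spiral \<alpha> \<beta> \<phi> T (We \<epsilon> T - Wst T) (Xe \<epsilon> T - Xst T)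
        - spiral \<alpha> \<beta> \<phi> (tl (\<epsilon> * R)) (We \<epsilon> (tl (\<epsilon> * R)) - Wst (tl (\<epsilon> * R))) (Xe \<epsilon> (tl (\<epsilon> * R)) - Xst (tl (\<epsilon> * R)))\<bar>
      \<le> exp (\<alpha> / 2 * tl (\<epsilon> * R)) * srad \<alpha> \<beta> (We \<epsilon> (tl (\<epsilon> * R)) - Wst (tl (\<epsilon> * R))) (Xe \<epsilon> (tl (\<epsilon> * R)) - Xst (tl (\<epsilon> * R))) / 4
      \<and> \<bar>We \<epsilon> T - Wst T\<bar> + \<bar>Xe \<epsilon> T - Xst T\<bar>
      \<le> C2 * (exp (\<alpha> / 2 * tl (\<epsilon> * R)) * srad \<alpha> \<beta> (We \<epsilon> (tl (\<epsilon> * R)) - Wst (tl (\<epsilon> * R))) (Xe \<epsilon> (tl (\<epsilon> * R)) - Xst (tl (\<epsilon> * R))))"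
    proof eventually_elim
      case (elim \<epsilon>)
      define t1 where "t1 = tl (\<epsilon> * R)"
      define d x where "d t = We \<epsilon> t - Wst t" and "x t = Xe \<epsilon> t - Xst t" for t
      define e where "e t = \<alpha> * (1 - cos (th t)) * x t - (nl p (We \<epsilon> t) - nl p (Wst t) - (m + \<kappa>) * d t)
        - (\<kappa> + \<mu>) * sin (th t)^2 * d t" for t
      define h where "h t = a0 * exp (2 * t) + b0 * z * exp (- \<eta> * (t - t1))" for t
      define H where "H t = a0 / 2 * exp (2 * t) - b0 * z / \<eta> * exp (- \<eta> * (t - t1))" for t
      have t1T: "t1 \<le> T" using elim(2) by (simp add: t1_def)
      have efs: "ef_at Wst Xst t" for t by (rule ef_at_sol[OF sol_at_Ust[OF th_bounds]])
      have dd: "(d has_real_derivative x t) (at t)" for t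
        unfolding d_def[abs_def] x_def using ef_at_We[of \<epsilon> t] efs[of t] by (intro DERIV_diff) (auto simp: ef_at_def)
      have xd: "(x has_real_derivative - \<alpha> * x t - m * d t + e t) (at t)" for t
      proof -
        have 1: "(Xe \<epsilon> has_real_derivative - \<alpha> * cos (th t) * Xe \<epsilon> t + \<kappa> * We \<epsilon> t - nl p (We \<epsilon> t) - (\<kappa> + \<mu>) * sin (th t) ^ 2 * We \<epsilon> t) (at t)"
          using ef_at_We[of \<epsilon> t] by (simp add: ef_at_def)
        have 2: "(Xst has_real_derivative - \<alpha> * cos (th t) * Xst t + \<kappa> * Wst t - nl p (Wst t) - (\<kappa> + \<mu>) * sin (th t) ^ 2 * Wst t) (at t)"
          using efs[of t] by (simp add: ef_at_def)
        show ?thesis unfolding x_def[abs_def]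
          by (rule DERIV_cong[OF DERIV_diff[OF 1 2]]) (simp add: e_def d_def x_def algebra_simps)
      qed
      have Hd: "(H has_real_derivative h t) (at t)" for t
        unfolding H_def[abs_def] h_def using C by (auto intro!: derivative_eq_intros)
      have h0: "0 \<le> h t" for t using a0 b0 z by (simp add: h_def)
      have eb: "\<bar>e t\<bar> \<le> h t * (\<bar>d t\<bar> + \<bar>x t\<bar>)" if t: "t \<in> {t1..T}" for t
      proof -
        define E F where "E = exp (- \<eta> * (t - t1))" and "F = exp (2 * t)"
        have EF: "0 < E" "0 < F" by (simp_all add: E_def F_def)
        have t0: "t \<in> {tl (\<epsilon> * R)..T0}" "t \<le> T" using t T by (auto simp: t1_def)
        have sq: "exp (- 2 * \<eta> * (t - tl (\<epsilon> * R))) = E^2" "exp (4 * t) = F^2"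
          by (simp_all add: E_def F_def t1_def algebra_simps flip: exp_double)
        from elim(1)[rule_format, OF t0(1), unfolded sq] have W: "\<bar>We \<epsilon> t - A\<bar> < A / 2" "(We \<epsilon> t - A)^2 + Xe \<epsilon> t^2 \<le> C * z^2 * E^2 + C * F^2"
          by blast+
        have "C * z^2 * E^2 + C * F^2 \<le> C^2 * (z^2 * E^2) + C^2 * F^2"
          unfolding mult.assoc using C by (intro add_mono mult_right_mono) (auto simp: power2_eq_square)
        also have "\<dots> \<le> (C * z * E + C * F)^2"
          using C z EF by (simp add: power2_sum power_mult_distrib)
        finally have "\<bar>We \<epsilon> t - A\<bar> \<le> C * z * E + C * F"
          using W(2) C z EF by (intro sum_squares_abs_le(1)[of _ "Xe \<epsilon> t"]) auto
        with stA[OF t0(2)] have s: "\<bar>We \<epsilon> t - A\<bar> + \<bar>Wst t - A\<bar> \<le> C * z * E + (C + C') * F"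
          by (simp add: F_def algebra_simps)
        have "\<bar>nl p (We \<epsilon> t) - nl p (Wst t) - (m + \<kappa>) * d t\<bar> \<le> K * (\<bar>We \<epsilon> t - A\<bar> + \<bar>Wst t - A\<bar>) * \<bar>d t\<bar>"
          unfolding d_def using W(1) stA2[OF t0(2)] by (intro K(2)) auto
        also have "\<dots> \<le> K * (C * z * E + (C + C') * F) * \<bar>d t\<bar>"
          using s K(1) by (intro mult_right_mono mult_left_mono) auto
        finally have e1: "\<bar>nl p (We \<epsilon> t) - nl p (Wst t) - (m + \<kappa>) * d t\<bar> \<le> (b0 * z * E + K * (C + C') * F) * \<bar>d t\<bar>"
          by (simp add: b0_def algebra_simps)
        have "\<bar>\<alpha> * (1 - cos (th t)) * x t\<bar> = \<alpha> * (1 - cos (th t)) * \<bar>x t\<bar>"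
          using mu_facts(3) cos_th_bounds(1)[of t] by (simp add: abs_mult)
        also have "\<dots> \<le> \<alpha> * (2 * F) * \<bar>x t\<bar>"
          unfolding F_def using mu_facts(3) cos_th_bounds(2)[of t] by (intro mult_right_mono mult_left_mono) auto
        finally have e2: "\<bar>\<alpha> * (1 - cos (th t)) * x t\<bar> \<le> \<alpha> * (2 * F) * \<bar>x t\<bar>" .
        have "\<bar>(\<kappa> + \<mu>) * sin (th t)^2 * d t\<bar> = (\<kappa> + \<mu>) * sin (th t)^2 * \<bar>d t\<bar>"
          using mu_facts by (simp add: abs_mult)
        also have "\<dots> \<le> (\<kappa> + \<mu>) * (4 * F) * \<bar>d t\<bar>"
          unfolding F_def using mu_facts sin_th_sq_le[of t] by (intro mult_right_mono mult_left_mono) auto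
        finally have e3: "\<bar>(\<kappa> + \<mu>) * sin (th t)^2 * d t\<bar> \<le> (\<kappa> + \<mu>) * (4 * F) * \<bar>d t\<bar>" .
        have "\<bar>e t\<bar> \<le> \<alpha> * (2 * F) * \<bar>x t\<bar> + (b0 * z * E + K * (C + C') * F) * \<bar>d t\<bar> + (\<kappa> + \<mu>) * (4 * F) * \<bar>d t\<bar>"
          unfolding e_def using e1 e2 e3 by linarith
        also have "\<dots> \<le> \<dots> + (\<alpha> * (2 * F) * \<bar>d t\<bar> + (b0 * z * E + K * (C + C') * F) * \<bar>x t\<bar> + (\<kappa> + \<mu>) * (4 * F) * \<bar>x t\<bar>)"
        proof -
          have "0 \<le> \<alpha> * (2 * F) * \<bar>d t\<bar>" "0 \<le> (b0 * z * E + K * (C + C') * F) * \<bar>x t\<bar>" "0 \<le> (\<kappa> + \<mu>) * (4 * F) * \<bar>x t\<bar>"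
            using mu_facts EF b0 z K C C' by simp_all
          then show ?thesis by linarith
        qed
        also have "\<dots> = h t * (\<bar>d t\<bar> + \<bar>x t\<bar>)"
          unfolding h_def a0_def E_def[symmetric] F_def[symmetric] by (simp add: algebra_simps)
        finally show ?thesis .
      qed
      have "exp (2 * T) \<le> \<tau>2" using exp2_small[OF \<tau>12(2)] T by simp
      then have "c * a0 * exp (2 * T) \<le> c * a0 * \<tau>2" using c a0 by simp
      also have "\<dots> = \<tau>" using c a0 by (simp add: \<tau>2_def)
      finally have 1: "c * (a0 / 2 * exp (2 * T)) \<le> \<tau> / 2" by simp
      have 2: "c * (b0 * z / \<eta>) = \<tau> / 2" using c b0 C by (simp add: z_def field_simps)
      have "H T - H t1 \<le> a0 / 2 * exp (2 * T) + b0 * z / \<eta>"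
      proof -
        have "0 \<le> b0 * z / \<eta> * exp (- \<eta> * (T - t1))" "0 \<le> a0 / 2 * exp (2 * t1)" using b0 z C a0 by simp_all
        then show ?thesis by (simp add: H_def)
      qed
      then have "c * (H T - H t1) \<le> c * (a0 / 2 * exp (2 * T) + b0 * z / \<eta>)" using c by simp
      also have "\<dots> \<le> \<tau> / 2 + \<tau> / 2" unfolding distrib_left by (rule add_mono[OF 1 eq_refl[OF 2]])
      also have "\<dots> = \<tau>" by simp
      finally have "exp (c * (H T - H t1)) \<le> exp \<tau>" by simp
      then have ex: "exp (c * (H T - H t1)) \<le> 5 / 4" by (simp add: \<tau>_def)
      define S where "S = exp (\<alpha> / 2 * t1) * srad \<alpha> \<beta> (d t1) (x t1)"
      have S: "0 \<le> S" by (simp add: S_def srad_def)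
      note sp = spiral_almost_constant[OF mu_facts(3) \<beta> t1T dd xd eb h0 Hd, folded c_def]
      have "\<bar>spiral \<alpha> \<beta> \<phi> T (d T) (x T) - spiral \<alpha> \<beta> \<phi> t1 (d t1) (x t1)\<bar> \<le> S / 4" for \<phi>
      proof -
        have "S * (exp (c * (H T - H t1)) - 1) \<le> S * (1 / 4)" using ex by (intro mult_left_mono S) simp
        then show ?thesis using sp(1)[of \<phi>, folded S_def] by linarith
      qed
      moreover have "\<bar>d T\<bar> + \<bar>x T\<bar> \<le> C2 * S"
      proof -
        have e: "exp (- \<alpha> / 2 * (T - t1)) = exp (- \<alpha> / 2 * T) * exp (\<alpha> / 2 * t1)"
          by (simp add: algebra_simps diff_divide_distrib flip: exp_add)
        have "\<bar>d T\<bar> + \<bar>x T\<bar> \<le> c * exp (- \<alpha> / 2 * T) * S * exp (c * (H T - H t1))"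
          using sp(2) unfolding e by (simp add: S_def mult.assoc)
        also have "\<dots> \<le> c * exp (- \<alpha> / 2 * T) * S * (5 / 4)" using c S ex by (intro mult_left_mono) auto
        finally show ?thesis by (simp add: C2_def mult.commute mult.left_commute)
      qed
      ultimately show ?case by (simp add: S_def d_def x_def t1_def)
    qed
  qed
qed

text \<open>The times at which the difference leaves the inner region are chosen such that its phase at \<open>\<Theta>s\<close>
  is a multiple of \<open>pi\<close>.\<close>
lemma alternating_sequence:
  assumes osc: "\<alpha>^2 < 4 * m"
  obtains \<epsilon> :: "nat \<Rightarrow> real" where "\<And>j. 0 < \<epsilon> j" "\<And>j. \<epsilon> (Suc j) < \<epsilon> j" "\<epsilon> \<longlonglongrightarrow> 0"
    "\<forall>\<^sub>F j in sequentially. 0 < (- 1) ^ j * Ue (\<epsilon> j) \<Theta>s"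
proof -
  define \<beta> where "\<beta> = sqrt (m - \<alpha>^2 / 4)"
  have \<beta>: "0 < \<beta>" using osc by (simp add: \<beta>_def)
  note Ts = Theta_star_props
  \<comment> \<open>Subtracting 1 places th T strictly to the left of \<Theta>s, as the
    linearization on [th T, \<Theta>s] demands.\<close>
  define T1 where "T1 = tl \<Theta>s - 1"
  obtain T R C where T: "T \<le> T1" and R: "0 < R" and C: "0 < C"
    and ev: "\<forall>\<^sub>F \<epsilon> in at_right 0. \<forall>\<phi>.
      \<bar>spiral \<alpha> \<beta> \<phi> T (We \<epsilon> T - Wst T) (Xe \<epsilon> T - Xst T)
        - spiral \<alpha> \<beta> \<phi> (tl (\<epsilon> * R)) (We \<epsilon> (tl (\<epsilon> * R)) - Wst (tl (\<epsilon> * R))) (Xe \<epsilon> (tl (\<epsilon> * R)) - Xst (tl (\<epsilon> * R)))\<bar>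
      \<le> exp (\<alpha> / 2 * tl (\<epsilon> * R)) * srad \<alpha> \<beta> (We \<epsilon> (tl (\<epsilon> * R)) - Wst (tl (\<epsilon> * R))) (Xe \<epsilon> (tl (\<epsilon> * R)) - Xst (tl (\<epsilon> * R))) / 4
      \<and> \<bar>We \<epsilon> T - Wst T\<bar> + \<bar>Xe \<epsilon> T - Xst T\<bar>
      \<le> C * (exp (\<alpha> / 2 * tl (\<epsilon> * R)) * srad \<alpha> \<beta> (We \<epsilon> (tl (\<epsilon> * R)) - Wst (tl (\<epsilon> * R))) (Xe \<epsilon> (tl (\<epsilon> * R)) - Xst (tl (\<epsilon> * R))))"
    by (rule spiral_family[OF osc, of T1, folded \<beta>_def]) blast
  have "th T < th (tl \<Theta>s)" using T by (intro th_strict_mono) (simp add: T1_def)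
  then have aT: "0 < th T" "th T < \<Theta>s" using th_bounds Ts by (simp_all add: th_tl)
  obtain a1 a2 where a12: "a1 \<noteq> 0 \<or> a2 \<noteq> 0" and lin: "\<And>e. 0 < e \<Longrightarrow> \<forall>\<^sub>F \<epsilon> in at_right 0.
      \<bar>(Ue \<epsilon> \<Theta>s - Ust \<Theta>s) - (a1 * (Ue \<epsilon> (th T) - Ust (th T)) + a2 * (Ve \<epsilon> (th T) - Vst (th T)))\<bar>
      \<le> e * (\<bar>Ue \<epsilon> (th T) - Ust (th T)\<bar> + \<bar>Ve \<epsilon> (th T) - Vst (th T)\<bar>)"
    by (rule linear_functional[OF aT Ts(2)]) blast
  define P Q where "P = sin (th T) powr (- \<mu>)" and "Q = sin (th T) powr (- (\<mu> + 1))"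
  have PQ: "0 < P" "0 < Q" using sin_th_pos[of T] by (simp_all add: P_def Q_def)
  define k1 k2 where "k1 = a1 * P - a2 * Q * \<mu> * cos (th T)" and "k2 = a2 * Q"
  have k: "k1 \<noteq> 0 \<or> k2 \<noteq> 0" using a12 PQ by (auto simp: k1_def k2_def)
  have \<beta>n: "\<beta> \<noteq> 0" using \<beta> by simp
  obtain r \<phi> where r: "0 < r" "\<And>u w. k1 * u + k2 * w = r * spiral \<alpha> \<beta> \<phi> T u w"
    by (rule spiral_functional[OF \<beta>n k, where \<alpha> = \<alpha> and b = T]) blast
  define M where "M = P + Q + Q * \<mu>"
  have M: "0 < M" using PQ mu_facts by (simp add: M_def add_pos_pos)
  have UV: "Ue \<epsilon> (th T) - Ust (th T) = P * (We \<epsilon> T - Wst T)"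
    "Ve \<epsilon> (th T) - Vst (th T) = Q * ((Xe \<epsilon> T - Xst T) - \<mu> * cos (th T) * (We \<epsilon> T - Wst T))" for \<epsilon>
    unfolding U_of_W(1)[of "Ue \<epsilon>" T] U_of_W(1)[of Ust T] U_of_W(2)[of "Ve \<epsilon>" T "Ue \<epsilon>"] U_of_W(2)[of Vst T Ust] P_def Q_def
    by (simp_all add: algebra_simps)
  \<comment> \<open>Makes e * M * C = r/4: the linearization error takes a quarter of the amplitude,
    as does the error of the spiral.\<close>
  define e where "e = r / (4 * M * C)"
  have e: "0 < e" using r M C by (simp add: e_def)
  \<comment> \<open>Limit of the difference at the starting time: the regular solution is then at
    time ln R of the Lane-Emden orbit, while the singular one tends to the equilibrium.\<close>
  define u0 w0 where "u0 = W0 (ln R) - A" and "w0 = X0 (ln R)"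
  have "w0 + \<alpha> / 2 * u0 \<noteq> 0 \<or> \<beta> * u0 \<noteq> 0" using W0_not_equilibrium[of "ln R"] \<beta> by (auto simp: u0_def w0_def)
  then obtain S \<psi> where S: "0 < S" and Sc: "w0 + \<alpha> / 2 * u0 = S * cos \<psi>" "\<beta> * u0 = S * sin \<psi>"
    by (rule polar_pos)
  have srad0: "srad \<alpha> \<beta> u0 w0 = S"
  proof -
    have "(S * cos \<psi>)^2 + (S * sin \<psi>)^2 = S^2 * ((cos \<psi>)^2 + (sin \<psi>)^2)"
      by (simp only: power_mult_distrib distrib_left)
    then show ?thesis using S unfolding srad_def Sc by simp
  qed
  let ?d = "\<lambda>\<epsilon>. We \<epsilon> (tl (\<epsilon> * R)) - Wst (tl (\<epsilon> * R))" and ?x = "\<lambda>\<epsilon>. Xe \<epsilon> (tl (\<epsilon> * R)) - Xst (tl (\<epsilon> * R))"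
  have lim: "(?d \<longlongrightarrow> u0) (at_right 0)" "(?x \<longlongrightarrow> w0 - 0) (at_right 0)"
    unfolding u0_def w0_def Ue_def Ve_def
    by (intro tendsto_diff EW_rescaled[OF R] filterlim_compose[OF Wst_tendsto(1) tl_scaled_at_bot[OF R]]
        filterlim_compose[OF Wst_tendsto(2) tl_scaled_at_bot[OF R]])+
  have lim1: "((\<lambda>\<epsilon>. ?x \<epsilon> + \<alpha> / 2 * ?d \<epsilon>) \<longlongrightarrow> S * cos \<psi>) (at_right 0)"
    using tendsto_add[OF lim(2) tendsto_mult[OF tendsto_const[of "\<alpha> / 2"] lim(1)]] by (simp only: diff_zero Sc)
  have lim2: "((\<lambda>\<epsilon>. \<beta> * ?d \<epsilon>) \<longlongrightarrow> S * sin \<psi>) (at_right 0)"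
    using tendsto_mult[OF tendsto_const[of \<beta>] lim(1)] by (simp add: Sc)
  have lim3: "((\<lambda>\<epsilon>. srad \<alpha> \<beta> (?d \<epsilon>) (?x \<epsilon>)) \<longlongrightarrow> S) (at_right 0)"
    unfolding srad0[symmetric] srad_def using lim by (intro tendsto_intros) auto
  have S16: "0 < S / 16" using S by simp
  have sgn: "\<forall>\<^sub>F \<epsilon> in at_right 0. \<forall>j. cos (\<beta> * tl (\<epsilon> * R) + \<phi> - \<psi>) = (- 1) ^ j \<longrightarrow> 0 < (- 1) ^ j * Ue \<epsilon> \<Theta>s"
    using ev lin[OF e] tendstoD[OF lim1 S16] tendstoD[OF lim2 S16] tendstoD[OF lim3 S16]
  proof eventually_elim
    case (elim \<epsilon>)
    define t1 E where "t1 = tl (\<epsilon> * R)" and "E = exp (\<alpha> / 2 * t1)"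
    define d x s where "d = ?d \<epsilon>" and "x = ?x \<epsilon>" and "s = srad \<alpha> \<beta> d x"
    have E: "0 < E" by (simp add: E_def)
    define d2 x2 where "d2 = We \<epsilon> T - Wst T" and "x2 = Xe \<epsilon> T - Xst T"
    have s: "\<bar>s - S\<bar> < S / 16" using elim(5) by (simp add: s_def d_def x_def dist_real_def)
    have z: "\<bar>(x + \<alpha> / 2 * d) - S * cos \<psi>\<bar> < S / 16" "\<bar>\<beta> * d - S * sin \<psi>\<bar> < S / 16"
      using elim(3,4) by (simp_all add: d_def x_def dist_real_def)
    have sp: "\<bar>spiral \<alpha> \<beta> \<phi> T d2 x2 - spiral \<alpha> \<beta> \<phi> t1 d x\<bar> \<le> E * s / 4" "\<bar>d2\<bar> + \<bar>x2\<bar> \<le> C * (E * s)"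
      using elim(1) by (auto simp: d2_def x2_def d_def x_def t1_def E_def s_def)
    have "\<bar>P * d2\<bar> + \<bar>Q * (x2 - \<mu> * cos (th T) * d2)\<bar> \<le> M * (\<bar>d2\<bar> + \<bar>x2\<bar>)"
    proof -
      have "\<bar>\<mu> * cos (th T) * d2\<bar> \<le> \<mu> * 1 * \<bar>d2\<bar>"
        unfolding abs_mult using mu_facts by (intro mult_right_mono mult_left_mono) auto
      then have "\<bar>x2 - \<mu> * cos (th T) * d2\<bar> \<le> \<bar>x2\<bar> + \<mu> * \<bar>d2\<bar>" by linarith
      then have "Q * \<bar>x2 - \<mu> * cos (th T) * d2\<bar> \<le> Q * (\<bar>x2\<bar> + \<mu> * \<bar>d2\<bar>)" using PQ by simp
      moreover have "0 \<le> Q * \<bar>d2\<bar>" "0 \<le> P * \<bar>x2\<bar>" "0 \<le> Q * \<mu> * \<bar>x2\<bar>" using PQ mu_facts by simp_all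
      moreover have "\<bar>P * d2\<bar> = P * \<bar>d2\<bar>" "\<bar>Q * (x2 - \<mu> * cos (th T) * d2)\<bar> = Q * \<bar>x2 - \<mu> * cos (th T) * d2\<bar>"
        using PQ by (simp_all add: abs_mult)
      ultimately show ?thesis by (simp add: M_def distrib_left distrib_right mult.assoc)
    qed
    then have "e * (\<bar>P * d2\<bar> + \<bar>Q * (x2 - \<mu> * cos (th T) * d2)\<bar>) \<le> e * (M * (C * (E * s)))"
      using e M sp(2) by (intro mult_left_mono) (auto intro: order_trans[OF _ mult_left_mono])
    also have "\<dots> = r * (E * s) / 4" using M C by (simp add: e_def)
    finally have err: "e * (\<bar>P * d2\<bar> + \<bar>Q * (x2 - \<mu> * cos (th T) * d2)\<bar>) \<le> r * (E * s) / 4" .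
    have "a1 * (P * d2) + a2 * (Q * (x2 - \<mu> * cos (th T) * d2)) = k1 * d2 + k2 * x2"
      by (simp add: k1_def k2_def algebra_simps)
    with elim(2)[unfolded UV, folded d2_def x2_def] err
    have 1: "\<bar>Ue \<epsilon> \<Theta>s - r * spiral \<alpha> \<beta> \<phi> T d2 x2\<bar> \<le> r * (E * s) / 4"
      using r(2)[of d2 x2] Ts(3) by simp
    have "\<bar>r * spiral \<alpha> \<beta> \<phi> T d2 x2 - r * spiral \<alpha> \<beta> \<phi> t1 d x\<bar> = r * \<bar>spiral \<alpha> \<beta> \<phi> T d2 x2 - spiral \<alpha> \<beta> \<phi> t1 d x\<bar>"
      using r(1) by (simp add: abs_mult flip: right_diff_distrib)
    also have "\<dots> \<le> r * (E * s / 4)" using sp(1) r(1) by (intro mult_left_mono) auto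
    finally have "\<bar>r * spiral \<alpha> \<beta> \<phi> T d2 x2 - r * spiral \<alpha> \<beta> \<phi> t1 d x\<bar> \<le> r * (E * s / 4)" .
    moreover have "\<bar>u - v\<bar> \<le> a \<Longrightarrow> \<bar>v - w\<bar> \<le> b \<Longrightarrow> \<bar>u - w\<bar> \<le> a + b" for u v w a b :: real by linarith
    ultimately have "\<bar>Ue \<epsilon> \<Theta>s - r * spiral \<alpha> \<beta> \<phi> t1 d x\<bar> \<le> r * (E * s) / 4 + r * (E * s / 4)" using 1 by blast
    also have "\<dots> = r * E * (s / 2)" by simp
    finally have 2: "\<bar>Ue \<epsilon> \<Theta>s - r * spiral \<alpha> \<beta> \<phi> t1 d x\<bar> \<le> r * E * (s / 2)" .
    let ?c = "cos (\<beta> * t1 + \<phi>)" and ?s = "sin (\<beta> * t1 + \<phi>)"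
    have "\<bar>?c * ((x + \<alpha> / 2 * d) - S * cos \<psi>)\<bar> \<le> 1 * (S / 16)" "\<bar>?s * (\<beta> * d - S * sin \<psi>)\<bar> \<le> 1 * (S / 16)"
      unfolding abs_mult using z S by (intro mult_mono; simp)+
    moreover have "?c * (x + \<alpha> / 2 * d) + ?s * (\<beta> * d) - S * cos (\<beta> * t1 + \<phi> - \<psi>)
        = ?c * ((x + \<alpha> / 2 * d) - S * cos \<psi>) + ?s * (\<beta> * d - S * sin \<psi>)"
      by (simp only: cos_diff) (simp add: algebra_simps)
    ultimately have 3: "\<bar>?c * (x + \<alpha> / 2 * d) + ?s * (\<beta> * d) - S * cos (\<beta> * t1 + \<phi> - \<psi>)\<bar> \<le> S / 8" by linarith
    have "r * E * \<bar>?c * (x + \<alpha> / 2 * d) + ?s * (\<beta> * d) - S * cos (\<beta> * t1 + \<phi> - \<psi>)\<bar> \<le> r * E * (S / 8)"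
      using 3 r E by (intro mult_left_mono) auto
    moreover have "\<bar>r * spiral \<alpha> \<beta> \<phi> t1 d x - r * E * (S * cos (\<beta> * t1 + \<phi> - \<psi>))\<bar>
        = r * E * \<bar>?c * (x + \<alpha> / 2 * d) + ?s * (\<beta> * d) - S * cos (\<beta> * t1 + \<phi> - \<psi>)\<bar>"
    proof -
      have "r * spiral \<alpha> \<beta> \<phi> t1 d x - r * E * (S * cos (\<beta> * t1 + \<phi> - \<psi>))
        = r * E * (?c * (x + \<alpha> / 2 * d) + ?s * (\<beta> * d) - S * cos (\<beta> * t1 + \<phi> - \<psi>))"
        unfolding spiral_def E_def right_diff_distrib by (simp only: mult.assoc)
      then show ?thesis using r E by (simp add: abs_mult)
    qed
    ultimately have 4: "\<bar>Ue \<epsilon> \<Theta>s - r * E * (S * cos (\<beta> * t1 + \<phi> - \<psi>))\<bar> \<le> r * E * (S / 8) + r * E * (s / 2)"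
      using 2 by linarith
    \<comment> \<open>Error budget: s/4 from the linearization, s/4 from the spiral, and twice S/16
      from the two limits, with s < 17/16 S.\<close>
    have "S / 8 + s / 2 < S" using s S by linarith
    then have "r * E * (S / 8 + s / 2) < r * E * S" using r(1) E by (intro mult_strict_left_mono) auto
    then have 5: "r * E * (S / 8) + r * E * (s / 2) < r * E * S" by (simp add: distrib_left)
    show ?case unfolding t1_def[symmetric]
    proof (intro allI impI)
      fix j assume j: "cos (\<beta> * t1 + \<phi> - \<psi>) = (- 1) ^ j"
      show "0 < (- 1) ^ j * Ue \<epsilon> \<Theta>s"
      proof (cases "even j")
        case True
        then show ?thesis using 4 5 j by simp
      next
        case False
        then show ?thesis using 4 5 j by simp
      qed
    qed
  qed
  \<comment> \<open>Solves \<beta> \<tau> + \<phi> - \<psi> = - j pi; the parameter \<epsilon> is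
    then chosen so that the starting time tl (\<epsilon> R) is exactly \<tau>.\<close>
  define \<tau> where "\<tau> j = (\<psi> - \<phi> - real j * pi) / \<beta>" for j
  define \<epsilon> where "\<epsilon> j = th (\<tau> j) / R" for j
  have tlj: "tl (\<epsilon> j * R) = \<tau> j" for j using R by (simp add: \<epsilon>_def tl_th)
  have cosj: "cos (\<beta> * tl (\<epsilon> j * R) + \<phi> - \<psi>) = (- 1) ^ j" for j
  proof -
    have "\<beta> * tl (\<epsilon> j * R) + \<phi> - \<psi> = - (real j * pi)" unfolding tlj using \<beta> by (simp add: \<tau>_def)
    then show ?thesis by (simp only: cos_minus cos_npi)
  qed
  have "filterlim (\<lambda>j. (\<phi> - \<psi>) / \<beta> + pi / \<beta> * real j) at_top sequentially"
    using \<beta> by (intro filterlim_tendsto_add_at_top[OF tendsto_const]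
      filterlim_tendsto_pos_mult_at_top[OF tendsto_const _ filterlim_real_sequentially]) simp
  moreover have "(\<lambda>j. (\<phi> - \<psi>) / \<beta> + pi / \<beta> * real j) = (\<lambda>j. - \<tau> j)"
    using \<beta> by (auto simp: \<tau>_def field_simps)
  ultimately have "filterlim \<tau> at_bot sequentially" by (simp add: filterlim_uminus_at_bot)
  from filterlim_compose[OF th_at_bot this] have "(\<lambda>j. th (\<tau> j) / R) \<longlonglongrightarrow> 0 / R"
    by (rule tendsto_divide[OF _ tendsto_const]) (use R in simp)
  then have lim0: "\<epsilon> \<longlonglongrightarrow> 0" by (simp add: \<epsilon>_def[abs_def])
  have pos: "0 < \<epsilon> j" for j using th_bounds R by (simp add: \<epsilon>_def)
  have "\<tau> (Suc j) < \<tau> j" for j using \<beta> by (simp add: \<tau>_def divide_strict_right_mono algebra_simps)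
  then have dec: "\<epsilon> (Suc j) < \<epsilon> j" for j using R by (auto simp: \<epsilon>_def intro!: divide_strict_right_mono th_strict_mono)
  have "filterlim \<epsilon> (at_right 0) sequentially"
    unfolding filterlim_at using lim0 pos by (auto simp: less_imp_neq[symmetric])
  from eventually_compose_filterlim[OF sgn this] have "\<forall>\<^sub>F j in sequentially. 0 < (- 1) ^ j * Ue (\<epsilon> j) \<Theta>s"
    by eventually_elim (use cosj in blast)
  with pos dec lim0 show thesis by (rule that)
qed

section \<open>Oscillation of \<Theta> around its limit\<close>

lemma Theta_oscillates:
  assumes osc: "\<alpha>^2 < 4 * m"
  obtains G :: "nat \<Rightarrow> real" where "strict_mono G" "\<And>n. 0 < G n" "filterlim G at_top sequentially"
    "\<And>n. (\<Theta> (G n) - \<Theta>s) * (\<Theta> (G (Suc n)) - \<Theta>s) < 0"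
proof -
  obtain \<epsilon> :: "nat \<Rightarrow> real" where pos: "\<And>j. 0 < \<epsilon> j" and dec: "\<And>j. \<epsilon> (Suc j) < \<epsilon> j" and lim: "\<epsilon> \<longlonglongrightarrow> 0"
    and sgn: "\<forall>\<^sub>F j in sequentially. 0 < (- 1) ^ j * Ue (\<epsilon> j) \<Theta>s"
    by (rule alternating_sequence[OF osc]) blast
  have r0: "filterlim \<epsilon> (at_right 0) sequentially"
    unfolding filterlim_at using lim pos by (auto simp: less_imp_neq[symmetric])
  have "\<forall>\<^sub>F j in sequentially. 0 < (- 1) ^ j * (\<Theta> (\<epsilon> j powr (- \<mu>)) - \<Theta>s)"
    using sgn eventually_compose_filterlim[OF Theta_sign r0]
  proof eventually_elim
    case (elim j)
    then show ?case by (cases "even j") auto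
  qed
  then obtain J where J: "\<And>j. J \<le> j \<Longrightarrow> 0 < (- 1) ^ j * (\<Theta> (\<epsilon> j powr (- \<mu>)) - \<Theta>s)"
    by (auto simp: eventually_sequentially)
  \<comment> \<open>The shift by J drops the finitely many indices at which the alternation is not
    yet guaranteed.\<close>
  define G where "G n = \<epsilon> (n + J) powr (- \<mu>)" for n
  show thesis
  proof (rule that[of G])
    show "strict_mono G"
      unfolding strict_mono_Suc_iff G_def using pos dec mu_facts by (auto intro: powr_less_mono2_neg)
    show "0 < G n" for n using pos[of "n + J"] by (simp add: G_def)
    have "(\<lambda>n. \<epsilon> (n + J)) \<longlonglongrightarrow> 0" using lim by (rule LIMSEQ_ignore_initial_segment)
    then have "(\<lambda>n. \<epsilon> (n + J) powr \<mu>) \<longlonglongrightarrow> 0"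
      by (rule tendsto_zero_powrI[OF _ tendsto_const]) (use mu_facts pos in \<open>auto simp: less_imp_le\<close>)
    moreover have "\<forall>\<^sub>F n in sequentially. 0 < \<epsilon> (n + J) powr \<mu>"
      by (intro always_eventually allI) (simp only: powr_gt_zero pos[THEN less_imp_neq, THEN not_sym] simp_thms)
    ultimately show "filterlim G at_top sequentially"
      unfolding G_def[abs_def] powr_minus by (rule filterlim_inverse_at_top)
    show "(\<Theta> (G n) - \<Theta>s) * (\<Theta> (G (Suc n)) - \<Theta>s) < 0" for n
    proof -
      have "0 < (- 1) ^ (n + J) * (\<Theta> (G n) - \<Theta>s)" "0 < (- 1) ^ (Suc n + J) * (\<Theta> (G (Suc n)) - \<Theta>s)"
        unfolding G_def by (rule J; simp)+
      then show ?thesis by (cases "even (n + J)") (auto simp: mult_less_0_iff)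
    qed
  qed
qed

text \<open>Intermediate value theorem on each interval from G n to G (n + 1), as \<Theta> is
  continuous; the bound G n \<le> G' n carries the divergence over.\<close>

lemma Theta_eq_star_sequence:
  assumes mono: "strict_mono G" and pos: "\<And>n. 0 < G n" and lim: "filterlim G at_top sequentially"
    and alt: "\<And>n. (\<Theta> (G n) - \<Theta>s) * (\<Theta> (G (Suc n)) - \<Theta>s) < 0"
  obtains G' :: "nat \<Rightarrow> real" where "\<And>n. 0 < G' n" "filterlim G' at_top sequentially" "\<And>n. \<Theta> (G' n) = \<Theta>s"
proof -
  have "\<exists>g\<ge>G n. \<Theta> g = \<Theta>s" for n
  proof -
    have le: "G n \<le> G (Suc n)" using mono by (simp add: strict_mono_less_eq)
    have cont: "continuous_on {G n..G (Suc n)} \<Theta>"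
      by (intro continuous_at_imp_continuous_on ballI DERIV_isCont[OF Theta_has_deriv]) (use pos[of n] in auto)
    consider "\<Theta> (G n) \<le> \<Theta>s" "\<Theta>s \<le> \<Theta> (G (Suc n))" | "\<Theta> (G (Suc n)) \<le> \<Theta>s" "\<Theta>s \<le> \<Theta> (G n)"
      using alt[of n] by (auto simp: mult_less_0_iff)
    then show ?thesis
      by cases (use IVT'[OF _ _ le cont] IVT2'[OF _ _ le cont] in blast)+
  qed
  then obtain G' where G': "\<And>n. G n \<le> G' n" "\<And>n. \<Theta> (G' n) = \<Theta>s" by metis
  show thesis
  proof (rule that[of G'])
    show "0 < G' n" for n using less_le_trans[OF pos G'(1)] .
    show "filterlim G' at_top sequentially" using lim G'(1) by (intro filterlim_at_top_mono[OF lim]) auto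
  qed (rule G'(2))
qed

end

theorem theoremA:
  fixes N :: nat and p :: real
  assumes "N \<ge> 3" and "p > (real N + 2) / (real N - 2)"
  shows "(\<forall>\<Gamma>>0. (\<exists>!\<theta>. first_zero N p \<Gamma> \<theta>) \<and> 0 < Theta N p \<Gamma> \<and> Theta N p \<Gamma> < pi)
    \<and> (\<exists>D. continuous_on {0<..} D \<and>
           (\<forall>\<Gamma>>0. (Theta N p has_real_derivative D \<Gamma>) (at \<Gamma>)) \<and>
           (\<forall>\<^sub>F \<Gamma> in at_right 0. D \<Gamma> < 0))
    \<and> (Theta N p \<longlongrightarrow> pi) (at_right 0)
    \<and> (\<exists>!\<theta>. sing_first_zero N p \<theta>)
    \<and> 0 < Theta_star N p \<and> Theta_star N p < pi
    \<and> (Theta N p \<longlongrightarrow> Theta_star N p) at_top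
    \<and> (below_JL N p \<longrightarrow>
         (\<exists>G :: nat \<Rightarrow> real. strict_mono G \<and> (\<forall>n. G n > 0) \<and> filterlim G at_top sequentially \<and>
            (\<forall>n. (Theta N p (G n) - Theta_star N p) * (Theta N p (G (Suc n)) - Theta_star N p) < 0))
       \<and> (\<exists>G :: nat \<Rightarrow> real. (\<forall>n. G n > 0) \<and> filterlim G at_top sequentially \<and>
            (\<forall>n. Theta N p (G n) = Theta_star N p)))"
proof -
  interpret sphere_problem N p by unfold_locales (use assms in auto)
  have osc: "\<exists>G :: nat \<Rightarrow> real. strict_mono G \<and> (\<forall>n. G n > 0) \<and> filterlim G at_top sequentially \<and>
      (\<forall>n. (\<Theta> (G n) - \<Theta>s) * (\<Theta> (G (Suc n)) - \<Theta>s) < 0)"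
    "\<exists>G :: nat \<Rightarrow> real. (\<forall>n. G n > 0) \<and> filterlim G at_top sequentially \<and> (\<forall>n. \<Theta> (G n) = \<Theta>s)"
    if b: "below_JL N p"
  proof -
    obtain G :: "nat \<Rightarrow> real" where G: "strict_mono G" "\<And>n. 0 < G n" "filterlim G at_top sequentially"
      "\<And>n. (\<Theta> (G n) - \<Theta>s) * (\<Theta> (G (Suc n)) - \<Theta>s) < 0"
      by (rule Theta_oscillates[OF below_JL_oscillatory[OF b]]) blast
    then show "\<exists>G :: nat \<Rightarrow> real. strict_mono G \<and> (\<forall>n. G n > 0) \<and> filterlim G at_top sequentially \<and>
      (\<forall>n. (\<Theta> (G n) - \<Theta>s) * (\<Theta> (G (Suc n)) - \<Theta>s) < 0)" by blast
    obtain G' :: "nat \<Rightarrow> real" where "\<And>n. 0 < G' n" "filterlim G' at_top sequentially" "\<And>n. \<Theta> (G' n) = \<Theta>s"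
      by (rule Theta_eq_star_sequence[OF G]) blast
    then show "\<exists>G :: nat \<Rightarrow> real. (\<forall>n. G n > 0) \<and> filterlim G at_top sequentially \<and> (\<forall>n. \<Theta> (G n) = \<Theta>s)" by blast
  qed
  have D: "\<exists>D. continuous_on {0<..} D \<and> (\<forall>\<Gamma>>0. (\<Theta> has_real_derivative D \<Gamma>) (at \<Gamma>)) \<and> (\<forall>\<^sub>F \<Gamma> in at_right 0. D \<Gamma> < 0)"
    using DT_cont Theta_has_deriv DT_neg by blast
  show ?thesis
  proof (intro conjI impI allI)
    show "\<exists>!\<theta>. first_zero N p \<Gamma> \<theta>" "0 < \<Theta> \<Gamma>" "\<Theta> \<Gamma> < pi" if "0 < \<Gamma>" for \<Gamma>
      by (rule first_zero_ex1[OF that] Theta_props[OF that])+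
  qed (rule D Theta_tendsto_pi sing_first_zero_ex1 Theta_star_props Theta_tendsto_star osc | assumption)+
qed

end
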